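(* Let $(X,\Sigma,\mathfrak m)$ be a probability space, $(\Omega,\mathcal A)$ a measurable space, $(M,|\cdot|)$ a complete random normed module with base $(X,\Sigma,\mathfrak m)$, and let $\mu\in\mathcal M(\Omega;L^0(\mathfrak m))$ be an $L^0$-valued measure of bounded variation. Then there exists a unique isometric isomorphism of random normed modules \[ J\colon L^1_\mu(\Omega;L^0(\mathfrak m))\,\hat\otimes_\pi M\to L^1_\mu(\Omega;M) \] such that $J\big((\mathbf 1_A^\mu\mathbf 1_E^{\mathfrak m})\otimes v\big)=\mathbf 1_A^\mu(\mathbf 1_E^{\mathfrak m}\cdot v)$ for every $A\in\mathcal A$, $E\in\Sigma$ and $v\in M$.
   Context: $L^0(\mathfrak m)$ is the algebra of $\mathfrak m$-a.e. equivalence classes of measurable functions $X\to\mathbb R$, with the $\mathfrak m$-a.e. order and the distance $\int|f-g|\wedge1\,\mathrm d\mathfrak m$; $L^0_+(\mathfrak m)$ is its positive cone; $\bar L^0(\mathfrak m)$ is the complete lattice of classes of $[-\infty,+\infty]$-valued measurable functions, in which $\bigvee,\bigwedge$ are taken; $\mathbf 1_E^{\mathfrak m}\in L^0(\mathfrak m)$ is the class of the characteristic function of $E\in\Sigma$. A sequence in $L^0_+(\mathfrak m)$ is summable if its partial sums are order bounded in $L^0(\mathfrak m)$. A random normed module with base $(X,\Sigma,\mathfrak m)$ is a module $M$ over $L^0(\mathfrak m)$ with a map $|\cdot|\colon M\to L^0_+(\mathfrak m)$ such that $|v|=0$ iff $v=0$, $|v+w|\le|v|+|w|$, $|f\cdot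 v|=|f||v|$; it is complete if $d_M(v,w)=\int|v-w|\wedge1\,\mathrm d\mathfrak m$ is complete. Its completion is its metric completion for $d_M$ with the extended operations and $L^0$-norm. An isometric isomorphism is an $L^0(\mathfrak m)$-linear bijection preserving the $L^0$-norm. Projective tensor product: for complete random normed modules $M,N$, let $M\otimes N$ be the algebraic tensor product over $L^0(\mathfrak m)$ with $L^0$-norm $|\alpha|_\pi=\bigwedge\{\sum_{i=1}^n|v_i||w_i|:\alpha=\sum_{i=1}^nv_i\otimes w_i\}$; this is a random normed module and $M\hat\otimes_\pi N$ is its completion. An $L^0$-valued measure is a map $\mu\colon\mathcal A\to L^0(\mathfrak m)$ with $\mu(\varnothing)=0$ such that for pairwise disjoint $(A_n)$ the sequence $(|\mu(A_n)|)_n$ is summable and $\mu(\bigcup_nA_n)=\sum_n\mu(A_n)$. Put $|\mu|(A)=\bigvee\{\sum_n|\mu(A_n)|:(A_n)_{n\in\mathbb N}\subseteq\mathcal A\text{ partition of }A\}$; $\mu$ is of bounded variation if $|\mu|(\Omega)\in L^0_+(\mathfrak m)$. Lebesgue–Bochner space: for a complete random normed module $M$, let $S^1_\mu(\Omega;M)$ be the space of simple maps $v=\sum_{i\in I}\mathbf 1_{A_i}\bar v^i\colon\Omega\to M$ ($(A_i)_{i\in I}\subseteq\mathcal A$ an at most countable partition of $\Omega$, $\bar v^i\in M$, $v=\bar v^i$ on $A_i$) such that $\{|\mu|(A_i)|\bar v^i|\}_i$ is summable, modulo equality outside sets $N\in\mathcal A$ with $|\mu|(N)=0$. The class is written $\sum_i\mathbf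 1_{A_i}^\mu\bar v^i$ (terms with $\bar v^i=0$ may be omitted). With pointwise operations and $|v|^{1,\mu}=\sum_i|\mu|(A_i)|\bar v^i|$ it is a random normed module; $L^1_\mu(\Omega;M)$ is its completion. *)

theory Defs
  imports
    "HOL-Probability.Probability_Measure"
    "HOL-Algebra.Module"
    "HOL-Algebra.Complete_Lattice"
    "HOL-Algebra.Generated_Groups"
    "HOL-Algebra.Free_Abelian_Groups"
begin

section \<open>The algebra \<open>L\<^sup>0\<close> and the lattice of extended real-valued classes\<close>

text \<open>
  Elements of \<open>L\<^sup>0\<close> are genuine equivalence classes, i.e. sets of functions.  Operations on
  classes are written in the style of \<^theory>\<open>HOL.Equiv_Relations\<close>: the union, over all
  representatives, of the class of the result.
\<close>

type_synonym 'a l0 = "('a \<Rightarrow> real) set"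

text \<open>
  Modules with a norm: the HOL-Algebra module record with an additional map into the base ring.
  As everywhere in HOL-Algebra, the fields \<open>mult\<close> and \<open>one\<close> inherited from rings are
  meaningless for a mere module.
\<close>

record ('r, 'm) rnm = "('r, 'm) module" +
  rnorm :: "'m \<Rightarrow> 'r"  (\<open>\<parallel>_\<parallel>\<index>\<close>)

definition L0_rel :: "'a measure \<Rightarrow> (('a \<Rightarrow> real) \<times> ('a \<Rightarrow> real)) set" where
  "L0_rel m = {(f, g). f \<in> borel_measurable m \<and> g \<in> borel_measurable m \<and> (AE x in m. f x = g x)}"

definition L0_class :: "'a measure \<Rightarrow> ('a \<Rightarrow> real) \<Rightarrow> 'a l0" where
  "L0_class m f = L0_rel m `` {f}"

text \<open>
  \<open>L\<^sup>0\<close> as a commutative ring which is at the same time a module over itself, normed by the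
  absolute value.
\<close>

definition L0 :: "'a measure \<Rightarrow> ('a l0, 'a l0) rnm" where
  "L0 m =
    \<lparr>carrier = borel_measurable m // L0_rel m,
     mult = (\<lambda>F G. \<Union>f\<in>F. \<Union>g\<in>G. L0_class m (\<lambda>x. f x * g x)),
     one = L0_class m (\<lambda>_. 1),
     ring.zero = L0_class m (\<lambda>_. 0),
     add = (\<lambda>F G. \<Union>f\<in>F. \<Union>g\<in>G. L0_class m (\<lambda>x. f x + g x)),
     smult = (\<lambda>F G. \<Union>f\<in>F. \<Union>g\<in>G. L0_class m (\<lambda>x. f x * g x)),
     rnorm = (\<lambda>F. \<Union>f\<in>F. L0_class m (\<lambda>x. \<bar>f x\<bar>))\<rparr>"

definition L0_le :: "'a measure \<Rightarrow> 'a l0 \<Rightarrow> 'a l0 \<Rightarrow> bool" where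
  "L0_le m F G \<longleftrightarrow> (\<exists>f\<in>F. \<exists>g\<in>G. AE x in m. f x \<le> g x)"

definition L0_pos :: "'a measure \<Rightarrow> 'a l0 set" where
  "L0_pos m = {F \<in> carrier (L0 m). L0_le m \<zero>\<^bsub>L0 m\<^esub> F}"

definition L0_ind :: "'a measure \<Rightarrow> 'a set \<Rightarrow> 'a l0" where
  "L0_ind m E = L0_class m (indicator E)"

definition L0bar_rel :: "'a measure \<Rightarrow> (('a \<Rightarrow> ereal) \<times> ('a \<Rightarrow> ereal)) set" where
  "L0bar_rel m =
    {(f, g). f \<in> borel_measurable m \<and> g \<in> borel_measurable m \<and> (AE x in m. f x = g x)}"

definition L0bar :: "'a measure \<Rightarrow> ('a \<Rightarrow> ereal) set gorder" where
  "L0bar m =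
    \<lparr>carrier = borel_measurable m // L0bar_rel m,
     eq = (=),
     le = (\<lambda>F G. \<exists>f\<in>F. \<exists>g\<in>G. AE x in m. f x \<le> g x)\<rparr>"

definition L0_to_bar :: "'a measure \<Rightarrow> 'a l0 \<Rightarrow> ('a \<Rightarrow> ereal) set" where
  "L0_to_bar m F = (\<Union>f\<in>F. L0bar_rel m `` {\<lambda>x. ereal (f x)})"

text \<open>Only meaningful on the image of \<open>L0_to_bar\<close>.\<close>

definition L0_of_bar :: "'a measure \<Rightarrow> ('a \<Rightarrow> ereal) set \<Rightarrow> 'a l0" where
  "L0_of_bar m G = (THE F. F \<in> carrier (L0 m) \<and> L0_to_bar m F = G)"


section \<open>Random normed modules\<close>

locale random_normed_module = Module.module "L0 m" M
  for m :: "'a measure" and M :: "('a l0, 'm) rnm" (structure) +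
  assumes rnorm_closed: "v \<in> carrier M \<Longrightarrow> \<parallel>v\<parallel> \<in> L0_pos m"
    and rnorm_eq_zero_iff: "v \<in> carrier M \<Longrightarrow> \<parallel>v\<parallel> = \<zero>\<^bsub>L0 m\<^esub> \<longleftrightarrow> v = \<zero>"
    and rnorm_triangle:
      "v \<in> carrier M \<Longrightarrow> w \<in> carrier M \<Longrightarrow> L0_le m \<parallel>v \<oplus> w\<parallel> (\<parallel>v\<parallel> \<oplus>\<^bsub>L0 m\<^esub> \<parallel>w\<parallel>)"
    and rnorm_smult:
      "f \<in> carrier (L0 m) \<Longrightarrow> v \<in> carrier M \<Longrightarrow> \<parallel>f \<odot> v\<parallel> = \<parallel>f\<parallel>\<^bsub>L0 m\<^esub> \<otimes>\<^bsub>L0 m\<^esub> \<parallel>v\<parallel>"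

text \<open>
  The distance; it is set to 0 outside the carrier only because the locale \<^locale>\<open>Metric_space\<close>
  asks for symmetry and nonnegativity on the whole type.
\<close>

definition rnm_dist :: "'a measure \<Rightarrow> ('a l0, 'm) rnm \<Rightarrow> 'm \<Rightarrow> 'm \<Rightarrow> real" where
  "rnm_dist m M v w =
    (if v \<in> carrier M \<and> w \<in> carrier M
     then (\<integral>x. min ((SOME f. f \<in> \<parallel>v \<ominus>\<^bsub>M\<^esub> w\<parallel>\<^bsub>M\<^esub>) x) 1 \<partial>m) else 0)"

locale complete_random_normed_module = random_normed_module +
  assumes complete: "Metric_space.mcomplete (carrier M) (rnm_dist m M)"

text \<open>Infinite sums in \<open>L\<^sup>0\<close> are limits of partial sums for the distance of \<open>L\<^sup>0\<close>.\<close>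

definition L0_lim :: "'a measure \<Rightarrow> (nat \<Rightarrow> 'a l0) \<Rightarrow> 'a l0 \<Rightarrow> bool" where
  "L0_lim m F G \<longleftrightarrow>
    range F \<subseteq> carrier (L0 m) \<and> G \<in> carrier (L0 m) \<and>
    (\<lambda>n. rnm_dist m (L0 m) (F n) G) \<longlonglongrightarrow> 0"

definition L0_sums :: "'a measure \<Rightarrow> (nat \<Rightarrow> 'a l0) \<Rightarrow> 'a l0 \<Rightarrow> bool" where
  "L0_sums m F S \<longleftrightarrow> L0_lim m (\<lambda>n. \<Oplus>\<^bsub>L0 m\<^esub>i\<in>{..<n}. F i) S"

definition L0_suminf :: "'a measure \<Rightarrow> (nat \<Rightarrow> 'a l0) \<Rightarrow> 'a l0" where
  "L0_suminf m F = (THE S. L0_sums m F S)"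

definition L0_summable :: "'a measure \<Rightarrow> (nat \<Rightarrow> 'a l0) \<Rightarrow> bool" where
  "L0_summable m F \<longleftrightarrow>
    range F \<subseteq> L0_pos m \<and>
    (\<exists>B\<in>carrier (L0 m). \<forall>n. L0_le m (\<Oplus>\<^bsub>L0 m\<^esub>i\<in>{..<n}. F i) B)"

locale rnm_isometric_iso =
  dom: random_normed_module m M + cod: random_normed_module m N
  for m :: "'a measure" and M :: "('a l0, 'm) rnm" and N :: "('a l0, 'n) rnm" +
  fixes J :: "'m \<Rightarrow> 'n"
  assumes bij: "bij_betw J (carrier M) (carrier N)"
    and additive: "v \<in> carrier M \<Longrightarrow> w \<in> carrier M \<Longrightarrow> J (v \<oplus>\<^bsub>M\<^esub> w) = J v \<oplus>\<^bsub>N\<^esub> J w"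
    and homogeneous:
      "f \<in> carrier (L0 m) \<Longrightarrow> v \<in> carrier M \<Longrightarrow> J (f \<odot>\<^bsub>M\<^esub> v) = f \<odot>\<^bsub>N\<^esub> J v"
    and isometric: "v \<in> carrier M \<Longrightarrow> \<parallel>J v\<parallel>\<^bsub>N\<^esub> = \<parallel>v\<parallel>\<^bsub>M\<^esub>"


section \<open>Completion\<close>

text \<open>
  Cauchy sequences modulo sequences whose distance tends to 0, with termwise operations; the norm
  of a class is the limit in \<open>L\<^sup>0\<close> of the norms.  The Cauchy condition is spelled out instead of using the
  locale \<^locale>\<open>Metric_space\<close>, so that it unfolds without first showing that the given
  record is a random normed module.
\<close>

definition rnm_Cauchy :: "'a measure \<Rightarrow> ('a l0, 'm) rnm \<Rightarrow> (nat \<Rightarrow> 'm) set" where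
  "rnm_Cauchy m M =
    {\<sigma>. range \<sigma> \<subseteq> carrier M \<and>
         (\<forall>\<epsilon>>0. \<exists>N. \<forall>i\<ge>N. \<forall>j\<ge>N. rnm_dist m M (\<sigma> i) (\<sigma> j) < \<epsilon>)}"

definition completion_rel :: "'a measure \<Rightarrow> ('a l0, 'm) rnm \<Rightarrow> ((nat \<Rightarrow> 'm) \<times> (nat \<Rightarrow> 'm)) set" where
  "completion_rel m M =
    {(\<sigma>, \<tau>). \<sigma> \<in> rnm_Cauchy m M \<and> \<tau> \<in> rnm_Cauchy m M \<and>
            (\<lambda>n. rnm_dist m M (\<sigma> n) (\<tau> n)) \<longlonglongrightarrow> 0}"

definition completion_class :: "'a measure \<Rightarrow> ('a l0, 'm) rnm \<Rightarrow> (nat \<Rightarrow> 'm) \<Rightarrow> (nat \<Rightarrow> 'm) set" where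
  "completion_class m M \<sigma> = completion_rel m M `` {\<sigma>}"

definition rnm_completion :: "'a measure \<Rightarrow> ('a l0, 'm) rnm \<Rightarrow> ('a l0, (nat \<Rightarrow> 'm) set) rnm" where
  "rnm_completion m M =
    \<lparr>carrier = rnm_Cauchy m M // completion_rel m M,
     mult = undefined,
     one = undefined,
     ring.zero = completion_class m M (\<lambda>_. \<zero>\<^bsub>M\<^esub>),
     add = (\<lambda>P Q. \<Union>\<sigma>\<in>P. \<Union>\<tau>\<in>Q. completion_class m M (\<lambda>n. \<sigma> n \<oplus>\<^bsub>M\<^esub> \<tau> n)),
     smult = (\<lambda>f P. \<Union>\<sigma>\<in>P. completion_class m M (\<lambda>n. f \<odot>\<^bsub>M\<^esub> \<sigma> n)),
     rnorm = (\<lambda>P. THE c. \<exists>\<sigma>\<in>P. L0_lim m (\<lambda>n. \<parallel>\<sigma> n\<parallel>\<^bsub>M\<^esub>) c)\<rparr>"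

definition completion_emb :: "'a measure \<Rightarrow> ('a l0, 'm) rnm \<Rightarrow> 'm \<Rightarrow> (nat \<Rightarrow> 'm) set" where
  "completion_emb m M v = completion_class m M (\<lambda>_. v)"


section \<open>Projective tensor product\<close>

text \<open>
  The algebraic tensor product over a commutative ring \<open>R\<close>: the free abelian group on
  \<open>carrier M \<times> carrier N\<close> modulo the subgroup generated by the bilinearity relations.
\<close>

definition tensor_subgroup ::
  "('r, 'k) ring_scheme \<Rightarrow> ('r, 'm, 'x) module_scheme \<Rightarrow> ('r, 'n, 'y) module_scheme \<Rightarrow>
    ('m \<times> 'n \<Rightarrow>\<^sub>0 int) set" where
  "tensor_subgroup R M N =
    generate (free_Abelian_group (carrier M \<times> carrier N))
     ({frag_of (v \<oplus>\<^bsub>M\<^esub> v', w) - frag_of (v, w) - frag_of (v', w) | v v' w.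
         v \<in> carrier M \<and> v' \<in> carrier M \<and> w \<in> carrier N} \<union>
      {frag_of (v, w \<oplus>\<^bsub>N\<^esub> w') - frag_of (v, w) - frag_of (v, w') | v w w'.
         v \<in> carrier M \<and> w \<in> carrier N \<and> w' \<in> carrier N} \<union>
      {frag_of (r \<odot>\<^bsub>M\<^esub> v, w) - frag_of (v, r \<odot>\<^bsub>N\<^esub> w) | r v w.
         r \<in> carrier R \<and> v \<in> carrier M \<and> w \<in> carrier N})"

definition tensor_class ::
  "('r, 'k) ring_scheme \<Rightarrow> ('r, 'm, 'x) module_scheme \<Rightarrow> ('r, 'n, 'y) module_scheme \<Rightarrow>
    ('m \<times> 'n \<Rightarrow>\<^sub>0 int) \<Rightarrow> ('m \<times> 'n \<Rightarrow>\<^sub>0 int) set" where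
  "tensor_class R M N x =
    tensor_subgroup R M N #>\<^bsub>free_Abelian_group (carrier M \<times> carrier N)\<^esub> x"

definition tensor_elem ::
  "('r, 'k) ring_scheme \<Rightarrow> ('r, 'm, 'x) module_scheme \<Rightarrow> ('r, 'n, 'y) module_scheme \<Rightarrow>
    'm \<Rightarrow> 'n \<Rightarrow> ('m \<times> 'n \<Rightarrow>\<^sub>0 int) set" where
  "tensor_elem R M N v w = tensor_class R M N (frag_of (v, w))"

definition tensor_module ::
  "('r, 'k) ring_scheme \<Rightarrow> ('r, 'm, 'x) module_scheme \<Rightarrow> ('r, 'n, 'y) module_scheme \<Rightarrow>
    ('r, ('m \<times> 'n \<Rightarrow>\<^sub>0 int) set) module" where
  "tensor_module R M N =
    (let Q = free_Abelian_group (carrier M \<times> carrier N) Mod tensor_subgroup R M N in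
     \<lparr>carrier = carrier Q,
      mult = undefined,
      one = undefined,
      ring.zero = \<one>\<^bsub>Q\<^esub>,
      add = (\<otimes>\<^bsub>Q\<^esub>),
      smult = (\<lambda>r \<alpha>. \<Union>x\<in>\<alpha>. tensor_class R M N (frag_extend (\<lambda>(v, w). frag_of (r \<odot>\<^bsub>M\<^esub> v, w)) x))\<rparr>)"

definition proj_norm ::
  "'a measure \<Rightarrow> ('a l0, 'm) rnm \<Rightarrow> ('a l0, 'n) rnm \<Rightarrow> ('m \<times> 'n \<Rightarrow>\<^sub>0 int) set \<Rightarrow> 'a l0" where
  "proj_norm m M N \<alpha> =
    L0_of_bar m (\<Sqinter>\<^bsub>L0bar m\<^esub>
      {L0_to_bar m (\<Oplus>\<^bsub>L0 m\<^esub>i\<in>{..<n}. \<parallel>v i\<parallel>\<^bsub>M\<^esub> \<otimes>\<^bsub>L0 m\<^esub> \<parallel>w i\<parallel>\<^bsub>N\<^esub>) | (n::nat) v w.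
        (\<forall>i<n. v i \<in> carrier M \<and> w i \<in> carrier N) \<and>
        \<alpha> = (\<Oplus>\<^bsub>tensor_module (L0 m) M N\<^esub>i\<in>{..<n}. tensor_elem (L0 m) M N (v i) (w i))})"

definition alg_proj_tensor ::
  "'a measure \<Rightarrow> ('a l0, 'm) rnm \<Rightarrow> ('a l0, 'n) rnm \<Rightarrow> ('a l0, ('m \<times> 'n \<Rightarrow>\<^sub>0 int) set) rnm" where
  "alg_proj_tensor m M N = module.extend (tensor_module (L0 m) M N) \<lparr>rnorm = proj_norm m M N\<rparr>"

definition proj_tensor ::
  "'a measure \<Rightarrow> ('a l0, 'm) rnm \<Rightarrow> ('a l0, 'n) rnm \<Rightarrow>
    ('a l0, (nat \<Rightarrow> ('m \<times> 'n \<Rightarrow>\<^sub>0 int) set) set) rnm" where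
  "proj_tensor m M N = rnm_completion m (alg_proj_tensor m M N)"

definition proj_tensor_elem ::
  "'a measure \<Rightarrow> ('a l0, 'm) rnm \<Rightarrow> ('a l0, 'n) rnm \<Rightarrow> 'm \<Rightarrow> 'n \<Rightarrow>
    (nat \<Rightarrow> ('m \<times> 'n \<Rightarrow>\<^sub>0 int) set) set" where
  "proj_tensor_elem m M N v w =
    completion_emb m (alg_proj_tensor m M N) (tensor_elem (L0 m) M N v w)"


section \<open>\<open>L\<^sup>0\<close>-valued measures\<close>

text \<open>
  At most countable partitions are indexed by all of \<open>\<nat>\<close>; the pieces may be empty, so that finite
  partitions are included.
\<close>

definition seq_partition :: "'b set set \<Rightarrow> 'b set \<Rightarrow> (nat \<Rightarrow> 'b set) \<Rightarrow> bool" where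
  "seq_partition \<A> A B \<longleftrightarrow> range B \<subseteq> \<A> \<and> disjoint_family B \<and> (\<Union>n. B n) = A"

definition L0_valued_measure :: "'a measure \<Rightarrow> 'b set set \<Rightarrow> ('b set \<Rightarrow> 'a l0) \<Rightarrow> bool" where
  "L0_valued_measure m \<A> \<mu> \<longleftrightarrow>
    \<mu> \<in> \<A> \<rightarrow> carrier (L0 m) \<and>
    \<mu> {} = \<zero>\<^bsub>L0 m\<^esub> \<and>
    (\<forall>A. range A \<subseteq> \<A> \<and> disjoint_family A \<longrightarrow>
      L0_summable m (\<lambda>n. \<parallel>\<mu> (A n)\<parallel>\<^bsub>L0 m\<^esub>) \<and>
      L0_sums m (\<lambda>n. \<mu> (A n)) (\<mu> (\<Union>n. A n)))"

definition variation_bar ::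
  "'a measure \<Rightarrow> 'b set set \<Rightarrow> ('b set \<Rightarrow> 'a l0) \<Rightarrow> 'b set \<Rightarrow> ('a \<Rightarrow> ereal) set" where
  "variation_bar m \<A> \<mu> A =
    \<Squnion>\<^bsub>L0bar m\<^esub> {L0_to_bar m (L0_suminf m (\<lambda>n. \<parallel>\<mu> (B n)\<parallel>\<^bsub>L0 m\<^esub>)) | B. seq_partition \<A> A B}"

definition bounded_variation ::
  "'a measure \<Rightarrow> 'b set \<Rightarrow> 'b set set \<Rightarrow> ('b set \<Rightarrow> 'a l0) \<Rightarrow> bool" where
  "bounded_variation m \<Omega> \<A> \<mu> \<longleftrightarrow> variation_bar m \<A> \<mu> \<Omega> \<in> L0_to_bar m ` L0_pos m"

text \<open>
  If \<open>\<mu>\<close> has bounded variation, then \<open>\<bar>\<mu>\<bar>(A) \<le> \<bar>\<mu>\<bar>(\<Omega>)\<close> is (the image of) an element of \<open>L\<^sup>0\<close>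
  for every \<open>A \<in> \<A>\<close>.
\<close>

definition variation ::
  "'a measure \<Rightarrow> 'b set set \<Rightarrow> ('b set \<Rightarrow> 'a l0) \<Rightarrow> 'b set \<Rightarrow> 'a l0" where
  "variation m \<A> \<mu> A = L0_of_bar m (variation_bar m \<A> \<mu> A)"


section \<open>Lebesgue--Bochner spaces\<close>

definition simple_rep ::
  "'a measure \<Rightarrow> 'b set \<Rightarrow> 'b set set \<Rightarrow> ('b set \<Rightarrow> 'a l0) \<Rightarrow> ('a l0, 'm) rnm \<Rightarrow>
    (nat \<Rightarrow> 'b set) \<Rightarrow> (nat \<Rightarrow> 'm) \<Rightarrow> ('b \<Rightarrow> 'm) \<Rightarrow> bool" where
  "simple_rep m \<Omega> \<A> \<mu> M A a v \<longleftrightarrow>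
    seq_partition \<A> \<Omega> A \<and> range a \<subseteq> carrier M \<and> (\<forall>n. \<forall>\<omega>\<in>A n. v \<omega> = a n) \<and>
    L0_summable m (\<lambda>n. variation m \<A> \<mu> (A n) \<otimes>\<^bsub>L0 m\<^esub> \<parallel>a n\<parallel>\<^bsub>M\<^esub>)"

definition S1_funs ::
  "'a measure \<Rightarrow> 'b set \<Rightarrow> 'b set set \<Rightarrow> ('b set \<Rightarrow> 'a l0) \<Rightarrow> ('a l0, 'm) rnm \<Rightarrow> ('b \<Rightarrow> 'm) set" where
  "S1_funs m \<Omega> \<A> \<mu> M = {v. \<exists>A a. simple_rep m \<Omega> \<A> \<mu> M A a v}"

text \<open>Values outside \<open>\<Omega>\<close> are irrelevant: the relation only looks at points of \<open>\<Omega>\<close>.\<close>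

definition S1_rel ::
  "'a measure \<Rightarrow> 'b set \<Rightarrow> 'b set set \<Rightarrow> ('b set \<Rightarrow> 'a l0) \<Rightarrow> ('a l0, 'm) rnm \<Rightarrow>
    (('b \<Rightarrow> 'm) \<times> ('b \<Rightarrow> 'm)) set" where
  "S1_rel m \<Omega> \<A> \<mu> M =
    {(v, w). v \<in> S1_funs m \<Omega> \<A> \<mu> M \<and> w \<in> S1_funs m \<Omega> \<A> \<mu> M \<and>
      (\<exists>N\<in>\<A>. variation m \<A> \<mu> N = \<zero>\<^bsub>L0 m\<^esub> \<and> (\<forall>\<omega>\<in>\<Omega> - N. v \<omega> = w \<omega>))}"

definition S1_class ::
  "'a measure \<Rightarrow> 'b set \<Rightarrow> 'b set set \<Rightarrow> ('b set \<Rightarrow> 'a l0) \<Rightarrow> ('a l0, 'm) rnm \<Rightarrow>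
    ('b \<Rightarrow> 'm) \<Rightarrow> ('b \<Rightarrow> 'm) set" where
  "S1_class m \<Omega> \<A> \<mu> M v = S1_rel m \<Omega> \<A> \<mu> M `` {v}"

text \<open>
  The norm of a class is the value common to all representatives and all their descriptions by
  a partition and a sequence of values.
\<close>

definition S1 ::
  "'a measure \<Rightarrow> 'b set \<Rightarrow> 'b set set \<Rightarrow> ('b set \<Rightarrow> 'a l0) \<Rightarrow> ('a l0, 'm) rnm \<Rightarrow>
    ('a l0, ('b \<Rightarrow> 'm) set) rnm" where
  "S1 m \<Omega> \<A> \<mu> M =
    \<lparr>carrier = S1_funs m \<Omega> \<A> \<mu> M // S1_rel m \<Omega> \<A> \<mu> M,
     mult = undefined,
     one = undefined,
     ring.zero = S1_class m \<Omega> \<A> \<mu> M (\<lambda>_. \<zero>\<^bsub>M\<^esub>),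
     add = (\<lambda>V W. \<Union>v\<in>V. \<Union>w\<in>W. S1_class m \<Omega> \<A> \<mu> M (\<lambda>\<omega>. v \<omega> \<oplus>\<^bsub>M\<^esub> w \<omega>)),
     smult = (\<lambda>f V. \<Union>v\<in>V. S1_class m \<Omega> \<A> \<mu> M (\<lambda>\<omega>. f \<odot>\<^bsub>M\<^esub> v \<omega>)),
     rnorm = (\<lambda>V. THE c. \<exists>v\<in>V. \<exists>A a. simple_rep m \<Omega> \<A> \<mu> M A a v \<and>
                c = L0_suminf m (\<lambda>n. variation m \<A> \<mu> (A n) \<otimes>\<^bsub>L0 m\<^esub> \<parallel>a n\<parallel>\<^bsub>M\<^esub>))\<rparr>"

definition L1 ::
  "'a measure \<Rightarrow> 'b set \<Rightarrow> 'b set set \<Rightarrow> ('b set \<Rightarrow> 'a l0) \<Rightarrow> ('a l0, 'm) rnm \<Rightarrow>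
    ('a l0, (nat \<Rightarrow> ('b \<Rightarrow> 'm) set) set) rnm" where
  "L1 m \<Omega> \<A> \<mu> M = rnm_completion m (S1 m \<Omega> \<A> \<mu> M)"

text \<open>The element written \<open>\<one>\<^sub>A\<^sup>\<mu> v\<close>, the class of the map equal to \<open>v\<close> on \<open>A\<close> and 0 elsewhere.\<close>

definition L1_ind ::
  "'a measure \<Rightarrow> 'b set \<Rightarrow> 'b set set \<Rightarrow> ('b set \<Rightarrow> 'a l0) \<Rightarrow> ('a l0, 'm) rnm \<Rightarrow>
    'b set \<Rightarrow> 'm \<Rightarrow> (nat \<Rightarrow> ('b \<Rightarrow> 'm) set) set" where
  "L1_ind m \<Omega> \<A> \<mu> M A v =
    completion_emb m (S1 m \<Omega> \<A> \<mu> M)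
      (S1_class m \<Omega> \<A> \<mu> M (\<lambda>\<omega>. if \<omega> \<in> A then v else \<zero>\<^bsub>M\<^esub>))"

end

theory Submission
  imports Defs
begin

text \<open>
  Pairing a simple function with a constant vector gives a bilinear map
  \<open>(s, w) \<mapsto> (\<omega> \<mapsto> s \<omega> \<cdot> w)\<close> with \<open>\<bar>s \<cdot> w\<bar> = \<bar>s\<bar> \<bar>w\<bar>\<close>, which extends to \<open>L\<^sup>1(\<Omega>; L\<^sup>0) \<times> M\<close> and hence induces a
  contraction from the algebraic tensor product to \<open>L\<^sup>1(\<Omega>; M)\<close>.  It is isometric on the finite sums
  \<open>\<Sum>i. \<one>\<^bsub>A i\<^esub> \<otimes> v i\<close>: cutting \<open>\<Omega>\<close> into pieces on which the associated function is constant, the projective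
  norm is at most the sum of the norms over the pieces, because the norm of \<open>L\<^sup>1\<close> is additive on functions
  with disjoint supports.  These sums are dense in the tensor product and their images are dense
  in \<open>L\<^sup>1(\<Omega>; M)\<close>, so the contraction extends to an isometric isomorphism, and the values on
  \<open>\<one>\<^bsub>A\<^esub> \<otimes> v\<close> determine it.

  Neither the projective norm nor the norm on simple functions has to be definite for this (for simple
  functions it need not be: the supports of \<open>\<bar>\<mu>\<bar>(A)\<close> and \<open>\<bar>v\<bar>\<close> may be disjoint subsets of \<open>X\<close>).  The
  completion identifies elements at distance 0, so seminorms suffice throughout.
\<close>

section \<open>The algebra \<open>L\<^sup>0\<close>\<close>

text \<open>Simple maps may take countably many values, whereas an algebraic tensor is a finite sum.
  Truncation closes this gap: cutting a simple map after finitely many cells converges to it,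
  because its norm is an almost everywhere convergent series. Moreover a scalar can be moved across
  the tensor sign, f 1_A \<otimes> v = 1_A \<otimes> f v, so only characteristic functions remain.
  The estimate of the projective norm from above rests on |1_A| = |\<mu>|(A), which makes |1_A| |v|
  the norm of 1_A v, and on the countable additivity of |\<mu>|, without which the norm of a simple
  map would depend on its description by a partition. Bounds carry a factor from \<open>L0\<close>
  and not a number. Multiplication by such a factor is not Lipschitz for the metric of convergence
  in measure, but it is uniformly continuous, and this lets the pairing pass to completions. Suprema
  and infima of classes are handled by reading inequalities almost everywhere on chosen
  representatives; each argument is arranged so that only countably many null sets are
  discarded.\<close>

locale L0_base = prob_space m for m :: "'a measure"
begin

abbreviation L0_plus (infixl \<open>\<oplus>\<^sub>0\<close> 65) where "F \<oplus>\<^sub>0 G \<equiv> F \<oplus>\<^bsub>L0 m\<^esub> G"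
abbreviation L0_minus (infixl \<open>\<ominus>\<^sub>0\<close> 65) where "F \<ominus>\<^sub>0 G \<equiv> F \<ominus>\<^bsub>L0 m\<^esub> G"
abbreviation L0_times (infixl \<open>\<otimes>\<^sub>0\<close> 70) where "F \<otimes>\<^sub>0 G \<equiv> F \<otimes>\<^bsub>L0 m\<^esub> G"
abbreviation L0_zero_syntax (\<open>\<zero>\<^sub>0\<close>) where "\<zero>\<^sub>0 \<equiv> \<zero>\<^bsub>L0 m\<^esub>"
abbreviation L0_one_syntax (\<open>\<one>\<^sub>0\<close>) where "\<one>\<^sub>0 \<equiv> \<one>\<^bsub>L0 m\<^esub>"
abbreviation L0_abs (\<open>\<parallel>_\<parallel>\<^sub>0\<close>) where "\<parallel>F\<parallel>\<^sub>0 \<equiv> \<parallel>F\<parallel>\<^bsub>L0 m\<^esub>"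
abbreviation L0_set (\<open>\<L>\<close>) where "\<L> \<equiv> carrier (L0 m)"

end

text \<open>The representative that \<^const>\<open>rnm_dist\<close> integrates.\<close>

definition L0_rep :: "'a l0 \<Rightarrow> 'a \<Rightarrow> real" where
  "L0_rep F = (SOME f. f \<in> F)"

text \<open>The distance of a nonnegative class from 0. Distances in every module are values of this
  one function at norms of differences, so metric estimates reduce to its monotonicity and
  subadditivity on the positive cone.\<close>

definition L0_len :: "'a measure \<Rightarrow> 'a l0 \<Rightarrow> real" where
  "L0_len m F = (\<integral>x. min (L0_rep F x) 1 \<partial>m)"

text \<open>Operations on classes are unions over representatives; independence of the
  representative collapses such a union to a single class.\<close>

lemma UN_eq_const: "F \<noteq> {} \<Longrightarrow> (\<And>f. f \<in> F \<Longrightarrow> h f = c) \<Longrightarrow> (\<Union>f\<in>F. h f) = c"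
  by auto

context L0_base
begin

lemma equiv_L0_rel: "equiv (borel_measurable m) (L0_rel m)"
  by (rule equivI) (auto simp: L0_rel_def refl_on_def sym_def trans_def)

lemma mem_L0_class:
  "f \<in> borel_measurable m \<Longrightarrow> g \<in> L0_class m f \<longleftrightarrow> g \<in> borel_measurable m \<and> (AE x in m. f x = g x)"
  by (auto simp: L0_class_def L0_rel_def)

lemma L0_class_eq_iff:
  assumes "f \<in> borel_measurable m" "g \<in> borel_measurable m"
  shows "L0_class m f = L0_class m g \<longleftrightarrow> (AE x in m. f x = g x)"
  using eq_equiv_class_iff[OF equiv_L0_rel assms] assms by (simp add: L0_class_def L0_rel_def)

lemma L0_class_closed [simp, intro]: "f \<in> borel_measurable m \<Longrightarrow> L0_class m f \<in> \<L>"
  by (simp add: L0_class_def L0_def quotientI)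

lemma L0_cases:
  assumes "F \<in> \<L>"
  obtains f where "f \<in> borel_measurable m" "F = L0_class m f"
  using assms by (auto simp: L0_def quotient_def L0_class_def)

lemma L0_class_nonempty: "f \<in> borel_measurable m \<Longrightarrow> L0_class m f \<noteq> {}"
  using mem_L0_class[of f f] by auto

lemma L0_rep_mem: "F \<in> \<L> \<Longrightarrow> L0_rep F \<in> F"
  by (metis L0_cases L0_class_nonempty L0_rep_def ex_in_conv someI_ex)

lemma L0_rep_measurable [measurable, simp]: "F \<in> \<L> \<Longrightarrow> L0_rep F \<in> borel_measurable m"
  by (metis L0_cases L0_rep_mem mem_L0_class)

lemma L0_class_rep [simp]: "F \<in> \<L> \<Longrightarrow> L0_class m (L0_rep F) = F"
  by (metis (no_types, lifting) L0_cases L0_class_eq_iff L0_rep_measurable L0_rep_mem mem_L0_class)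

lemma AE_rep_class: "f \<in> borel_measurable m \<Longrightarrow> AE x in m. L0_rep (L0_class m f) x = f x"
  by (metis L0_class_closed L0_class_eq_iff L0_class_rep L0_rep_measurable)

lemma L0_eq_iff:
  "F \<in> \<L> \<Longrightarrow> G \<in> \<L> \<Longrightarrow> F = G \<longleftrightarrow> (AE x in m. L0_rep F x = L0_rep G x)"
  by (metis L0_class_eq_iff L0_class_rep L0_rep_measurable)

lemma L0_class_binop:
  assumes f: "f \<in> borel_measurable m" and g: "g \<in> borel_measurable m"
    and h: "\<And>f g. f \<in> borel_measurable m \<Longrightarrow> g \<in> borel_measurable m \<Longrightarrow> (\<lambda>x. h (f x) (g x)) \<in> borel_measurable m"
  shows "(\<Union>f'\<in>L0_class m f. \<Union>g'\<in>L0_class m g. L0_class m (\<lambda>x. h (f' x) (g' x)))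
    = L0_class m (\<lambda>x. h (f x) (g x))"
proof (intro UN_eq_const L0_class_nonempty f g)
  fix f' g' assume "f' \<in> L0_class m f" "g' \<in> L0_class m g"
  then have "f' \<in> borel_measurable m" "g' \<in> borel_measurable m" "AE x in m. f x = f' x" "AE x in m. g x = g' x"
    using f g by (auto simp: mem_L0_class)
  then show "L0_class m (\<lambda>x. h (f' x) (g' x)) = L0_class m (\<lambda>x. h (f x) (g x))"
    by (subst L0_class_eq_iff) (auto intro!: h f g)
qed

lemma L0_class_add:
  "f \<in> borel_measurable m \<Longrightarrow> g \<in> borel_measurable m \<Longrightarrow>
    L0_class m f \<oplus>\<^sub>0 L0_class m g = L0_class m (\<lambda>x. f x + g x)"
  using L0_class_binop[of f g "(+)"] by (simp add: L0_def)

lemma L0_class_mult: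
  "f \<in> borel_measurable m \<Longrightarrow> g \<in> borel_measurable m \<Longrightarrow>
    L0_class m f \<otimes>\<^sub>0 L0_class m g = L0_class m (\<lambda>x. f x * g x)"
  using L0_class_binop[of f g "(*)"] by (simp add: L0_def)

lemma L0_smult_eq [simp]: "F \<odot>\<^bsub>L0 m\<^esub> G = F \<otimes>\<^sub>0 G"
  by (simp add: L0_def)

lemma L0_class_norm:
  assumes f: "f \<in> borel_measurable m"
  shows "\<parallel>L0_class m f\<parallel>\<^sub>0 = L0_class m (\<lambda>x. \<bar>f x\<bar>)"
proof -
  have "(\<Union>f'\<in>L0_class m f. L0_class m (\<lambda>x. \<bar>f' x\<bar>)) = L0_class m (\<lambda>x. \<bar>f x\<bar>)"
  proof (intro UN_eq_const L0_class_nonempty f)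
    fix f' assume "f' \<in> L0_class m f"
    then have "f' \<in> borel_measurable m" "AE x in m. f x = f' x"
      using f by (auto simp: mem_L0_class)
    then show "L0_class m (\<lambda>x. \<bar>f' x\<bar>) = L0_class m (\<lambda>x. \<bar>f x\<bar>)"
      by (subst L0_class_eq_iff) (use f in auto)
  qed
  then show ?thesis by (simp add: L0_def)
qed

lemma L0_zero: "\<zero>\<^sub>0 = L0_class m (\<lambda>_. 0)" and L0_one: "\<one>\<^sub>0 = L0_class m (\<lambda>_. 1)"
  by (simp_all add: L0_def)

lemma L0_class_le_iff:
  assumes "f \<in> borel_measurable m" "g \<in> borel_measurable m"
  shows "L0_le m (L0_class m f) (L0_class m g) \<longleftrightarrow> (AE x in m. f x \<le> g x)"
proof
  assume "L0_le m (L0_class m f) (L0_class m g)"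
  then obtain f' g' where "f' \<in> L0_class m f" "g' \<in> L0_class m g" "AE x in m. f' x \<le> g' x"
    by (auto simp: L0_le_def)
  then have "AE x in m. f x = f' x" "AE x in m. g x = g' x" "AE x in m. f' x \<le> g' x"
    using assms by (auto simp: mem_L0_class)
  then show "AE x in m. f x \<le> g x" by eventually_elim auto
next
  assume "AE x in m. f x \<le> g x"
  then show "L0_le m (L0_class m f) (L0_class m g)"
    unfolding L0_le_def using assms by (intro bexI[of _ f] bexI[of _ g]) (auto simp: mem_L0_class)
qed

lemma L0_cring: "cring (L0 m)"
proof (intro cringI abelian_groupI comm_monoidI)
  fix F G H assume "F \<in> \<L>" "G \<in> \<L>" "H \<in> \<L>"
  then obtain f g h where "f \<in> borel_measurable m" "g \<in> borel_measurable m" "h \<in> borel_measurable m"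
    "F = L0_class m f" "G = L0_class m g" "H = L0_class m h"
    by (metis L0_cases)
  then show "F \<oplus>\<^sub>0 G \<oplus>\<^sub>0 H = F \<oplus>\<^sub>0 (G \<oplus>\<^sub>0 H)" "F \<otimes>\<^sub>0 G \<otimes>\<^sub>0 H = F \<otimes>\<^sub>0 (G \<otimes>\<^sub>0 H)"
    "(F \<oplus>\<^sub>0 G) \<otimes>\<^sub>0 H = F \<otimes>\<^sub>0 H \<oplus>\<^sub>0 G \<otimes>\<^sub>0 H"
    by (simp_all add: L0_class_add L0_class_mult algebra_simps)
next
  fix F G assume "F \<in> \<L>" "G \<in> \<L>"
  then obtain f g where fg: "f \<in> borel_measurable m" "g \<in> borel_measurable m"
    "F = L0_class m f" "G = L0_class m g"
    by (metis L0_cases)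
  then show "F \<oplus>\<^sub>0 G \<in> \<L>" "F \<otimes>\<^sub>0 G \<in> \<L>"
    "F \<oplus>\<^sub>0 G = G \<oplus>\<^sub>0 F" "F \<otimes>\<^sub>0 G = G \<otimes>\<^sub>0 F"
    by (auto simp add: L0_class_add L0_class_mult algebra_simps)
next
  fix F assume "F \<in> \<L>"
  then obtain f where fg: "f \<in> borel_measurable m" "F = L0_class m f"
    by (metis L0_cases)
  then show "\<zero>\<^sub>0 \<oplus>\<^sub>0 F = F" "\<one>\<^sub>0 \<otimes>\<^sub>0 F = F"
    by (auto simp add: L0_class_add L0_class_mult L0_zero L0_one)
  show "\<exists>y\<in>\<L>. y \<oplus>\<^sub>0 F = \<zero>\<^sub>0"
    by (rule bexI[of _ "L0_class m (\<lambda>x. - f x)"]) (use fg in \<open>auto simp: L0_class_add L0_zero\<close>)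
qed (auto simp: L0_zero L0_one)

sublocale L0: cring "L0 m" by (rule L0_cring)

lemma L0_module: "module (L0 m) (L0 m)"
  by (intro moduleI L0_cring L0.abelian_group_axioms)
    (auto simp: L0.l_distr L0.r_distr L0.m_assoc)

lemma L0_class_minus:
  assumes "f \<in> borel_measurable m"
  shows "\<ominus>\<^bsub>L0 m\<^esub> L0_class m f = L0_class m (\<lambda>x. - f x)"
  by (rule L0.minus_equality) (use assms in \<open>auto simp: L0_class_add L0_zero\<close>)

lemma L0_class_diff:
  assumes "f \<in> borel_measurable m" "g \<in> borel_measurable m"
  shows "L0_class m f \<ominus>\<^sub>0 L0_class m g = L0_class m (\<lambda>x. f x - g x)"
  using assms by (simp add: a_minus_def L0_class_minus L0_class_add)

lemma L0_norm_closed [simp, intro]: "F \<in> \<L> \<Longrightarrow> \<parallel>F\<parallel>\<^sub>0 \<in> \<L>"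
  by (erule L0_cases) (simp add: L0_class_norm)

section \<open>Operations and order of classes, read almost everywhere on representatives\<close>

lemma AE_rep_add:
  "F \<in> \<L> \<Longrightarrow> G \<in> \<L> \<Longrightarrow> AE x in m. L0_rep (F \<oplus>\<^sub>0 G) x = L0_rep F x + L0_rep G x"
  using AE_rep_class[of "\<lambda>x. L0_rep F x + L0_rep G x"] L0_class_add[of "L0_rep F" "L0_rep G"] by simp

lemma AE_rep_mult:
  "F \<in> \<L> \<Longrightarrow> G \<in> \<L> \<Longrightarrow> AE x in m. L0_rep (F \<otimes>\<^sub>0 G) x = L0_rep F x * L0_rep G x"
  using AE_rep_class[of "\<lambda>x. L0_rep F x * L0_rep G x"] L0_class_mult[of "L0_rep F" "L0_rep G"] by simp

lemma AE_rep_diff: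
  "F \<in> \<L> \<Longrightarrow> G \<in> \<L> \<Longrightarrow> AE x in m. L0_rep (F \<ominus>\<^sub>0 G) x = L0_rep F x - L0_rep G x"
  using AE_rep_class[of "\<lambda>x. L0_rep F x - L0_rep G x"] L0_class_diff[of "L0_rep F" "L0_rep G"] by simp

lemma AE_rep_norm:
  "F \<in> \<L> \<Longrightarrow> AE x in m. L0_rep \<parallel>F\<parallel>\<^sub>0 x = \<bar>L0_rep F x\<bar>"
  using AE_rep_class[of "\<lambda>x. \<bar>L0_rep F x\<bar>"] L0_class_norm[of "L0_rep F"] by simp

lemma AE_rep_zero: "AE x in m. L0_rep \<zero>\<^sub>0 x = 0"
  by (simp add: L0_zero AE_rep_class)

lemma AE_rep_one: "AE x in m. L0_rep \<one>\<^sub>0 x = 1"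
  by (simp add: L0_one AE_rep_class)

lemma AE_rep_finsum:
  assumes "finite I" "\<And>i. i \<in> I \<Longrightarrow> F i \<in> \<L>"
  shows "AE x in m. L0_rep (\<Oplus>\<^bsub>L0 m\<^esub>i\<in>I. F i) x = (\<Sum>i\<in>I. L0_rep (F i) x)"
  using assms
proof (induction I rule: finite_induct)
  case empty then show ?case by (simp add: AE_rep_zero)
next
  case (insert i I)
  have "AE x in m. L0_rep (F i \<oplus>\<^sub>0 (\<Oplus>\<^bsub>L0 m\<^esub>i\<in>I. F i)) x = L0_rep (F i) x + L0_rep (\<Oplus>\<^bsub>L0 m\<^esub>i\<in>I. F i) x"
    by (intro AE_rep_add L0.finsum_closed) (use insert in auto)
  moreover have "(\<Oplus>\<^bsub>L0 m\<^esub>i\<in>insert i I. F i) = F i \<oplus>\<^sub>0 (\<Oplus>\<^bsub>L0 m\<^esub>i\<in>I. F i)"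
    by (rule L0.finsum_insert) (use insert in auto)
  moreover have "AE x in m. L0_rep (\<Oplus>\<^bsub>L0 m\<^esub>i\<in>I. F i) x = (\<Sum>i\<in>I. L0_rep (F i) x)"
    using insert by auto
  ultimately show ?case using insert by auto
qed

lemma L0_le_iff:
  "F \<in> \<L> \<Longrightarrow> G \<in> \<L> \<Longrightarrow> L0_le m F G \<longleftrightarrow> (AE x in m. L0_rep F x \<le> L0_rep G x)"
  by (metis L0_class_le_iff L0_class_rep L0_rep_measurable)

lemma L0_pos_closed [intro]: "F \<in> L0_pos m \<Longrightarrow> F \<in> \<L>"
  by (simp add: L0_pos_def)

lemma L0_pos_iff: "F \<in> L0_pos m \<longleftrightarrow> F \<in> \<L> \<and> (AE x in m. 0 \<le> L0_rep F x)"
proof (cases "F \<in> \<L>")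
  case True
  then have "L0_le m \<zero>\<^sub>0 F \<longleftrightarrow> (AE x in m. L0_rep \<zero>\<^sub>0 x \<le> L0_rep F x)"
    by (simp add: L0_le_iff)
  also have "\<dots> \<longleftrightarrow> (AE x in m. 0 \<le> L0_rep F x)"
    using AE_rep_zero by (intro eventually_subst) auto
  finally show ?thesis using True by (simp add: L0_pos_def)
qed (auto simp: L0_pos_def)

lemma AE_rep_pos: "F \<in> L0_pos m \<Longrightarrow> AE x in m. 0 \<le> L0_rep F x"
  by (simp add: L0_pos_iff)

lemma L0_posI: "F \<in> \<L> \<Longrightarrow> AE x in m. 0 \<le> L0_rep F x \<Longrightarrow> F \<in> L0_pos m"
  by (simp add: L0_pos_iff)

declare L0_pos_closed [simp]

lemma L0_class_pos: "f \<in> borel_measurable m \<Longrightarrow> AE x in m. 0 \<le> f x \<Longrightarrow> L0_class m f \<in> L0_pos m"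
  using L0_class_le_iff[of "\<lambda>_. 0" f] by (simp add: L0_pos_def L0_zero del: L0_pos_closed)

lemma L0_le_refl [simp]: "F \<in> \<L> \<Longrightarrow> L0_le m F F"
  by (simp add: L0_le_iff)

lemma L0_le_trans [trans]:
  assumes "L0_le m F G" "L0_le m G H" "F \<in> \<L>" "G \<in> \<L>" "H \<in> \<L>"
  shows "L0_le m F H"
proof -
  have "AE x in m. L0_rep F x \<le> L0_rep G x" "AE x in m. L0_rep G x \<le> L0_rep H x" using assms by (auto simp: L0_le_iff)
  then have "AE x in m. L0_rep F x \<le> L0_rep H x" by eventually_elim auto
  then show ?thesis using assms by (auto simp: L0_le_iff)
qed

lemma L0_le_antisym:
  assumes "L0_le m F G" "L0_le m G F" "F \<in> \<L>" "G \<in> \<L>"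
  shows "F = G"
proof -
  have "AE x in m. L0_rep F x \<le> L0_rep G x" "AE x in m. L0_rep G x \<le> L0_rep F x" using assms by (auto simp: L0_le_iff)
  then have "AE x in m. L0_rep F x = L0_rep G x" by eventually_elim auto
  then show ?thesis using assms by (auto simp: L0_eq_iff)
qed

lemma L0_norm_pos [simp, intro]: "F \<in> \<L> \<Longrightarrow> \<parallel>F\<parallel>\<^sub>0 \<in> L0_pos m"
  by (erule L0_cases) (simp add: L0_class_norm L0_class_pos)

lemma L0_pos_zero [simp, intro]: "\<zero>\<^sub>0 \<in> L0_pos m"
  by (simp add: L0_zero L0_class_pos)

lemma L0_pos_one [simp, intro]: "\<one>\<^sub>0 \<in> L0_pos m"
  by (simp add: L0_one L0_class_pos)

lemma L0_pos_add [simp, intro]: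
  assumes "F \<in> L0_pos m" "G \<in> L0_pos m" shows "F \<oplus>\<^sub>0 G \<in> L0_pos m"
proof -
  have "AE x in m. 0 \<le> L0_rep (F \<oplus>\<^sub>0 G) x"
    using AE_rep_add[of F G] AE_rep_pos[OF assms(1)] AE_rep_pos[OF assms(2)] assms by auto
  then show ?thesis using assms by (auto intro: L0_posI)
qed

lemma L0_pos_mult [simp, intro]:
  assumes "F \<in> L0_pos m" "G \<in> L0_pos m" shows "F \<otimes>\<^sub>0 G \<in> L0_pos m"
proof -
  have "AE x in m. 0 \<le> L0_rep (F \<otimes>\<^sub>0 G) x"
    using AE_rep_mult[of F G] AE_rep_pos[OF assms(1)] AE_rep_pos[OF assms(2)] assms by auto
  then show ?thesis using assms by (auto intro: L0_posI)
qed

lemma L0_norm_eq_self: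
  assumes "F \<in> L0_pos m" shows "\<parallel>F\<parallel>\<^sub>0 = F"
proof -
  have "AE x in m. L0_rep \<parallel>F\<parallel>\<^sub>0 x = L0_rep F x"
    using AE_rep_norm[of F] AE_rep_pos[OF assms] assms by auto
  then show ?thesis using assms by (subst L0_eq_iff) auto
qed

lemma L0_add_mono:
  assumes "L0_le m F F'" "L0_le m G G'"
    "F \<in> \<L>" "F' \<in> \<L>" "G \<in> \<L>" "G' \<in> \<L>"
  shows "L0_le m (F \<oplus>\<^sub>0 G) (F' \<oplus>\<^sub>0 G')"
proof -
  have "AE x in m. L0_rep F x \<le> L0_rep F' x" "AE x in m. L0_rep G x \<le> L0_rep G' x" using assms by (auto simp: L0_le_iff)
  then have "AE x in m. L0_rep (F \<oplus>\<^sub>0 G) x \<le> L0_rep (F' \<oplus>\<^sub>0 G') x"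
    using AE_rep_add[OF assms(3,5)] AE_rep_add[OF assms(4,6)] by eventually_elim auto
  then show ?thesis using assms by (auto simp: L0_le_iff)
qed

section \<open>The truncated integral and the metric of convergence in measure\<close>

lemma L0_len_class: "f \<in> borel_measurable m \<Longrightarrow> L0_len m (L0_class m f) = (\<integral>x. min (f x) 1 \<partial>m)"
  unfolding L0_len_def by (rule integral_cong_AE) (use AE_rep_class[of f] in auto)

lemma integrable_min_1:
  "f \<in> borel_measurable m \<Longrightarrow> AE x in m. 0 \<le> f x \<Longrightarrow> integrable m (\<lambda>x. min (f x) (1::real))"
  by (rule integrable_const_bound[where B=1]) auto

lemma L0_len_nonneg: "F \<in> L0_pos m \<Longrightarrow> 0 \<le> L0_len m F"
  unfolding L0_len_def by (rule integral_nonneg_AE) (use AE_rep_pos[of F] in auto)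

lemma L0_len_zero [simp]: "L0_len m \<zero>\<^sub>0 = 0"
  by (simp add: L0_zero L0_len_class)

lemma L0_len_mono:
  assumes "F \<in> L0_pos m" "G \<in> \<L>" "L0_le m F G"
  shows "L0_len m F \<le> L0_len m G"
proof -
  have le: "AE x in m. L0_rep F x \<le> L0_rep G x" using assms by (simp add: L0_le_iff)
  have G: "AE x in m. 0 \<le> L0_rep G x" using le AE_rep_pos[OF assms(1)] by eventually_elim auto
  show ?thesis unfolding L0_len_def
    by (rule integral_mono_AE) (use assms le G AE_rep_pos[OF assms(1)] in \<open>auto intro!: integrable_min_1\<close>)
qed

lemma L0_len_add:
  assumes "F \<in> L0_pos m" "G \<in> L0_pos m"
  shows "L0_len m (F \<oplus>\<^sub>0 G) \<le> L0_len m F + L0_len m G"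
proof -
  note p = AE_rep_pos[OF assms(1)] AE_rep_pos[OF assms(2)] AE_rep_pos[OF L0_pos_add[OF assms]]
  have "L0_len m (F \<oplus>\<^sub>0 G) \<le> (\<integral>x. min (L0_rep F x) 1 + min (L0_rep G x) 1 \<partial>m)"
    unfolding L0_len_def
  proof (rule integral_mono_AE)
    show "AE x in m. min (L0_rep (F \<oplus>\<^sub>0 G) x) 1 \<le> min (L0_rep F x) 1 + min (L0_rep G x) 1"
      using AE_rep_add[OF L0_pos_closed[OF assms(1)] L0_pos_closed[OF assms(2)]] p by eventually_elim auto
  qed (use assms p in \<open>auto intro!: integrable_min_1 Bochner_Integration.integrable_add\<close>)
  also have "\<dots> = L0_len m F + L0_len m G"
    unfolding L0_len_def by (rule Bochner_Integration.integral_add) (use assms p in \<open>auto intro!: integrable_min_1\<close>)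
  finally show ?thesis .
qed

lemma L0_len_eq_zeroD:
  assumes "F \<in> L0_pos m" "L0_len m F = 0"
  shows "F = \<zero>\<^sub>0"
proof -
  note p = AE_rep_pos[OF assms(1)]
  have "AE x in m. min (L0_rep F x) 1 = 0"
    using assms p
    by (subst integral_nonneg_eq_0_iff_AE[symmetric]) (auto intro!: integrable_min_1 simp: L0_len_def)
  then have "AE x in m. L0_rep F x = L0_rep \<zero>\<^sub>0 x" using AE_rep_zero by eventually_elim auto
  then show ?thesis using assms by (subst L0_eq_iff) auto
qed

text \<open>Dominated convergence: the integrands are bounded by 1, which is integrable on a
  probability space.\<close>

lemma L0_len_tendsto_AE:
  assumes "\<And>n. F n \<in> L0_pos m" "AE x in m. (\<lambda>n. L0_rep (F n) x) \<longlonglongrightarrow> 0"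
  shows "(\<lambda>n. L0_len m (F n)) \<longlonglongrightarrow> 0"
proof -
  have p: "AE x in m. 0 \<le> L0_rep (F n) x" for n using assms AE_rep_pos by auto
  have "(\<lambda>n. \<integral>x. min (L0_rep (F n) x) 1 \<partial>m) \<longlonglongrightarrow> (\<integral>x. 0 \<partial>m)"
  proof (rule integral_dominated_convergence[where w="\<lambda>_. 1"])
    show "AE x in m. (\<lambda>n. min (L0_rep (F n) x) 1) \<longlonglongrightarrow> 0"
      using assms(2) by eventually_elim (auto intro: tendsto_eq_intros)
    show "AE x in m. norm (min (L0_rep (F n) x) 1) \<le> 1" for n using p[of n] by eventually_elim auto
  qed (use assms(1) in auto)
  then show ?thesis by (simp add: L0_len_def)
qed

text \<open>Multiplication by \<open>G\<close> is not Lipschitz for the metric, since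
  \<open>G\<close> may be unbounded. But \<open>G\<close> exceeds a large constant \<open>K\<close>
  only with small probability, and elsewhere multiplication enlarges the truncated integral at most
  \<open>K\<close> times.\<close>

lemma L0_len_mult_tendsto:
  assumes F: "\<And>n. F n \<in> L0_pos m" and lim: "(\<lambda>n. L0_len m (F n)) \<longlonglongrightarrow> 0" and G: "G \<in> L0_pos m"
  shows "(\<lambda>n. L0_len m (G \<otimes>\<^sub>0 F n)) \<longlonglongrightarrow> 0"
proof (rule LIMSEQ_I)
  fix r :: real assume r: "0 < r"
  have Gm [measurable]: "L0_rep G \<in> borel_measurable m" using G by auto
  have "(\<lambda>k. \<P>(x in m. L0_rep G x > real k)) \<longlonglongrightarrow> measure m (\<Inter>k. {x\<in>space m. L0_rep G x > real k})"
    by (rule finite_Lim_measure_decseq) (auto simp: decseq_def)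
  also have "(\<Inter>k. {x\<in>space m. L0_rep G x > real k}) = {}"
  proof (rule equals0I)
    fix x assume "x \<in> (\<Inter>k. {x\<in>space m. L0_rep G x > real k})"
    moreover obtain k where "L0_rep G x \<le> real k" using real_arch_simple by blast
    ultimately show False by (auto dest!: spec[of _ k])
  qed
  finally have "(\<lambda>k. \<P>(x in m. L0_rep G x > real k)) \<longlonglongrightarrow> 0" by simp
  \<comment> \<open>Half of \<open>r\<close> is reserved for the event where \<open>G\<close>
    exceeds \<open>K\<close>. The condition \<open>K \<ge> 1\<close> gives min (K t) 1 \<le> K min t
    1 for t \<ge> 0.\<close>
  then have "eventually (\<lambda>k. \<P>(x in m. L0_rep G x > real k) < r/2 \<and> k \<ge> 1) sequentially"
    using r by (intro eventually_conj eventually_ge_at_top order_tendstoD(2)[where y=0]) auto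
  then obtain K :: nat where K: "\<P>(x in m. L0_rep G x > real K) < r/2" "K \<ge> 1"
    using eventually_happens'[OF sequentially_bot] by blast
  have "eventually (\<lambda>n. L0_len m (F n) < r / (2*K)) sequentially"
    by (rule order_tendstoD(2)[OF lim]) (use r K in auto)
  then obtain N where N: "\<And>n. n \<ge> N \<Longrightarrow> L0_len m (F n) < r / (2*K)"
    by (auto simp: eventually_sequentially)
  have "norm (L0_len m (G \<otimes>\<^sub>0 F n) - 0) < r" if n: "n \<ge> N" for n
  proof -
    note p = AE_rep_pos[OF F[of n]] AE_rep_pos[OF G] AE_rep_pos[OF L0_pos_mult[OF G F[of n]]]
    have [measurable]: "L0_rep (F n) \<in> borel_measurable m" using F by auto
    have ind: "integrable m (\<lambda>x. indicator {x\<in>space m. L0_rep G x > real K} x :: real)"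
      by (rule integrable_const_bound[where B=1]) auto
    have "L0_len m (G \<otimes>\<^sub>0 F n) \<le> (\<integral>x. indicator {x\<in>space m. L0_rep G x > real K} x + K * min (L0_rep (F n) x) 1 \<partial>m)"
      unfolding L0_len_def
    proof (rule integral_mono_AE)
      show "AE x in m. min (L0_rep (G \<otimes>\<^sub>0 F n) x) 1 \<le> indicator {x\<in>space m. L0_rep G x > real K} x + K * min (L0_rep (F n) x) 1"
        using AE_rep_mult[OF L0_pos_closed[OF G] L0_pos_closed[OF F[of n]]] p AE_space
      proof eventually_elim
        case (elim x)
        show ?case
        proof (cases "L0_rep G x > real K")
          case True
          then show ?thesis using elim by (auto simp: min_le_iff_disj)
        next
          case False
          have "L0_rep G x * L0_rep (F n) x \<le> K * L0_rep (F n) x"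
            using elim False by (intro mult_right_mono) auto
          then show ?thesis using False K elim by (auto simp: min_def)
        qed
      qed
      show "integrable m (\<lambda>x. indicator {x\<in>space m. L0_rep G x > real K} x + K * min (L0_rep (F n) x) 1)"
        by (intro Bochner_Integration.integrable_add ind integrable_mult_right integrable_min_1) (use p in auto)
    qed (use F G p in \<open>auto intro!: integrable_min_1\<close>)
    also have "\<dots> = (\<integral>x. indicator {x\<in>space m. L0_rep G x > real K} x \<partial>m) + (\<integral>x. K * min (L0_rep (F n) x) 1 \<partial>m)"
      by (intro Bochner_Integration.integral_add ind integrable_mult_right integrable_min_1) (use p in auto)
    also have "\<dots> = \<P>(x in m. L0_rep G x > real K) + K * L0_len m (F n)"
      unfolding L0_len_def by simp
    also have "\<dots> < r/2 + K * (r/(2*K))"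
      using K N[OF n] by (intro add_less_le_mono mult_left_mono) auto
    also have "\<dots> = r" using K by (simp add: field_simps)
    finally show ?thesis using L0_len_nonneg[OF L0_pos_mult[OF G F[of n]]] by simp
  qed
  then show "\<exists>no. \<forall>n\<ge>no. norm (L0_len m (G \<otimes>\<^sub>0 F n) - 0) < r" by blast
qed

lemma L0_dist_eq:
  assumes "F \<in> \<L>" "G \<in> \<L>"
  shows "rnm_dist m (L0 m) F G = (\<integral>x. min \<bar>L0_rep F x - L0_rep G x\<bar> 1 \<partial>m)"
proof -
  have "rnm_dist m (L0 m) F G = L0_len m \<parallel>F \<ominus>\<^sub>0 G\<parallel>\<^sub>0"
    using assms by (simp add: rnm_dist_def L0_len_def L0_rep_def)
  also have "F \<ominus>\<^sub>0 G = L0_class m (\<lambda>x. L0_rep F x - L0_rep G x)"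
    using L0_class_diff[of "L0_rep F" "L0_rep G"] assms by simp
  finally show ?thesis using assms by (simp add: L0_class_norm L0_len_class)
qed

lemma L0_lim_AE:
  assumes "\<And>n. F n \<in> \<L>" "G \<in> \<L>" "AE x in m. (\<lambda>n. L0_rep (F n) x) \<longlonglongrightarrow> L0_rep G x"
  shows "L0_lim m F G"
proof -
  have "(\<lambda>n. \<integral>x. min \<bar>L0_rep (F n) x - L0_rep G x\<bar> 1 \<partial>m) \<longlonglongrightarrow> (\<integral>x. 0 \<partial>m)"
  proof (rule integral_dominated_convergence[where w="\<lambda>_. 1"])
    show "AE x in m. (\<lambda>n. min \<bar>L0_rep (F n) x - L0_rep G x\<bar> 1) \<longlonglongrightarrow> 0"
      using assms(3)
    proof eventually_elim
      case (elim x)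
      then have "(\<lambda>n. min \<bar>L0_rep (F n) x - L0_rep G x\<bar> 1) \<longlonglongrightarrow> min \<bar>L0_rep G x - L0_rep G x\<bar> 1"
        by (intro tendsto_intros)
      then show ?case by simp
    qed
  qed (use assms in auto)
  then show ?thesis using assms by (auto simp: L0_lim_def L0_dist_eq)
qed

text \<open>A subsequence with geometrically decreasing distances has almost everywhere summable
  increments, hence an almost everywhere limit; a Cauchy sequence converges to the limit of any of
  its subsequences.\<close>

lemma L0_complete:
  assumes F: "\<And>n. F n \<in> \<L>"
    and cauchy: "\<And>\<epsilon>. \<epsilon> > 0 \<Longrightarrow> \<exists>N. \<forall>i\<ge>N. \<forall>j\<ge>N. rnm_dist m (L0 m) (F i) (F j) < \<epsilon>"
  shows "\<exists>G. L0_lim m F G"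
proof -
  define d where "d i j x = min \<bar>L0_rep (F i) x - L0_rep (F j) x\<bar> 1" for i j x
  have dm [measurable]: "d i j \<in> borel_measurable m" for i j unfolding d_def using F by auto
  have di: "integrable m (d i j)" for i j
    unfolding d_def using F by (intro integrable_min_1) auto
  have dist: "rnm_dist m (L0 m) (F i) (F j) = (\<integral>x. d i j x \<partial>m)" for i j
    unfolding d_def by (rule L0_dist_eq[OF F F])
  have "\<exists>N. \<forall>i\<ge>N. \<forall>j\<ge>N. (\<integral>x. d i j x \<partial>m) < (1/2)^k" for k :: nat
    using cauchy[of "(1/2)^k"] by (simp add: dist)
  then obtain N where N: "\<And>k i j. i \<ge> N k \<Longrightarrow> j \<ge> N k \<Longrightarrow> (\<integral>x. d i j x \<partial>m) < (1/2)^k"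
    by metis
  \<comment> \<open>Summing the thresholds makes \<open>r k\<close> at least \<open>N k\<close>, and
    the summand \<open>k\<close> makes \<open>r\<close> strictly increasing.\<close>
  define r where "r k = (\<Sum>i\<le>k. N i) + k" for k
  have r_mono: "strict_mono r" by (auto simp: r_def strict_mono_Suc_iff)
  have rN: "r k \<ge> N k" for k unfolding r_def by (rule order.trans[OF member_le_sum[of k "{..k}" N]]) auto
  have rN': "r (Suc k) \<ge> N k" for k using rN[of k] r_mono by (meson le_SucI order.trans strict_mono_less_eq lessI less_imp_le)
  have dnn: "0 \<le> d i j x" for i j x by (simp add: d_def)
  have "(\<integral>\<^sup>+x. suminf (\<lambda>k. ennreal (d (r k) (r (Suc k)) x)) \<partial>m) = suminf (\<lambda>k. \<integral>\<^sup>+x. ennreal (d (r k) (r (Suc k)) x) \<partial>m)"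
    by (rule nn_integral_suminf) auto
  also have "\<dots> \<le> suminf (\<lambda>k. ennreal ((1/2)^k))"
  proof (intro suminf_le allI)
    fix k
    have "(\<integral>\<^sup>+x. ennreal (d (r k) (r (Suc k)) x) \<partial>m) = ennreal (\<integral>x. d (r k) (r (Suc k)) x \<partial>m)"
      by (rule nn_integral_eq_integral[OF di]) (simp add: dnn)
    also have "\<dots> \<le> ennreal ((1/2)^k)" using N[OF rN rN'] by (intro ennreal_leI) (simp add: less_imp_le)
    finally show "(\<integral>\<^sup>+x. ennreal (d (r k) (r (Suc k)) x) \<partial>m) \<le> ennreal ((1/2)^k)" .
  qed auto
  also have "\<dots> < \<infinity>"
    by (subst suminf_ennreal2) (auto simp: summable_geometric)
  finally have "(\<integral>\<^sup>+x. suminf (\<lambda>k. ennreal (d (r k) (r (Suc k)) x)) \<partial>m) \<noteq> \<infinity>" by simp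
  then have "AE x in m. suminf (\<lambda>k. ennreal (d (r k) (r (Suc k)) x)) \<noteq> \<infinity>"
    by (intro nn_integral_noteq_infinite) auto
  then have conv: "AE x in m. convergent (\<lambda>k. L0_rep (F (r k)) x)"
  proof eventually_elim
    case (elim x)
    have s: "summable (\<lambda>k. d (r k) (r (Suc k)) x)"
      by (rule summable_suminf_not_top) (use elim dnn in auto)
    \<comment> \<open>The terms of a summable series are eventually below 1, where the truncation
      has no effect; hence the increments themselves are summable.\<close>
    have "(\<lambda>k. d (r k) (r (Suc k)) x) \<longlonglongrightarrow> 0" by (rule summable_LIMSEQ_zero[OF s])
    then have "eventually (\<lambda>k. d (r k) (r (Suc k)) x < 1) sequentially" by (rule order_tendstoD) simp
    then have "eventually (\<lambda>k. norm (L0_rep (F (r (Suc k))) x - L0_rep (F (r k)) x) = d (r k) (r (Suc k)) x) sequentially"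
      by eventually_elim (auto simp: d_def min_def abs_minus_commute split: if_splits)
    then have "summable (\<lambda>k. norm (L0_rep (F (r (Suc k))) x - L0_rep (F (r k)) x))"
      using s summable_cong by fastforce
    then have "summable (\<lambda>k. L0_rep (F (r (Suc k))) x - L0_rep (F (r k)) x)" by (rule summable_norm_cancel)
    then have "convergent (\<lambda>n. \<Sum>k<n. L0_rep (F (r (Suc k))) x - L0_rep (F (r k)) x)"
      by (simp add: summable_iff_convergent)
    then have "convergent (\<lambda>n. (L0_rep (F (r n)) x - L0_rep (F (r 0)) x) + L0_rep (F (r 0)) x)"
      using sum_lessThan_telescope[of "\<lambda>k. L0_rep (F (r k)) x"] by (intro convergent_add convergent_const) simp
    then show ?case by simp
  qed
  define g where "g x = lim (\<lambda>k. L0_rep (F (r k)) x)" for x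
  have gm [measurable]: "g \<in> borel_measurable m" unfolding g_def using F by (intro borel_measurable_lim_metric) auto
  define G where "G = L0_class m g"
  have G: "G \<in> \<L>" by (simp add: G_def)
  have "AE x in m. (\<lambda>k. L0_rep (F (r k)) x) \<longlonglongrightarrow> L0_rep G x"
    using conv AE_rep_class[OF gm] unfolding G_def g_def by eventually_elim (auto simp: convergent_LIMSEQ_iff)
  then have lim: "(\<lambda>k. rnm_dist m (L0 m) (F (r k)) G) \<longlonglongrightarrow> 0"
    using L0_lim_AE[of "\<lambda>k. F (r k)" G] F G by (auto simp: L0_lim_def)
  have tri: "rnm_dist m (L0 m) (F i) G \<le> rnm_dist m (L0 m) (F i) (F j) + rnm_dist m (L0 m) (F j) G" for i j
    unfolding L0_dist_eq[OF F F] L0_dist_eq[OF F G]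
    by (subst Bochner_Integration.integral_add[symmetric])
       (use F G in \<open>auto intro!: integral_mono integrable_min_1 Bochner_Integration.integrable_add\<close>)
  have "(\<lambda>n. rnm_dist m (L0 m) (F n) G) \<longlonglongrightarrow> 0"
  proof (rule LIMSEQ_I)
    fix e :: real assume e: "0 < e"
    obtain N where N: "\<And>i j. i \<ge> N \<Longrightarrow> j \<ge> N \<Longrightarrow> rnm_dist m (L0 m) (F i) (F j) < e/2"
      using cauchy[of "e/2"] e by auto
    have "eventually (\<lambda>k. rnm_dist m (L0 m) (F (r k)) G < e/2 \<and> k \<ge> N) sequentially"
      using e by (intro eventually_conj eventually_ge_at_top order_tendstoD(2)[OF lim]) auto
    then obtain k where k: "rnm_dist m (L0 m) (F (r k)) G < e/2" "k \<ge> N"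
      using eventually_happens'[OF sequentially_bot] by blast
    have rk: "r k \<ge> N" using k(2) seq_suble[OF r_mono, of k] by linarith
    have "rnm_dist m (L0 m) (F n) G < e" if "n \<ge> N" for n
      using tri[of n "r k"] N[OF that rk] k by linarith
    moreover have "0 \<le> rnm_dist m (L0 m) (F n) G" for n
      unfolding L0_dist_eq[OF F G] by (intro Bochner_Integration.integral_nonneg) auto
    ultimately show "\<exists>no. \<forall>n\<ge>no. norm (rnm_dist m (L0 m) (F n) G - 0) < e" by (intro exI[of _ N]) auto
  qed
  then show ?thesis using F G by (auto simp: L0_lim_def intro!: exI[of _ G])
qed

end

section \<open>Seminormed modules over \<open>L\<^sup>0\<close> and their completions\<close>

lemma tendsto_zero_le:
  fixes a b :: "nat \<Rightarrow> real"
  assumes "b \<longlonglongrightarrow> 0" "\<And>n. 0 \<le> a n" "\<And>n. a n \<le> b n"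
  shows "a \<longlonglongrightarrow> 0"
  by (rule tendsto_sandwich[OF always_eventually always_eventually tendsto_const assms(1)]) (use assms in auto)

lemmas tendsto_zero_inverse = tendsto_zero_le[OF LIMSEQ_inverse_real_of_nat]

locale seminormed_L0_module = L0_base m + Module.module "L0 m" M
  for m :: "'a measure" and M :: "('a l0, 'm) rnm" (structure) +
  assumes norm_in_pos [simp, intro]: "v \<in> carrier M \<Longrightarrow> \<parallel>v\<parallel> \<in> L0_pos m"
    and norm_triangle:
      "v \<in> carrier M \<Longrightarrow> w \<in> carrier M \<Longrightarrow> L0_le m \<parallel>v \<oplus> w\<parallel> (\<parallel>v\<parallel> \<oplus>\<^sub>0 \<parallel>w\<parallel>)"
    and norm_smult:
      "f \<in> \<L> \<Longrightarrow> v \<in> carrier M \<Longrightarrow> \<parallel>f \<odot> v\<parallel> = \<parallel>f\<parallel>\<^sub>0 \<otimes>\<^sub>0 \<parallel>v\<parallel>"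

text \<open>Separates definiteness from the other axioms. The value of the norm at the zero vector
  is forced by homogeneity, so one implication expresses definiteness.\<close>

lemma (in L0_base) random_normed_module_iff:
  "random_normed_module m M \<longleftrightarrow>
    seminormed_L0_module m M \<and> (\<forall>v\<in>carrier M. \<parallel>v\<parallel>\<^bsub>M\<^esub> = \<zero>\<^sub>0 \<longrightarrow> v = \<zero>\<^bsub>M\<^esub>)"
proof
  assume "random_normed_module m M"
  then interpret random_normed_module m M .
  show "seminormed_L0_module m M \<and> (\<forall>v\<in>carrier M. \<parallel>v\<parallel>\<^bsub>M\<^esub> = \<zero>\<^sub>0 \<longrightarrow> v = \<zero>\<^bsub>M\<^esub>)"
    using rnorm_closed rnorm_eq_zero_iff rnorm_triangle rnorm_smult
    by (auto intro!: seminormed_L0_module.intro seminormed_L0_module_axioms.intro module_axioms L0_base_axioms)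
next
  assume *: "seminormed_L0_module m M \<and> (\<forall>v\<in>carrier M. \<parallel>v\<parallel>\<^bsub>M\<^esub> = \<zero>\<^sub>0 \<longrightarrow> v = \<zero>\<^bsub>M\<^esub>)"
  then interpret seminormed_L0_module m M by simp
  have "\<parallel>\<zero>\<^bsub>M\<^esub>\<parallel>\<^bsub>M\<^esub> = \<parallel>\<zero>\<^sub>0 \<odot>\<^bsub>M\<^esub> \<zero>\<^bsub>M\<^esub>\<parallel>\<^bsub>M\<^esub>" by simp
  also have "\<dots> = \<zero>\<^sub>0"
    by (subst norm_smult) (auto simp: L0_norm_eq_self)
  finally show "random_normed_module m M"
    using * by (auto intro!: random_normed_module.intro random_normed_module_axioms.intro module_axioms norm_triangle norm_smult)
qed

context L0_base
begin

lemma L0_seminormed: "seminormed_L0_module m (L0 m)"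
proof (intro seminormed_L0_module.intro seminormed_L0_module_axioms.intro L0_module L0_base_axioms)
  fix F G assume F: "F \<in> \<L>" and G: "G \<in> \<L>"
  show "L0_le m \<parallel>F \<oplus>\<^sub>0 G\<parallel>\<^sub>0 (\<parallel>F\<parallel>\<^sub>0 \<oplus>\<^sub>0 \<parallel>G\<parallel>\<^sub>0)"
    by (rule L0_cases[OF F], rule L0_cases[OF G]) (auto simp: L0_class_add L0_class_norm L0_class_le_iff)
  show "\<parallel>F \<odot>\<^bsub>L0 m\<^esub> G\<parallel>\<^sub>0 = \<parallel>F\<parallel>\<^sub>0 \<otimes>\<^sub>0 \<parallel>G\<parallel>\<^sub>0"
    by (rule L0_cases[OF F], rule L0_cases[OF G]) (auto simp: L0_class_mult L0_class_norm abs_mult)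
qed auto

text \<open>If no \<delta> worked for some \<epsilon>, there would be classes of length below
  1/(n+1) whose products with \<open>G\<close> stay away from 0, contrary to
  \<open>L0_len_mult_tendsto\<close>. This form yields one modulus of continuity for all pairs of
  points.\<close>

lemma L0_len_mult_eps:
  assumes G: "G \<in> L0_pos m" and e: "\<epsilon> > 0"
  shows "\<exists>\<delta>>0. \<forall>F\<in>L0_pos m. L0_len m F < \<delta> \<longrightarrow> L0_len m (G \<otimes>\<^sub>0 F) < \<epsilon>"
proof (rule ccontr)
  assume "\<not> ?thesis"
  then have "\<forall>n. \<exists>F\<in>L0_pos m. L0_len m F < inverse (real (Suc n)) \<and> \<not> L0_len m (G \<otimes>\<^sub>0 F) < \<epsilon>"
    by (metis inverse_positive_iff_positive of_nat_0_less_iff zero_less_Suc)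
  then obtain F where F: "\<And>n. F n \<in> L0_pos m" "\<And>n. L0_len m (F n) < inverse (real (Suc n))"
    "\<And>n. \<not> L0_len m (G \<otimes>\<^sub>0 F n) < \<epsilon>" by metis
  have "(\<lambda>n. L0_len m (F n)) \<longlonglongrightarrow> 0"
    by (rule tendsto_zero_inverse) (rule L0_len_nonneg, rule F(1), rule less_imp_le, rule F(2))
  from L0_len_mult_tendsto[OF F(1) this G] have "eventually (\<lambda>n. L0_len m (G \<otimes>\<^sub>0 F n) < \<epsilon>) sequentially"
    using e by (rule order_tendstoD)
  then show False using F(3) by (simp add: eventually_sequentially)
qed

lemma L0_lim_dist:
  "L0_lim m F G \<longleftrightarrow> range F \<subseteq> \<L> \<and> G \<in> \<L> \<and> (\<lambda>n. L0_len m \<parallel>F n \<ominus>\<^sub>0 G\<parallel>\<^sub>0) \<longlonglongrightarrow> 0"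
proof (cases "range F \<subseteq> \<L> \<and> G \<in> \<L>")
  case True
  then have "F n \<in> \<L>" for n by auto
  then have "rnm_dist m (L0 m) (F n) G = L0_len m \<parallel>F n \<ominus>\<^sub>0 G\<parallel>\<^sub>0" for n
    using True by (simp add: rnm_dist_def L0_len_def L0_rep_def)
  then show ?thesis by (simp add: L0_lim_def)
qed (auto simp: L0_lim_def)

text \<open>The positive part of \<open>a\<close> minus \<open>b\<close> does not depend on
  \<open>n\<close> and is dominated by the sum of the two approximation errors, so its length is
  0.\<close>

lemma L0_lim_le:
  assumes F: "L0_lim m F a" and G: "L0_lim m G b" and le: "\<And>n. L0_le m (F n) (G n)"
  shows "L0_le m a b"
proof -
  have c: "F n \<in> \<L>" "G n \<in> \<L>" "a \<in> \<L>" "b \<in> \<L>" for n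
    using F G by (auto simp: L0_lim_def)
  define H where "H = L0_class m (\<lambda>x. max (L0_rep a x - L0_rep b x) 0)"
  have H: "H \<in> L0_pos m" unfolding H_def using c by (intro L0_class_pos) auto
  let ?D = "\<lambda>n. \<parallel>F n \<ominus>\<^sub>0 a\<parallel>\<^sub>0 \<oplus>\<^sub>0 \<parallel>G n \<ominus>\<^sub>0 b\<parallel>\<^sub>0"
  have "L0_len m H \<le> L0_len m \<parallel>F n \<ominus>\<^sub>0 a\<parallel>\<^sub>0 + L0_len m \<parallel>G n \<ominus>\<^sub>0 b\<parallel>\<^sub>0" for n
  proof -
    have "L0_le m H (?D n)"
    proof (subst L0_le_iff)
      have h: "AE x in m. L0_rep H x = max (L0_rep a x - L0_rep b x) 0"
        unfolding H_def by (rule AE_rep_class) (use c in auto)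
      show "AE x in m. L0_rep H x \<le> L0_rep (?D n) x"
        using h AE_rep_add[of "\<parallel>F n \<ominus>\<^sub>0 a\<parallel>\<^sub>0" "\<parallel>G n \<ominus>\<^sub>0 b\<parallel>\<^sub>0", OF L0_norm_closed[OF L0.minus_closed[OF c(1,3)]] L0_norm_closed[OF L0.minus_closed[OF c(2,4)]]]
          AE_rep_norm[OF L0.minus_closed[OF c(1,3)], of n] AE_rep_norm[OF L0.minus_closed[OF c(2,4)], of n]
          AE_rep_diff[OF c(1,3), of n] AE_rep_diff[OF c(2,4), of n] le[of n, unfolded L0_le_iff[OF c(1,2)]]
        by eventually_elim auto
    qed (use c H in auto)
    from L0_len_mono[OF H _ this] L0_len_add[of "\<parallel>F n \<ominus>\<^sub>0 a\<parallel>\<^sub>0" "\<parallel>G n \<ominus>\<^sub>0 b\<parallel>\<^sub>0"]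
    show ?thesis using c by auto
  qed
  moreover have "(\<lambda>n. L0_len m \<parallel>F n \<ominus>\<^sub>0 a\<parallel>\<^sub>0 + L0_len m \<parallel>G n \<ominus>\<^sub>0 b\<parallel>\<^sub>0) \<longlonglongrightarrow> 0 + 0"
    using F G by (intro tendsto_add) (auto simp: L0_lim_dist)
  ultimately have "L0_len m H \<le> 0" by (intro LIMSEQ_le_const) auto
  with L0_len_nonneg[OF H] have "H = \<zero>\<^sub>0" by (intro L0_len_eq_zeroD H) auto
  then have "AE x in m. max (L0_rep a x - L0_rep b x) 0 = 0"
    using c by (simp add: H_def L0_zero L0_class_eq_iff)
  then show ?thesis using c by (subst L0_le_iff) (auto elim!: eventually_mono)
qed

lemma L0_pos_le: "F \<in> L0_pos m \<Longrightarrow> L0_le m \<zero>\<^sub>0 F"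
  by (simp add: L0_pos_def del: L0_pos_closed)

lemma L0_lim_unique: "L0_lim m F a \<Longrightarrow> L0_lim m F b \<Longrightarrow> a = b"
  by (rule L0_le_antisym; (rule L0_lim_le[of F _ F])?) (auto simp: L0_lim_def image_subset_iff)

lemma L0_lim_const: "a \<in> \<L> \<Longrightarrow> L0_lim m (\<lambda>_. a) a"
  by (rule L0_lim_AE) auto

text \<open>Each of \<open>F n\<close> and \<open>a\<close> is at most the other plus the absolute
  value of their difference, so the length is 1-Lipschitz on the positive cone.\<close>

lemma L0_len_lim:
  assumes F: "L0_lim m F a" and p: "\<And>n. F n \<in> L0_pos m"
  shows "a \<in> L0_pos m" "(\<lambda>n. L0_len m (F n)) \<longlonglongrightarrow> L0_len m a"
proof -
  interpret L: seminormed_L0_module m "L0 m" by (rule L0_seminormed)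
  have c: "F n \<in> \<L>" "a \<in> \<L>" for n using F by (auto simp: L0_lim_def)
  have "L0_le m \<zero>\<^sub>0 a"
    by (rule L0_lim_le[OF L0_lim_const F]) (use p in \<open>auto simp: L0_pos_le\<close>)
  then show a: "a \<in> L0_pos m" using c by (simp add: L0_pos_def del: L0_pos_closed)
  let ?D = "\<lambda>n. \<parallel>F n \<ominus>\<^sub>0 a\<parallel>\<^sub>0"
  have D: "?D n \<in> L0_pos m" for n using c by auto
  have AED: "AE x in m. L0_rep (?D n) x = \<bar>L0_rep (F n) x - L0_rep a x\<bar>" for n
    using AE_rep_norm[OF L0.minus_closed[OF c(1,2)], of n] AE_rep_diff[OF c(1,2), of n] by eventually_elim auto
  have "L0_le m (F n) (a \<oplus>\<^sub>0 ?D n)" "L0_le m a (F n \<oplus>\<^sub>0 ?D n)" for n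
  proof -
    have "AE x in m. L0_rep (F n) x \<le> L0_rep (a \<oplus>\<^sub>0 ?D n) x"
      using AED[of n] AE_rep_add[OF c(2) L0_pos_closed[OF D], of n] by eventually_elim auto
    moreover have "AE x in m. L0_rep a x \<le> L0_rep (F n \<oplus>\<^sub>0 ?D n) x"
      using AED[of n] AE_rep_add[OF c(1) L0_pos_closed[OF D], of n n] by eventually_elim auto
    ultimately show "L0_le m (F n) (a \<oplus>\<^sub>0 ?D n)" "L0_le m a (F n \<oplus>\<^sub>0 ?D n)"
      using c D by (auto simp: L0_le_iff)
  qed
  then have "L0_len m (F n) \<le> L0_len m a + L0_len m (?D n)" "L0_len m a \<le> L0_len m (F n) + L0_len m (?D n)" for n
    using a p[of n] D[of n] L0_len_add[OF a D, of n] L0_len_add[OF p[of n] D[of n]]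
      L0_len_mono[of "F n" "a \<oplus>\<^sub>0 ?D n"] L0_len_mono[of a "F n \<oplus>\<^sub>0 ?D n"] by (auto intro: order.trans)
  then have "norm (L0_len m (F n) - L0_len m a) \<le> L0_len m (?D n)" for n
    by (auto simp: abs_le_iff algebra_simps)
  moreover have "(\<lambda>n. L0_len m (?D n)) \<longlonglongrightarrow> 0" using F by (simp add: L0_lim_dist)
  ultimately have "(\<lambda>n. norm (L0_len m (F n) - L0_len m a)) \<longlonglongrightarrow> 0"
    by (rule tendsto_zero_le[rotated 2]) simp
  then have "(\<lambda>n. L0_len m (F n) - L0_len m a) \<longlonglongrightarrow> 0" by (rule tendsto_norm_zero_cancel)
  then show "(\<lambda>n. L0_len m (F n)) \<longlonglongrightarrow> L0_len m a" by (simp add: LIM_zero_cancel)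
qed

end

section \<open>Metric calculus in a seminormed module\<close>

context seminormed_L0_module
begin

abbreviation "dst \<equiv> rnm_dist m M"
abbreviation "Cauchy_seqs \<equiv> rnm_Cauchy m M"
abbreviation "Cpl \<equiv> rnm_completion m M"
abbreviation "cls \<equiv> completion_class m M"
abbreviation "emb \<equiv> completion_emb m M"

lemma norm_zero [simp]: "\<parallel>\<zero>\<parallel> = \<zero>\<^sub>0"
proof -
  have "\<parallel>\<zero>\<parallel> = \<parallel>\<zero>\<^sub>0 \<odot> \<zero>\<parallel>" by simp
  also have "\<dots> = \<zero>\<^sub>0"
    by (subst norm_smult) (auto simp: L0_norm_eq_self)
  finally show ?thesis .
qed

lemma norm_closed [simp, intro]: "v \<in> carrier M \<Longrightarrow> \<parallel>v\<parallel> \<in> \<L>"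
  by auto

text \<open>Lets a map that is known to be additive and homogeneous be applied to
  differences.\<close>

lemma smult_minus_one: "v \<in> carrier M \<Longrightarrow> (\<ominus>\<^bsub>L0 m\<^esub> \<one>\<^sub>0) \<odot> v = \<ominus> v"
  by (simp add: smult_l_minus)

lemma minus_zero [simp]: "\<ominus> \<zero> = \<zero>"
  by (rule M.minus_equality) auto

lemma diff_zero [simp]: "v \<in> carrier M \<Longrightarrow> v \<ominus> \<zero> = v"
  by (simp add: a_minus_def)

lemma norm_minus [simp]:
  assumes "v \<in> carrier M"
  shows "\<parallel>\<ominus> v\<parallel> = \<parallel>v\<parallel>"
proof -
  have "\<parallel>\<ominus> v\<parallel> = \<parallel>\<ominus>\<^bsub>L0 m\<^esub> \<one>\<^sub>0\<parallel>\<^sub>0 \<otimes>\<^sub>0 \<parallel>v\<parallel>"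
    using assms by (simp add: smult_minus_one[symmetric] norm_smult)
  also have "\<parallel>\<ominus>\<^bsub>L0 m\<^esub> \<one>\<^sub>0\<parallel>\<^sub>0 = \<one>\<^sub>0"
    by (simp add: L0_one L0_class_minus L0_class_norm)
  finally show ?thesis using assms by simp
qed

lemma norm_diff_commute:
  assumes "v \<in> carrier M" "w \<in> carrier M"
  shows "\<parallel>v \<ominus> w\<parallel> = \<parallel>w \<ominus> v\<parallel>"
proof -
  have "v \<ominus> w = \<ominus> (w \<ominus> v)" using assms by (simp add: a_minus_def M.minus_add M.a_comm)
  then show ?thesis using assms by simp
qed

lemma diff_add_diff:
  assumes "u \<in> carrier M" "v \<in> carrier M" "w \<in> carrier M"
  shows "(u \<ominus> v) \<oplus> (v \<ominus> w) = u \<ominus> w"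
proof -
  have "(u \<ominus> v) \<oplus> (v \<ominus> w) = u \<oplus> ((\<ominus> v \<oplus> v) \<oplus> \<ominus> w)"
    using assms by (simp add: a_minus_def M.a_assoc)
  then show ?thesis using assms by (simp add: M.l_neg a_minus_def)
qed

lemma diff_eq_zeroD:
  assumes "v \<in> carrier M" "w \<in> carrier M" "v \<ominus> w = \<zero>"
  shows "v = w"
  using diff_add_diff[of v w \<zero>] assms by simp

lemma add_diff_add:
  assumes "u \<in> carrier M" "v \<in> carrier M" "u' \<in> carrier M" "v' \<in> carrier M"
  shows "(u \<oplus> v) \<ominus> (u' \<oplus> v') = (u \<ominus> u') \<oplus> (v \<ominus> v')"
  using assms by (simp add: a_minus_def M.minus_add M.a_ac)

lemma smult_diff:
  assumes "f \<in> \<L>" "v \<in> carrier M" "w \<in> carrier M"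
  shows "f \<odot> v \<ominus> f \<odot> w = f \<odot> (v \<ominus> w)"
  using assms by (simp add: a_minus_def smult_r_distr smult_r_minus)

lemma norm_diff_triangle:
  assumes "u \<in> carrier M" "v \<in> carrier M" "w \<in> carrier M"
  shows "L0_le m \<parallel>u \<ominus> w\<parallel> (\<parallel>u \<ominus> v\<parallel> \<oplus>\<^sub>0 \<parallel>v \<ominus> w\<parallel>)"
  using norm_triangle[of "u \<ominus> v" "v \<ominus> w"] assms by (simp add: diff_add_diff)

text \<open>Makes the norm a 1-Lipschitz map into \<open>L0\<close>, so that norms along a Cauchy
  sequence form a Cauchy sequence again.\<close>

lemma norm_reverse_triangle:
  assumes "v \<in> carrier M" "w \<in> carrier M"
  shows "L0_le m \<parallel>\<parallel>v\<parallel> \<ominus>\<^sub>0 \<parallel>w\<parallel>\<parallel>\<^sub>0 \<parallel>v \<ominus> w\<parallel>"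
proof -
  have "L0_le m \<parallel>v\<parallel> (\<parallel>v \<ominus> w\<parallel> \<oplus>\<^sub>0 \<parallel>w\<parallel>)" "L0_le m \<parallel>w\<parallel> (\<parallel>v \<ominus> w\<parallel> \<oplus>\<^sub>0 \<parallel>v\<parallel>)"
    using norm_diff_triangle[of v w \<zero>] norm_diff_triangle[of w v \<zero>] assms
    by (simp_all add: norm_diff_commute[of w v])
  then have "AE x in m. L0_rep \<parallel>v\<parallel> x \<le> L0_rep (\<parallel>v \<ominus> w\<parallel> \<oplus>\<^sub>0 \<parallel>w\<parallel>) x"
    "AE x in m. L0_rep \<parallel>w\<parallel> x \<le> L0_rep (\<parallel>v \<ominus> w\<parallel> \<oplus>\<^sub>0 \<parallel>v\<parallel>) x"
    using assms by (auto simp: L0_le_iff)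
  moreover have "AE x in m. L0_rep (\<parallel>v \<ominus> w\<parallel> \<oplus>\<^sub>0 \<parallel>w\<parallel>) x = L0_rep \<parallel>v \<ominus> w\<parallel> x + L0_rep \<parallel>w\<parallel> x"
    "AE x in m. L0_rep (\<parallel>v \<ominus> w\<parallel> \<oplus>\<^sub>0 \<parallel>v\<parallel>) x = L0_rep \<parallel>v \<ominus> w\<parallel> x + L0_rep \<parallel>v\<parallel> x"
    "AE x in m. L0_rep \<parallel>\<parallel>v\<parallel> \<ominus>\<^sub>0 \<parallel>w\<parallel>\<parallel>\<^sub>0 x = \<bar>L0_rep (\<parallel>v\<parallel> \<ominus>\<^sub>0 \<parallel>w\<parallel>) x\<bar>"
    "AE x in m. L0_rep (\<parallel>v\<parallel> \<ominus>\<^sub>0 \<parallel>w\<parallel>) x = L0_rep \<parallel>v\<parallel> x - L0_rep \<parallel>w\<parallel> x"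
    using assms by (auto intro!: AE_rep_add AE_rep_norm AE_rep_diff)
  ultimately have "AE x in m. L0_rep \<parallel>\<parallel>v\<parallel> \<ominus>\<^sub>0 \<parallel>w\<parallel>\<parallel>\<^sub>0 x \<le> L0_rep \<parallel>v \<ominus> w\<parallel> x"
    by eventually_elim auto
  then show ?thesis using assms by (subst L0_le_iff) auto
qed

lemma dst_eq: "v \<in> carrier M \<Longrightarrow> w \<in> carrier M \<Longrightarrow> dst v w = L0_len m \<parallel>v \<ominus> w\<parallel>"
  by (simp add: rnm_dist_def L0_len_def L0_rep_def)

lemma dst_nonneg: "0 \<le> dst v w"
  by (cases "v \<in> carrier M \<and> w \<in> carrier M") (auto simp: dst_eq L0_len_nonneg, auto simp: rnm_dist_def)

lemma dst_self [simp]: "v \<in> carrier M \<Longrightarrow> dst v v = 0"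
  by (simp add: dst_eq M.r_neg a_minus_def)

lemma dst_commute: "v \<in> carrier M \<Longrightarrow> w \<in> carrier M \<Longrightarrow> dst v w = dst w v"
  by (simp add: dst_eq norm_diff_commute[of v w])

lemma dst_triangle:
  assumes "u \<in> carrier M" "v \<in> carrier M" "w \<in> carrier M"
  shows "dst u w \<le> dst u v + dst v w"
proof -
  have "dst u w \<le> L0_len m (\<parallel>u \<ominus> v\<parallel> \<oplus>\<^sub>0 \<parallel>v \<ominus> w\<parallel>)"
    using assms by (auto simp: dst_eq intro!: L0_len_mono norm_diff_triangle)
  also have "\<dots> \<le> dst u v + dst v w" using assms by (auto simp: dst_eq intro!: L0_len_add)
  finally show ?thesis .
qed

lemma dst_add:
  assumes "u \<in> carrier M" "v \<in> carrier M" "u' \<in> carrier M" "v' \<in> carrier M"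
  shows "dst (u \<oplus> v) (u' \<oplus> v') \<le> dst u u' + dst v v'"
proof -
  have "dst (u \<oplus> v) (u' \<oplus> v') \<le> L0_len m (\<parallel>u \<ominus> u'\<parallel> \<oplus>\<^sub>0 \<parallel>v \<ominus> v'\<parallel>)"
    using assms by (auto simp: dst_eq add_diff_add intro!: L0_len_mono norm_triangle)
  also have "\<dots> \<le> dst u u' + dst v v'" using assms by (auto simp: dst_eq intro!: L0_len_add)
  finally show ?thesis .
qed

lemma dst_add_tendsto:
  assumes "\<And>n. \<sigma> n \<in> carrier M" "\<And>n. \<tau> n \<in> carrier M" "\<And>n. \<sigma>' n \<in> carrier M" "\<And>n. \<tau>' n \<in> carrier M"
    and "(\<lambda>n. dst (\<sigma> n) (\<sigma>' n)) \<longlonglongrightarrow> 0" "(\<lambda>n. dst (\<tau> n) (\<tau>' n)) \<longlonglongrightarrow> 0"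
  shows "(\<lambda>n. dst (\<sigma> n \<oplus> \<tau> n) (\<sigma>' n \<oplus> \<tau>' n)) \<longlonglongrightarrow> 0"
  by (rule tendsto_zero_le[OF tendsto_add[OF assms(5,6), simplified] dst_nonneg dst_add[OF assms(1-4)]])

lemma dst_trans_tendsto:
  assumes "\<And>n. \<sigma> n \<in> carrier M" "\<And>n. \<tau> n \<in> carrier M" "\<And>n. \<rho> n \<in> carrier M"
    and "(\<lambda>n. dst (\<sigma> n) (\<tau> n)) \<longlonglongrightarrow> 0" "(\<lambda>n. dst (\<tau> n) (\<rho> n)) \<longlonglongrightarrow> 0"
  shows "(\<lambda>n. dst (\<sigma> n) (\<rho> n)) \<longlonglongrightarrow> 0"
  by (rule tendsto_zero_le[OF tendsto_add[OF assms(4,5), simplified] dst_nonneg dst_triangle[OF assms(1-3)]])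

text \<open>A scalar is in general an unbounded class, so multiplication by it is uniformly
  continuous rather than Lipschitz.\<close>

lemma dst_smult_eps:
  assumes f: "f \<in> \<L>" and e: "\<epsilon> > 0"
  shows "\<exists>\<delta>>0. \<forall>v\<in>carrier M. \<forall>w\<in>carrier M. dst v w < \<delta> \<longrightarrow> dst (f \<odot> v) (f \<odot> w) < \<epsilon>"
proof -
  obtain \<delta> where d: "\<delta> > 0" "\<And>F. F \<in> L0_pos m \<Longrightarrow> L0_len m F < \<delta> \<Longrightarrow> L0_len m (\<parallel>f\<parallel>\<^sub>0 \<otimes>\<^sub>0 F) < \<epsilon>"
    using L0_len_mult_eps[OF L0_norm_pos[OF f] e] by blast
  show ?thesis
    using d f by (intro exI[of _ \<delta>]) (auto simp: dst_eq smult_diff norm_smult)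
qed

lemma dst_smult_tendsto:
  assumes "f \<in> \<L>" "\<And>n. \<sigma> n \<in> carrier M" "\<And>n. \<tau> n \<in> carrier M" "(\<lambda>n. dst (\<sigma> n) (\<tau> n)) \<longlonglongrightarrow> 0"
  shows "(\<lambda>n. dst (f \<odot> \<sigma> n) (f \<odot> \<tau> n)) \<longlonglongrightarrow> 0"
  using L0_len_mult_tendsto[of "\<lambda>n. \<parallel>\<sigma> n \<ominus> \<tau> n\<parallel>" "\<parallel>f\<parallel>\<^sub>0"] assms
  by (simp add: dst_eq smult_diff norm_smult)

lemma norm_lim:
  assumes "\<And>n. \<sigma> n \<in> carrier M" "v \<in> carrier M" "(\<lambda>n. dst (\<sigma> n) v) \<longlonglongrightarrow> 0"
  shows "L0_lim m (\<lambda>n. \<parallel>\<sigma> n\<parallel>) \<parallel>v\<parallel>"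
proof -
  have "(\<lambda>n. L0_len m \<parallel>\<parallel>\<sigma> n\<parallel> \<ominus>\<^sub>0 \<parallel>v\<parallel>\<parallel>\<^sub>0) \<longlonglongrightarrow> 0"
    by (rule tendsto_zero_le[OF assms(3)])
       (auto intro!: L0_len_nonneg L0_len_mono norm_reverse_triangle assms simp: dst_eq assms)
  then show ?thesis using assms by (auto simp: L0_lim_dist)
qed

end

context L0_base
begin

lemma L0_lim_mult:
  assumes "f \<in> \<L>" "L0_lim m F a"
  shows "L0_lim m (\<lambda>n. f \<otimes>\<^sub>0 F n) (f \<otimes>\<^sub>0 a)"
proof -
  interpret L: seminormed_L0_module m "L0 m" by (rule L0_seminormed)
  show ?thesis using L.dst_smult_tendsto[of f F "\<lambda>_. a"] assms by (auto simp: L0_lim_def image_subset_iff)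
qed

lemma L0_lim_add:
  assumes "L0_lim m F a" "L0_lim m G b"
  shows "L0_lim m (\<lambda>n. F n \<oplus>\<^sub>0 G n) (a \<oplus>\<^sub>0 b)"
proof -
  interpret L: seminormed_L0_module m "L0 m" by (rule L0_seminormed)
  show ?thesis using L.dst_add_tendsto[of F G "\<lambda>_. a" "\<lambda>_. b"] assms by (auto simp: L0_lim_def image_subset_iff)
qed

end

section \<open>Cauchy sequences and the completion\<close>

context seminormed_L0_module
begin

lemma Cauchy_seqsD: "\<sigma> \<in> Cauchy_seqs \<Longrightarrow> \<sigma> n \<in> carrier M"
  by (auto simp: rnm_Cauchy_def)

lemma Cauchy_seqsE:
  assumes "\<sigma> \<in> Cauchy_seqs" "\<epsilon> > 0"
  obtains N where "\<And>i j. i \<ge> N \<Longrightarrow> j \<ge> N \<Longrightarrow> dst (\<sigma> i) (\<sigma> j) < \<epsilon>"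
  using assms by (auto simp: rnm_Cauchy_def) metis

lemma Cauchy_seqsI:
  assumes "\<And>n. \<sigma> n \<in> carrier M" "\<And>\<epsilon>. \<epsilon> > 0 \<Longrightarrow> \<exists>N. \<forall>i\<ge>N. \<forall>j\<ge>N. dst (\<sigma> i) (\<sigma> j) < \<epsilon>"
  shows "\<sigma> \<in> Cauchy_seqs"
  using assms by (auto simp: rnm_Cauchy_def)

lemma Cauchy_seqs_const [simp, intro]: "v \<in> carrier M \<Longrightarrow> (\<lambda>_. v) \<in> Cauchy_seqs"
  by (rule Cauchy_seqsI) auto

lemma Cauchy_seqs_add [simp, intro]:
  assumes "\<sigma> \<in> Cauchy_seqs" "\<tau> \<in> Cauchy_seqs"
  shows "(\<lambda>n. \<sigma> n \<oplus> \<tau> n) \<in> Cauchy_seqs"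
proof (rule Cauchy_seqsI)
  fix \<epsilon> :: real assume e: "\<epsilon> > 0"
  obtain N where N: "\<And>i j. i \<ge> N \<Longrightarrow> j \<ge> N \<Longrightarrow> dst (\<sigma> i) (\<sigma> j) < \<epsilon>/2"
    using Cauchy_seqsE[OF assms(1), of "\<epsilon>/2"] e by auto
  obtain N' where N': "\<And>i j. i \<ge> N' \<Longrightarrow> j \<ge> N' \<Longrightarrow> dst (\<tau> i) (\<tau> j) < \<epsilon>/2"
    using Cauchy_seqsE[OF assms(2), of "\<epsilon>/2"] e by auto
  have "dst (\<sigma> i \<oplus> \<tau> i) (\<sigma> j \<oplus> \<tau> j) < \<epsilon>" if "i \<ge> max N N'" "j \<ge> max N N'" for i j
    using dst_add[of "\<sigma> i" "\<tau> i" "\<sigma> j" "\<tau> j"] N[of i j] N'[of i j] that Cauchy_seqsD[OF assms(1)] Cauchy_seqsD[OF assms(2)]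
    by fastforce
  then show "\<exists>N. \<forall>i\<ge>N. \<forall>j\<ge>N. dst (\<sigma> i \<oplus> \<tau> i) (\<sigma> j \<oplus> \<tau> j) < \<epsilon>" by blast
qed (use assms Cauchy_seqsD in auto)

lemma Cauchy_seqs_smult [simp, intro]:
  assumes "f \<in> \<L>" "\<sigma> \<in> Cauchy_seqs"
  shows "(\<lambda>n. f \<odot> \<sigma> n) \<in> Cauchy_seqs"
proof (rule Cauchy_seqsI)
  fix \<epsilon> :: real assume e: "\<epsilon> > 0"
  obtain \<delta> where d: "\<delta> > 0" "\<And>v w. v\<in>carrier M \<Longrightarrow> w\<in>carrier M \<Longrightarrow> dst v w < \<delta> \<Longrightarrow> dst (f \<odot> v) (f \<odot> w) < \<epsilon>"
    using dst_smult_eps[OF assms(1) e] by blast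
  obtain N where N: "\<And>i j. i \<ge> N \<Longrightarrow> j \<ge> N \<Longrightarrow> dst (\<sigma> i) (\<sigma> j) < \<delta>"
    using Cauchy_seqsE[OF assms(2) d(1)] by auto
  show "\<exists>N. \<forall>i\<ge>N. \<forall>j\<ge>N. dst (f \<odot> \<sigma> i) (f \<odot> \<sigma> j) < \<epsilon>"
    using d(2) N Cauchy_seqsD[OF assms(2)] by (intro exI[of _ N]) auto
qed (use assms Cauchy_seqsD in auto)

lemma Cauchy_seqs_minus [simp, intro]:
  assumes "\<sigma> \<in> Cauchy_seqs"
  shows "(\<lambda>n. \<ominus> \<sigma> n) \<in> Cauchy_seqs"
  using Cauchy_seqs_smult[of "\<ominus>\<^bsub>L0 m\<^esub> \<one>\<^sub>0" \<sigma>] assms Cauchy_seqsD[OF assms] by (simp add: smult_minus_one)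

lemma equiv_completion_rel: "equiv Cauchy_seqs (completion_rel m M)"
proof (rule equivI)
  show "sym (completion_rel m M)"
    using dst_commute Cauchy_seqsD by (auto simp: sym_def completion_rel_def)
  show "trans (completion_rel m M)"
    using Cauchy_seqsD by (auto simp: trans_def completion_rel_def intro: dst_trans_tendsto)
qed (use Cauchy_seqsD in \<open>auto simp: completion_rel_def refl_on_def\<close>)

lemma mem_cls: "\<sigma> \<in> Cauchy_seqs \<Longrightarrow> \<tau> \<in> cls \<sigma> \<longleftrightarrow> \<tau> \<in> Cauchy_seqs \<and> (\<lambda>n. dst (\<sigma> n) (\<tau> n)) \<longlonglongrightarrow> 0"
  by (auto simp: completion_class_def completion_rel_def)

lemma cls_eq_iff:
  "\<sigma> \<in> Cauchy_seqs \<Longrightarrow> \<tau> \<in> Cauchy_seqs \<Longrightarrow> cls \<sigma> = cls \<tau> \<longleftrightarrow> (\<lambda>n. dst (\<sigma> n) (\<tau> n)) \<longlonglongrightarrow> 0"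
  using eq_equiv_class_iff[OF equiv_completion_rel] by (simp add: completion_class_def completion_rel_def)

lemma cls_self: "\<sigma> \<in> Cauchy_seqs \<Longrightarrow> \<sigma> \<in> cls \<sigma>"
  using mem_cls[of \<sigma> \<sigma>] Cauchy_seqsD by auto

lemma cls_closed [simp, intro]: "\<sigma> \<in> Cauchy_seqs \<Longrightarrow> cls \<sigma> \<in> carrier Cpl"
  by (simp add: rnm_completion_def completion_class_def quotientI)

lemma Cpl_cases:
  assumes "X \<in> carrier Cpl"
  obtains \<sigma> where "\<sigma> \<in> Cauchy_seqs" "X = cls \<sigma>"
  using assms by (auto simp: rnm_completion_def quotient_def completion_class_def)

lemma cls_add:
  assumes s: "\<sigma> \<in> Cauchy_seqs" and t: "\<tau> \<in> Cauchy_seqs"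
  shows "cls \<sigma> \<oplus>\<^bsub>Cpl\<^esub> cls \<tau> = cls (\<lambda>n. \<sigma> n \<oplus> \<tau> n)"
proof -
  have "(\<Union>\<sigma>'\<in>cls \<sigma>. \<Union>\<tau>'\<in>cls \<tau>. cls (\<lambda>n. \<sigma>' n \<oplus> \<tau>' n)) = cls (\<lambda>n. \<sigma> n \<oplus> \<tau> n)"
  proof (intro UN_eq_const)
    fix \<sigma>' \<tau>' assume "\<sigma>' \<in> cls \<sigma>" "\<tau>' \<in> cls \<tau>"
    then have *: "\<sigma>' \<in> Cauchy_seqs" "\<tau>' \<in> Cauchy_seqs" "(\<lambda>n. dst (\<sigma> n) (\<sigma>' n)) \<longlonglongrightarrow> 0" "(\<lambda>n. dst (\<tau> n) (\<tau>' n)) \<longlonglongrightarrow> 0"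
      using s t by (auto simp: mem_cls)
    have "cls (\<lambda>n. \<sigma> n \<oplus> \<tau> n) = cls (\<lambda>n. \<sigma>' n \<oplus> \<tau>' n)"
      by (subst cls_eq_iff) (use * s t Cauchy_seqsD in \<open>auto intro!: dst_add_tendsto\<close>)
    then show "cls (\<lambda>n. \<sigma>' n \<oplus> \<tau>' n) = cls (\<lambda>n. \<sigma> n \<oplus> \<tau> n)" by simp
  qed (use cls_self s t in auto)
  then show ?thesis by (simp add: rnm_completion_def)
qed

lemma cls_smult:
  assumes f: "f \<in> \<L>" and s: "\<sigma> \<in> Cauchy_seqs"
  shows "f \<odot>\<^bsub>Cpl\<^esub> cls \<sigma> = cls (\<lambda>n. f \<odot> \<sigma> n)"
proof -
  have "(\<Union>\<sigma>'\<in>cls \<sigma>. cls (\<lambda>n. f \<odot> \<sigma>' n)) = cls (\<lambda>n. f \<odot> \<sigma> n)"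
  proof (intro UN_eq_const)
    fix \<sigma>' assume "\<sigma>' \<in> cls \<sigma>"
    then have *: "\<sigma>' \<in> Cauchy_seqs" "(\<lambda>n. dst (\<sigma> n) (\<sigma>' n)) \<longlonglongrightarrow> 0"
      using s by (auto simp: mem_cls)
    have "cls (\<lambda>n. f \<odot> \<sigma> n) = cls (\<lambda>n. f \<odot> \<sigma>' n)"
      by (subst cls_eq_iff) (use * s f Cauchy_seqsD in \<open>auto intro!: dst_smult_tendsto\<close>)
    then show "cls (\<lambda>n. f \<odot> \<sigma>' n) = cls (\<lambda>n. f \<odot> \<sigma> n)" by simp
  qed (use cls_self s in auto)
  then show ?thesis by (simp add: rnm_completion_def)
qed

lemma Cpl_zero: "\<zero>\<^bsub>Cpl\<^esub> = cls (\<lambda>_. \<zero>)"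
  by (simp add: rnm_completion_def)

lemma norm_Cauchy:
  assumes s: "\<sigma> \<in> Cauchy_seqs"
  shows "\<exists>c. L0_lim m (\<lambda>n. \<parallel>\<sigma> n\<parallel>) c"
proof (rule L0_complete)
  fix \<epsilon> :: real assume "\<epsilon> > 0"
  then obtain N where N: "\<And>i j. i \<ge> N \<Longrightarrow> j \<ge> N \<Longrightarrow> dst (\<sigma> i) (\<sigma> j) < \<epsilon>"
    using Cauchy_seqsE[OF s] by blast
  interpret L: seminormed_L0_module m "L0 m" by (rule L0_seminormed)
  have "rnm_dist m (L0 m) \<parallel>\<sigma> i\<parallel> \<parallel>\<sigma> j\<parallel> \<le> dst (\<sigma> i) (\<sigma> j)" for i j
    using Cauchy_seqsD[OF s]
    by (auto simp: L.dst_eq dst_eq intro!: L0_len_mono norm_reverse_triangle)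
  then show "\<exists>N. \<forall>i\<ge>N. \<forall>j\<ge>N. rnm_dist m (L0 m) \<parallel>\<sigma> i\<parallel> \<parallel>\<sigma> j\<parallel> < \<epsilon>"
    using N by (meson le_less_trans)
qed (use Cauchy_seqsD[OF s] in auto)

lemma norm_lim_cong:
  assumes s: "\<And>n. \<sigma> n \<in> carrier M" and t: "\<And>n. \<tau> n \<in> carrier M" and d: "(\<lambda>n. dst (\<sigma> n) (\<tau> n)) \<longlonglongrightarrow> 0"
    and c: "L0_lim m (\<lambda>n. \<parallel>\<sigma> n\<parallel>) c"
  shows "L0_lim m (\<lambda>n. \<parallel>\<tau> n\<parallel>) c"
proof -
  interpret L: seminormed_L0_module m "L0 m" by (rule L0_seminormed)
  have "(\<lambda>n. rnm_dist m (L0 m) \<parallel>\<tau> n\<parallel> \<parallel>\<sigma> n\<parallel>) \<longlonglongrightarrow> 0"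
    by (rule tendsto_zero_le[OF d L.dst_nonneg])
       (auto intro!: L0_len_mono norm_reverse_triangle simp: dst_commute[OF s t] dst_eq L.dst_eq s t)
  moreover have "(\<lambda>n. rnm_dist m (L0 m) \<parallel>\<sigma> n\<parallel> c) \<longlonglongrightarrow> 0" using c by (simp add: L0_lim_def)
  ultimately have "(\<lambda>n. rnm_dist m (L0 m) \<parallel>\<tau> n\<parallel> c) \<longlonglongrightarrow> 0"
    by (rule L.dst_trans_tendsto[rotated 3]) (use s t c in \<open>auto simp: L0_lim_def\<close>)
  then show ?thesis using t c by (auto simp: L0_lim_def)
qed

text \<open>Equivalent Cauchy sequences have the same limit of norms and limits in \<open>L0\<close>
  are unique, so the definite description in the completion has exactly one candidate.\<close>

lemma cls_norm:
  assumes s: "\<sigma> \<in> Cauchy_seqs"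
  shows "L0_lim m (\<lambda>n. \<parallel>\<sigma> n\<parallel>) \<parallel>cls \<sigma>\<parallel>\<^bsub>Cpl\<^esub>"
proof -
  obtain c where c: "L0_lim m (\<lambda>n. \<parallel>\<sigma> n\<parallel>) c" using norm_Cauchy[OF s] by blast
  have "(THE c. \<exists>\<tau>\<in>cls \<sigma>. L0_lim m (\<lambda>n. \<parallel>\<tau> n\<parallel>) c) = c"
  proof (rule the_equality)
    show "\<exists>\<tau>\<in>cls \<sigma>. L0_lim m (\<lambda>n. \<parallel>\<tau> n\<parallel>) c" using c cls_self[OF s] by blast
    fix c' assume "\<exists>\<tau>\<in>cls \<sigma>. L0_lim m (\<lambda>n. \<parallel>\<tau> n\<parallel>) c'"
    then obtain \<tau> where t: "\<tau> \<in> cls \<sigma>" "L0_lim m (\<lambda>n. \<parallel>\<tau> n\<parallel>) c'" by blast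
    then have "L0_lim m (\<lambda>n. \<parallel>\<tau> n\<parallel>) c"
      using s Cauchy_seqsD c by (intro norm_lim_cong[of \<sigma> \<tau>]) (auto simp: mem_cls)
    then show "c' = c" using t L0_lim_unique by blast
  qed
  then show ?thesis using c by (simp add: rnm_completion_def)
qed

lemma cls_norm_eqI: "\<sigma> \<in> Cauchy_seqs \<Longrightarrow> L0_lim m (\<lambda>n. \<parallel>\<sigma> n\<parallel>) c \<Longrightarrow> \<parallel>cls \<sigma>\<parallel>\<^bsub>Cpl\<^esub> = c"
  using cls_norm L0_lim_unique by blast

lemma Cpl_module: "module (L0 m) Cpl"
proof (intro moduleI L0_cring abelian_groupI)
  fix X Y Z assume "X \<in> carrier Cpl" "Y \<in> carrier Cpl" "Z \<in> carrier Cpl"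
  then obtain \<sigma> \<tau> \<rho> where *: "\<sigma> \<in> Cauchy_seqs" "\<tau> \<in> Cauchy_seqs" "\<rho> \<in> Cauchy_seqs" "X = cls \<sigma>" "Y = cls \<tau>" "Z = cls \<rho>"
    by (metis Cpl_cases)
  then show "X \<oplus>\<^bsub>Cpl\<^esub> Y \<oplus>\<^bsub>Cpl\<^esub> Z = X \<oplus>\<^bsub>Cpl\<^esub> (Y \<oplus>\<^bsub>Cpl\<^esub> Z)"
    by (simp add: cls_add M.a_assoc Cauchy_seqsD)
next
  fix X Y assume "X \<in> carrier Cpl" "Y \<in> carrier Cpl"
  then obtain \<sigma> \<tau> where *: "\<sigma> \<in> Cauchy_seqs" "\<tau> \<in> Cauchy_seqs" "X = cls \<sigma>" "Y = cls \<tau>"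
    by (metis Cpl_cases)
  then show "X \<oplus>\<^bsub>Cpl\<^esub> Y \<in> carrier Cpl" "X \<oplus>\<^bsub>Cpl\<^esub> Y = Y \<oplus>\<^bsub>Cpl\<^esub> X"
    by (auto simp add: cls_add M.a_comm Cauchy_seqsD)
  fix f assume f: "f \<in> \<L>"
  show "f \<odot>\<^bsub>Cpl\<^esub> (X \<oplus>\<^bsub>Cpl\<^esub> Y) = f \<odot>\<^bsub>Cpl\<^esub> X \<oplus>\<^bsub>Cpl\<^esub> f \<odot>\<^bsub>Cpl\<^esub> Y"
    using * f by (simp add: cls_add cls_smult Cauchy_seqsD smult_r_distr)
next
  fix X assume "X \<in> carrier Cpl"
  then obtain \<sigma> where *: "\<sigma> \<in> Cauchy_seqs" "X = cls \<sigma>"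
    by (metis Cpl_cases)
  then show "\<zero>\<^bsub>Cpl\<^esub> \<oplus>\<^bsub>Cpl\<^esub> X = X"
    by (simp add: cls_add Cauchy_seqsD Cpl_zero)
  show "\<exists>Y\<in>carrier Cpl. Y \<oplus>\<^bsub>Cpl\<^esub> X = \<zero>\<^bsub>Cpl\<^esub>"
    using * by (intro bexI[of _ "cls (\<lambda>n. \<ominus> \<sigma> n)"]) (auto simp: cls_add Cauchy_seqsD Cpl_zero M.l_neg)
  show "\<one>\<^sub>0 \<odot>\<^bsub>Cpl\<^esub> X = X" using * by (simp add: cls_smult Cauchy_seqsD)
  fix f g assume fg: "f \<in> \<L>" "g \<in> \<L>"
  show "(f \<oplus>\<^sub>0 g) \<odot>\<^bsub>Cpl\<^esub> X = f \<odot>\<^bsub>Cpl\<^esub> X \<oplus>\<^bsub>Cpl\<^esub> g \<odot>\<^bsub>Cpl\<^esub> X"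
    "(f \<otimes>\<^sub>0 g) \<odot>\<^bsub>Cpl\<^esub> X = f \<odot>\<^bsub>Cpl\<^esub> (g \<odot>\<^bsub>Cpl\<^esub> X)"
    using * fg by (simp_all add: cls_add cls_smult Cauchy_seqsD smult_l_distr smult_assoc1)
next
  fix f X assume "f \<in> \<L>" "X \<in> carrier Cpl"
  then show "f \<odot>\<^bsub>Cpl\<^esub> X \<in> carrier Cpl"
    by (auto elim!: Cpl_cases simp: cls_smult)
qed (auto simp: Cpl_zero)

text \<open>Each axiom relates limits of norms, and inequalities, sums and multiples pass to limits
  in \<open>L0\<close>.\<close>

lemma Cpl_seminormed: "seminormed_L0_module m Cpl"
proof (intro seminormed_L0_module.intro seminormed_L0_module_axioms.intro Cpl_module L0_base_axioms)
  fix X assume "X \<in> carrier Cpl"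
  then obtain \<sigma> where *: "\<sigma> \<in> Cauchy_seqs" "X = cls \<sigma>"
    by (metis Cpl_cases)
  show "\<parallel>X\<parallel>\<^bsub>Cpl\<^esub> \<in> L0_pos m"
    unfolding *(2) by (rule L0_len_lim(1)[OF cls_norm[OF *(1)]]) (use * Cauchy_seqsD in blast)
  fix f assume f: "f \<in> \<L>"
  have "L0_lim m (\<lambda>n. \<parallel>f\<parallel>\<^sub>0 \<otimes>\<^sub>0 \<parallel>\<sigma> n\<parallel>) (\<parallel>f\<parallel>\<^sub>0 \<otimes>\<^sub>0 \<parallel>cls \<sigma>\<parallel>\<^bsub>Cpl\<^esub>)"
    using cls_norm[OF *(1)] f by (intro L0_lim_mult) auto
  then show "\<parallel>f \<odot>\<^bsub>Cpl\<^esub> X\<parallel>\<^bsub>Cpl\<^esub> = \<parallel>f\<parallel>\<^sub>0 \<otimes>\<^sub>0 \<parallel>X\<parallel>\<^bsub>Cpl\<^esub>"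
    using f * by (simp add: cls_smult) (intro cls_norm_eqI; simp add: norm_smult Cauchy_seqsD)
next
  fix X Y assume "X \<in> carrier Cpl" "Y \<in> carrier Cpl"
  then obtain \<sigma> \<tau> where *: "\<sigma> \<in> Cauchy_seqs" "\<tau> \<in> Cauchy_seqs" "X = cls \<sigma>" "Y = cls \<tau>"
    by (metis Cpl_cases)
  show "L0_le m \<parallel>X \<oplus>\<^bsub>Cpl\<^esub> Y\<parallel>\<^bsub>Cpl\<^esub> (\<parallel>X\<parallel>\<^bsub>Cpl\<^esub> \<oplus>\<^sub>0 \<parallel>Y\<parallel>\<^bsub>Cpl\<^esub>)"
    unfolding *(3,4) cls_add[OF *(1,2)]
    by (rule L0_lim_le[OF cls_norm L0_lim_add[OF cls_norm cls_norm]])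
       (use * in \<open>auto intro!: norm_triangle Cauchy_seqsD\<close>)
qed

sublocale Cpl: Module.module "L0 m" Cpl by (rule Cpl_module)

lemma cls_minus: "\<sigma> \<in> Cauchy_seqs \<Longrightarrow> \<ominus>\<^bsub>Cpl\<^esub> cls \<sigma> = cls (\<lambda>n. \<ominus> \<sigma> n)"
  by (rule Cpl.minus_equality) (auto simp: cls_add Cpl_zero Cauchy_seqsD M.l_neg)

lemma cls_diff: "\<sigma> \<in> Cauchy_seqs \<Longrightarrow> \<tau> \<in> Cauchy_seqs \<Longrightarrow> cls \<sigma> \<ominus>\<^bsub>Cpl\<^esub> cls \<tau> = cls (\<lambda>n. \<sigma> n \<ominus> \<tau> n)"
  by (simp add: a_minus_def cls_minus cls_add)

text \<open>The norm of a class is the limit of the norms of its terms, and the length is continuous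
  along this limit.\<close>

lemma cls_dist:
  assumes s: "\<sigma> \<in> Cauchy_seqs" and t: "\<tau> \<in> Cauchy_seqs"
  shows "(\<lambda>n. dst (\<sigma> n) (\<tau> n)) \<longlonglongrightarrow> rnm_dist m Cpl (cls \<sigma>) (cls \<tau>)"
proof -
  interpret C: seminormed_L0_module m Cpl by (rule Cpl_seminormed)
  have d: "(\<lambda>n. \<sigma> n \<ominus> \<tau> n) \<in> Cauchy_seqs" using s t by (simp add: a_minus_def)
  have "(\<lambda>n. L0_len m \<parallel>\<sigma> n \<ominus> \<tau> n\<parallel>) \<longlonglongrightarrow> L0_len m \<parallel>cls (\<lambda>n. \<sigma> n \<ominus> \<tau> n)\<parallel>\<^bsub>Cpl\<^esub>"
    by (rule L0_len_lim(2)[OF cls_norm[OF d]]) (use d Cauchy_seqsD in blast)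
  then show ?thesis using s t by (simp add: dst_eq C.dst_eq Cauchy_seqsD cls_diff)
qed

lemma emb_closed [simp, intro]: "v \<in> carrier M \<Longrightarrow> emb v \<in> carrier Cpl"
  by (simp add: completion_emb_def)

lemma emb_add: "v \<in> carrier M \<Longrightarrow> w \<in> carrier M \<Longrightarrow>
    emb (v \<oplus> w) = emb v \<oplus>\<^bsub>Cpl\<^esub> emb w"
  by (simp add: completion_emb_def cls_add)

lemma emb_smult: "f \<in> \<L> \<Longrightarrow> v \<in> carrier M \<Longrightarrow>
    emb (f \<odot> v) = f \<odot>\<^bsub>Cpl\<^esub> emb v"
  by (simp add: completion_emb_def cls_smult)

lemma emb_norm: "v \<in> carrier M \<Longrightarrow> \<parallel>emb v\<parallel>\<^bsub>Cpl\<^esub> = \<parallel>v\<parallel>"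
  unfolding completion_emb_def by (rule cls_norm_eqI) (auto intro: L0_lim_const)

lemma emb_zero: "emb \<zero> = \<zero>\<^bsub>Cpl\<^esub>"
  by (simp add: completion_emb_def Cpl_zero)

lemma emb_dist:
  assumes "v \<in> carrier M" "w \<in> carrier M"
  shows "rnm_dist m Cpl (emb v) (emb w) = dst v w"
  using cls_dist[of "\<lambda>_. v" "\<lambda>_. w"] assms by (auto simp: completion_emb_def intro: LIMSEQ_unique)

text \<open>Fix \<open>n\<close> and let the second index of the Cauchy estimate tend to
  infinity.\<close>

lemma emb_lim:
  assumes s: "\<sigma> \<in> Cauchy_seqs"
  shows "(\<lambda>n. rnm_dist m Cpl (emb (\<sigma> n)) (cls \<sigma>)) \<longlonglongrightarrow> 0"
proof (rule LIMSEQ_I)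
  interpret C: seminormed_L0_module m Cpl by (rule Cpl_seminormed)
  fix e :: real assume e: "0 < e"
  then obtain N where N: "\<And>i j. i \<ge> N \<Longrightarrow> j \<ge> N \<Longrightarrow> dst (\<sigma> i) (\<sigma> j) < e/2"
    using Cauchy_seqsE[OF s, of "e/2"] by auto
  have "rnm_dist m Cpl (emb (\<sigma> n)) (cls \<sigma>) \<le> e/2" if "n \<ge> N" for n
  proof (rule LIMSEQ_le_const2)
    show "(\<lambda>k. dst (\<sigma> n) (\<sigma> k)) \<longlonglongrightarrow> rnm_dist m Cpl (emb (\<sigma> n)) (cls \<sigma>)"
      unfolding completion_emb_def using cls_dist[of "\<lambda>_. \<sigma> n" \<sigma>] s by (simp add: Cauchy_seqsD)
    show "\<exists>K. \<forall>k\<ge>K. dst (\<sigma> n) (\<sigma> k) \<le> e/2" using N[OF that] by (intro exI[of _ N]) (auto intro: less_imp_le)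
  qed
  then show "\<exists>no. \<forall>n\<ge>no. norm (rnm_dist m Cpl (emb (\<sigma> n)) (cls \<sigma>) - 0) < e"
    using e C.dst_nonneg by (intro exI[of _ N]) force
qed

lemma emb_dense:
  assumes "X \<in> carrier Cpl" "\<epsilon> > 0"
  shows "\<exists>v\<in>carrier M. rnm_dist m Cpl (emb v) X < \<epsilon>"
proof -
  obtain \<sigma> where *: "\<sigma> \<in> Cauchy_seqs" "X = cls \<sigma>" using assms by (metis Cpl_cases)
  have "eventually (\<lambda>n. rnm_dist m Cpl (emb (\<sigma> n)) X < \<epsilon>) sequentially"
    unfolding *(2) by (rule order_tendstoD(2)[OF emb_lim]) (use * assms in auto)
  then obtain n where "rnm_dist m Cpl (emb (\<sigma> n)) X < \<epsilon>"
    using eventually_happens'[OF sequentially_bot] by blast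
  then show ?thesis using * Cauchy_seqsD by blast
qed

end

text \<open>The two additional properties are what arguments with limits consume: definiteness makes
  limits unique, completeness in terms of Cauchy sequences makes them exist.\<close>

locale banach_L0_module = seminormed_L0_module +
  assumes norm_eq_zeroD: "v \<in> carrier M \<Longrightarrow> \<parallel>v\<parallel> = \<zero>\<^sub>0 \<Longrightarrow> v = \<zero>"
    and seq_complete: "\<sigma> \<in> rnm_Cauchy m M \<Longrightarrow> \<exists>v\<in>carrier M. (\<lambda>n. rnm_dist m M (\<sigma> n) v) \<longlonglongrightarrow> 0"
begin

lemma dst_eq_zeroD:
  assumes "v \<in> carrier M" "w \<in> carrier M" "dst v w = 0"
  shows "v = w"
proof -
  have "\<parallel>v \<ominus> w\<parallel> = \<zero>\<^sub>0" using assms by (intro L0_len_eq_zeroD) (auto simp: dst_eq)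
  then have "v \<ominus> w = \<zero>" using assms by (intro norm_eq_zeroD) auto
  then show ?thesis by (rule diff_eq_zeroD[OF assms(1,2)])
qed

lemma lim_unique:
  assumes "\<And>n. \<sigma> n \<in> carrier M" "v \<in> carrier M" "w \<in> carrier M"
    "(\<lambda>n. dst (\<sigma> n) v) \<longlonglongrightarrow> 0" "(\<lambda>n. dst (\<sigma> n) w) \<longlonglongrightarrow> 0"
  shows "v = w"
proof (rule dst_eq_zeroD)
  have "(\<lambda>n. dst v w) \<longlonglongrightarrow> 0"
    by (rule dst_trans_tendsto[of "\<lambda>_. v" \<sigma>]) (use assms dst_commute in auto)
  then show "dst v w = 0" by (simp add: LIMSEQ_const_iff)
qed (use assms in auto)

lemma random_normed: "random_normed_module m M"
  using seminormed_L0_module_axioms norm_eq_zeroD by (simp add: random_normed_module_iff)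

end

context seminormed_L0_module
begin

text \<open>A class of norm 0 is represented by a sequence whose norms tend to 0, and such a
  sequence is equivalent to the zero sequence. For completeness, the n-th term of a Cauchy sequence
  of classes is replaced by an embedded vector within 1/(n+1); these vectors form a Cauchy sequence,
  and its class is the limit.\<close>

lemma Cpl_banach: "banach_L0_module m Cpl"
proof (intro banach_L0_module.intro banach_L0_module_axioms.intro Cpl_seminormed)
  interpret C: seminormed_L0_module m Cpl by (rule Cpl_seminormed)
  fix X assume "X \<in> carrier Cpl" and 0: "\<parallel>X\<parallel>\<^bsub>Cpl\<^esub> = \<zero>\<^sub>0"
  then obtain \<sigma> where *: "\<sigma> \<in> Cauchy_seqs" "X = cls \<sigma>"
    by (metis Cpl_cases)
  have "(\<lambda>n. L0_len m \<parallel>\<sigma> n\<parallel>) \<longlonglongrightarrow> L0_len m \<zero>\<^sub>0"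
    using cls_norm[OF *(1)] 0 * by (intro L0_len_lim(2)) (auto intro: Cauchy_seqsD)
  then show "X = \<zero>\<^bsub>Cpl\<^esub>"
    using * by (simp add: Cpl_zero cls_eq_iff dst_eq Cauchy_seqsD)
next
  interpret C: seminormed_L0_module m Cpl by (rule Cpl_seminormed)
  fix P assume P: "P \<in> rnm_Cauchy m Cpl"
  have Pc: "P n \<in> carrier Cpl" for n by (rule C.Cauchy_seqsD[OF P])
  have "\<exists>v\<in>carrier M. rnm_dist m Cpl (emb v) (P n) < inverse (real (Suc n))" for n
    by (rule emb_dense[OF Pc]) auto
  then obtain v where v: "\<And>n. v n \<in> carrier M" "\<And>n. rnm_dist m Cpl (emb (v n)) (P n) < inverse (real (Suc n))"
    by metis
  have lim: "(\<lambda>n. rnm_dist m Cpl (emb (v n)) (P n)) \<longlonglongrightarrow> 0"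
    by (rule tendsto_zero_inverse) (rule C.dst_nonneg, rule less_imp_le, rule v(2))
  have vC: "v \<in> Cauchy_seqs"
  proof (rule Cauchy_seqsI[OF v(1)])
    fix \<epsilon> :: real assume e: "\<epsilon> > 0"
    obtain N where N: "\<And>i j. i \<ge> N \<Longrightarrow> j \<ge> N \<Longrightarrow> rnm_dist m Cpl (P i) (P j) < \<epsilon>/3"
      using C.Cauchy_seqsE[OF P, of "\<epsilon>/3"] e by auto
    have "eventually (\<lambda>n. rnm_dist m Cpl (emb (v n)) (P n) < \<epsilon>/3) sequentially"
      by (rule order_tendstoD(2)[OF lim]) (use e in auto)
    then obtain N' where N': "\<And>n. n \<ge> N' \<Longrightarrow> rnm_dist m Cpl (emb (v n)) (P n) < \<epsilon>/3"
      by (auto simp: eventually_sequentially)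
    have "dst (v i) (v j) < \<epsilon>" if "i \<ge> max N N'" "j \<ge> max N N'" for i j
    proof -
      have "dst (v i) (v j) = rnm_dist m Cpl (emb (v i)) (emb (v j))" using v by (simp add: emb_dist)
      also have "\<dots> \<le> rnm_dist m Cpl (emb (v i)) (P i) + rnm_dist m Cpl (P i) (emb (v j))"
        using v Pc by (intro C.dst_triangle) auto
      also have "rnm_dist m Cpl (P i) (emb (v j)) \<le> rnm_dist m Cpl (P i) (P j) + rnm_dist m Cpl (P j) (emb (v j))"
        using v Pc by (intro C.dst_triangle) auto
      also have "rnm_dist m Cpl (P j) (emb (v j)) = rnm_dist m Cpl (emb (v j)) (P j)"
        using v Pc by (intro C.dst_commute) auto
      finally show ?thesis using N'[of i] N'[of j] N[of i j] that by auto
    qed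
    then show "\<exists>N. \<forall>i\<ge>N. \<forall>j\<ge>N. dst (v i) (v j) < \<epsilon>" by blast
  qed
  have "(\<lambda>n. rnm_dist m Cpl (P n) (cls v)) \<longlonglongrightarrow> 0"
    by (rule C.dst_trans_tendsto[of P "\<lambda>n. emb (v n)"])
       (use Pc v vC lim emb_lim[OF vC] C.dst_commute in auto)
  then show "\<exists>v\<in>carrier Cpl. (\<lambda>n. rnm_dist m Cpl (P n) v) \<longlonglongrightarrow> 0" using vC by blast
qed

end

text \<open>The factor \<open>g\<close> is a class and gives no Lipschitz constant for the real
  distances; \<open>L0_len_mult_eps\<close> still provides a modulus of continuity. The bound is
  stated on differences, so that additivity of \<open>T\<close> enters only where the rule is
  applied.\<close>

lemma (in L0_base) uniformly_continuous_norm_bound: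
  assumes "seminormed_L0_module m P" "seminormed_L0_module m Q"
    and T: "\<And>v. v \<in> carrier P \<Longrightarrow> T v \<in> carrier Q"
    and g: "g \<in> L0_pos m"
    and b: "\<And>v w. v \<in> carrier P \<Longrightarrow> w \<in> carrier P \<Longrightarrow> L0_le m \<parallel>T v \<ominus>\<^bsub>Q\<^esub> T w\<parallel>\<^bsub>Q\<^esub> (g \<otimes>\<^sub>0 \<parallel>v \<ominus>\<^bsub>P\<^esub> w\<parallel>\<^bsub>P\<^esub>)"
    and e: "\<epsilon> > 0"
  shows "\<exists>\<delta>>0. \<forall>v\<in>carrier P. \<forall>w\<in>carrier P. rnm_dist m P v w < \<delta> \<longrightarrow> rnm_dist m Q (T v) (T w) < \<epsilon>"
proof -
  interpret P: seminormed_L0_module m P by fact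
  interpret Q: seminormed_L0_module m Q by fact
  obtain \<delta> where d: "\<delta> > 0" "\<And>F. F \<in> L0_pos m \<Longrightarrow> L0_len m F < \<delta> \<Longrightarrow> L0_len m (g \<otimes>\<^sub>0 F) < \<epsilon>"
    using L0_len_mult_eps[OF g e] by blast
  have "rnm_dist m Q (T v) (T w) < \<epsilon>" if "v \<in> carrier P" "w \<in> carrier P" "rnm_dist m P v w < \<delta>" for v w
  proof -
    have "rnm_dist m Q (T v) (T w) \<le> L0_len m (g \<otimes>\<^sub>0 \<parallel>v \<ominus>\<^bsub>P\<^esub> w\<parallel>\<^bsub>P\<^esub>)"
      using that T g by (auto simp: Q.dst_eq intro!: L0_len_mono b)
    also have "\<dots> < \<epsilon>" using that d by (auto simp: P.dst_eq)
    finally show ?thesis .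
  qed
  then show ?thesis using d by blast
qed

section \<open>Extension of bounded module homomorphisms to the completion\<close>

locale bounded_L0_hom = L0_base m + P: seminormed_L0_module m P + C: banach_L0_module m C
  for m :: "'a measure" and P :: "('a l0, 'p) rnm" and C :: "('a l0, 'c) rnm" +
  fixes T :: "'p \<Rightarrow> 'c" and g :: "'a l0"
  assumes T_closed [simp, intro]: "v \<in> carrier P \<Longrightarrow> T v \<in> carrier C"
    and T_add: "v \<in> carrier P \<Longrightarrow> w \<in> carrier P \<Longrightarrow> T (v \<oplus>\<^bsub>P\<^esub> w) = T v \<oplus>\<^bsub>C\<^esub> T w"
    and T_smult: "f \<in> \<L> \<Longrightarrow> v \<in> carrier P \<Longrightarrow> T (f \<odot>\<^bsub>P\<^esub> v) = f \<odot>\<^bsub>C\<^esub> T v"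
    and g_pos: "g \<in> L0_pos m"
    and T_bound: "v \<in> carrier P \<Longrightarrow> L0_le m \<parallel>T v\<parallel>\<^bsub>C\<^esub> (g \<otimes>\<^sub>0 \<parallel>v\<parallel>\<^bsub>P\<^esub>)"
begin

text \<open>The value at a class is the limit of \<open>T\<close> along any of its representatives;
  \<open>ext_cls\<close> shows that it exists and does not depend on the representative.\<close>

definition ext :: "(nat \<Rightarrow> 'p) set \<Rightarrow> 'c" where
  "ext X = (THE c. c \<in> carrier C \<and> (\<exists>\<sigma>\<in>X. (\<lambda>n. C.dst (T (\<sigma> n)) c) \<longlonglongrightarrow> 0))"

lemma T_diff: "v \<in> carrier P \<Longrightarrow> w \<in> carrier P \<Longrightarrow> T (v \<ominus>\<^bsub>P\<^esub> w) = T v \<ominus>\<^bsub>C\<^esub> T w"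
  by (simp add: a_minus_def T_add T_smult P.smult_minus_one[symmetric] C.smult_minus_one[symmetric])

lemma T_unif:
  "\<epsilon> > 0 \<Longrightarrow> \<exists>\<delta>>0. \<forall>v\<in>carrier P. \<forall>w\<in>carrier P. P.dst v w < \<delta> \<longrightarrow> C.dst (T v) (T w) < \<epsilon>"
  by (rule uniformly_continuous_norm_bound[OF P.seminormed_L0_module_axioms C.seminormed_L0_module_axioms _ g_pos])
     (simp_all add: T_closed T_diff[symmetric] T_bound)

lemma T_Cauchy:
  assumes "\<sigma> \<in> P.Cauchy_seqs" shows "(\<lambda>n. T (\<sigma> n)) \<in> C.Cauchy_seqs"
proof (rule C.Cauchy_seqsI)
  fix \<epsilon> :: real assume "\<epsilon> > 0"
  then obtain \<delta> where d: "\<delta> > 0" "\<And>v w. v\<in>carrier P \<Longrightarrow> w\<in>carrier P \<Longrightarrow> P.dst v w < \<delta> \<Longrightarrow> C.dst (T v) (T w) < \<epsilon>"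
    using T_unif by blast
  obtain N where N: "\<And>i j. i \<ge> N \<Longrightarrow> j \<ge> N \<Longrightarrow> P.dst (\<sigma> i) (\<sigma> j) < \<delta>"
    using P.Cauchy_seqsE[OF assms d(1)] by auto
  show "\<exists>N. \<forall>i\<ge>N. \<forall>j\<ge>N. C.dst (T (\<sigma> i)) (T (\<sigma> j)) < \<epsilon>"
    using d(2) N P.Cauchy_seqsD[OF assms] by (intro exI[of _ N]) auto
qed (use P.Cauchy_seqsD[OF assms] in auto)

lemma T_dist_tendsto:
  assumes "\<And>n. \<sigma> n \<in> carrier P" "\<And>n. \<tau> n \<in> carrier P" "(\<lambda>n. P.dst (\<sigma> n) (\<tau> n)) \<longlonglongrightarrow> 0"
  shows "(\<lambda>n. C.dst (T (\<sigma> n)) (T (\<tau> n))) \<longlonglongrightarrow> 0"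
proof (rule LIMSEQ_I)
  fix \<epsilon> :: real assume "\<epsilon> > 0"
  then obtain \<delta> where d: "\<delta> > 0" "\<And>v w. v\<in>carrier P \<Longrightarrow> w\<in>carrier P \<Longrightarrow> P.dst v w < \<delta> \<Longrightarrow> C.dst (T v) (T w) < \<epsilon>"
    using T_unif by blast
  have "eventually (\<lambda>n. P.dst (\<sigma> n) (\<tau> n) < \<delta>) sequentially"
    by (rule order_tendstoD(2)[OF assms(3) d(1)])
  then have "eventually (\<lambda>n. norm (C.dst (T (\<sigma> n)) (T (\<tau> n)) - 0) < \<epsilon>) sequentially"
    by eventually_elim (simp add: C.dst_nonneg d(2) assms)
  then show "\<exists>no. \<forall>n\<ge>no. norm (C.dst (T (\<sigma> n)) (T (\<tau> n)) - 0) < \<epsilon>"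
    by (simp only: eventually_sequentially)
qed

text \<open>Uniform continuity sends Cauchy sequences to Cauchy sequences, and equivalent ones to
  sequences whose distance tends to 0; limits in \<open>C\<close> exist and are unique.\<close>

lemma ext_cls:
  assumes s: "\<sigma> \<in> P.Cauchy_seqs"
  shows "ext (P.cls \<sigma>) \<in> carrier C" "(\<lambda>n. C.dst (T (\<sigma> n)) (ext (P.cls \<sigma>))) \<longlonglongrightarrow> 0"
proof -
  obtain c where c: "c \<in> carrier C" "(\<lambda>n. C.dst (T (\<sigma> n)) c) \<longlonglongrightarrow> 0"
    using C.seq_complete[OF T_Cauchy[OF s]] by blast
  have "ext (P.cls \<sigma>) = c"
    unfolding ext_def
  proof (rule the_equality)
    show "c \<in> carrier C \<and> (\<exists>\<sigma>\<in>P.cls \<sigma>. (\<lambda>n. C.dst (T (\<sigma> n)) c) \<longlonglongrightarrow> 0)"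
      using c P.cls_self[OF s] by blast
    fix c' assume "c' \<in> carrier C \<and> (\<exists>\<sigma>\<in>P.cls \<sigma>. (\<lambda>n. C.dst (T (\<sigma> n)) c') \<longlonglongrightarrow> 0)"
    then obtain \<tau> where t: "c' \<in> carrier C" "\<tau> \<in> P.cls \<sigma>" "(\<lambda>n. C.dst (T (\<tau> n)) c') \<longlonglongrightarrow> 0" by blast
    have t': "\<tau> \<in> P.Cauchy_seqs" "(\<lambda>n. P.dst (\<sigma> n) (\<tau> n)) \<longlonglongrightarrow> 0" using t s by (auto simp: P.mem_cls)
    have "(\<lambda>n. C.dst (T (\<sigma> n)) c') \<longlonglongrightarrow> 0"
      by (rule C.dst_trans_tendsto[of _ "\<lambda>n. T (\<tau> n)"])
         (use t t' s P.Cauchy_seqsD in \<open>auto intro!: T_dist_tendsto\<close>)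
    then show "c' = c"
      using C.lim_unique[of "\<lambda>n. T (\<sigma> n)" c' c] c t s P.Cauchy_seqsD by auto
  qed
  then show "ext (P.cls \<sigma>) \<in> carrier C" "(\<lambda>n. C.dst (T (\<sigma> n)) (ext (P.cls \<sigma>))) \<longlonglongrightarrow> 0" using c by auto
qed

lemma ext_eqI:
  assumes "\<sigma> \<in> P.Cauchy_seqs" "c \<in> carrier C" "(\<lambda>n. C.dst (T (\<sigma> n)) c) \<longlonglongrightarrow> 0"
  shows "ext (P.cls \<sigma>) = c"
  using ext_cls[OF assms(1)] C.lim_unique[of "\<lambda>n. T (\<sigma> n)"] assms P.Cauchy_seqsD by auto

lemma ext_closed [simp, intro]: "X \<in> carrier P.Cpl \<Longrightarrow> ext X \<in> carrier C"
  by (erule P.Cpl_cases) (simp add: ext_cls)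

lemma ext_emb: "v \<in> carrier P \<Longrightarrow> ext (P.emb v) = T v"
  unfolding completion_emb_def by (rule ext_eqI) auto

lemma ext_add:
  assumes "X \<in> carrier P.Cpl" "Y \<in> carrier P.Cpl"
  shows "ext (X \<oplus>\<^bsub>P.Cpl\<^esub> Y) = ext X \<oplus>\<^bsub>C\<^esub> ext Y"
proof -
  obtain \<sigma> \<tau> where *: "\<sigma> \<in> P.Cauchy_seqs" "\<tau> \<in> P.Cauchy_seqs" "X = P.cls \<sigma>" "Y = P.cls \<tau>"
    using assms by (metis P.Cpl_cases)
  show ?thesis
    unfolding *(3,4) P.cls_add[OF *(1,2)]
  proof (rule ext_eqI)
    have "(\<lambda>n. C.dst (T (\<sigma> n) \<oplus>\<^bsub>C\<^esub> T (\<tau> n)) (ext (P.cls \<sigma>) \<oplus>\<^bsub>C\<^esub> ext (P.cls \<tau>))) \<longlonglongrightarrow> 0"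
      by (rule C.dst_add_tendsto) (use * P.Cauchy_seqsD in \<open>auto intro!: ext_cls\<close>)
    then show "(\<lambda>n. C.dst (T (\<sigma> n \<oplus>\<^bsub>P\<^esub> \<tau> n)) (ext (P.cls \<sigma>) \<oplus>\<^bsub>C\<^esub> ext (P.cls \<tau>))) \<longlonglongrightarrow> 0"
      using * P.Cauchy_seqsD by (simp add: T_add)
  qed (use * in auto)
qed

lemma ext_smult:
  assumes f: "f \<in> \<L>" and X: "X \<in> carrier P.Cpl"
  shows "ext (f \<odot>\<^bsub>P.Cpl\<^esub> X) = f \<odot>\<^bsub>C\<^esub> ext X"
proof -
  obtain \<sigma> where *: "\<sigma> \<in> P.Cauchy_seqs" "X = P.cls \<sigma>"
    using X by (metis P.Cpl_cases)
  show ?thesis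
    unfolding *(2) P.cls_smult[OF f *(1)]
  proof (rule ext_eqI)
    have "(\<lambda>n. C.dst (f \<odot>\<^bsub>C\<^esub> T (\<sigma> n)) (f \<odot>\<^bsub>C\<^esub> ext (P.cls \<sigma>))) \<longlonglongrightarrow> 0"
      by (rule C.dst_smult_tendsto) (use * f P.Cauchy_seqsD in \<open>auto intro!: ext_cls\<close>)
    then show "(\<lambda>n. C.dst (T (f \<odot>\<^bsub>P\<^esub> \<sigma> n)) (f \<odot>\<^bsub>C\<^esub> ext (P.cls \<sigma>))) \<longlonglongrightarrow> 0"
      using * f P.Cauchy_seqsD by (simp add: T_smult)
  qed (use * f in auto)
qed

lemma ext_norm_lim:
  assumes s: "\<sigma> \<in> P.Cauchy_seqs"
  shows "L0_lim m (\<lambda>n. \<parallel>T (\<sigma> n)\<parallel>\<^bsub>C\<^esub>) \<parallel>ext (P.cls \<sigma>)\<parallel>\<^bsub>C\<^esub>"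
  by (rule C.norm_lim) (use s P.Cauchy_seqsD in \<open>auto intro!: ext_cls\<close>)

lemma ext_bound:
  assumes X: "X \<in> carrier P.Cpl"
  shows "L0_le m \<parallel>ext X\<parallel>\<^bsub>C\<^esub> (g \<otimes>\<^sub>0 \<parallel>X\<parallel>\<^bsub>P.Cpl\<^esub>)"
proof -
  obtain \<sigma> where *: "\<sigma> \<in> P.Cauchy_seqs" "X = P.cls \<sigma>"
    using X by (metis P.Cpl_cases)
  show ?thesis unfolding *(2)
    by (rule L0_lim_le[OF ext_norm_lim L0_lim_mult[OF _ P.cls_norm]])
       (use * g_pos P.Cauchy_seqsD in \<open>auto intro!: T_bound\<close>)
qed

text \<open>Isometry also works backwards: if the images of \<sigma> n converge to \<open>c\<close>,
  then \<sigma> is itself Cauchy, and its class is a preimage of \<open>c\<close>. Injectivity comes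
  from definiteness of the norm on the completion.\<close>

lemma ext_iso:
  assumes iso: "\<And>v. v \<in> carrier P \<Longrightarrow> \<parallel>T v\<parallel>\<^bsub>C\<^esub> = \<parallel>v\<parallel>\<^bsub>P\<^esub>"
    and dense: "\<And>c \<epsilon>. c \<in> carrier C \<Longrightarrow> \<epsilon> > 0 \<Longrightarrow> \<exists>v\<in>carrier P. C.dst (T v) c < \<epsilon>"
  shows "rnm_isometric_iso m P.Cpl C ext"
proof -
  interpret D: banach_L0_module m P.Cpl by (rule P.Cpl_banach)
  have ext_norm: "\<parallel>ext X\<parallel>\<^bsub>C\<^esub> = \<parallel>X\<parallel>\<^bsub>P.Cpl\<^esub>" if X: "X \<in> carrier P.Cpl" for X
  proof -
    obtain \<sigma> where *: "\<sigma> \<in> P.Cauchy_seqs" "X = P.cls \<sigma>"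
      using X by (metis P.Cpl_cases)
    have "L0_lim m (\<lambda>n. \<parallel>\<sigma> n\<parallel>\<^bsub>P\<^esub>) \<parallel>ext (P.cls \<sigma>)\<parallel>\<^bsub>C\<^esub>"
      using ext_norm_lim[OF *(1)] by (simp add: iso P.Cauchy_seqsD[OF *(1)])
    then show ?thesis using P.cls_norm_eqI * by auto
  qed
  have T_dist: "C.dst (T v) (T w) = P.dst v w" if "v \<in> carrier P" "w \<in> carrier P" for v w
    using that by (simp add: C.dst_eq P.dst_eq T_diff[symmetric] iso)
  have inj: "inj_on ext (carrier P.Cpl)"
  proof (rule inj_onI)
    fix X Y assume XY: "X \<in> carrier P.Cpl" "Y \<in> carrier P.Cpl" "ext X = ext Y"
    have "ext (X \<ominus>\<^bsub>P.Cpl\<^esub> Y) = ext X \<ominus>\<^bsub>C\<^esub> ext Y"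
      using XY by (simp add: a_minus_def ext_add ext_smult D.smult_minus_one[symmetric] C.smult_minus_one[symmetric])
    also have "\<dots> = \<zero>\<^bsub>C\<^esub>" using XY by (simp add: a_minus_def C.r_neg)
    finally have "\<parallel>X \<ominus>\<^bsub>P.Cpl\<^esub> Y\<parallel>\<^bsub>P.Cpl\<^esub> = \<zero>\<^sub>0" using ext_norm[of "X \<ominus>\<^bsub>P.Cpl\<^esub> Y"] XY by simp
    then have "X \<ominus>\<^bsub>P.Cpl\<^esub> Y = \<zero>\<^bsub>P.Cpl\<^esub>" using XY by (intro D.norm_eq_zeroD) auto
    then show "X = Y" by (rule D.diff_eq_zeroD[OF XY(1,2)])
  qed
  have surj: "carrier C \<subseteq> ext ` carrier P.Cpl"
  proof
    fix c assume c: "c \<in> carrier C"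
    have "\<exists>v\<in>carrier P. C.dst (T v) c < inverse (real (Suc n))" for n
      by (rule dense[OF c]) auto
    then obtain \<sigma> where s: "\<And>n. \<sigma> n \<in> carrier P" "\<And>n. C.dst (T (\<sigma> n)) c < inverse (real (Suc n))"
      by metis
    have lim: "(\<lambda>n. C.dst (T (\<sigma> n)) c) \<longlonglongrightarrow> 0"
      by (rule tendsto_zero_inverse) (rule C.dst_nonneg, rule less_imp_le, rule s(2))
    have sC: "\<sigma> \<in> P.Cauchy_seqs"
    proof (rule P.Cauchy_seqsI[OF s(1)])
      fix \<epsilon> :: real assume e: "\<epsilon> > 0"
      have "eventually (\<lambda>n. C.dst (T (\<sigma> n)) c < \<epsilon>/2) sequentially"
        by (rule order_tendstoD(2)[OF lim]) (use e in auto)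
      then obtain N where N: "\<And>n. n \<ge> N \<Longrightarrow> C.dst (T (\<sigma> n)) c < \<epsilon>/2"
        by (auto simp: eventually_sequentially)
      have "P.dst (\<sigma> i) (\<sigma> j) < \<epsilon>" if "i \<ge> N" "j \<ge> N" for i j
      proof -
        have "P.dst (\<sigma> i) (\<sigma> j) = C.dst (T (\<sigma> i)) (T (\<sigma> j))" using s by (simp add: T_dist)
        also have "\<dots> \<le> C.dst (T (\<sigma> i)) c + C.dst c (T (\<sigma> j))"
          using s c by (intro C.dst_triangle) auto
        also have "C.dst c (T (\<sigma> j)) = C.dst (T (\<sigma> j)) c"
          using s c by (intro C.dst_commute) auto
        finally show ?thesis using N[OF that(1)] N[OF that(2)] by auto
      qed
      then show "\<exists>N. \<forall>i\<ge>N. \<forall>j\<ge>N. P.dst (\<sigma> i) (\<sigma> j) < \<epsilon>" by blast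
    qed
    have "ext (P.cls \<sigma>) = c" by (rule ext_eqI[OF sC c lim])
    then show "c \<in> ext ` carrier P.Cpl" using sC by blast
  qed
  show ?thesis
    by (intro rnm_isometric_iso.intro rnm_isometric_iso_axioms.intro D.random_normed C.random_normed)
       (use inj surj in \<open>auto simp: bij_betw_def ext_add ext_smult ext_norm\<close>)
qed

end

section \<open>Essential suprema and the variation of a vector measure\<close>

lemma sums_nonneg:
  fixes f :: "nat \<Rightarrow> real"
  shows "f sums s \<Longrightarrow> (\<And>n. 0 \<le> f n) \<Longrightarrow> 0 \<le> s"
  by (rule sums_le[OF _ sums_zero])

text \<open>Tonelli for a double series of nonnegative numbers, through unordered sums over pairs.
  The conclusions enumerate the pairs along \<open>prod_decode\<close> in either order, for
  refinements of partitions, and sum by columns, for the countable additivity of the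
  variation.\<close>

lemma double_sums_nonneg:
  fixes a :: "nat \<Rightarrow> nat \<Rightarrow> real"
  assumes nn: "\<And>i j. 0 \<le> a i j" and rows: "\<And>i. (\<lambda>j. a i j) sums r i" and tot: "r sums S"
  shows "(\<lambda>k. a (fst (prod_decode k)) (snd (prod_decode k))) sums S"
    and "summable (\<lambda>i. a i j)" and "(\<lambda>j. suminf (\<lambda>i. a i j)) sums S"
    and "(\<lambda>k. a (snd (prod_decode k)) (fst (prod_decode k))) sums S"
proof -
  let ?f = "\<lambda>p. a (fst p) (snd p)"
  have r0: "0 \<le> r i" for i by (rule sums_nonneg[OF rows nn])
  have row: "((\<lambda>j. ?f (i, j)) has_sum r i) UNIV" for i
    using sums_nonneg_imp_has_sum[OF rows nn] by simp
  have r: "(r has_sum S) UNIV" by (rule sums_nonneg_imp_has_sum[OF tot r0])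
  have summ: "?f summable_on UNIV \<times> UNIV"
    by (rule summable_on_SigmaI[OF row]) (use r nn in \<open>auto simp: summable_on_def\<close>)
  have f: "(?f has_sum S) (UNIV \<times> UNIV)"
    by (rule has_sum_SigmaI[OF row r summ])
  have "((\<lambda>k. ?f (prod_decode k)) has_sum S) UNIV"
    using has_sum_reindex_bij_betw[OF bij_prod_decode, of ?f S] f by simp
  then show "(\<lambda>k. a (fst (prod_decode k)) (snd (prod_decode k))) sums S" by (rule has_sum_imp_sums)
  have f': "((\<lambda>(x, y). ?f (y, x)) has_sum S) (UNIV \<times> UNIV)" by (rule has_sum_swap[THEN iffD1, OF f])
  have "((\<lambda>k. case prod_decode k of (x, y) \<Rightarrow> ?f (y, x)) has_sum S) UNIV"
    using has_sum_reindex_bij_betw[OF bij_prod_decode, of "\<lambda>(x, y). ?f (y, x)" S] f' by simp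
  then have "((\<lambda>k. a (snd (prod_decode k)) (fst (prod_decode k))) has_sum S) UNIV"
    by (simp add: case_prod_unfold)
  then show "(\<lambda>k. a (snd (prod_decode k)) (fst (prod_decode k))) sums S" by (rule has_sum_imp_sums)
  have "(\<lambda>(j, i). a i j) summable_on UNIV \<times> UNIV"
    using f' by (auto simp: summable_on_def case_prod_unfold)
  then have col: "(\<lambda>i. a i j) summable_on UNIV" for j by (rule summable_on_SigmaD1) auto
  then show s: "summable (\<lambda>i. a i j)" for j by (rule summable_on_UNIV_nonneg_real_iff[THEN iffD1, OF nn])
  have "((\<lambda>j. suminf (\<lambda>i. a i j)) has_sum S) UNIV"
  proof (rule has_sum_SigmaD[OF f'])
    show "((\<lambda>y. case (x, y) of (x, y) \<Rightarrow> ?f (y, x)) has_sum suminf (\<lambda>i. a i x)) UNIV" for x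
      using sums_nonneg_imp_has_sum[OF summable_sums[OF s] nn, of x] by simp
  qed
  then show "(\<lambda>j. suminf (\<lambda>i. a i j)) sums S" by (rule has_sum_imp_sums)
qed

context L0_base
begin

text \<open>
  For every rational \<open>q\<close> some countable subfamily \<open>C\<close> maximises the measure of \<open>{sup C > q}\<close>.  The union of
  these subfamilies is countable, and adding one more function to it changes its supremum only on
  a null set.
\<close>

lemma essential_supremum_exists:
  fixes \<F> :: "('a \<Rightarrow> ereal) set"
  assumes F: "\<F> \<subseteq> borel_measurable m"
  obtains h where "h \<in> borel_measurable m" "\<And>f. f \<in> \<F> \<Longrightarrow> AE x in m. f x \<le> h x"
    "\<And>g. (\<And>f. f \<in> \<F> \<Longrightarrow> AE x in m. f x \<le> g x) \<Longrightarrow> AE x in m. h x \<le> g x"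
proof -
  define H where "H C x = (SUP f\<in>C. f x)" for C :: "('a \<Rightarrow> ereal) set" and x
  have Hm [measurable]: "H C \<in> borel_measurable m" if "countable C" "C \<subseteq> \<F>" for C
    unfolding H_def using that F by (intro borel_measurable_SUP) auto
  have H_mono: "H C x \<le> H D x" if "C \<subseteq> D" for C D x
    unfolding H_def using that by (intro SUP_subset_mono) auto
  define P where "P q C = measure m {x \<in> space m. H C x > ereal (real_of_rat q)}" for q :: rat and C
  define \<C> where "\<C> = {C. countable C \<and> C \<subseteq> \<F>}"
  have P_mono: "P q C \<le> P q D" if "C \<subseteq> D" "D \<in> \<C>" for q C D
  proof -
    have [measurable]: "H D \<in> borel_measurable m" using that Hm by (auto simp: \<C>_def)
    show ?thesis
      unfolding P_def using H_mono[OF that(1)] by (intro finite_measure_mono) (auto intro: less_le_trans)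
  qed
  have "\<exists>C\<in>\<C>. \<forall>D\<in>\<C>. P q D \<le> P q C" for q
  proof -
    have bdd: "bdd_above (P q ` \<C>)" by (intro bdd_aboveI[of _ 1]) (auto simp: P_def)
    have ne: "{} \<in> \<C>" by (simp add: \<C>_def)
    let ?s = "SUP C\<in>\<C>. P q C"
    have "\<exists>C\<in>\<C>. ?s - inverse (real (Suc n)) < P q C" for n
      using less_cSUP_iff[OF _ bdd, of "?s - inverse (real (Suc n))"] ne by auto
    then obtain C where C: "\<And>n. C n \<in> \<C>" "\<And>n. ?s - inverse (real (Suc n)) < P q (C n)" by metis
    \<comment> \<open>By monotonicity of \<open>P q\<close>, the union of a maximising sequence
      attains the supremum over the countable subfamilies.\<close>
    have U: "(\<Union>n. C n) \<in> \<C>" using C by (auto simp: \<C>_def)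
    have "?s - inverse (real (Suc n)) \<le> P q (\<Union>n. C n)" for n
      using C(2)[of n] P_mono[OF _ U, of "C n" q] by fastforce
    moreover have "(\<lambda>n. ?s - inverse (real (Suc n))) \<longlonglongrightarrow> ?s - 0"
      by (intro tendsto_diff tendsto_const LIMSEQ_inverse_real_of_nat)
    ultimately have "?s - 0 \<le> P q (\<Union>n. C n)" by (intro LIMSEQ_le_const2) auto
    moreover have "P q D \<le> ?s" if "D \<in> \<C>" for D using that bdd by (rule cSUP_upper)
    ultimately show ?thesis using U by (intro bexI[of _ "\<Union>n. C n"]) fastforce+
  qed
  then obtain C where C: "\<And>q. C q \<in> \<C>" "\<And>q D. D \<in> \<C> \<Longrightarrow> P q D \<le> P q (C q)" by metis
  define U where "U = (\<Union>q. C q)"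
  have U: "U \<in> \<C>" unfolding U_def using C(1) by (auto simp: \<C>_def)
  have Um [measurable]: "H U \<in> borel_measurable m" using U Hm by (auto simp: \<C>_def)
  have PU: "P q D \<le> P q U" if "D \<in> \<C>" for q D
    using C(2)[OF that, of q] P_mono[OF _ U, of "C q" q] by (fastforce simp: U_def)
  show thesis
  proof (rule that[of "H U"])
    show "H U \<in> borel_measurable m" by fact
  next
    fix f assume f: "f \<in> \<F>"
    then have [measurable]: "f \<in> borel_measurable m" using F by auto
    have I: "insert f U \<in> \<C>" using f U by (auto simp: \<C>_def)
    have [measurable]: "H (insert f U) \<in> borel_measurable m" using I Hm by (auto simp: \<C>_def)
    have "AE x in m. f x > ereal (real_of_rat q) \<longrightarrow> H U x > ereal (real_of_rat q)" for q
    proof -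
      let ?A = "{x \<in> space m. H U x > ereal (real_of_rat q)}" and ?B = "{x \<in> space m. H (insert f U) x > ereal (real_of_rat q)}"
      have sub: "?A \<subseteq> ?B" using H_mono[of U "insert f U"] by (auto intro: less_le_trans)
      have "measure m (?B - ?A) = measure m ?B - measure m ?A"
        by (rule finite_measure_Diff) (use sub in auto)
      also have "\<dots> \<le> 0" using PU[OF I, of q] by (simp add: P_def)
      finally have "measure m (?B - ?A) = 0" by (simp add: measure_le_0_iff)
      then have "AE x in m. x \<notin> ?B - ?A"
        by (subst AE_iff_measurable[where N="?B - ?A"]) (auto simp: emeasure_eq_measure dest: sets.sets_into_space)
      then show ?thesis using AE_space
      proof eventually_elim
        case (elim x)
        have "f x \<le> H (insert f U) x" by (auto simp: H_def)
        then show ?case using elim by auto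
      qed
    qed
    then have "AE x in m. \<forall>q. f x > ereal (real_of_rat q) \<longrightarrow> H U x > ereal (real_of_rat q)"
      by (subst AE_all_countable) auto
    then show "AE x in m. f x \<le> H U x"
    proof eventually_elim
      case (elim x)
      show ?case
      proof (rule ccontr)
        assume "\<not> ?thesis"
        then have "H U x < f x" by simp
        then obtain q :: rat where "H U x < ereal (real_of_rat q)" "ereal (real_of_rat q) < f x"
          using ereal_dense3 by blast
        then show False using elim by (meson less_asym)
      qed
    qed
  next
    fix g assume g: "\<And>f. f \<in> \<F> \<Longrightarrow> AE x in m. f x \<le> g x"
    \<comment> \<open>\<open>U\<close> is countable, so the bounds for its members hold outside one
      common null set.\<close>
    have "AE x in m. \<forall>f\<in>U. f x \<le> g x"
      using U g by (subst AE_ball_countable) (auto simp: \<C>_def)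
    then show "AE x in m. H U x \<le> g x"
      by eventually_elim (auto simp: H_def intro: SUP_least)
  qed
qed

section \<open>The complete lattice of extended real-valued classes\<close>

abbreviation "bcls f \<equiv> L0bar_rel m `` {f}"

lemma equiv_L0bar_rel: "equiv (borel_measurable m) (L0bar_rel m)"
  by (rule equivI) (auto simp: L0bar_rel_def refl_on_def sym_def trans_def)

lemma bcls_eq_iff:
  "f \<in> borel_measurable m \<Longrightarrow> g \<in> borel_measurable m \<Longrightarrow> bcls f = bcls g \<longleftrightarrow> (AE x in m. f x = g x)"
  using eq_equiv_class_iff[OF equiv_L0bar_rel] by (simp add: L0bar_rel_def)

lemma bcls_closed [simp, intro]: "f \<in> borel_measurable m \<Longrightarrow> bcls f \<in> carrier (L0bar m)"
  by (simp add: L0bar_def quotientI)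

lemma L0bar_cases:
  assumes "F \<in> carrier (L0bar m)"
  obtains f where "f \<in> borel_measurable m" "F = bcls f"
  using assms by (auto simp: L0bar_def quotient_def)

lemma bcls_le_iff:
  assumes "f \<in> borel_measurable m" "g \<in> borel_measurable m"
  shows "bcls f \<sqsubseteq>\<^bsub>L0bar m\<^esub> bcls g \<longleftrightarrow> (AE x in m. f x \<le> g x)"
proof
  assume "bcls f \<sqsubseteq>\<^bsub>L0bar m\<^esub> bcls g"
  then obtain f' g' where "AE x in m. f x = f' x" "AE x in m. g x = g' x" "AE x in m. f' x \<le> g' x"
    by (auto simp: L0bar_def L0bar_rel_def)
  then show "AE x in m. f x \<le> g x" by eventually_elim auto
next
  assume "AE x in m. f x \<le> g x"
  then show "bcls f \<sqsubseteq>\<^bsub>L0bar m\<^esub> bcls g"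
    using assms by (auto simp: L0bar_def L0bar_rel_def intro!: bexI[of _ f] bexI[of _ g])
qed

lemma L0_to_bar_eq:
  assumes F: "F \<in> \<L>"
  shows "L0_to_bar m F = bcls (\<lambda>x. ereal (L0_rep F x))"
  unfolding L0_to_bar_def
proof (rule UN_eq_const)
  show "F \<noteq> {}" using L0_rep_mem[OF F] by auto
  fix f assume "f \<in> F"
  then have f: "f \<in> borel_measurable m" "AE x in m. L0_rep F x = f x"
    using mem_L0_class[of "L0_rep F" f] F by auto
  show "bcls (\<lambda>x. ereal (f x)) = bcls (\<lambda>x. ereal (L0_rep F x))"
    by (subst bcls_eq_iff) (use f F in auto)
qed

lemma L0_to_bar_closed [simp, intro]: "F \<in> \<L> \<Longrightarrow> L0_to_bar m F \<in> carrier (L0bar m)"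
  by (simp add: L0_to_bar_eq)

lemma L0_to_bar_le_iff:
  "F \<in> \<L> \<Longrightarrow> G \<in> \<L> \<Longrightarrow> L0_to_bar m F \<sqsubseteq>\<^bsub>L0bar m\<^esub> L0_to_bar m G \<longleftrightarrow> L0_le m F G"
  by (simp add: L0_to_bar_eq bcls_le_iff L0_le_iff)

lemma L0_of_bar_to_bar: "F \<in> \<L> \<Longrightarrow> L0_of_bar m (L0_to_bar m F) = F"
  unfolding L0_of_bar_def
  by (rule the_equality) (auto simp: L0_to_bar_eq bcls_eq_iff L0_eq_iff)

text \<open>The lattice supremum is a choice among least upper bounds, so it is enough to exhibit
  one: the class of the essential supremum of chosen representatives.\<close>

lemma L0bar_sup_least:
  assumes S: "S \<subseteq> carrier (L0bar m)"
  shows "least (L0bar m) (\<Squnion>\<^bsub>L0bar m\<^esub> S) (Upper (L0bar m) S)"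
proof -
  have "\<forall>F\<in>S. \<exists>f. f \<in> borel_measurable m \<and> F = bcls f" using S by (metis L0bar_cases subsetD)
  then obtain r where r: "\<And>F. F \<in> S \<Longrightarrow> r F \<in> borel_measurable m \<and> F = bcls (r F)" by metis
  obtain h where h: "h \<in> borel_measurable m" "\<And>f. f \<in> r ` S \<Longrightarrow> AE x in m. f x \<le> h x"
    "\<And>g. (\<And>f. f \<in> r ` S \<Longrightarrow> AE x in m. f x \<le> g x) \<Longrightarrow> AE x in m. h x \<le> g x"
    by (rule essential_supremum_exists[of "r ` S"]) (use r in auto)
  have "least (L0bar m) (bcls h) (Upper (L0bar m) S)"
    unfolding least_def
  proof (intro conjI ballI)
    have "F \<sqsubseteq>\<^bsub>L0bar m\<^esub> bcls h" if F: "F \<in> S" for F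
      using h(1) h(2)[of "r F"] r[OF F] F bcls_le_iff[of "r F" h] by auto
    then show "bcls h \<in> Upper (L0bar m) S"
      using h(1) unfolding Upper_def by auto
    fix G assume G: "G \<in> Upper (L0bar m) S"
    then have "G \<in> carrier (L0bar m)" by (simp add: Upper_def)
    then obtain g where g: "g \<in> borel_measurable m" "G = bcls g" by (rule L0bar_cases)
    have "AE x in m. r F x \<le> g x" if "F \<in> S" for F
    proof -
      have "F \<sqsubseteq>\<^bsub>L0bar m\<^esub> G" using G that S by (auto simp: Upper_def)
      then show ?thesis using r[OF that] g bcls_le_iff by metis
    qed
    then have "AE x in m. h x \<le> g x" by (intro h(3)) auto
    then show "bcls h \<sqsubseteq>\<^bsub>L0bar m\<^esub> G" using h(1) g by (simp add: bcls_le_iff)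
  qed (auto simp: Upper_def)
  then show ?thesis unfolding sup_def by (rule someI)
qed

text \<open>The infimum is the negated essential supremum of the negated representatives.\<close>

lemma L0bar_inf_greatest:
  assumes S: "S \<subseteq> carrier (L0bar m)"
  shows "greatest (L0bar m) (\<Sqinter>\<^bsub>L0bar m\<^esub> S) (Lower (L0bar m) S)"
proof -
  have "\<forall>F\<in>S. \<exists>f. f \<in> borel_measurable m \<and> F = bcls f" using S by (metis L0bar_cases subsetD)
  then obtain r where r: "\<And>F. F \<in> S \<Longrightarrow> r F \<in> borel_measurable m \<and> F = bcls (r F)" by metis
  let ?N = "(\<lambda>F x. - r F x) ` S"
  obtain h where h: "h \<in> borel_measurable m" "\<And>f. f \<in> ?N \<Longrightarrow> AE x in m. f x \<le> h x"
    "\<And>g. (\<And>f. f \<in> ?N \<Longrightarrow> AE x in m. f x \<le> g x) \<Longrightarrow> AE x in m. h x \<le> g x"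
    by (rule essential_supremum_exists[of ?N]) (use r in auto)
  have hm: "(\<lambda>x. - h x) \<in> borel_measurable m" using h(1) by simp
  have "greatest (L0bar m) (bcls (\<lambda>x. - h x)) (Lower (L0bar m) S)"
    unfolding greatest_def
  proof (intro conjI ballI)
    have "bcls (\<lambda>x. - h x) \<sqsubseteq>\<^bsub>L0bar m\<^esub> F" if F: "F \<in> S" for F
    proof -
      have "AE x in m. - r F x \<le> h x" using F by (intro h(2)) auto
      then have "AE x in m. - h x \<le> r F x" by eventually_elim (simp add: ereal_uminus_le_reorder)
      then show ?thesis using r[OF F] hm bcls_le_iff by metis
    qed
    then show "bcls (\<lambda>x. - h x) \<in> Lower (L0bar m) S"
      using hm unfolding Lower_def by auto
    fix G assume G: "G \<in> Lower (L0bar m) S"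
    then have "G \<in> carrier (L0bar m)" by (simp add: Lower_def)
    then obtain g where g: "g \<in> borel_measurable m" "G = bcls g" by (rule L0bar_cases)
    have "AE x in m. - r F x \<le> - g x" if "F \<in> S" for F
    proof -
      have "G \<sqsubseteq>\<^bsub>L0bar m\<^esub> F" using G that S by (auto simp: Lower_def)
      then have "AE x in m. g x \<le> r F x" using r[OF that] g bcls_le_iff by metis
      then show ?thesis by eventually_elim auto
    qed
    then have "AE x in m. h x \<le> - g x" by (intro h(3)) auto
    then have "AE x in m. g x \<le> - h x" by eventually_elim (metis ereal_uminus_le_reorder ereal_uminus_uminus)
    then show "G \<sqsubseteq>\<^bsub>L0bar m\<^esub> bcls (\<lambda>x. - h x)" using hm g by (auto simp: bcls_le_iff)
  qed (auto simp: Lower_def)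
  then show ?thesis unfolding inf_def by (rule someI)
qed

text \<open>A class squeezed between two real-valued ones is almost everywhere finite, so
  \<open>real_of_ereal\<close> changes it only on a null set.\<close>

lemma L0bar_between:
  assumes s: "s \<in> carrier (L0bar m)" and F: "F \<in> \<L>" "G \<in> \<L>"
    and le: "L0_to_bar m F \<sqsubseteq>\<^bsub>L0bar m\<^esub> s" "s \<sqsubseteq>\<^bsub>L0bar m\<^esub> L0_to_bar m G"
  obtains H where "H \<in> \<L>" "s = L0_to_bar m H"
proof -
  obtain f where f: "f \<in> borel_measurable m" "s = bcls f" using s by (rule L0bar_cases)
  define H where "H = L0_class m (\<lambda>x. real_of_ereal (f x))"
  have H: "H \<in> \<L>" using f by (simp add: H_def)
  have "AE x in m. L0_rep H x = real_of_ereal (f x)" unfolding H_def using f by (intro AE_rep_class) auto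
  moreover have "AE x in m. ereal (L0_rep F x) \<le> f x" "AE x in m. f x \<le> ereal (L0_rep G x)"
    using le F f by (auto simp: L0_to_bar_eq bcls_le_iff)
  ultimately have "AE x in m. f x = ereal (L0_rep H x)"
  proof eventually_elim
    case (elim x) then show ?case by (cases "f x") auto
  qed
  then have "s = L0_to_bar m H" using f H by (simp add: L0_to_bar_eq bcls_eq_iff)
  then show thesis using that H by blast
qed

lemma sup_upper:
  assumes "\<F> \<subseteq> \<L>" "F \<in> \<F>" "\<Squnion>\<^bsub>L0bar m\<^esub> (L0_to_bar m ` \<F>) = L0_to_bar m B" "B \<in> \<L>"
  shows "L0_le m F B"
proof -
  have S: "L0_to_bar m ` \<F> \<subseteq> carrier (L0bar m)" using assms by auto
  have "L0_to_bar m F \<sqsubseteq>\<^bsub>L0bar m\<^esub> L0_to_bar m B"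
    using L0bar_sup_least[OF S] assms S by (auto simp: least_def Upper_def)
  then show ?thesis using assms by (auto simp: L0_to_bar_le_iff)
qed

text \<open>A member of the nonempty family bounds the supremum from below and \<open>B\<close>
  bounds it from above, so it is almost everywhere finite and \<open>L0_of_bar\<close> returns it as
  an element of \<open>L0\<close>.\<close>

lemma L0_sup:
  assumes F: "\<F> \<subseteq> \<L>" "\<F> \<noteq> {}" and B: "B \<in> \<L>" "\<And>F. F \<in> \<F> \<Longrightarrow> L0_le m F B"
  defines "s \<equiv> L0_of_bar m (\<Squnion>\<^bsub>L0bar m\<^esub> (L0_to_bar m ` \<F>))"
  shows "s \<in> \<L>" "\<And>F. F \<in> \<F> \<Longrightarrow> L0_le m F s"
    "\<And>G. G \<in> \<L> \<Longrightarrow> (\<And>F. F \<in> \<F> \<Longrightarrow> L0_le m F G) \<Longrightarrow> L0_le m s G"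
proof -
  let ?S = "L0_to_bar m ` \<F>"
  have S: "?S \<subseteq> carrier (L0bar m)" using F by auto
  note l = L0bar_sup_least[OF S]
  have up: "\<Squnion>\<^bsub>L0bar m\<^esub> ?S \<sqsubseteq>\<^bsub>L0bar m\<^esub> L0_to_bar m G" if "G \<in> \<L>" "\<And>F. F \<in> \<F> \<Longrightarrow> L0_le m F G" for G
  proof -
    have "L0_to_bar m F \<sqsubseteq>\<^bsub>L0bar m\<^esub> L0_to_bar m G" if "F \<in> \<F>" for F
      using that \<open>\<And>F. F \<in> \<F> \<Longrightarrow> L0_le m F G\<close> F \<open>G \<in> \<L>\<close> by (subst L0_to_bar_le_iff) auto
    then have "L0_to_bar m G \<in> Upper (L0bar m) ?S" using that by (auto simp: Upper_def)
    then show ?thesis using l by (simp add: least_def)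
  qed
  obtain F where "F \<in> \<F>" using F by auto
  then have "L0_to_bar m F \<sqsubseteq>\<^bsub>L0bar m\<^esub> \<Squnion>\<^bsub>L0bar m\<^esub> ?S"
    using l S by (auto simp: least_def Upper_def)
  moreover have "\<Squnion>\<^bsub>L0bar m\<^esub> ?S \<in> carrier (L0bar m)" using l by (rule least_closed)
  ultimately obtain H where H: "H \<in> \<L>" "\<Squnion>\<^bsub>L0bar m\<^esub> ?S = L0_to_bar m H"
    using up[OF B] B(1) F \<open>F \<in> \<F>\<close> by (meson L0bar_between subsetD)
  have sH: "s = H" unfolding s_def H(2) by (rule L0_of_bar_to_bar[OF H(1)])
  show "s \<in> \<L>" using H sH by simp
  show "L0_le m F s" if "F \<in> \<F>" for F using sup_upper[OF F(1) that H(2,1)] sH by simp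
  show "L0_le m s G" if "G \<in> \<L>" "\<And>F. F \<in> \<F> \<Longrightarrow> L0_le m F G" for G
    using up[OF that] H that sH by (simp add: L0_to_bar_le_iff)
qed

lemma L0_inf:
  assumes F: "\<F> \<subseteq> \<L>" "\<F> \<noteq> {}" and B: "B \<in> \<L>" "\<And>F. F \<in> \<F> \<Longrightarrow> L0_le m B F"
  defines "s \<equiv> L0_of_bar m (\<Sqinter>\<^bsub>L0bar m\<^esub> (L0_to_bar m ` \<F>))"
  shows "s \<in> \<L>" "\<And>F. F \<in> \<F> \<Longrightarrow> L0_le m s F"
    "\<And>G. G \<in> \<L> \<Longrightarrow> (\<And>F. F \<in> \<F> \<Longrightarrow> L0_le m G F) \<Longrightarrow> L0_le m G s"
proof -
  let ?S = "L0_to_bar m ` \<F>"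
  have S: "?S \<subseteq> carrier (L0bar m)" using F by auto
  note l = L0bar_inf_greatest[OF S]
  have lo: "L0_to_bar m G \<sqsubseteq>\<^bsub>L0bar m\<^esub> \<Sqinter>\<^bsub>L0bar m\<^esub> ?S" if "G \<in> \<L>" "\<And>F. F \<in> \<F> \<Longrightarrow> L0_le m G F" for G
  proof -
    have "L0_to_bar m G \<sqsubseteq>\<^bsub>L0bar m\<^esub> L0_to_bar m F" if "F \<in> \<F>" for F
      using that \<open>\<And>F. F \<in> \<F> \<Longrightarrow> L0_le m G F\<close> F \<open>G \<in> \<L>\<close> by (subst L0_to_bar_le_iff) auto
    then have "L0_to_bar m G \<in> Lower (L0bar m) ?S" using that by (auto simp: Lower_def)
    then show ?thesis using l by (simp add: greatest_def)
  qed
  have up: "\<Sqinter>\<^bsub>L0bar m\<^esub> ?S \<sqsubseteq>\<^bsub>L0bar m\<^esub> L0_to_bar m F" if "F \<in> \<F>" for F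
    using l S that by (auto simp: greatest_def Lower_def)
  obtain F where "F \<in> \<F>" using F by auto
  moreover have "\<Sqinter>\<^bsub>L0bar m\<^esub> ?S \<in> carrier (L0bar m)" using l by (rule greatest_closed)
  ultimately obtain H where H: "H \<in> \<L>" "\<Sqinter>\<^bsub>L0bar m\<^esub> ?S = L0_to_bar m H"
    using up[OF \<open>F \<in> \<F>\<close>] lo[OF B] B(1) F by (meson L0bar_between subsetD)
  have sH: "s = H" unfolding s_def H(2) by (rule L0_of_bar_to_bar[OF H(1)])
  show "s \<in> \<L>" using H sH by simp
  show "L0_le m s F" if "F \<in> \<F>" for F
    using up[OF that] H F(1) that sH by (auto simp: L0_to_bar_le_iff)
  show "L0_le m G s" if "G \<in> \<L>" "\<And>F. F \<in> \<F> \<Longrightarrow> L0_le m G F" for G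
    using lo[OF that] H that sH by (simp add: L0_to_bar_le_iff)
qed

section \<open>Series of classes as series of numbers at almost every point\<close>

lemma L0_sums_AE:
  assumes F: "\<And>n. F n \<in> \<L>" and s: "AE x in m. summable (\<lambda>n. L0_rep (F n) x)"
  shows "L0_sums m F (L0_suminf m F)" "AE x in m. L0_rep (L0_suminf m F) x = suminf (\<lambda>n. L0_rep (F n) x)"
proof -
  define S where "S = L0_class m (\<lambda>x. suminf (\<lambda>n. L0_rep (F n) x))"
  have Sm: "(\<lambda>x. suminf (\<lambda>n. L0_rep (F n) x)) \<in> borel_measurable m" using F by (intro borel_measurable_suminf) auto
  have S: "S \<in> \<L>" "AE x in m. L0_rep S x = suminf (\<lambda>n. L0_rep (F n) x)"
    unfolding S_def using Sm by (auto intro: AE_rep_class)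
  have "AE x in m. \<forall>n. L0_rep (\<Oplus>\<^bsub>L0 m\<^esub>i\<in>{..<n}. F i) x = (\<Sum>i<n. L0_rep (F i) x)"
    by (subst AE_all_countable) (auto intro!: AE_rep_finsum F)
  then have "AE x in m. (\<lambda>n. L0_rep (\<Oplus>\<^bsub>L0 m\<^esub>i\<in>{..<n}. F i) x) \<longlonglongrightarrow> L0_rep S x"
    using S(2) s
  proof eventually_elim
    case (elim x)
    then show ?case using summable_LIMSEQ[of "\<lambda>n. L0_rep (F n) x"] by simp
  qed
  then have L: "L0_sums m F S" unfolding L0_sums_def using F S by (intro L0_lim_AE L0.finsum_closed) auto
  have "L0_suminf m F = S" unfolding L0_suminf_def
  proof (rule the_equality)
    show "S' = S" if "L0_sums m F S'" for S'
      using that L unfolding L0_sums_def by (rule L0_lim_unique)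
  qed (rule L)
  then show "L0_sums m F (L0_suminf m F)" "AE x in m. L0_rep (L0_suminf m F) x = suminf (\<lambda>n. L0_rep (F n) x)"
    using L S by auto
qed

lemma L0_suminf_closed: "L0_sums m F (L0_suminf m F) \<Longrightarrow> L0_suminf m F \<in> \<L>"
  by (auto simp: L0_sums_def L0_lim_def)

lemma L0_sums_unique: "L0_sums m F S \<Longrightarrow> L0_sums m F S' \<Longrightarrow> S = S'"
  unfolding L0_sums_def by (rule L0_lim_unique)

text \<open>Partial sums of nonnegative classes below one class are bounded by a number at almost
  every point, hence converge there; conversely the pointwise sum is itself such a bound. From here
  on summability is a pointwise matter.\<close>

lemma L0_summable_iff:
  "L0_summable m F \<longleftrightarrow> range F \<subseteq> L0_pos m \<and> (AE x in m. summable (\<lambda>n. L0_rep (F n) x))"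
proof (cases "range F \<subseteq> L0_pos m")
  case True
  then have F: "F n \<in> \<L>" "F n \<in> L0_pos m" for n by auto
  have sums: "AE x in m. \<forall>n. L0_rep (\<Oplus>\<^bsub>L0 m\<^esub>i\<in>{..<n}. F i) x = (\<Sum>i<n. L0_rep (F i) x)"
    by (subst AE_all_countable) (auto intro!: AE_rep_finsum F)
  have pos: "AE x in m. \<forall>n. 0 \<le> L0_rep (F n) x"
    using AE_rep_pos[OF F(2)] by (subst AE_all_countable) auto
  have c: "(\<Oplus>\<^bsub>L0 m\<^esub>i\<in>{..<n}. F i) \<in> \<L>" for n using F by (intro L0.finsum_closed) auto
  have "L0_summable m F \<longleftrightarrow> (\<exists>B\<in>\<L>. \<forall>n. L0_le m (\<Oplus>\<^bsub>L0 m\<^esub>i\<in>{..<n}. F i) B)"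
    using True by (simp add: L0_summable_def)
  also have "\<dots> \<longleftrightarrow> (AE x in m. summable (\<lambda>n. L0_rep (F n) x))"
  proof
    assume "\<exists>B\<in>\<L>. \<forall>n. L0_le m (\<Oplus>\<^bsub>L0 m\<^esub>i\<in>{..<n}. F i) B"
    then obtain B where B: "B \<in> \<L>" "\<And>n. L0_le m (\<Oplus>\<^bsub>L0 m\<^esub>i\<in>{..<n}. F i) B" by blast
    then have "AE x in m. \<forall>n. L0_rep (\<Oplus>\<^bsub>L0 m\<^esub>i\<in>{..<n}. F i) x \<le> L0_rep B x"
      using c by (subst AE_all_countable) (auto simp: L0_le_iff)
    then show "AE x in m. summable (\<lambda>n. L0_rep (F n) x)"
      using sums pos
    proof eventually_elim
      case (elim x)
      show ?case
        by (rule summableI_nonneg_bounded[where x="L0_rep B x"]) (use elim in auto)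
    qed
  next
    assume s: "AE x in m. summable (\<lambda>n. L0_rep (F n) x)"
    note S = L0_sums_AE[OF F(1) s]
    have "AE x in m. L0_rep (\<Oplus>\<^bsub>L0 m\<^esub>i\<in>{..<n}. F i) x \<le> L0_rep (L0_suminf m F) x" for n
      using sums pos S(2) s by eventually_elim (auto intro!: sum_le_suminf)
    then show "\<exists>B\<in>\<L>. \<forall>n. L0_le m (\<Oplus>\<^bsub>L0 m\<^esub>i\<in>{..<n}. F i) B"
      using L0_suminf_closed[OF S(1)] c by (intro bexI[of _ "L0_suminf m F"]) (auto simp: L0_le_iff)
  qed
  finally show ?thesis using True by simp
qed (auto simp: L0_summable_def)

lemma L0_summable_suminf:
  assumes "L0_summable m F"
  shows "L0_suminf m F \<in> L0_pos m" "AE x in m. (\<lambda>n. L0_rep (F n) x) sums L0_rep (L0_suminf m F) x"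
proof -
  have F: "F n \<in> \<L>" "F n \<in> L0_pos m" and s: "AE x in m. summable (\<lambda>n. L0_rep (F n) x)" for n
    using assms by (auto simp: L0_summable_iff)
  note S = L0_sums_AE[OF F(1) s]
  show sums: "AE x in m. (\<lambda>n. L0_rep (F n) x) sums L0_rep (L0_suminf m F) x"
    using S(2) s by eventually_elim (simp add: summable_sums)
  have pos: "AE x in m. \<forall>n. 0 \<le> L0_rep (F n) x"
    using AE_rep_pos[OF F(2)] by (subst AE_all_countable) auto
  have "AE x in m. 0 \<le> L0_rep (L0_suminf m F) x"
    using sums pos by eventually_elim (erule sums_nonneg, simp)
  then show "L0_suminf m F \<in> L0_pos m" using L0_suminf_closed[OF S(1)] by (intro L0_posI) auto
qed

end

section \<open>The variation of a vector measure and its countable additivity\<close>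

locale L0_vector_measure = L0_base m + SA: sigma_algebra \<Omega> \<A>
  for m :: "'a measure" and \<Omega> :: "'b set" and \<A> :: "'b set set" +
  fixes \<mu> :: "'b set \<Rightarrow> 'a l0"
  assumes vector_measure: "L0_valued_measure m \<A> \<mu>"
    and bounded_var: "bounded_variation m \<Omega> \<A> \<mu>"
begin

abbreviation "V \<equiv> variation m \<A> \<mu>"

definition part_sum :: "(nat \<Rightarrow> 'b set) \<Rightarrow> 'a l0" where
  "part_sum B = L0_suminf m (\<lambda>n. \<parallel>\<mu> (B n)\<parallel>\<^sub>0)"

definition part_sums :: "'b set \<Rightarrow> 'a l0 set" where
  "part_sums A = part_sum ` {B. seq_partition \<A> A B}"

lemma mu_closed [simp, intro]: "A \<in> \<A> \<Longrightarrow> \<mu> A \<in> \<L>"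
  using vector_measure by (auto simp: L0_valued_measure_def)

lemma seq_partitionD:
  assumes "seq_partition \<A> A B"
  shows "B n \<in> \<A>" "disjoint_family B" "(\<Union>n. B n) = A" "B n \<subseteq> A" "A \<in> \<A>"
  using assms SA.countable_nat_UN[of B] by (auto simp: seq_partition_def image_subset_iff)

text \<open>Translates the axioms for one partition into numerical series at almost every point of
  the base space.\<close>

lemma part_sum_AE:
  assumes "seq_partition \<A> A B"
  shows "part_sum B \<in> L0_pos m" "AE x in m. (\<lambda>n. \<bar>L0_rep (\<mu> (B n)) x\<bar>) sums L0_rep (part_sum B) x"
    "AE x in m. L0_rep (\<mu> A) x = suminf (\<lambda>n. L0_rep (\<mu> (B n)) x)"
proof -
  note B = seq_partitionD[OF assms]
  have s: "L0_summable m (\<lambda>n. \<parallel>\<mu> (B n)\<parallel>\<^sub>0)" and l: "L0_sums m (\<lambda>n. \<mu> (B n)) (\<mu> A)"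
    using vector_measure B(1,2) unfolding L0_valued_measure_def B(3)[symmetric] by (blast, blast)
  show "part_sum B \<in> L0_pos m" unfolding part_sum_def by (rule L0_summable_suminf[OF s])
  have n: "AE x in m. \<forall>n. L0_rep \<parallel>\<mu> (B n)\<parallel>\<^sub>0 x = \<bar>L0_rep (\<mu> (B n)) x\<bar>"
    using B by (subst AE_all_countable) (auto intro!: AE_rep_norm)
  show *: "AE x in m. (\<lambda>n. \<bar>L0_rep (\<mu> (B n)) x\<bar>) sums L0_rep (part_sum B) x"
    using n L0_summable_suminf(2)[OF s] unfolding part_sum_def by eventually_elim simp
  have "AE x in m. summable (\<lambda>n. L0_rep (\<mu> (B n)) x)"
    using * by eventually_elim (auto simp: sums_iff intro: summable_rabs_cancel)
  from L0_sums_AE[OF _ this] B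
  have **: "L0_sums m (\<lambda>n. \<mu> (B n)) (L0_suminf m (\<lambda>n. \<mu> (B n)))"
    "AE x in m. L0_rep (L0_suminf m (\<lambda>n. \<mu> (B n))) x = suminf (\<lambda>n. L0_rep (\<mu> (B n)) x)"
    by auto
  from L0_sums_unique[OF l **(1)] **(2)
  show "AE x in m. L0_rep (\<mu> A) x = suminf (\<lambda>n. L0_rep (\<mu> (B n)) x)" by simp
qed

lemma variation_bar_eq: "variation_bar m \<A> \<mu> A = \<Squnion>\<^bsub>L0bar m\<^esub> (L0_to_bar m ` part_sums A)"
proof -
  have "{L0_to_bar m (L0_suminf m (\<lambda>n. \<parallel>\<mu> (B n)\<parallel>\<^sub>0)) | B. seq_partition \<A> A B} = L0_to_bar m ` part_sums A"
    by (auto simp: part_sums_def part_sum_def)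
  then show ?thesis by (simp add: variation_bar_def)
qed

lemma part_sums_subset: "part_sums A \<subseteq> \<L>"
  using part_sum_AE(1) by (auto simp: part_sums_def)

lemma seq_partition_Int:
  assumes B: "seq_partition \<A> A B" and C: "C \<in> \<A>" "C \<subseteq> A"
  shows "seq_partition \<A> C (\<lambda>n. C \<inter> B n)"
proof -
  note * = seq_partitionD[OF B]
  have "disjoint_family (\<lambda>n. C \<inter> B n)" using *(2) unfolding disjoint_family_on_def by blast
  moreover have "(\<Union>n. C \<inter> B n) = C" using *(3) C by auto
  ultimately show ?thesis using *(1) C by (auto simp: seq_partition_def)
qed

lemma seq_partition_trivial:
  assumes "A \<in> \<A>" shows "seq_partition \<A> A (\<lambda>n. if n = 0 then A else {})"
  using assms by (auto simp: seq_partition_def disjoint_family_on_def)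

text \<open>Prepending by \<open>case_nat\<close> lets a series over the new partition be split off
  at index 0.\<close>

lemma seq_partition_Cons:
  assumes B: "seq_partition \<A> A B" and C: "C \<in> \<A>" "A \<inter> C = {}"
  shows "seq_partition \<A> (A \<union> C) (case_nat C B)"
proof -
  note * = seq_partitionD[OF B]
  have "(\<Union>n. case_nat C B n) = A \<union> C"
    using *(3) by (auto split: nat.splits)
  moreover have "C \<inter> B n = {}" for n using *(4)[of n] C(2) by blast
  then have "disjoint_family (case_nat C B)"
    using *(2) unfolding disjoint_family_on_def by (auto simp: Int_commute split: nat.splits)
  ultimately show ?thesis using * C by (auto simp: seq_partition_def split: nat.splits)
qed

text \<open>Adjoining the complement of \<open>A\<close> turns a partition of \<open>A\<close> into
  one of \<Omega> and does not decrease the sum, so the total variation bounds all of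
  \<open>part_sums A\<close>.\<close>

lemma variation_bounded:
  assumes "A \<in> \<A>"
  obtains K where "K \<in> \<L>" "\<And>F. F \<in> part_sums A \<Longrightarrow> L0_le m F K"
proof -
  obtain K where K: "K \<in> L0_pos m" "variation_bar m \<A> \<mu> \<Omega> = L0_to_bar m K"
    using bounded_var by (auto simp: bounded_variation_def)
  have "L0_le m F K" if F: "F \<in> part_sums A" for F
  proof -
    obtain B where B: "seq_partition \<A> A B" "F = part_sum B" using F by (auto simp: part_sums_def)
    have B': "seq_partition \<A> \<Omega> (case_nat (\<Omega> - A) B)"
    proof -
      have "A \<union> (\<Omega> - A) = \<Omega>" using assms SA.sets_into_space by auto
      then show ?thesis using seq_partition_Cons[OF B(1), of "\<Omega> - A"] assms by auto
    qed
    have 1: "L0_le m (part_sum (case_nat (\<Omega> - A) B)) K"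
      by (rule sup_upper[OF part_sums_subset[of \<Omega>]])
         (use K B' in \<open>auto simp: part_sums_def variation_bar_eq\<close>)
    have "AE x in m. L0_rep (part_sum B) x \<le> L0_rep (part_sum (case_nat (\<Omega> - A) B)) x"
      using part_sum_AE(2)[OF B(1)] part_sum_AE(2)[OF B']
    proof eventually_elim
      case (elim x)
      \<comment> \<open>The complement is the term of index 0; removing it leaves the series over
        \<open>B\<close>.\<close>
      have "(\<lambda>n. \<bar>L0_rep (\<mu> (case_nat (\<Omega> - A) B (Suc n))) x\<bar>) sums
        (L0_rep (part_sum (case_nat (\<Omega> - A) B)) x - \<bar>L0_rep (\<mu> (case_nat (\<Omega> - A) B 0)) x\<bar>)"
        using elim(2) by (subst sums_Suc_iff) simp
      then have "L0_rep (part_sum B) x = L0_rep (part_sum (case_nat (\<Omega> - A) B)) x - \<bar>L0_rep (\<mu> (\<Omega> - A)) x\<bar>"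
        using sums_unique2[OF elim(1)] by simp
      then show ?case by simp
    qed
    then have "L0_le m (part_sum B) (part_sum (case_nat (\<Omega> - A) B))"
      using part_sum_AE(1)[OF B(1)] part_sum_AE(1)[OF B'] by (subst L0_le_iff) auto
    from L0_le_trans[OF this 1] show ?thesis
      using B K part_sum_AE(1)[OF B(1)] part_sum_AE(1)[OF B'] by auto
  qed
  then show thesis using that K by blast
qed

text \<open>The bound on the part sums makes the supremum finite, so |\<mu>|(A) is a least upper
  bound inside \<open>L0\<close>; this characterisation replaces the definition from here
  on.\<close>

lemma V_sup:
  assumes A: "A \<in> \<A>"
  shows V_closed: "V A \<in> \<L>"
    and V_upper: "seq_partition \<A> A B \<Longrightarrow> L0_le m (part_sum B) (V A)"
    and V_least: "G \<in> \<L> \<Longrightarrow> (\<And>B. seq_partition \<A> A B \<Longrightarrow> L0_le m (part_sum B) G) \<Longrightarrow> L0_le m (V A) G"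
proof -
  obtain K where K: "K \<in> \<L>" "\<And>F. F \<in> part_sums A \<Longrightarrow> L0_le m F K"
    using variation_bounded[OF A] by blast
  have ne: "part_sums A \<noteq> {}" using seq_partition_trivial[OF A] by (auto simp: part_sums_def)
  note s = L0_sup[OF part_sums_subset ne K, folded variation_bar_eq, folded variation_def]
  show "V A \<in> \<L>" by (rule s(1))
  show "seq_partition \<A> A B \<Longrightarrow> L0_le m (part_sum B) (V A)" by (rule s(2)) (auto simp: part_sums_def)
  show "G \<in> \<L> \<Longrightarrow> (\<And>B. seq_partition \<A> A B \<Longrightarrow> L0_le m (part_sum B) G) \<Longrightarrow> L0_le m (V A) G"
    by (rule s(3)) (auto simp: part_sums_def)
qed

lemma V_upper_AE:
  assumes "seq_partition \<A> A B"
  shows "AE x in m. L0_rep (part_sum B) x \<le> L0_rep (V A) x"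
  using V_upper[OF seq_partitionD(5)[OF assms] assms] part_sum_AE(1)[OF assms] V_closed[OF seq_partitionD(5)[OF assms]]
  by (simp add: L0_le_iff)

lemma V_pos [simp, intro]:
  assumes A: "A \<in> \<A>" shows "V A \<in> L0_pos m"
proof -
  note B = seq_partition_trivial[OF A]
  have "AE x in m. 0 \<le> L0_rep (V A) x"
    using AE_rep_pos[OF part_sum_AE(1)[OF B]] V_upper_AE[OF B] by eventually_elim auto
  then show ?thesis using V_closed[OF A] by (rule L0_posI[rotated])
qed

text \<open>Even indices carry \<open>B\<close> and odd ones \<open>C\<close>, the arrangement in
  which \<open>sums_if\<close> adds two series.\<close>

lemma interleave_partition:
  assumes B: "seq_partition \<A> A B" and C: "seq_partition \<A> A' C" and d: "A \<inter> A' = {}"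
  shows "seq_partition \<A> (A \<union> A') (\<lambda>n. if even n then B (n div 2) else C ((n - 1) div 2))"
proof -
  note * = seq_partitionD[OF B] seq_partitionD[OF C]
  let ?D = "\<lambda>n. if even n then B (n div 2) else C ((n - 1) div 2)"
  have "disjoint_family ?D"
    unfolding disjoint_family_on_def
  proof (intro ballI impI)
    fix i j :: nat assume ij: "i \<noteq> j"
    show "?D i \<inter> ?D j = {}"
    proof (cases "even i = even j")
      case False
      then show ?thesis using *(4,9) d by (cases "even i"; cases "even j"; simp; blast)
    next
      case True
      then show ?thesis
        using ij *(2,7) by (cases "even i"; auto simp: disjoint_family_on_def elim!: evenE oddE; blast)
    qed
  qed
  moreover have "(\<Union>n. ?D n) = A \<union> A'"
  proof (intro equalityI subsetI)
    fix \<omega> assume "\<omega> \<in> A \<union> A'"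
    then consider n where "\<omega> \<in> B n" | n where "\<omega> \<in> C n" using *(3,8) by auto
    then show "\<omega> \<in> (\<Union>n. ?D n)"
    proof cases
      case 1 then show ?thesis by (intro UN_I[of "2*n"]) auto
    next
      case 2 then show ?thesis by (intro UN_I[of "2*n+1"]) auto
    qed
  qed (use *(4,9) in \<open>auto split: if_splits\<close>)
  ultimately show ?thesis using * by (auto simp: seq_partition_def)
qed

text \<open>
  The two suprema are taken one after the other, with the other summand moved to the right-hand side, so
  that the part sums need not be shown to be upwards directed.
\<close>

lemma V_superadditive:
  assumes A: "A \<in> \<A>" "A' \<in> \<A>" "A \<inter> A' = {}"
  shows "AE x in m. L0_rep (V A) x + L0_rep (V A') x \<le> L0_rep (V (A \<union> A')) x"
proof -
  have U: "A \<union> A' \<in> \<A>" using A by auto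
  note c = V_closed[OF A(1)] V_closed[OF A(2)] V_closed[OF U]
  have 1: "AE x in m. L0_rep (part_sum B) x + L0_rep (part_sum C) x \<le> L0_rep (V (A \<union> A')) x"
    if B: "seq_partition \<A> A B" and C: "seq_partition \<A> A' C" for B C
  proof -
    let ?D = "\<lambda>n. if even n then B (n div 2) else C ((n - 1) div 2)"
    note D = interleave_partition[OF B C A(3)]
    show ?thesis
      using part_sum_AE(2)[OF B] part_sum_AE(2)[OF C] part_sum_AE(2)[OF D] V_upper_AE[OF D]
    proof eventually_elim
      case (elim x)
      have "(\<lambda>n. if even n then \<bar>L0_rep (\<mu> (B (n div 2))) x\<bar> else \<bar>L0_rep (\<mu> (C ((n-1) div 2))) x\<bar>)
          sums (L0_rep (part_sum C) x + L0_rep (part_sum B) x)"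
        by (rule sums_if[OF elim(2) elim(1)])
      also have "(\<lambda>n. if even n then \<bar>L0_rep (\<mu> (B (n div 2))) x\<bar> else \<bar>L0_rep (\<mu> (C ((n-1) div 2))) x\<bar>) = (\<lambda>n. \<bar>L0_rep (\<mu> (?D n)) x\<bar>)"
        by auto
      finally show ?case using sums_unique2[OF elim(3)] elim(4) by force
    qed
  qed
  have 2: "L0_le m (V A) (V (A \<union> A') \<ominus>\<^sub>0 part_sum C)" if C: "seq_partition \<A> A' C" for C
  proof (rule V_least[OF A(1)])
    have pc: "part_sum C \<in> \<L>" using part_sum_AE(1)[OF C] by auto
    show "V (A \<union> A') \<ominus>\<^sub>0 part_sum C \<in> \<L>" using c pc by auto
    fix B assume B: "seq_partition \<A> A B"
    have "AE x in m. L0_rep (part_sum B) x \<le> L0_rep (V (A \<union> A') \<ominus>\<^sub>0 part_sum C) x"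
      using 1[OF B C] AE_rep_diff[OF c(3) pc] by eventually_elim auto
    then show "L0_le m (part_sum B) (V (A \<union> A') \<ominus>\<^sub>0 part_sum C)"
      using part_sum_AE(1)[OF B] c pc by (subst L0_le_iff) auto
  qed
  have "L0_le m (V A') (V (A \<union> A') \<ominus>\<^sub>0 V A)"
  proof (rule V_least[OF A(2)])
    show "V (A \<union> A') \<ominus>\<^sub>0 V A \<in> \<L>" using c by auto
    fix C assume C: "seq_partition \<A> A' C"
    have pc: "part_sum C \<in> \<L>" using part_sum_AE(1)[OF C] by auto
    have "AE x in m. L0_rep (V A) x \<le> L0_rep (V (A \<union> A') \<ominus>\<^sub>0 part_sum C) x"
      using 2[OF C] c pc by (subst (asm) L0_le_iff) auto
    then have "AE x in m. L0_rep (part_sum C) x \<le> L0_rep (V (A \<union> A') \<ominus>\<^sub>0 V A) x"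
      using AE_rep_diff[OF c(3) pc] AE_rep_diff[OF c(3) c(1)] by eventually_elim auto
    then show "L0_le m (part_sum C) (V (A \<union> A') \<ominus>\<^sub>0 V A)"
      using c pc by (subst L0_le_iff) auto
  qed
  then have "AE x in m. L0_rep (V A') x \<le> L0_rep (V (A \<union> A') \<ominus>\<^sub>0 V A) x"
    using c by (subst (asm) L0_le_iff) auto
  then show ?thesis using AE_rep_diff[OF c(3) c(1)] by eventually_elim auto
qed

lemma V_mono:
  assumes A: "A \<in> \<A>" "A' \<in> \<A>" "A \<subseteq> A'"
  shows "AE x in m. L0_rep (V A) x \<le> L0_rep (V A') x"
proof -
  have "A \<union> (A' - A) = A'" using A by auto
  then have "AE x in m. L0_rep (V A) x + L0_rep (V (A' - A)) x \<le> L0_rep (V A') x"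
    using V_superadditive[of A "A' - A"] A by auto
  moreover have "AE x in m. 0 \<le> L0_rep (V (A' - A)) x" using A by (intro AE_rep_pos) auto
  ultimately show ?thesis by eventually_elim auto
qed

text \<open>Finite superadditivity and monotonicity bound the partial sums by |\<mu>|(A). For the
  reverse bound an arbitrary partition \<open>P\<close> of \<open>A\<close> is cut by
  \<open>B\<close>: |\<mu>(P k)| is at most the sum of |\<mu>(P k \<inter> B n)| over n, and after
  exchanging the order of summation each sum over k is at most |\<mu>|(B n).\<close>

lemma V_sums:
  assumes B: "seq_partition \<A> A B"
  shows "AE x in m. (\<lambda>n. L0_rep (V (B n)) x) sums L0_rep (V A) x"
proof -
  note b = seq_partitionD[OF B]
  have pos: "AE x in m. \<forall>n. 0 \<le> L0_rep (V (B n)) x"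
    using AE_rep_pos[OF V_pos[OF b(1)]] by (subst AE_all_countable) auto
  have fin: "AE x in m. (\<Sum>i<n. L0_rep (V (B i)) x) \<le> L0_rep (V (\<Union>i<n. B i)) x" for n
  proof (induction n)
    case 0
    show ?case using AE_rep_pos[OF V_pos[OF SA.empty_sets]] by simp
  next
    case (Suc n)
    have "B i \<inter> B n = {}" if "i < n" for i
      by (rule disjoint_family_onD[OF b(2)]) (use that in auto)
    then have "(\<Union>i<n. B i) \<inter> B n = {}" by auto
    moreover have "(\<Union>i<n. B i) \<union> B n = (\<Union>i<Suc n. B i)" by (auto simp: less_Suc_eq)
    ultimately have "AE x in m. L0_rep (V (\<Union>i<n. B i)) x + L0_rep (V (B n)) x \<le> L0_rep (V (\<Union>i<Suc n. B i)) x"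
      using V_superadditive[of "\<Union>i<n. B i" "B n"] b(1) SA.finite_UN[of "{..<n}" B] by simp
    then show ?case using Suc.IH by eventually_elim auto
  qed
  have "AE x in m. (\<Sum>i<n. L0_rep (V (B i)) x) \<le> L0_rep (V A) x" for n
  proof -
    have "AE x in m. L0_rep (V (\<Union>i<n. B i)) x \<le> L0_rep (V A) x"
      by (rule V_mono) (use b in auto)
    then show ?thesis using fin[of n] by eventually_elim auto
  qed
  then have "AE x in m. \<forall>n. (\<Sum>i<n. L0_rep (V (B i)) x) \<le> L0_rep (V A) x"
    by (subst AE_all_countable) auto
  then have le: "AE x in m. summable (\<lambda>n. L0_rep (V (B n)) x) \<and> suminf (\<lambda>n. L0_rep (V (B n)) x) \<le> L0_rep (V A) x"
    using pos
  proof eventually_elim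
    case (elim x)
    have "summable (\<lambda>n. L0_rep (V (B n)) x)"
      by (rule summableI_nonneg_bounded[where x="L0_rep (V A) x"]) (use elim in auto)
    then show ?case using elim by (auto intro!: suminf_le_const)
  qed
  have sm: "AE x in m. summable (\<lambda>n. L0_rep (V (B n)) x)" using le by eventually_elim auto
  let ?S = "L0_suminf m (\<lambda>n. V (B n))"
  have Bc: "V (B n) \<in> \<L>" for n using V_closed[OF b(1)] .
  note S = L0_sums_AE[OF Bc sm]
  have Sc: "?S \<in> \<L>" by (rule L0_suminf_closed[OF S(1)])
  have "L0_le m (V A) ?S"
  proof (rule V_least[OF b(5) Sc])
    fix P assume P: "seq_partition \<A> A P"
    note p = seq_partitionD[OF P]
    have row: "seq_partition \<A> (P k) (\<lambda>n. P k \<inter> B n)" for k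
      by (rule seq_partition_Int[OF B p(1,4)])
    have col: "seq_partition \<A> (B n) (\<lambda>k. P k \<inter> B n)" for n
      using seq_partition_Int[OF P b(1,4), of n] by (simp add: Int_commute)
    have r: "AE x in m. \<forall>k. summable (\<lambda>n. \<bar>L0_rep (\<mu> (P k \<inter> B n)) x\<bar>) \<and> \<bar>L0_rep (\<mu> (P k)) x\<bar> \<le> suminf (\<lambda>n. \<bar>L0_rep (\<mu> (P k \<inter> B n)) x\<bar>)"
    proof (subst AE_all_countable, intro allI)
      fix k
      show "AE x in m. summable (\<lambda>n. \<bar>L0_rep (\<mu> (P k \<inter> B n)) x\<bar>) \<and> \<bar>L0_rep (\<mu> (P k)) x\<bar> \<le> suminf (\<lambda>n. \<bar>L0_rep (\<mu> (P k \<inter> B n)) x\<bar>)"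
        using part_sum_AE(2)[OF row[of k]] part_sum_AE(3)[OF row[of k]]
        by eventually_elim (metis summable_rabs sums_iff)
    qed
    have c: "AE x in m. \<forall>n. (\<lambda>k. \<bar>L0_rep (\<mu> (P k \<inter> B n)) x\<bar>) sums L0_rep (part_sum (\<lambda>k. P k \<inter> B n)) x \<and>
        L0_rep (part_sum (\<lambda>k. P k \<inter> B n)) x \<le> L0_rep (V (B n)) x"
      using part_sum_AE(2)[OF col] V_upper_AE[OF col] by (subst AE_all_countable) auto
    have "AE x in m. L0_rep (part_sum P) x \<le> L0_rep ?S x"
      using r c sm part_sum_AE(2)[OF P] S(2)
    proof eventually_elim
      case (elim x)
      let ?a = "\<lambda>n k. \<bar>L0_rep (\<mu> (P k \<inter> B n)) x\<bar>" and ?c = "\<lambda>n. L0_rep (part_sum (\<lambda>k. P k \<inter> B n)) x"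
      have c0: "0 \<le> ?c n" for n
        by (rule sums_nonneg[OF conjunct1[OF spec[OF elim(2)]]]) simp
      have cs: "summable ?c"
        by (rule summable_comparison_test'[OF elim(3), of 0]) (use elim(2) c0 in auto)
      \<comment> \<open>Indexing \<open>?a\<close> by the cells of \<open>B\<close> before those of
        \<open>P\<close> makes \<open>?c\<close> the row sums; the column sums then form the series
        over \<open>P\<close>.\<close>
      have D: "(\<lambda>k. suminf (\<lambda>n. ?a n k)) sums suminf ?c"
        by (rule double_sums_nonneg(3)[OF _ _ summable_sums[OF cs]]) (use elim(2) in auto)
      have "L0_rep (part_sum P) x \<le> suminf ?c"
        by (rule sums_le[OF _ elim(4) D]) (use elim(1) in auto)
      also have "\<dots> \<le> suminf (\<lambda>n. L0_rep (V (B n)) x)"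
        by (rule suminf_le[OF _ cs elim(3)]) (use elim(2) in auto)
      finally show ?case using elim(5) by simp
    qed
    then show "L0_le m (part_sum P) ?S" using part_sum_AE(1)[OF P] Sc by (subst L0_le_iff) auto
  qed
  then have "AE x in m. L0_rep (V A) x \<le> L0_rep ?S x" using V_closed[OF b(5)] Sc by (simp add: L0_le_iff)
  then show ?thesis using le S(2)
    by eventually_elim (auto simp: sums_iff)
qed

text \<open>The empty set is the disjoint union of infinitely many copies of itself, which gives a
  convergent constant series; its term must be 0.\<close>

lemma V_empty [simp]: "V {} = \<zero>\<^sub>0"
proof -
  have "seq_partition \<A> {} (\<lambda>_. {})" by (auto simp: seq_partition_def disjoint_family_on_def)
  from V_sums[OF this] have "AE x in m. L0_rep (V {}) x = L0_rep \<zero>\<^sub>0 x"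
    using AE_rep_zero
  proof eventually_elim
    case (elim x)
    have "summable (\<lambda>n::nat. L0_rep (V {}) x)" using elim(1) by (simp add: sums_iff)
    then show ?case using elim(2) summable_LIMSEQ_zero[of "\<lambda>n. L0_rep (V {}) x"] by (simp add: LIMSEQ_const_iff)
  qed
  then show ?thesis using V_closed[of "{}"] by (subst L0_eq_iff) auto
qed

lemma V_add:
  assumes A: "A \<in> \<A>" "A' \<in> \<A>" "A \<inter> A' = {}"
  shows "AE x in m. L0_rep (V (A \<union> A')) x = L0_rep (V A) x + L0_rep (V A') x"
proof -
  let ?B = "case_nat A' (\<lambda>n. if n = 0 then A else {}) :: nat \<Rightarrow> 'b set"
  have "seq_partition \<A> (A \<union> A') ?B"
    by (rule seq_partition_Cons[OF seq_partition_trivial[OF A(1)] A(2,3)])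
  from V_sums[OF this] AE_rep_zero show ?thesis
  proof eventually_elim
    case (elim x)
    \<comment> \<open>Beyond the indices 0 and 1 all cells are empty and contribute 0.\<close>
    have "(\<lambda>n. L0_rep (V (?B n)) x) sums (\<Sum>n\<in>{0, 1}. L0_rep (V (?B n)) x)"
      by (rule sums_finite) (use elim(2) in \<open>auto split: nat.splits\<close>)
    from sums_unique2[OF elim(1) this] show ?case by simp
  qed
qed

end

section \<open>Simple functions\<close>

context L0_vector_measure
begin

lemma L0_le_zero_eq:
  assumes "F \<in> L0_pos m" "L0_le m F \<zero>\<^sub>0"
  shows "F = \<zero>\<^sub>0"
  using assms L0_pos_le by (intro L0_le_antisym) auto

lemma V_null_subset:
  assumes "A \<in> \<A>" "N \<in> \<A>" "A \<subseteq> N" "V N = \<zero>\<^sub>0"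
  shows "V A = \<zero>\<^sub>0"
proof (rule L0_le_zero_eq)
  show "L0_le m (V A) \<zero>\<^sub>0"
    using V_mono[OF assms(1-3)] assms by (simp add: L0_le_iff V_closed)
qed (use assms in auto)

lemma V_null_Un:
  assumes "N \<in> \<A>" "N' \<in> \<A>" "V N = \<zero>\<^sub>0" "V N' = \<zero>\<^sub>0"
  shows "V (N \<union> N') = \<zero>\<^sub>0"
proof (rule L0_le_zero_eq)
  have D: "V (N' - N) = \<zero>\<^sub>0" by (rule V_null_subset[of _ N']) (use assms in auto)
  have "AE x in m. L0_rep (V (N \<union> (N' - N))) x = L0_rep (V N) x + L0_rep (V (N' - N)) x"
    by (rule V_add) (use assms in auto)
  then have "AE x in m. L0_rep (V (N \<union> N')) x \<le> L0_rep \<zero>\<^sub>0 x"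
    using AE_rep_zero unfolding D assms(3) by eventually_elim simp
  then show "L0_le m (V (N \<union> N')) \<zero>\<^sub>0" using assms by (subst L0_le_iff) (auto intro: V_closed)
qed (use assms in auto)

text \<open>Enumerating the pairs of cells by \<open>prod_decode\<close> keeps the common refinement
  indexed by the natural numbers.\<close>

lemma seq_partition_refine:
  assumes C: "seq_partition \<A> \<Omega> C" and D: "seq_partition \<A> \<Omega> D"
  shows "seq_partition \<A> \<Omega> (\<lambda>k. C (fst (prod_decode k)) \<inter> D (snd (prod_decode k)))"
proof -
  note c = seq_partitionD[OF C] and d = seq_partitionD[OF D]
  let ?E = "\<lambda>k. C (fst (prod_decode k)) \<inter> D (snd (prod_decode k))"
  have "disjoint_family ?E"
    unfolding disjoint_family_on_def
  proof (intro ballI impI)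
    fix k l :: nat assume "k \<noteq> l"
    then have "prod_decode k \<noteq> prod_decode l" by (metis prod_decode_inverse)
    then have "fst (prod_decode k) \<noteq> fst (prod_decode l) \<or> snd (prod_decode k) \<noteq> snd (prod_decode l)"
      by (auto simp: prod_eq_iff)
    then show "?E k \<inter> ?E l = {}"
      using disjoint_family_onD[OF c(2), of "fst (prod_decode k)" "fst (prod_decode l)"]
        disjoint_family_onD[OF d(2), of "snd (prod_decode k)" "snd (prod_decode l)"] by auto
  qed
  moreover have "(\<Union>k. ?E k) = \<Omega>"
  proof (intro equalityI subsetI)
    fix \<omega> assume w: "\<omega> \<in> \<Omega>"
    obtain i where i: "\<omega> \<in> C i" using w c(3) by blast
    obtain j where j: "\<omega> \<in> D j" using w d(3) by blast
    show "\<omega> \<in> (\<Union>k. ?E k)" using i j by (intro UN_I[of "prod_encode (i, j)"]) auto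
  qed (use c(4) in blast)
  ultimately show ?thesis using c(1) d(1) by (auto simp: seq_partition_def)
qed

end

section \<open>Norms of simple maps\<close>

locale L0_bochner = L0_vector_measure m \<Omega> \<A> \<mu> + M: seminormed_L0_module m M
  for m :: "'a measure" and \<Omega> :: "'b set" and \<A> \<mu> and M :: "('a l0, 'c) rnm" (structure)
begin

abbreviation "S1f \<equiv> S1_funs m \<Omega> \<A> \<mu> M"
abbreviation "srep \<equiv> simple_rep m \<Omega> \<A> \<mu> M"
abbreviation "cl \<equiv> S1_class m \<Omega> \<A> \<mu> M"
abbreviation "SM \<equiv> S1 m \<Omega> \<A> \<mu> M"

definition rep_norm :: "(nat \<Rightarrow> 'b set) \<Rightarrow> (nat \<Rightarrow> 'c) \<Rightarrow> 'a l0" where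
  "rep_norm C c = L0_suminf m (\<lambda>n. V (C n) \<otimes>\<^sub>0 \<parallel>c n\<parallel>)"

lemma AE_rep_term:
  fixes C :: "nat \<Rightarrow> 'b set"
  assumes "\<And>n. C n \<in> \<A>" "\<And>n. c n \<in> carrier M"
  shows "AE x in m. \<forall>n. L0_rep (V (C n) \<otimes>\<^sub>0 \<parallel>c n\<parallel>) x = L0_rep (V (C n)) x * L0_rep \<parallel>c n\<parallel> x"
  using assms by (subst AE_all_countable) (auto intro!: AE_rep_mult V_closed)

lemma AE_term_nonneg:
  fixes C :: "nat \<Rightarrow> 'b set"
  assumes "\<And>n. C n \<in> \<A>" "\<And>n. c n \<in> carrier M"
  shows "AE x in m. \<forall>n. 0 \<le> L0_rep (V (C n)) x \<and> 0 \<le> L0_rep \<parallel>c n\<parallel> x"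
  using assms AE_rep_pos[OF V_pos] AE_rep_pos[OF M.norm_in_pos] by (subst AE_all_countable) auto

text \<open>Replaces order summability of classes by summability of products of representatives at
  almost every point, the form in which the series are manipulated below.\<close>

lemma srep_iff:
  "srep C c v \<longleftrightarrow> seq_partition \<A> \<Omega> C \<and> (\<forall>n. c n \<in> carrier M) \<and> (\<forall>n. \<forall>\<omega>\<in>C n. v \<omega> = c n) \<and>
    (AE x in m. summable (\<lambda>n. L0_rep (V (C n)) x * L0_rep \<parallel>c n\<parallel> x))"
proof (cases "seq_partition \<A> \<Omega> C \<and> (\<forall>n. c n \<in> carrier M)")
  case True
  then have C: "C n \<in> \<A>" "c n \<in> carrier M" for n using seq_partitionD by auto
  have "L0_summable m (\<lambda>n. V (C n) \<otimes>\<^sub>0 \<parallel>c n\<parallel>) \<longleftrightarrow>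
      (AE x in m. summable (\<lambda>n. L0_rep (V (C n) \<otimes>\<^sub>0 \<parallel>c n\<parallel>) x))"
    using C by (auto simp: L0_summable_iff)
  also have "\<dots> \<longleftrightarrow> (AE x in m. summable (\<lambda>n. L0_rep (V (C n)) x * L0_rep \<parallel>c n\<parallel> x))"
    using AE_rep_term[of C c, OF C] by (intro eventually_subst) (auto elim!: eventually_mono)
  finally show ?thesis using True by (auto simp: simple_rep_def)
qed (auto simp: simple_rep_def)

lemma srepD:
  assumes "srep C c v"
  shows "seq_partition \<A> \<Omega> C" "C n \<in> \<A>" "c n \<in> carrier M" "\<omega> \<in> C n \<Longrightarrow> v \<omega> = c n"
    "AE x in m. summable (\<lambda>n. L0_rep (V (C n)) x * L0_rep \<parallel>c n\<parallel> x)"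
  using assms seq_partitionD by (auto simp: srep_iff)

lemma rep_norm:
  assumes "srep C c v"
  shows "rep_norm C c \<in> L0_pos m"
    "AE x in m. (\<lambda>n. L0_rep (V (C n)) x * L0_rep \<parallel>c n\<parallel> x) sums L0_rep (rep_norm C c) x"
proof -
  have s: "L0_summable m (\<lambda>n. V (C n) \<otimes>\<^sub>0 \<parallel>c n\<parallel>)" using assms by (simp add: simple_rep_def)
  show "rep_norm C c \<in> L0_pos m" unfolding rep_norm_def by (rule L0_summable_suminf(1)[OF s])
  show "AE x in m. (\<lambda>n. L0_rep (V (C n)) x * L0_rep \<parallel>c n\<parallel> x) sums L0_rep (rep_norm C c) x"
    using L0_summable_suminf(2)[OF s] AE_rep_term[of C c, OF srepD(2,3)[OF assms]]
    unfolding rep_norm_def by eventually_elim simp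
qed

lemma rep_norm_eqI:
  assumes "srep C c v" "F \<in> \<L>"
    "AE x in m. (\<lambda>n. L0_rep (V (C n)) x * L0_rep \<parallel>c n\<parallel> x) sums L0_rep F x"
  shows "rep_norm C c = F"
proof -
  have "AE x in m. L0_rep (rep_norm C c) x = L0_rep F x"
    using rep_norm(2)[OF assms(1)] assms(3) by eventually_elim (rule sums_unique2)
  then show ?thesis using rep_norm(1)[OF assms(1)] assms(2) by (subst L0_eq_iff) auto
qed

text \<open>Countable additivity of |\<mu>| on each cell, together with Tonelli, keeps the norm
  unchanged. The refinement is enumerated in both orders so that refining \<open>C\<close> by
  \<open>D\<close> and \<open>D\<close> by \<open>C\<close> can produce literally the same sequence
  of sets, as \<open>common_srep\<close> requires.\<close>

lemma srep_refine:
  assumes r: "srep C c v" and D: "seq_partition \<A> \<Omega> D"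
  defines "E \<equiv> \<lambda>k. C (fst (prod_decode k)) \<inter> D (snd (prod_decode k))" and "c' \<equiv> \<lambda>k. c (fst (prod_decode k))"
    and "E' \<equiv> \<lambda>k. D (fst (prod_decode k)) \<inter> C (snd (prod_decode k))" and "c'' \<equiv> \<lambda>k. c (snd (prod_decode k))"
  shows "srep E c' v" "rep_norm E c' = rep_norm C c" "srep E' c'' v" "rep_norm E' c'' = rep_norm C c"
proof -
  note C = srepD[OF r]
  have "AE x in m. \<forall>i. (\<lambda>j. L0_rep (V (C i \<inter> D j)) x) sums L0_rep (V (C i)) x"
    using V_sums[OF seq_partition_Int[OF D]] C(2) seq_partitionD(4)[OF C(1)] by (subst AE_all_countable) auto
  moreover have "AE x in m. \<forall>i j. 0 \<le> L0_rep (V (C i \<inter> D j)) x"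
    using C(2) seq_partitionD(1)[OF D] by (auto simp: AE_all_countable intro!: AE_rep_pos)
  ultimately have *: "AE x in m. (\<lambda>k. L0_rep (V (E k)) x * L0_rep \<parallel>c' k\<parallel> x) sums L0_rep (rep_norm C c) x \<and>
      (\<lambda>k. L0_rep (V (E' k)) x * L0_rep \<parallel>c'' k\<parallel> x) sums L0_rep (rep_norm C c) x"
    using rep_norm(2)[OF r] AE_term_nonneg[of C c, OF C(2,3)]
  proof eventually_elim
    case (elim x)
    let ?a = "\<lambda>i j. L0_rep (V (C i \<inter> D j)) x * L0_rep \<parallel>c i\<parallel> x"
    have nn: "0 \<le> ?a i j" for i j using elim by simp
    have rows: "(\<lambda>j. ?a i j) sums (L0_rep (V (C i)) x * L0_rep \<parallel>c i\<parallel> x)" for i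
      using elim(1) by (intro sums_mult2) auto
    show ?case
      using double_sums_nonneg(1,4)[of ?a, OF nn rows elim(3)] by (simp add: E_def c'_def E'_def c''_def Int_commute)
  qed
  have E: "seq_partition \<A> \<Omega> E" "seq_partition \<A> \<Omega> E'" unfolding E_def E'_def
    by (rule seq_partition_refine[OF C(1) D], rule seq_partition_refine[OF D C(1)])
  have h1: "AE x in m. (\<lambda>k. L0_rep (V (E k)) x * L0_rep \<parallel>c' k\<parallel> x) sums L0_rep (rep_norm C c) x"
    and h2: "AE x in m. (\<lambda>k. L0_rep (V (E' k)) x * L0_rep \<parallel>c'' k\<parallel> x) sums L0_rep (rep_norm C c) x"
    using * by (auto elim!: eventually_mono)
  have "AE x in m. summable (\<lambda>k. L0_rep (V (E k)) x * L0_rep \<parallel>c' k\<parallel> x)"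
    "AE x in m. summable (\<lambda>k. L0_rep (V (E' k)) x * L0_rep \<parallel>c'' k\<parallel> x)"
    by (rule eventually_mono[OF h1], erule sums_summable) (rule eventually_mono[OF h2], erule sums_summable)
  moreover have "c' k \<in> carrier M" "c'' k \<in> carrier M" "\<forall>\<omega>\<in>E k. v \<omega> = c' k" "\<forall>\<omega>\<in>E' k. v \<omega> = c'' k" for k
    using C(3,4) by (auto simp: E_def c'_def E'_def c''_def)
  ultimately show 1: "srep E c' v" and 2: "srep E' c'' v"
    unfolding srep_iff using E by auto
  show "rep_norm E c' = rep_norm C c" "rep_norm E' c'' = rep_norm C c"
    using rep_norm_eqI[OF 1 _ h1] rep_norm_eqI[OF 2 _ h2] rep_norm(1)[OF r] by auto
qed

lemma common_srep:
  assumes v: "srep C c v" and w: "srep D d w"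
  obtains E c' d' where "srep E c' v" "srep E d' w" "rep_norm E c' = rep_norm C c" "rep_norm E d' = rep_norm D d"
  using srep_refine(1,2)[OF v srepD(1)[OF w]] srep_refine(3,4)[OF w srepD(1)[OF v]] by blast

text \<open>On a common partition a cell either lies in \<open>N\<close>, and then has variation 0,
  or contains a point outside \<open>N\<close>, where the two maps agree, and then the two values
  coincide.\<close>

lemma rep_norm_unique:
  assumes v: "srep C c v" and w: "srep D d w" and N: "N \<in> \<A>" "V N = \<zero>\<^sub>0" "\<And>\<omega>. \<omega> \<in> \<Omega> - N \<Longrightarrow> v \<omega> = w \<omega>"
  shows "rep_norm C c = rep_norm D d"
proof -
  obtain E c' d' where E: "srep E c' v" "srep E d' w" "rep_norm E c' = rep_norm C c" "rep_norm E d' = rep_norm D d"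
    using common_srep[OF v w] by blast
  have "V (E n) \<otimes>\<^sub>0 \<parallel>c' n\<parallel> = V (E n) \<otimes>\<^sub>0 \<parallel>d' n\<parallel>" for n
  proof (cases "E n \<subseteq> N")
    case True
    then have "V (E n) = \<zero>\<^sub>0" using V_null_subset[of "E n" N] srepD(2)[OF E(1)] N by auto
    then show ?thesis using srepD(3)[OF E(1)] srepD(3)[OF E(2)] by simp
  next
    case False
    then obtain \<omega> where w: "\<omega> \<in> E n" "\<omega> \<notin> N" by auto
    then have "\<omega> \<in> \<Omega>" using seq_partitionD(4)[OF srepD(1)[OF E(1)]] by blast
    then show ?thesis using N(3)[of \<omega>] w srepD(4)[OF E(1) w(1)] srepD(4)[OF E(2) w(1)] by auto
  qed
  then show ?thesis using E(3,4) by (simp add: rep_norm_def)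
qed

lemma S1f_iff: "v \<in> S1f \<longleftrightarrow> (\<exists>C c. srep C c v)"
  by (simp add: S1_funs_def)

lemma S1f_closed:
  assumes "v \<in> S1f" "\<omega> \<in> \<Omega>" shows "v \<omega> \<in> carrier M"
proof -
  obtain C c where r: "srep C c v" using assms by (auto simp: S1f_iff)
  obtain n where "\<omega> \<in> C n" using assms(2) seq_partitionD(3)[OF srepD(1)[OF r]] by blast
  then show ?thesis using srepD(3,4)[OF r] by metis
qed

lemma srep_cong:
  assumes r: "srep C c v" and e: "\<And>\<omega>. \<omega> \<in> \<Omega> \<Longrightarrow> w \<omega> = v \<omega>"
  shows "srep C c w"
proof -
  have "C n \<subseteq> \<Omega>" for n using seq_partitionD(4)[OF srepD(1)[OF r]] .
  then show ?thesis using r e unfolding srep_iff by (metis subsetD)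
qed

lemma S1f_cong: "v \<in> S1f \<Longrightarrow> (\<And>\<omega>. \<omega> \<in> \<Omega> \<Longrightarrow> w \<omega> = v \<omega>) \<Longrightarrow> w \<in> S1f"
  using srep_cong by (auto simp: S1f_iff) blast

lemma equiv_S1_rel: "equiv S1f (S1_rel m \<Omega> \<A> \<mu> M)"
proof (rule equivI)
  show "refl_on S1f (S1_rel m \<Omega> \<A> \<mu> M)"
    by (auto simp: refl_on_def S1_rel_def intro!: bexI[of _ "{}"])
  show "sym (S1_rel m \<Omega> \<A> \<mu> M)" unfolding sym_def S1_rel_def by fastforce
  show "trans (S1_rel m \<Omega> \<A> \<mu> M)"
  proof (rule transI)
    fix u v w assume "(u, v) \<in> S1_rel m \<Omega> \<A> \<mu> M" "(v, w) \<in> S1_rel m \<Omega> \<A> \<mu> M"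
    then obtain N N' where "u \<in> S1f" "v \<in> S1f" "w \<in> S1f" "N \<in> \<A>" "V N = \<zero>\<^sub>0" "\<forall>\<omega>\<in>\<Omega> - N. u \<omega> = v \<omega>"
      "N' \<in> \<A>" "V N' = \<zero>\<^sub>0" "\<forall>\<omega>\<in>\<Omega> - N'. v \<omega> = w \<omega>"
      by (auto simp: S1_rel_def)
    moreover from this have "\<forall>\<omega>\<in>\<Omega> - (N \<union> N'). u \<omega> = w \<omega>" by simp
    ultimately show "(u, w) \<in> S1_rel m \<Omega> \<A> \<mu> M"
      using V_null_Un[of N N'] SA.Un[of N N'] unfolding S1_rel_def by blast
  qed
qed (auto simp: S1_rel_def)

lemma mem_cl: "v \<in> S1f \<Longrightarrow> w \<in> cl v \<longleftrightarrow> w \<in> S1f \<and> (\<exists>N\<in>\<A>. V N = \<zero>\<^sub>0 \<and> (\<forall>\<omega>\<in>\<Omega> - N. v \<omega> = w \<omega>))"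
  by (auto simp: S1_class_def S1_rel_def)

lemma cl_eq_iff:
  "v \<in> S1f \<Longrightarrow> w \<in> S1f \<Longrightarrow> cl v = cl w \<longleftrightarrow> (\<exists>N\<in>\<A>. V N = \<zero>\<^sub>0 \<and> (\<forall>\<omega>\<in>\<Omega> - N. v \<omega> = w \<omega>))"
  using eq_equiv_class_iff[OF equiv_S1_rel] by (simp add: S1_class_def S1_rel_def)

lemma cl_eqI: "v \<in> S1f \<Longrightarrow> (\<And>\<omega>. \<omega> \<in> \<Omega> \<Longrightarrow> v \<omega> = w \<omega>) \<Longrightarrow> cl v = cl w"
  by (subst cl_eq_iff) (auto intro: S1f_cong[of v] intro!: bexI[of _ "{}"])

lemma cl_self: "v \<in> S1f \<Longrightarrow> v \<in> cl v"
  by (auto simp: mem_cl intro!: bexI[of _ "{}"])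

lemma cl_closed [simp, intro]: "v \<in> S1f \<Longrightarrow> cl v \<in> carrier SM"
  by (simp add: S1_def S1_class_def quotientI)

lemma SM_cases:
  assumes "X \<in> carrier SM"
  obtains v where "v \<in> S1f" "X = cl v"
  using assms by (auto simp: S1_def quotient_def S1_class_def)

text \<open>By \<open>rep_norm_unique\<close>, all representatives and all their descriptions give
  one value, so the definite description in \<open>S1\<close> is met.\<close>

lemma cl_norm:
  assumes r: "srep C c v"
  shows "\<parallel>cl v\<parallel>\<^bsub>SM\<^esub> = rep_norm C c"
proof -
  have v: "v \<in> S1f" using r by (auto simp: S1f_iff)
  have "(THE F. \<exists>w\<in>cl v. \<exists>A a. srep A a w \<and> F = L0_suminf m (\<lambda>n. V (A n) \<otimes>\<^sub>0 \<parallel>a n\<parallel>)) = rep_norm C c"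
    unfolding rep_norm_def[symmetric]
  proof (rule the_equality)
    show "\<exists>w\<in>cl v. \<exists>A a. srep A a w \<and> rep_norm C c = rep_norm A a" using r cl_self[OF v] by blast
    fix F assume "\<exists>w\<in>cl v. \<exists>A a. srep A a w \<and> F = rep_norm A a"
    then obtain w A a where w: "w \<in> cl v" "srep A a w" "F = rep_norm A a" by blast
    then show "F = rep_norm C c"
      using v rep_norm_unique[OF r w(2)] by (fastforce simp: mem_cl)
  qed
  then show ?thesis by (simp add: S1_def)
qed

text \<open>Both maps are described on one partition, which \<open>common_srep\<close> always
  provides; the triangle inequality can then be applied term by term.\<close>

lemma srep_add:
  assumes v: "srep C c v" and w: "srep C d w"
  shows "srep C (\<lambda>n. c n \<oplus> d n) (\<lambda>\<omega>. v \<omega> \<oplus> w \<omega>)"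
    and "L0_le m (rep_norm C (\<lambda>n. c n \<oplus> d n)) (rep_norm C c \<oplus>\<^sub>0 rep_norm C d)"
proof -
  note C = srepD[OF v] and D = srepD[OF w]
  have tri: "AE x in m. \<forall>n. L0_rep \<parallel>c n \<oplus> d n\<parallel> x \<le> L0_rep \<parallel>c n\<parallel> x + L0_rep \<parallel>d n\<parallel> x"
  proof (subst AE_all_countable, intro allI)
    fix n
    have "AE x in m. L0_rep \<parallel>c n \<oplus> d n\<parallel> x \<le> L0_rep (\<parallel>c n\<parallel> \<oplus>\<^sub>0 \<parallel>d n\<parallel>) x"
      using M.norm_triangle[of "c n" "d n"] C(3) D(3) by (simp add: L0_le_iff)
    then show "AE x in m. L0_rep \<parallel>c n \<oplus> d n\<parallel> x \<le> L0_rep \<parallel>c n\<parallel> x + L0_rep \<parallel>d n\<parallel> x"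
      using AE_rep_add[of "\<parallel>c n\<parallel>" "\<parallel>d n\<parallel>"] C(3) D(3) by auto
  qed
  have *: "AE x in m. \<forall>n. 0 \<le> L0_rep (V (C n)) x * L0_rep \<parallel>c n \<oplus> d n\<parallel> x \<and>
      L0_rep (V (C n)) x * L0_rep \<parallel>c n \<oplus> d n\<parallel> x \<le>
      L0_rep (V (C n)) x * L0_rep \<parallel>c n\<parallel> x + L0_rep (V (C n)) x * L0_rep \<parallel>d n\<parallel> x"
    using tri AE_term_nonneg[of C "\<lambda>n. c n \<oplus> d n", OF C(2) M.a_closed[OF C(3) D(3)]]
  proof eventually_elim
    case (elim x)
    show ?case using elim by (auto simp: distrib_left[symmetric] intro!: mult_left_mono)
  qed
  have s: "AE x in m. (\<lambda>n. L0_rep (V (C n)) x * L0_rep \<parallel>c n\<parallel> x + L0_rep (V (C n)) x * L0_rep \<parallel>d n\<parallel> x)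
      sums (L0_rep (rep_norm C c) x + L0_rep (rep_norm C d) x)"
    using rep_norm(2)[OF v] rep_norm(2)[OF w] by eventually_elim (rule sums_add)
  have "AE x in m. summable (\<lambda>n. L0_rep (V (C n)) x * L0_rep \<parallel>c n \<oplus> d n\<parallel> x)"
    using * s
  proof eventually_elim
    case (elim x)
    show ?case by (rule summable_comparison_test'[OF sums_summable[OF elim(2)], of 0]) (use elim(1) in auto)
  qed
  then show r: "srep C (\<lambda>n. c n \<oplus> d n) (\<lambda>\<omega>. v \<omega> \<oplus> w \<omega>)"
    unfolding srep_iff using C(1,3,4) D(3,4) by auto
  have "AE x in m. L0_rep (rep_norm C (\<lambda>n. c n \<oplus> d n)) x \<le> L0_rep (rep_norm C c \<oplus>\<^sub>0 rep_norm C d) x"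
    using rep_norm(2)[OF r] s * AE_rep_add[of "rep_norm C c" "rep_norm C d", OF L0_pos_closed[OF rep_norm(1)[OF v]] L0_pos_closed[OF rep_norm(1)[OF w]]]
  proof eventually_elim
    case (elim x)
    have "L0_rep (rep_norm C (\<lambda>n. c n \<oplus> d n)) x \<le> L0_rep (rep_norm C c) x + L0_rep (rep_norm C d) x"
      by (rule sums_le[OF _ elim(1,2)]) (use elim(3) in auto)
    then show ?case using elim(4) by simp
  qed
  then show "L0_le m (rep_norm C (\<lambda>n. c n \<oplus> d n)) (rep_norm C c \<oplus>\<^sub>0 rep_norm C d)"
    using rep_norm(1)[OF r] rep_norm(1)[OF v] rep_norm(1)[OF w] by (subst L0_le_iff) auto
qed

lemma srep_smult:
  assumes v: "srep C c v" and f: "f \<in> \<L>"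
  shows "srep C (\<lambda>n. f \<odot> c n) (\<lambda>\<omega>. f \<odot> v \<omega>)"
    and "rep_norm C (\<lambda>n. f \<odot> c n) = \<parallel>f\<parallel>\<^sub>0 \<otimes>\<^sub>0 rep_norm C c"
proof -
  note C = srepD[OF v]
  have "AE x in m. \<forall>n. L0_rep \<parallel>f \<odot> c n\<parallel> x = L0_rep \<parallel>f\<parallel>\<^sub>0 x * L0_rep \<parallel>c n\<parallel> x"
    using C(3) f by (subst AE_all_countable) (auto simp: M.norm_smult intro!: AE_rep_mult)
  then have *: "AE x in m. (\<lambda>n. L0_rep (V (C n)) x * L0_rep \<parallel>f \<odot> c n\<parallel> x) sums L0_rep (\<parallel>f\<parallel>\<^sub>0 \<otimes>\<^sub>0 rep_norm C c) x"
    using rep_norm(2)[OF v] AE_rep_mult[of "\<parallel>f\<parallel>\<^sub>0" "rep_norm C c", OF L0_norm_closed[OF f] L0_pos_closed[OF rep_norm(1)[OF v]]]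
  proof eventually_elim
    case (elim x)
    have "(\<lambda>n. L0_rep \<parallel>f\<parallel>\<^sub>0 x * (L0_rep (V (C n)) x * L0_rep \<parallel>c n\<parallel> x)) sums (L0_rep \<parallel>f\<parallel>\<^sub>0 x * L0_rep (rep_norm C c) x)"
      by (rule sums_mult[OF elim(2)])
    then show ?case using elim(1,3) by (simp add: mult.left_commute)
  qed
  show r: "srep C (\<lambda>n. f \<odot> c n) (\<lambda>\<omega>. f \<odot> v \<omega>)"
    unfolding srep_iff using C(1,3,4) f * by (auto elim!: eventually_mono intro: sums_summable)
  show "rep_norm C (\<lambda>n. f \<odot> c n) = \<parallel>f\<parallel>\<^sub>0 \<otimes>\<^sub>0 rep_norm C c"
    by (rule rep_norm_eqI[OF r _ *]) (use f rep_norm(1)[OF v] in auto)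
qed

lemma S1f_add [simp, intro]: "v \<in> S1f \<Longrightarrow> w \<in> S1f \<Longrightarrow> (\<lambda>\<omega>. v \<omega> \<oplus> w \<omega>) \<in> S1f"
  unfolding S1f_iff by (metis common_srep srep_add(1))

lemma S1f_smult [simp, intro]: "f \<in> \<L> \<Longrightarrow> v \<in> S1f \<Longrightarrow> (\<lambda>\<omega>. f \<odot> v \<omega>) \<in> S1f"
  unfolding S1f_iff using srep_smult(1) by blast

lemma S1f_minus [simp, intro]: "v \<in> S1f \<Longrightarrow> (\<lambda>\<omega>. \<ominus> v \<omega>) \<in> S1f"
  by (rule S1f_cong[OF S1f_smult[of "\<ominus>\<^bsub>L0 m\<^esub> \<one>\<^sub>0" v]]) (auto simp: M.smult_minus_one S1f_closed)

lemma srep_zero: "seq_partition \<A> \<Omega> C \<Longrightarrow> srep C (\<lambda>_. \<zero>) (\<lambda>_. \<zero>)"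
  unfolding srep_iff using AE_rep_zero by (auto elim!: eventually_mono)

lemma S1f_zero [simp, intro]: "(\<lambda>_. \<zero>) \<in> S1f"
  using srep_zero[OF seq_partition_trivial[OF SA.top]] by (auto simp: S1f_iff)

lemma cl_add:
  assumes v: "v \<in> S1f" and w: "w \<in> S1f"
  shows "cl v \<oplus>\<^bsub>SM\<^esub> cl w = cl (\<lambda>\<omega>. v \<omega> \<oplus> w \<omega>)"
proof -
  have "(\<Union>v'\<in>cl v. \<Union>w'\<in>cl w. cl (\<lambda>\<omega>. v' \<omega> \<oplus> w' \<omega>)) = cl (\<lambda>\<omega>. v \<omega> \<oplus> w \<omega>)"
  proof (intro UN_eq_const)
    fix v' w' assume "v' \<in> cl v" "w' \<in> cl w"
    then obtain N N' where *: "v' \<in> S1f" "w' \<in> S1f" "N \<in> \<A>" "V N = \<zero>\<^sub>0" "\<forall>\<omega>\<in>\<Omega> - N. v \<omega> = v' \<omega>"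
      "N' \<in> \<A>" "V N' = \<zero>\<^sub>0" "\<forall>\<omega>\<in>\<Omega> - N'. w \<omega> = w' \<omega>"
      using v w by (auto simp: mem_cl)
    then have "\<forall>\<omega>\<in>\<Omega> - (N \<union> N'). v' \<omega> \<oplus> w' \<omega> = v \<omega> \<oplus> w \<omega>" by simp
    then show "cl (\<lambda>\<omega>. v' \<omega> \<oplus> w' \<omega>) = cl (\<lambda>\<omega>. v \<omega> \<oplus> w \<omega>)"
      using v w * V_null_Un[of N N'] SA.Un[of N N'] by (subst cl_eq_iff) blast+
  qed (use cl_self v w in auto)
  then show ?thesis by (simp add: S1_def)
qed

lemma cl_smult:
  assumes f: "f \<in> \<L>" and v: "v \<in> S1f"
  shows "f \<odot>\<^bsub>SM\<^esub> cl v = cl (\<lambda>\<omega>. f \<odot> v \<omega>)"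
proof -
  have "(\<Union>v'\<in>cl v. cl (\<lambda>\<omega>. f \<odot> v' \<omega>)) = cl (\<lambda>\<omega>. f \<odot> v \<omega>)"
  proof (intro UN_eq_const)
    fix v' assume "v' \<in> cl v"
    then obtain N where *: "v' \<in> S1f" "N \<in> \<A>" "V N = \<zero>\<^sub>0" "\<forall>\<omega>\<in>\<Omega> - N. v \<omega> = v' \<omega>"
      using v by (auto simp: mem_cl)
    then show "cl (\<lambda>\<omega>. f \<odot> v' \<omega>) = cl (\<lambda>\<omega>. f \<odot> v \<omega>)"
      using v f by (subst cl_eq_iff) (auto intro!: bexI[of _ N])
  qed (use cl_self v in auto)
  then show ?thesis by (simp add: S1_def)
qed

lemma SM_zero: "\<zero>\<^bsub>SM\<^esub> = cl (\<lambda>_. \<zero>)"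
  by (simp add: S1_def)

text \<open>Each axiom holds at every point of \<Omega>, so the two classes agree by
  \<open>cl_eqI\<close>.\<close>

lemma SM_module: "module (L0 m) SM"
proof (intro moduleI L0_cring abelian_groupI)
  fix X Y Z assume "X \<in> carrier SM" "Y \<in> carrier SM" "Z \<in> carrier SM"
  then obtain u v w where *: "u \<in> S1f" "v \<in> S1f" "w \<in> S1f" "X = cl u" "Y = cl v" "Z = cl w"
    by (metis SM_cases)
  show "X \<oplus>\<^bsub>SM\<^esub> Y \<oplus>\<^bsub>SM\<^esub> Z = X \<oplus>\<^bsub>SM\<^esub> (Y \<oplus>\<^bsub>SM\<^esub> Z)"
    unfolding *(4-6) using *(1-3) by (simp add: cl_add) (intro cl_eqI; simp add: M.a_assoc S1f_closed)
next
  fix X Y assume "X \<in> carrier SM" "Y \<in> carrier SM"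
  then obtain v w where *: "v \<in> S1f" "w \<in> S1f" "X = cl v" "Y = cl w"
    by (metis SM_cases)
  show "X \<oplus>\<^bsub>SM\<^esub> Y \<in> carrier SM" using * by (simp add: cl_add)
  show "X \<oplus>\<^bsub>SM\<^esub> Y = Y \<oplus>\<^bsub>SM\<^esub> X"
    unfolding *(3,4) using *(1,2) by (simp add: cl_add) (intro cl_eqI; simp add: M.a_comm S1f_closed)
  fix f assume f: "f \<in> \<L>"
  show "f \<odot>\<^bsub>SM\<^esub> (X \<oplus>\<^bsub>SM\<^esub> Y) = f \<odot>\<^bsub>SM\<^esub> X \<oplus>\<^bsub>SM\<^esub> f \<odot>\<^bsub>SM\<^esub> Y"
    unfolding *(3,4) using *(1,2) f by (simp add: cl_add cl_smult) (intro cl_eqI; simp add: M.smult_r_distr S1f_closed)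
next
  fix X assume "X \<in> carrier SM"
  then obtain v where *: "v \<in> S1f" "X = cl v"
    by (metis SM_cases)
  show "\<zero>\<^bsub>SM\<^esub> \<oplus>\<^bsub>SM\<^esub> X = X"
    unfolding *(2) SM_zero using *(1) by (simp add: cl_add) (intro cl_eqI; simp add: S1f_closed)
  have "cl (\<lambda>\<omega>. \<ominus> v \<omega>) \<oplus>\<^bsub>SM\<^esub> X = \<zero>\<^bsub>SM\<^esub>"
    unfolding *(2) SM_zero using *(1) by (simp add: cl_add) (intro cl_eqI; simp add: S1f_closed M.l_neg)
  then show "\<exists>Y\<in>carrier SM. Y \<oplus>\<^bsub>SM\<^esub> X = \<zero>\<^bsub>SM\<^esub>" using *(1) by blast
  show "\<one>\<^sub>0 \<odot>\<^bsub>SM\<^esub> X = X"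
    unfolding *(2) using *(1) by (simp add: cl_smult) (intro cl_eqI; simp add: S1f_closed)
  fix f g assume fg: "f \<in> \<L>" "g \<in> \<L>"
  show "(f \<oplus>\<^sub>0 g) \<odot>\<^bsub>SM\<^esub> X = f \<odot>\<^bsub>SM\<^esub> X \<oplus>\<^bsub>SM\<^esub> g \<odot>\<^bsub>SM\<^esub> X"
    unfolding *(2) using *(1) fg by (simp add: cl_add cl_smult) (intro cl_eqI; simp add: M.smult_l_distr S1f_closed)
  show "(f \<otimes>\<^sub>0 g) \<odot>\<^bsub>SM\<^esub> X = f \<odot>\<^bsub>SM\<^esub> (g \<odot>\<^bsub>SM\<^esub> X)"
    unfolding *(2) using *(1) fg by (simp add: cl_smult) (intro cl_eqI; simp add: M.smult_assoc1 S1f_closed)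
next
  fix f X assume "f \<in> \<L>" "X \<in> carrier SM"
  then show "f \<odot>\<^bsub>SM\<^esub> X \<in> carrier SM"
    by (auto elim!: SM_cases simp: cl_smult)
qed (auto simp: SM_zero)

lemma SM_seminormed: "seminormed_L0_module m SM"
proof (intro seminormed_L0_module.intro seminormed_L0_module_axioms.intro SM_module L0_base_axioms)
  fix X assume "X \<in> carrier SM"
  then obtain v where v: "v \<in> S1f" "X = cl v" by (metis SM_cases)
  obtain C c where r: "srep C c v" using v by (auto simp: S1f_iff)
  show "\<parallel>X\<parallel>\<^bsub>SM\<^esub> \<in> L0_pos m" using v r rep_norm(1)[OF r] by (simp add: cl_norm)
  fix f assume f: "f \<in> \<L>"
  show "\<parallel>f \<odot>\<^bsub>SM\<^esub> X\<parallel>\<^bsub>SM\<^esub> = \<parallel>f\<parallel>\<^sub>0 \<otimes>\<^sub>0 \<parallel>X\<parallel>\<^bsub>SM\<^esub>"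
    unfolding v(2) cl_smult[OF f v(1)] cl_norm[OF r] cl_norm[OF srep_smult(1)[OF r f]] by (rule srep_smult(2)[OF r f])
next
  fix X Y assume "X \<in> carrier SM" "Y \<in> carrier SM"
  then obtain v w where *: "v \<in> S1f" "w \<in> S1f" "X = cl v" "Y = cl w"
    by (metis SM_cases)
  then obtain C c D d where "srep C c v" "srep D d w" by (auto simp: S1f_iff)
  then obtain E c' d' where E: "srep E c' v" "srep E d' w" by (metis common_srep)
  show "L0_le m \<parallel>X \<oplus>\<^bsub>SM\<^esub> Y\<parallel>\<^bsub>SM\<^esub> (\<parallel>X\<parallel>\<^bsub>SM\<^esub> \<oplus>\<^sub>0 \<parallel>Y\<parallel>\<^bsub>SM\<^esub>)"
    unfolding *(3,4) cl_add[OF *(1,2)] cl_norm[OF E(1)] cl_norm[OF E(2)] cl_norm[OF srep_add(1)[OF E]]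
    by (rule srep_add(2)[OF E])
qed

sublocale SM: seminormed_L0_module m SM by (rule SM_seminormed)

text \<open>Where one of the two values is 0, the triangle inequality is an equality. Values on
  empty cells are arbitrary and therefore exempted from \<open>e\<close>; such cells have variation
  0.\<close>

lemma rep_norm_add_eqI:
  assumes v: "srep C c v" and w: "srep C d w"
    and e: "\<And>n. C n \<noteq> {} \<Longrightarrow> c n = \<zero> \<or> d n = \<zero>"
  shows "rep_norm C (\<lambda>n. c n \<oplus> d n) = rep_norm C c \<oplus>\<^sub>0 rep_norm C d"
proof (rule rep_norm_eqI[OF srep_add(1)[OF v w]])
  note C = srepD[OF v] and D = srepD[OF w]
  show "AE x in m. (\<lambda>n. L0_rep (V (C n)) x * L0_rep \<parallel>c n \<oplus> d n\<parallel> x) sums L0_rep (rep_norm C c \<oplus>\<^sub>0 rep_norm C d) x"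
    using rep_norm(2)[OF v] rep_norm(2)[OF w] AE_rep_zero
      AE_rep_add[of "rep_norm C c" "rep_norm C d", OF L0_pos_closed[OF rep_norm(1)[OF v]] L0_pos_closed[OF rep_norm(1)[OF w]]]
  proof eventually_elim
    case (elim x)
    have "L0_rep (V (C n)) x * L0_rep \<parallel>c n \<oplus> d n\<parallel> x =
        L0_rep (V (C n)) x * L0_rep \<parallel>c n\<parallel> x + L0_rep (V (C n)) x * L0_rep \<parallel>d n\<parallel> x" for n
      using e[of n] C(3)[of n] D(3)[of n] elim(3) by (cases "C n = {}") auto
    then show ?case using sums_add[OF elim(1,2)] elim(4) by simp
  qed
qed (use rep_norm(1)[OF v] rep_norm(1)[OF w] in auto)

text \<open>A point of a nonempty cell of a common partition lies outside \<open>A\<close> or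
  outside \<open>B\<close>, so one of the two values on that cell is 0.\<close>

lemma norm_add_disjoint:
  assumes v: "v \<in> S1f" and w: "w \<in> S1f" and d: "A \<inter> B = {}"
    and v0: "\<And>\<omega>. \<omega> \<in> \<Omega> - A \<Longrightarrow> v \<omega> = \<zero>" and w0: "\<And>\<omega>. \<omega> \<in> \<Omega> - B \<Longrightarrow> w \<omega> = \<zero>"
  shows "\<parallel>cl (\<lambda>\<omega>. v \<omega> \<oplus> w \<omega>)\<parallel>\<^bsub>SM\<^esub> = \<parallel>cl v\<parallel>\<^bsub>SM\<^esub> \<oplus>\<^sub>0 \<parallel>cl w\<parallel>\<^bsub>SM\<^esub>"
proof -
  obtain C c D d where "srep C c v" "srep D d w" using v w by (auto simp: S1f_iff)
  then obtain E c d where E: "srep E c v" "srep E d w" by (metis common_srep)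
  have "c n = \<zero> \<or> d n = \<zero>" if ne: "E n \<noteq> {}" for n
  proof -
    obtain \<omega> where \<omega>: "\<omega> \<in> E n" using ne by auto
    then have "\<omega> \<in> \<Omega>" using seq_partitionD(4)[OF srepD(1)[OF E(1)]] by blast
    then have "v \<omega> = \<zero> \<or> w \<omega> = \<zero>" using v0 w0 d by blast
    then show ?thesis using srepD(4)[OF E(1) \<omega>] srepD(4)[OF E(2) \<omega>] by simp
  qed
  then show ?thesis
    unfolding cl_norm[OF E(1)] cl_norm[OF E(2)] cl_norm[OF srep_add(1)[OF E]] by (rule rep_norm_add_eqI[OF E])
qed

definition ind :: "'b set \<Rightarrow> 'c \<Rightarrow> 'b \<Rightarrow> 'c" where
  "ind A c = (\<lambda>\<omega>. if \<omega> \<in> A then c else \<zero>)"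

text \<open>The complement of \<open>A\<close> occupies index 0 and \<open>A\<close> itself index 1,
  which is why \<open>c'\<close> takes the value \<open>c\<close> at 1.\<close>

lemma srep_ind:
  assumes A: "A \<in> \<A>" and c: "c \<in> carrier M"
  defines "C \<equiv> case_nat (\<Omega> - A) (\<lambda>n. if n = 0 then A else {})" and "c' \<equiv> \<lambda>n. if n = 1 then c else \<zero>"
  shows "srep C c' (ind A c)" "rep_norm C c' = V A \<otimes>\<^sub>0 \<parallel>c\<parallel>"
proof -
  have "A \<union> (\<Omega> - A) = \<Omega>" using A SA.sets_into_space by auto
  then have C: "seq_partition \<A> \<Omega> C"
    using seq_partition_Cons[OF seq_partition_trivial[OF A], of "\<Omega> - A"] A by (auto simp: C_def)
  have s: "AE x in m. (\<lambda>n. L0_rep (V (C n)) x * L0_rep \<parallel>c' n\<parallel> x) sums L0_rep (V A \<otimes>\<^sub>0 \<parallel>c\<parallel>) x"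
    using AE_rep_mult[of "V A" "\<parallel>c\<parallel>", OF V_closed[OF A] M.norm_closed[OF c]] AE_rep_zero
  proof eventually_elim
    case (elim x)
    have "(\<lambda>n. L0_rep (V (C n)) x * L0_rep \<parallel>c' n\<parallel> x) sums (\<Sum>n\<in>{1}. L0_rep (V (C n)) x * L0_rep \<parallel>c' n\<parallel> x)"
      by (rule sums_finite) (use elim(2) in \<open>auto simp: c'_def\<close>)
    then show ?case using elim(1) by (simp add: C_def c'_def)
  qed
  show r: "srep C c' (ind A c)"
    unfolding srep_iff using C c s
    by (auto simp: c'_def C_def ind_def elim!: eventually_mono intro: sums_summable split: nat.splits if_splits)
  show "rep_norm C c' = V A \<otimes>\<^sub>0 \<parallel>c\<parallel>"
    by (rule rep_norm_eqI[OF r _ s]) (use A c V_closed in auto)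
qed

lemma S1f_ind [simp, intro]: "A \<in> \<A> \<Longrightarrow> c \<in> carrier M \<Longrightarrow> ind A c \<in> S1f"
  using srep_ind(1) by (auto simp: S1f_iff)

lemma ind_norm: "A \<in> \<A> \<Longrightarrow> c \<in> carrier M \<Longrightarrow> \<parallel>cl (ind A c)\<parallel>\<^bsub>SM\<^esub> = V A \<otimes>\<^sub>0 \<parallel>c\<parallel>"
  using cl_norm[OF srep_ind(1)] srep_ind(2) by simp

lemma ind_smult: "A \<in> \<A> \<Longrightarrow> c \<in> carrier M \<Longrightarrow> f \<in> \<L> \<Longrightarrow>
    cl (ind A (f \<odot> c)) = f \<odot>\<^bsub>SM\<^esub> cl (ind A c)"
  by (simp add: cl_smult) (rule cl_eqI[OF S1f_ind]; simp add: ind_def)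

lemma ind_Un: "A \<in> \<A> \<Longrightarrow> B \<in> \<A> \<Longrightarrow> A \<inter> B = {} \<Longrightarrow> c \<in> carrier M \<Longrightarrow>
    cl (ind (A \<union> B) c) = cl (ind A c) \<oplus>\<^bsub>SM\<^esub> cl (ind B c)"
  by (simp add: cl_add) (rule cl_eqI[OF S1f_ind]; auto simp: ind_def)

text \<open>Keeping only the first \<open>N\<close> cells leaves a finite sum of characteristic
  functions times constants, which an algebraic tensor can represent.\<close>

definition trunc :: "(nat \<Rightarrow> 'b set) \<Rightarrow> ('b \<Rightarrow> 'c) \<Rightarrow> nat \<Rightarrow> 'b \<Rightarrow> 'c" where
  "trunc C v N = (\<lambda>\<omega>. if \<omega> \<in> (\<Union>n<N. C n) then v \<omega> else \<zero>)"

lemma srep_disjoint: "srep C c v \<Longrightarrow> \<omega> \<in> C n \<Longrightarrow> \<omega> \<in> C k \<Longrightarrow> n = k"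
  using seq_partitionD(2)[OF srepD(1)] by (metis IntI UNIV_I disjoint_family_onD empty_iff)

text \<open>Stated for an arbitrary selection \<open>P\<close> of cells, because both the truncation
  and its tail are obtained from it.\<close>

lemma srep_sub:
  assumes r: "srep C c v"
  shows "srep C (\<lambda>n. if P n then c n else \<zero>) (\<lambda>\<omega>. if \<exists>n. P n \<and> \<omega> \<in> C n then v \<omega> else \<zero>)"
proof -
  note C = srepD[OF r]
  have "AE x in m. summable (\<lambda>n. L0_rep (V (C n)) x * L0_rep \<parallel>if P n then c n else \<zero>\<parallel> x)"
    using C(5) AE_term_nonneg[of C c, OF C(2,3)] AE_rep_zero
  proof eventually_elim
    case (elim x)
    show ?case by (rule summable_comparison_test'[OF elim(1), of 0]) (use elim(2,3) in auto)
  qed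
  then show ?thesis unfolding srep_iff using C(1,3,4) srep_disjoint[OF r] by auto metis+
qed

lemma S1f_trunc: "srep C c v \<Longrightarrow> trunc C v N \<in> S1f"
  using srep_sub[of C c v "\<lambda>n. n < N"] by (auto simp: S1f_iff trunc_def Bex_def lessThan_def)

lemma trunc_0: "trunc C v 0 = (\<lambda>_. \<zero>)"
  by (simp add: trunc_def)

lemma trunc_Suc:
  assumes r: "srep C c v"
  shows "cl (trunc C v (Suc N)) = cl (trunc C v N) \<oplus>\<^bsub>SM\<^esub> cl (ind (C N) (c N))"
proof -
  note C = srepD[OF r]
  have "trunc C v (Suc N) \<omega> = trunc C v N \<omega> \<oplus> ind (C N) (c N) \<omega>" if "\<omega> \<in> \<Omega>" for \<omega>
  proof (cases "\<omega> \<in> C N")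
    case True
    \<comment> \<open>Disjointness keeps the new cell away from the earlier ones, so the truncation
      vanishes there and nothing is counted twice.\<close>
    have "\<omega> \<notin> C k" if "k < N" for k using srep_disjoint[OF r True, of k] that by blast
    then have "\<omega> \<notin> (\<Union>n<N. C n)" "\<omega> \<in> (\<Union>n<Suc N. C n)" using True by auto
    then show ?thesis using True C(3)[of N] C(4)[OF True] by (simp add: trunc_def ind_def)
  next
    case False
    have "v \<omega> \<in> carrier M" by (rule S1f_closed[OF _ that]) (use r in \<open>auto simp: S1f_iff\<close>)
    moreover have "\<omega> \<in> (\<Union>n<Suc N. C n) \<longleftrightarrow> \<omega> \<in> (\<Union>n<N. C n)" using False by (auto simp: less_Suc_eq)
    ultimately show ?thesis using False unfolding trunc_def ind_def by simp
  qed
  then have "cl (trunc C v (Suc N)) = cl (\<lambda>\<omega>. trunc C v N \<omega> \<oplus> ind (C N) (c N) \<omega>)"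
    by (intro cl_eqI S1f_trunc[OF r])
  then show ?thesis using C by (simp add: cl_add S1f_trunc[OF r])
qed

text \<open>The norm of the tail is almost everywhere the sum of a convergent series minus a partial
  sum. It tends to 0 pointwise and hence in the metric.\<close>

lemma trunc_tendsto:
  assumes r: "srep C c v"
  shows "(\<lambda>N. rnm_dist m SM (cl (trunc C v N)) (cl v)) \<longlonglongrightarrow> 0"
proof -
  note C = srepD[OF r]
  have v: "v \<in> S1f" using r by (auto simp: S1f_iff)
  define t where "t N = (\<lambda>\<omega>. if \<exists>n. \<not> n < N \<and> \<omega> \<in> C n then v \<omega> else \<zero>)" for N
  define d where "d N = (\<lambda>n. if \<not> n < N then c n else \<zero>)" for N
  have rt: "srep C (d N) (t N)" for N unfolding t_def d_def by (rule srep_sub[OF r])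
  have t: "t N \<in> S1f" for N using rt by (auto simp: S1f_iff)
  have "cl v = cl (trunc C v N) \<oplus>\<^bsub>SM\<^esub> cl (t N)" for N
  proof -
    have "v \<omega> = trunc C v N \<omega> \<oplus> t N \<omega>" if w: "\<omega> \<in> \<Omega>" for \<omega>
    proof -
      obtain n where n: "\<omega> \<in> C n" using w seq_partitionD(3)[OF C(1)] by blast
      have k: "\<omega> \<in> C k \<longleftrightarrow> k = n" for k using srep_disjoint[OF r n, of k] n by blast
      have "\<omega> \<in> (\<Union>k<N. C k) \<longleftrightarrow> n < N" "(\<exists>k. \<not> k < N \<and> \<omega> \<in> C k) \<longleftrightarrow> \<not> n < N" using k by auto
      then show ?thesis using S1f_closed[OF v w] unfolding trunc_def t_def by simp
    qed
    then have "cl v = cl (\<lambda>\<omega>. trunc C v N \<omega> \<oplus> t N \<omega>)" by (intro cl_eqI v)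
    then show ?thesis using t by (simp add: cl_add S1f_trunc[OF r])
  qed
  then have "cl v \<ominus>\<^bsub>SM\<^esub> cl (trunc C v N) = cl (t N)" for N
    using t S1f_trunc[OF r] SM.add_diff_add[of "cl (trunc C v N)" "cl (t N)" "cl (trunc C v N)" "\<zero>\<^bsub>SM\<^esub>"]
    by (simp add: SM.r_neg a_minus_def)
  then have eq: "rnm_dist m SM (cl (trunc C v N)) (cl v) = L0_len m (rep_norm C (d N))" for N
    using SM.dst_commute[of "cl (trunc C v N)" "cl v"] SM.dst_eq[of "cl v" "cl (trunc C v N)"] v S1f_trunc[OF r] cl_norm[OF rt]
    by simp
  have "(\<lambda>N. L0_len m (rep_norm C (d N))) \<longlonglongrightarrow> 0"
  proof (rule L0_len_tendsto_AE)
    show "rep_norm C (d N) \<in> L0_pos m" for N by (rule rep_norm(1)[OF rt])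
    have "AE x in m. \<forall>N. (\<lambda>n. L0_rep (V (C n)) x * L0_rep \<parallel>d N n\<parallel> x) sums L0_rep (rep_norm C (d N)) x"
      using rep_norm(2)[OF rt] by (subst AE_all_countable) auto
    then show "AE x in m. (\<lambda>N. L0_rep (rep_norm C (d N)) x) \<longlonglongrightarrow> 0"
      using rep_norm(2)[OF r] AE_rep_zero
    proof eventually_elim
      case (elim x)
      let ?a = "\<lambda>n. L0_rep (V (C n)) x * L0_rep \<parallel>c n\<parallel> x"
      have "L0_rep (rep_norm C (d N)) x = L0_rep (rep_norm C c) x - (\<Sum>n<N. ?a n)" for N
      proof -
        have "(\<lambda>n. if n \<in> {..<N} then ?a n else 0) sums (\<Sum>n<N. ?a n)"
          by (rule sums_If_finite_set) simp
        from sums_diff[OF elim(2) this]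
        have "(\<lambda>n. ?a n - (if n \<in> {..<N} then ?a n else 0)) sums (L0_rep (rep_norm C c) x - (\<Sum>n<N. ?a n))" .
        also have "(\<lambda>n. ?a n - (if n \<in> {..<N} then ?a n else 0)) = (\<lambda>n. L0_rep (V (C n)) x * L0_rep \<parallel>d N n\<parallel> x)"
          using elim(3) by (auto simp: d_def)
        finally show ?thesis using elim(1) sums_unique2 by blast
      qed
      moreover have "(\<lambda>N. L0_rep (rep_norm C c) x - (\<Sum>n<N. ?a n)) \<longlonglongrightarrow> L0_rep (rep_norm C c) x - L0_rep (rep_norm C c) x"
        using elim(2) unfolding sums_def by (intro tendsto_diff tendsto_const)
      ultimately show ?case by simp
    qed
  qed
  then show ?thesis by (simp add: eq)
qed

lemma trunc_dense:
  assumes "X \<in> carrier SM.Cpl" "\<epsilon> > 0"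
  obtains C c s N where "srep C c s" "rnm_dist m SM.Cpl (SM.emb (cl (trunc C s N))) X < \<epsilon>"
proof -
  interpret Q: seminormed_L0_module m SM.Cpl by (rule SM.Cpl_seminormed)
  obtain S where S: "S \<in> carrier SM" "rnm_dist m SM.Cpl (SM.emb S) X < \<epsilon>/2"
    using SM.emb_dense[OF assms(1), of "\<epsilon>/2"] assms(2) by auto
  obtain s where s: "s \<in> S1f" "S = cl s" using S(1) by (rule SM_cases)
  obtain C c where r: "srep C c s" using s(1) by (auto simp: S1f_iff)
  have "eventually (\<lambda>N. rnm_dist m SM (cl (trunc C s N)) (cl s) < \<epsilon>/2) sequentially"
    by (rule order_tendstoD(2)[OF trunc_tendsto[OF r]]) (use assms in auto)
  then obtain N where N: "rnm_dist m SM (cl (trunc C s N)) (cl s) < \<epsilon>/2"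
    using eventually_happens'[OF sequentially_bot] by blast
  have t: "cl (trunc C s N) \<in> carrier SM" using S1f_trunc[OF r] by simp
  have "rnm_dist m SM.Cpl (SM.emb (cl (trunc C s N))) X \<le>
      rnm_dist m SM.Cpl (SM.emb (cl (trunc C s N))) (SM.emb S) + rnm_dist m SM.Cpl (SM.emb S) X"
    by (rule Q.dst_triangle) (use t S assms in auto)
  then have "rnm_dist m SM.Cpl (SM.emb (cl (trunc C s N))) X < \<epsilon>"
    using N S t by (simp add: SM.emb_dist s(2)[symmetric])
  then show thesis using r that by blast
qed

end

section \<open>The projective tensor seminorm\<close>

context L0_base
begin

lemma L0_diff_le_iff:
  assumes F: "F \<in> \<L>" "G \<in> \<L>" "H \<in> \<L>"
  shows "L0_le m (F \<ominus>\<^sub>0 G) H \<longleftrightarrow> L0_le m F (G \<oplus>\<^sub>0 H)"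
proof -
  have "(AE x in m. L0_rep (F \<ominus>\<^sub>0 G) x \<le> L0_rep H x) \<longleftrightarrow> (AE x in m. L0_rep F x \<le> L0_rep (G \<oplus>\<^sub>0 H) x)"
    using AE_rep_diff[OF F(1,2)] AE_rep_add[OF F(2,3)] by (intro eventually_subst, eventually_elim) auto
  then show ?thesis using F by (simp add: L0_le_iff)
qed

lemma L0_inverse_exists:
  assumes f: "f \<in> \<L>"
  obtains g where "g \<in> \<L>"
    "AE x in m. L0_rep g x = (if L0_rep f x = 0 then 0 else 1 / L0_rep f x)"
proof
  have h: "(\<lambda>x. if L0_rep f x = 0 then 0 else 1 / L0_rep f x) \<in> borel_measurable m" using f by measurable
  show "L0_class m (\<lambda>x. if L0_rep f x = 0 then 0 else 1 / L0_rep f x) \<in> \<L>" using h by simp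
  show "AE x in m. L0_rep (L0_class m (\<lambda>x. if L0_rep f x = 0 then 0 else 1 / L0_rep f x)) x = (if L0_rep f x = 0 then 0 else 1 / L0_rep f x)"
    by (rule AE_rep_class[OF h])
qed

text \<open>
  The reverse inequality comes from applying the bound to a partial inverse of \<open>f\<close>, equal to \<open>1 / f\<close> where
  \<open>f \<noteq> 0\<close> and to 0 elsewhere.
\<close>

lemma seminormed_of_subhomogeneous:
  fixes M :: "('a l0, 'm) rnm" (structure)
  assumes M: "module (L0 m) M"
    and pos: "\<And>v. v \<in> carrier M \<Longrightarrow> \<parallel>v\<parallel> \<in> L0_pos m"
    and tri: "\<And>v w. v \<in> carrier M \<Longrightarrow> w \<in> carrier M \<Longrightarrow> L0_le m \<parallel>v \<oplus> w\<parallel> (\<parallel>v\<parallel> \<oplus>\<^sub>0 \<parallel>w\<parallel>)"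
    and sub: "\<And>f v. f \<in> \<L> \<Longrightarrow> v \<in> carrier M \<Longrightarrow> L0_le m \<parallel>f \<odot> v\<parallel> (\<parallel>f\<parallel>\<^sub>0 \<otimes>\<^sub>0 \<parallel>v\<parallel>)"
  shows "seminormed_L0_module m M"
proof (intro seminormed_L0_module.intro seminormed_L0_module_axioms.intro M L0_base_axioms pos tri)
  interpret Module.module "L0 m" M by (rule M)
  fix f v assume f: "f \<in> \<L>" and v: "v \<in> carrier M"
  obtain g where g: "g \<in> \<L>" "AE x in m. L0_rep g x = (if L0_rep f x = 0 then 0 else 1 / L0_rep f x)"
    using L0_inverse_exists[OF f] by blast
  \<comment> \<open>\<open>e\<close> is the class of the indicator of the set where \<open>f\<close>
    vanishes. It splits \<open>v\<close> into \<open>g \<odot> (f \<odot> v)\<close> and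
    \<open>e \<odot> v\<close>, and the norm of the second summand is 0 wherever \<open>f\<close> is
    not.\<close>
  define e where "e = \<one>\<^sub>0 \<ominus>\<^sub>0 g \<otimes>\<^sub>0 f"
  have e: "e \<in> \<L>" unfolding e_def using f g by auto
  have AE_e: "AE x in m. L0_rep e x = (if L0_rep f x = 0 then 1 else 0)"
    unfolding e_def using AE_rep_diff[of "\<one>\<^sub>0" "g \<otimes>\<^sub>0 f"] AE_rep_mult[OF g(1) f] AE_rep_one g f by auto
  have ge: "g \<otimes>\<^sub>0 f \<oplus>\<^sub>0 e = \<one>\<^sub>0"
  proof -
    have "AE x in m. L0_rep (g \<otimes>\<^sub>0 f \<oplus>\<^sub>0 e) x = L0_rep \<one>\<^sub>0 x"
      using AE_rep_add[of "g \<otimes>\<^sub>0 f" e] AE_rep_mult[OF g(1) f] AE_e g(2) AE_rep_one g f e by auto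
    then show ?thesis using f g e by (subst L0_eq_iff) auto
  qed
  have "v = g \<odot> (f \<odot> v) \<oplus> e \<odot> v"
    using f g(1) e v ge smult_l_distr[of "g \<otimes>\<^sub>0 f" e v] by (simp add: smult_assoc1)
  then have "L0_le m \<parallel>v\<parallel> (\<parallel>g \<odot> (f \<odot> v)\<parallel> \<oplus>\<^sub>0 \<parallel>e \<odot> v\<parallel>)"
    using tri[of "g \<odot> (f \<odot> v)" "e \<odot> v"] f g(1) e v by simp
  then have 1: "AE x in m. L0_rep \<parallel>v\<parallel> x \<le> L0_rep (\<parallel>g \<odot> (f \<odot> v)\<parallel> \<oplus>\<^sub>0 \<parallel>e \<odot> v\<parallel>) x"
    using pos f g(1) e v by (simp add: L0_le_iff)
  have 2: "AE x in m. L0_rep (\<parallel>g \<odot> (f \<odot> v)\<parallel> \<oplus>\<^sub>0 \<parallel>e \<odot> v\<parallel>) x = L0_rep \<parallel>g \<odot> (f \<odot> v)\<parallel> x + L0_rep \<parallel>e \<odot> v\<parallel> x"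
    using pos f g(1) e v by (intro AE_rep_add) auto
  have s: "AE x in m. L0_rep \<parallel>h \<odot> u\<parallel> x \<le> \<bar>L0_rep h x\<bar> * L0_rep \<parallel>u\<parallel> x" if h: "h \<in> \<L>" and u: "u \<in> carrier M" for h u
  proof -
    have "AE x in m. L0_rep \<parallel>h \<odot> u\<parallel> x \<le> L0_rep (\<parallel>h\<parallel>\<^sub>0 \<otimes>\<^sub>0 \<parallel>u\<parallel>) x"
      using sub[OF h u] pos h u by (simp add: L0_le_iff)
    then show ?thesis
      using AE_rep_mult[of "\<parallel>h\<parallel>\<^sub>0" "\<parallel>u\<parallel>", OF L0_norm_closed[OF h] L0_pos_closed[OF pos[OF u]]] AE_rep_norm[OF h]
      by eventually_elim auto
  qed
  have "AE x in m. \<bar>L0_rep f x\<bar> * L0_rep \<parallel>v\<parallel> x \<le> L0_rep \<parallel>f \<odot> v\<parallel> x"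
    using 1 2 s[OF g(1) smult_closed[OF f v]] s[OF e v] AE_e g(2) AE_rep_pos[OF pos[OF smult_closed[OF f v]]]
  proof eventually_elim
    case (elim x)
    show ?case
    proof (cases "L0_rep f x = 0")
      case False
      have "L0_rep \<parallel>v\<parallel> x \<le> \<bar>1 / L0_rep f x\<bar> * L0_rep \<parallel>f \<odot> v\<parallel> x"
        using elim False by auto
      then show ?thesis using False by (auto simp: field_simps)
    qed (use elim in auto)
  qed
  moreover have "AE x in m. L0_rep (\<parallel>f\<parallel>\<^sub>0 \<otimes>\<^sub>0 \<parallel>v\<parallel>) x = \<bar>L0_rep f x\<bar> * L0_rep \<parallel>v\<parallel> x"
    using AE_rep_mult[of "\<parallel>f\<parallel>\<^sub>0" "\<parallel>v\<parallel>", OF L0_norm_closed[OF f] L0_pos_closed[OF pos[OF v]]] AE_rep_norm[OF f]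
    by eventually_elim auto
  ultimately have "AE x in m. L0_rep \<parallel>f \<odot> v\<parallel> x = L0_rep (\<parallel>f\<parallel>\<^sub>0 \<otimes>\<^sub>0 \<parallel>v\<parallel>) x"
    using s[OF f v] by eventually_elim auto
  then show "\<parallel>f \<odot> v\<parallel> = \<parallel>f\<parallel>\<^sub>0 \<otimes>\<^sub>0 \<parallel>v\<parallel>"
    using pos f v by (subst L0_eq_iff) auto
qed

end

section \<open>The algebraic tensor product as a module\<close>

locale L0_tensor = L0_base m + M: seminormed_L0_module m M + N: seminormed_L0_module m N
  for m :: "'a measure" and M :: "('a l0, 'm) rnm" and N :: "('a l0, 'n) rnm"
begin

abbreviation "pairs \<equiv> carrier M \<times> carrier N"
abbreviation "rels \<equiv> tensor_subgroup (L0 m) M N"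
abbreviation "tc \<equiv> tensor_class (L0 m) M N"
abbreviation "te \<equiv> tensor_elem (L0 m) M N"
abbreviation "TM \<equiv> tensor_module (L0 m) M N"
abbreviation "AT \<equiv> alg_proj_tensor m M N"

definition gens :: "('m \<times> 'n \<Rightarrow>\<^sub>0 int) set" where
  "gens =
     {frag_of (v \<oplus>\<^bsub>M\<^esub> v', w) - frag_of (v, w) - frag_of (v', w) | v v' w.
         v \<in> carrier M \<and> v' \<in> carrier M \<and> w \<in> carrier N} \<union>
      {frag_of (v, w \<oplus>\<^bsub>N\<^esub> w') - frag_of (v, w) - frag_of (v, w') | v w w'.
         v \<in> carrier M \<and> w \<in> carrier N \<and> w' \<in> carrier N} \<union>
      {frag_of (r \<odot>\<^bsub>M\<^esub> v, w) - frag_of (v, r \<odot>\<^bsub>N\<^esub> w) | r v w.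
         r \<in> \<L> \<and> v \<in> carrier M \<and> w \<in> carrier N}"

definition frags :: "('m \<times> 'n \<Rightarrow>\<^sub>0 int) set" where
  "frags = {x. Poly_Mapping.keys x \<subseteq> pairs}"

lemma frags_0 [simp]: "0 \<in> frags"
  by (simp add: frags_def)

lemma frags_diff [simp]: "x \<in> frags \<Longrightarrow> y \<in> frags \<Longrightarrow> x - y \<in> frags"
  using keys_diff[of x y] by (auto simp: frags_def)

lemma frags_of [simp]: "frag_of (v, w) \<in> frags \<longleftrightarrow> v \<in> carrier M \<and> w \<in> carrier N"
  by (simp add: frags_def)

lemma frags_minus [simp]: "x \<in> frags \<Longrightarrow> - x \<in> frags"
  by (simp add: frags_def)

lemma frags_add [simp]: "x \<in> frags \<Longrightarrow> y \<in> frags \<Longrightarrow> x + y \<in> frags"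
  using frags_diff[of x "- y"] by simp

lemma frags_induct [consumes 1, case_names zero diff of]:
  assumes "x \<in> frags" "P 0" "\<And>x y. x \<in> frags \<Longrightarrow> y \<in> frags \<Longrightarrow> P x \<Longrightarrow> P y \<Longrightarrow> P (x - y)"
    "\<And>v w. v \<in> carrier M \<Longrightarrow> w \<in> carrier N \<Longrightarrow> P (frag_of (v, w))"
  shows "P x"
  by (rule free_Abelian_group_induct[of x pairs]) (use assms in \<open>auto simp: frags_def\<close>)

lemma gens_frags: "gens \<subseteq> frags"
  by (auto simp: gens_def)

lemma rels_eq: "rels = generate (free_Abelian_group pairs) gens"
  by (simp add: tensor_subgroup_def gens_def)

lemma rels_subgroup: "subgroup rels (free_Abelian_group pairs)"
  unfolding rels_eq
  by (rule group.generate_is_subgroup[OF group_free_Abelian_group]) (use gens_frags in \<open>auto simp: frags_def\<close>)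

lemma rels_frags: "x \<in> rels \<Longrightarrow> x \<in> frags"
  using subsetD[OF subgroup.subset[OF rels_subgroup], of x] by (simp add: frags_def)

lemma rels_0 [simp]: "0 \<in> rels"
  using subgroup.one_closed[OF rels_subgroup] by simp

lemma rels_diff: "x \<in> rels \<Longrightarrow> y \<in> rels \<Longrightarrow> x - y \<in> rels"
  using subgroup.m_closed[OF rels_subgroup, of x "- y"] subgroup.m_inv_closed[OF rels_subgroup, of y] rels_frags[of y]
  by (simp add: frags_def)

lemma rels_add: "x \<in> rels \<Longrightarrow> y \<in> rels \<Longrightarrow> x + y \<in> rels"
  using subgroup.m_closed[OF rels_subgroup, of x y] by simp

lemma rels_gens: "x \<in> gens \<Longrightarrow> x \<in> rels"
  unfolding rels_eq by (rule generate.incl)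

text \<open>In additive notation, closure under differences covers the inverses and the products by
  which a subgroup is generated, and additive maps handle differences in one case.\<close>

lemma rels_induct [consumes 1, case_names zero gen diff]:
  assumes x: "x \<in> rels" and P0: "P 0" and Pg: "\<And>x. x \<in> gens \<Longrightarrow> P x"
    and Pd: "\<And>x y. x \<in> rels \<Longrightarrow> y \<in> rels \<Longrightarrow> P x \<Longrightarrow> P y \<Longrightarrow> P (x - y)"
  shows "P x"
proof -
  have neg: "P (- y)" if "y \<in> rels" "P y" for y using Pd[OF rels_0 that(1) P0 that(2)] by simp
  have "x \<in> generate (free_Abelian_group pairs) gens" using x by (simp add: rels_eq)
  then have "x \<in> rels \<and> P x"
  proof induction
    case one then show ?case using P0 by simp
  next
    case (incl h) then show ?case using Pg rels_gens by simp
  next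
    case (inv h)
    then have "Poly_Mapping.keys h \<subseteq> pairs" using gens_frags by (auto simp: frags_def)
    then have "inv\<^bsub>free_Abelian_group pairs\<^esub> h = - h" by (rule inv_free_Abelian_group)
    then show ?case using neg[OF rels_gens[OF inv] Pg[OF inv]] rels_diff[OF rels_0 rels_gens[OF inv]] by simp
  next
    case (eng h1 h2)
    then show ?case using Pd[of h1 "- h2"] neg[of h2] rels_diff[OF rels_0, of h2] rels_add[of h1 h2] by simp
  qed
  then show ?thesis by simp
qed

lemma rels_bilinear:
  "v \<in> carrier M \<Longrightarrow> v' \<in> carrier M \<Longrightarrow> w \<in> carrier N \<Longrightarrow> frag_of (v \<oplus>\<^bsub>M\<^esub> v', w) - frag_of (v, w) - frag_of (v', w) \<in> rels"
  "v \<in> carrier M \<Longrightarrow> w \<in> carrier N \<Longrightarrow> w' \<in> carrier N \<Longrightarrow> frag_of (v, w \<oplus>\<^bsub>N\<^esub> w') - frag_of (v, w) - frag_of (v, w') \<in> rels"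
  "r \<in> \<L> \<Longrightarrow> v \<in> carrier M \<Longrightarrow> w \<in> carrier N \<Longrightarrow> frag_of (r \<odot>\<^bsub>M\<^esub> v, w) - frag_of (v, r \<odot>\<^bsub>N\<^esub> w) \<in> rels"
  by (rule rels_gens; force simp: gens_def)+

lemma mem_tc: "y \<in> tc x \<longleftrightarrow> y - x \<in> rels"
  unfolding tensor_class_def r_coset_def by (auto simp: algebra_simps) (metis diff_add_cancel)

lemma tc_eq_iff: "tc x = tc y \<longleftrightarrow> x - y \<in> rels"
proof
  assume "tc x = tc y"
  then show "x - y \<in> rels" using mem_tc[of x x] mem_tc[of x y] by simp
next
  assume xy: "x - y \<in> rels"
  have "z - x \<in> rels \<longleftrightarrow> z - y \<in> rels" for z
    using rels_add[OF _ xy, of "z - x"] rels_diff[OF _ xy, of "z - y"] by auto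
  then show "tc x = tc y" by (auto simp: mem_tc)
qed

lemma TM_carrier: "carrier TM = tc ` frags"
  by (auto simp: tensor_module_def Let_def FactGroup_def RCOSETS_def tensor_class_def frags_def)

lemma tc_closed [simp, intro]: "x \<in> frags \<Longrightarrow> tc x \<in> carrier TM"
  by (simp add: TM_carrier)

lemma TM_zero: "\<zero>\<^bsub>TM\<^esub> = tc 0"
  by (auto simp: tensor_module_def Let_def mem_tc)

text \<open>The factor group adds cosets as sets; shifting one summand by a relation shows that the
  set sum is a single coset.\<close>

lemma TM_add: "tc x \<oplus>\<^bsub>TM\<^esub> tc y = tc (x + y)"
proof -
  have "tc x \<oplus>\<^bsub>TM\<^esub> tc y = {a + b | a b. a \<in> tc x \<and> b \<in> tc y}"
    by (auto simp: tensor_module_def Let_def FactGroup_def set_mult_def)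
  also have "\<dots> = tc (x + y)"
  proof (intro equalityI subsetI)
    fix z assume "z \<in> {a + b | a b. a \<in> tc x \<and> b \<in> tc y}"
    then obtain a b where "a - x \<in> rels" "b - y \<in> rels" "z = a + b" by (auto simp: mem_tc)
    then show "z \<in> tc (x + y)" using rels_add[of "a - x" "b - y"] by (simp add: mem_tc algebra_simps)
  next
    fix z assume "z \<in> tc (x + y)"
    then have "z - y \<in> tc x" "y \<in> tc y" by (auto simp: mem_tc algebra_simps)
    then show "z \<in> {a + b | a b. a \<in> tc x \<and> b \<in> tc y}" by (metis (mono_tags, lifting) diff_add_cancel mem_Collect_eq)
  qed
  finally show ?thesis .
qed

text \<open>The scalar acts on the left factor of each pair. On formal sums this is additive in the
  sum, but addition of scalars is respected only modulo the relations.\<close>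

definition scale :: "'a l0 \<Rightarrow> ('m \<times> 'n \<Rightarrow>\<^sub>0 int) \<Rightarrow> ('m \<times> 'n \<Rightarrow>\<^sub>0 int)" where
  "scale r = frag_extend (\<lambda>(v, w). frag_of (r \<odot>\<^bsub>M\<^esub> v, w))"

lemma scale_simps [simp]: "scale r 0 = 0" "scale r (x - y) = scale r x - scale r y" "scale r (x + y) = scale r x + scale r y"
  "scale r (frag_of (v, w)) = frag_of (r \<odot>\<^bsub>M\<^esub> v, w)"
  by (simp_all add: scale_def frag_extend_diff frag_extend_add)

lemma scale_frags [simp]: "r \<in> \<L> \<Longrightarrow> x \<in> frags \<Longrightarrow> scale r x \<in> frags"
  by (erule frags_induct) auto

lemma scale_rels:
  assumes r: "r \<in> \<L>" and x: "x \<in> rels" shows "scale r x \<in> rels"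
  using x
proof (induction rule: rels_induct)
  case (gen x)
  then consider (a) v v' w where "v \<in> carrier M" "v' \<in> carrier M" "w \<in> carrier N" "x = frag_of (v \<oplus>\<^bsub>M\<^esub> v', w) - frag_of (v, w) - frag_of (v', w)"
    | (b) v w w' where "v \<in> carrier M" "w \<in> carrier N" "w' \<in> carrier N" "x = frag_of (v, w \<oplus>\<^bsub>N\<^esub> w') - frag_of (v, w) - frag_of (v, w')"
    | (c) s v w where "s \<in> \<L>" "v \<in> carrier M" "w \<in> carrier N" "x = frag_of (s \<odot>\<^bsub>M\<^esub> v, w) - frag_of (v, s \<odot>\<^bsub>N\<^esub> w)"
    by (auto simp: gens_def)
  then show ?case
  proof cases
    case a then show ?thesis using r rels_bilinear(1)[of "r \<odot>\<^bsub>M\<^esub> v" "r \<odot>\<^bsub>M\<^esub> v'" w] by (simp add: M.smult_r_distr)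
  next
    case b then show ?thesis using r rels_bilinear(2)[of "r \<odot>\<^bsub>M\<^esub> v" w w'] by simp
  next
    case c
    \<comment> \<open>Commutativity of the base ring moves \<open>r\<close> past \<open>s\<close>,
      so the scaled relation is again a relation of the third kind.\<close>
    have "r \<odot>\<^bsub>M\<^esub> (s \<odot>\<^bsub>M\<^esub> v) = s \<odot>\<^bsub>M\<^esub> (r \<odot>\<^bsub>M\<^esub> v)" using c r by (simp add: M.smult_assoc1[symmetric] L0.m_comm)
    then show ?thesis using c r rels_bilinear(3)[of s "r \<odot>\<^bsub>M\<^esub> v" w] by simp
  qed
qed (simp_all add: rels_diff)

lemma TM_smult:
  assumes r: "r \<in> \<L>"
  shows "r \<odot>\<^bsub>TM\<^esub> tc x = tc (scale r x)"
proof -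
  have "(\<Union>y\<in>tc x. tc (scale r y)) = tc (scale r x)"
  proof (rule UN_eq_const)
    show "tc x \<noteq> {}" using mem_tc[of x x] by auto
    fix y assume "y \<in> tc x"
    then show "tc (scale r y) = tc (scale r x)"
      using scale_rels[OF r, of "y - x"] by (simp add: mem_tc tc_eq_iff)
  qed
  then show ?thesis by (simp add: tensor_module_def Let_def scale_def)
qed

lemma TM_module: "module (L0 m) TM"
proof (intro moduleI L0_cring abelian_groupI)
  fix X Y Z assume "X \<in> carrier TM" "Y \<in> carrier TM" "Z \<in> carrier TM"
  then show "X \<oplus>\<^bsub>TM\<^esub> Y \<oplus>\<^bsub>TM\<^esub> Z = X \<oplus>\<^bsub>TM\<^esub> (Y \<oplus>\<^bsub>TM\<^esub> Z)"
    by (auto simp: TM_carrier TM_add add.assoc)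
next
  fix X Y assume XY: "X \<in> carrier TM" "Y \<in> carrier TM"
  then show "X \<oplus>\<^bsub>TM\<^esub> Y \<in> carrier TM" "X \<oplus>\<^bsub>TM\<^esub> Y = Y \<oplus>\<^bsub>TM\<^esub> X"
    by (auto simp: TM_carrier TM_add add.commute)
  fix f assume f: "f \<in> \<L>"
  show "f \<odot>\<^bsub>TM\<^esub> (X \<oplus>\<^bsub>TM\<^esub> Y) = f \<odot>\<^bsub>TM\<^esub> X \<oplus>\<^bsub>TM\<^esub> f \<odot>\<^bsub>TM\<^esub> Y"
    using XY f by (auto simp: TM_carrier TM_add TM_smult)
next
  fix X assume "X \<in> carrier TM"
  then obtain x where x: "x \<in> frags" "X = tc x" by (auto simp: TM_carrier)
  show "\<zero>\<^bsub>TM\<^esub> \<oplus>\<^bsub>TM\<^esub> X = X" by (simp add: x TM_zero TM_add)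
  show "\<exists>Y\<in>carrier TM. Y \<oplus>\<^bsub>TM\<^esub> X = \<zero>\<^bsub>TM\<^esub>"
    using x by (intro bexI[of _ "tc (- x)"]) (auto simp: TM_zero TM_add)
  have "scale \<one>\<^sub>0 x = x" using x(1) by (induction rule: frags_induct) auto
  then show "\<one>\<^sub>0 \<odot>\<^bsub>TM\<^esub> X = X" by (simp add: x TM_smult)
  fix f g assume fg: "f \<in> \<L>" "g \<in> \<L>"
  \<comment> \<open>This axiom holds only modulo the relations: on a single pair it is additivity in
    the left factor.\<close>
  have "scale (f \<oplus>\<^sub>0 g) x - (scale f x + scale g x) \<in> rels"
    using x(1)
  proof (induction rule: frags_induct)
    case (diff x y)
    then show ?case using rels_diff[OF diff(3,4)] by (simp add: algebra_simps)
  next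
    case (of v w)
    then show ?case using fg rels_bilinear(1)[of "f \<odot>\<^bsub>M\<^esub> v" "g \<odot>\<^bsub>M\<^esub> v" w] by (simp add: M.smult_l_distr algebra_simps)
  qed simp
  then show "(f \<oplus>\<^sub>0 g) \<odot>\<^bsub>TM\<^esub> X = f \<odot>\<^bsub>TM\<^esub> X \<oplus>\<^bsub>TM\<^esub> g \<odot>\<^bsub>TM\<^esub> X"
    using fg by (simp add: x TM_smult TM_add tc_eq_iff)
  have "scale (f \<otimes>\<^sub>0 g) x = scale f (scale g x)"
    using x(1) fg by (induction rule: frags_induct) (auto simp: M.smult_assoc1)
  then show "(f \<otimes>\<^sub>0 g) \<odot>\<^bsub>TM\<^esub> X = f \<odot>\<^bsub>TM\<^esub> (g \<odot>\<^bsub>TM\<^esub> X)"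
    using fg by (simp add: x TM_smult)
next
  fix f X assume "f \<in> \<L>" "X \<in> carrier TM"
  then show "f \<odot>\<^bsub>TM\<^esub> X \<in> carrier TM" by (auto simp: TM_carrier TM_smult)
qed (simp add: TM_zero)

sublocale TM: Module.module "L0 m" TM by (rule TM_module)

lemma te_closed [simp, intro]: "v \<in> carrier M \<Longrightarrow> w \<in> carrier N \<Longrightarrow> te v w \<in> carrier TM"
  by (simp add: tensor_elem_def)

lemma te_add_left: "v \<in> carrier M \<Longrightarrow> v' \<in> carrier M \<Longrightarrow> w \<in> carrier N \<Longrightarrow> te (v \<oplus>\<^bsub>M\<^esub> v') w = te v w \<oplus>\<^bsub>TM\<^esub> te v' w"
  using rels_bilinear(1)[of v v' w] by (simp add: tensor_elem_def TM_add tc_eq_iff algebra_simps)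

lemma te_add_right: "v \<in> carrier M \<Longrightarrow> w \<in> carrier N \<Longrightarrow> w' \<in> carrier N \<Longrightarrow> te v (w \<oplus>\<^bsub>N\<^esub> w') = te v w \<oplus>\<^bsub>TM\<^esub> te v w'"
  using rels_bilinear(2)[of v w w'] by (simp add: tensor_elem_def TM_add tc_eq_iff algebra_simps)

lemma te_smult_left: "r \<in> \<L> \<Longrightarrow> te (r \<odot>\<^bsub>M\<^esub> v) w = r \<odot>\<^bsub>TM\<^esub> te v w"
  by (simp add: tensor_elem_def TM_smult)

lemma te_smult_right: "r \<in> \<L> \<Longrightarrow> v \<in> carrier M \<Longrightarrow> w \<in> carrier N \<Longrightarrow> te v (r \<odot>\<^bsub>N\<^esub> w) = te (r \<odot>\<^bsub>M\<^esub> v) w"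
  using rels_diff[OF rels_0 rels_bilinear(3)[of r v w]] by (simp add: tensor_elem_def tc_eq_iff)

text \<open>Universal property of the tensor product: the additive extension of \<open>b\<close> to
  formal sums kills the generating relations, hence takes one value on all representatives of a
  class.\<close>

lemma tensor_lift:
  fixes C :: "('a l0, 'c, 'z) module_scheme" (structure)
  assumes C: "module (L0 m) C"
    and b: "\<And>v w. v \<in> carrier M \<Longrightarrow> w \<in> carrier N \<Longrightarrow> b v w \<in> carrier C"
    and b1: "\<And>v v' w. v \<in> carrier M \<Longrightarrow> v' \<in> carrier M \<Longrightarrow> w \<in> carrier N \<Longrightarrow> b (v \<oplus>\<^bsub>M\<^esub> v') w = b v w \<oplus> b v' w"
    and b2: "\<And>v w w'. v \<in> carrier M \<Longrightarrow> w \<in> carrier N \<Longrightarrow> w' \<in> carrier N \<Longrightarrow> b v (w \<oplus>\<^bsub>N\<^esub> w') = b v w \<oplus> b v w'"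
    and b3: "\<And>r v w. r \<in> \<L> \<Longrightarrow> v \<in> carrier M \<Longrightarrow> w \<in> carrier N \<Longrightarrow> b (r \<odot>\<^bsub>M\<^esub> v) w = r \<odot> b v w"
    and b4: "\<And>r v w. r \<in> \<L> \<Longrightarrow> v \<in> carrier M \<Longrightarrow> w \<in> carrier N \<Longrightarrow> b v (r \<odot>\<^bsub>N\<^esub> w) = r \<odot> b v w"
  obtains T where "\<And>\<alpha>. \<alpha> \<in> carrier TM \<Longrightarrow> T \<alpha> \<in> carrier C"
    "\<And>\<alpha> \<beta>. \<alpha> \<in> carrier TM \<Longrightarrow> \<beta> \<in> carrier TM \<Longrightarrow> T (\<alpha> \<oplus>\<^bsub>TM\<^esub> \<beta>) = T \<alpha> \<oplus> T \<beta>"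
    "\<And>r \<alpha>. r \<in> \<L> \<Longrightarrow> \<alpha> \<in> carrier TM \<Longrightarrow> T (r \<odot>\<^bsub>TM\<^esub> \<alpha>) = r \<odot> T \<alpha>"
    "\<And>v w. v \<in> carrier M \<Longrightarrow> w \<in> carrier N \<Longrightarrow> T (te v w) = b v w"
proof -
  interpret C: Module.module "L0 m" C by (rule C)
  obtain h where h: "h \<in> hom (free_Abelian_group pairs) (add_monoid C)" "\<And>p. p \<in> pairs \<Longrightarrow> h (frag_of p) = (case p of (v, w) \<Rightarrow> b v w)"
    by (rule comm_group.free_Abelian_group_universal[OF C.a_comm_group, of "\<lambda>(v, w). b v w" pairs]) (use b in auto)
  have hc: "h x \<in> carrier C" if "x \<in> frags" for x
    using hom_in_carrier[OF h(1), of x] that by (simp add: frags_def)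
  have ha: "h (x + y) = h x \<oplus> h y" if "x \<in> frags" "y \<in> frags" for x y
    using hom_mult[OF h(1), of x y] that by (simp add: frags_def)
  have hb: "h (frag_of (v, w)) = b v w" if "v \<in> carrier M" "w \<in> carrier N" for v w
    using h(2)[of "(v, w)"] that by simp
  have hd: "h (x - y) = h x \<ominus> h y" if "x \<in> frags" "y \<in> frags" for x y
  proof -
    have "h x = h (x - y) \<oplus> h y" using ha[of "x - y" y] that by simp
    then show ?thesis using hc[OF that(1)] hc[OF that(2)] hc[of "x - y"] that
      by (simp add: a_minus_def C.a_assoc C.r_neg)
  qed
  have h0: "h 0 = \<zero>" using hd[of 0 0] hc[of 0] by (simp add: a_minus_def C.r_neg)
  have hr: "h x = \<zero>" if "x \<in> rels" for x
    using that
  proof (induction rule: rels_induct)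
    case (gen x)
    then consider (a) v v' w where "v \<in> carrier M" "v' \<in> carrier M" "w \<in> carrier N" "x = frag_of (v \<oplus>\<^bsub>M\<^esub> v', w) - frag_of (v, w) - frag_of (v', w)"
      | (b) v w w' where "v \<in> carrier M" "w \<in> carrier N" "w' \<in> carrier N" "x = frag_of (v, w \<oplus>\<^bsub>N\<^esub> w') - frag_of (v, w) - frag_of (v, w')"
      | (c) s v w where "s \<in> \<L>" "v \<in> carrier M" "w \<in> carrier N" "x = frag_of (s \<odot>\<^bsub>M\<^esub> v, w) - frag_of (v, s \<odot>\<^bsub>N\<^esub> w)"
      by (auto simp: gens_def)
    then show ?case
    proof cases
      case a
      have "b v w \<oplus> b v' w \<ominus> b v w \<ominus> b v' w = \<zero>"
        using b[OF a(1,3)] b[OF a(2,3)] by (simp add: a_minus_def C.a_ac C.r_neg C.r_neg1 C.r_neg2)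
      then show ?thesis using a by (simp add: hd hb b1)
    next
      case b': b
      have "b v w \<oplus> b v w' \<ominus> b v w \<ominus> b v w' = \<zero>"
        using b[OF b'(1,2)] b[OF b'(1,3)] by (simp add: a_minus_def C.a_ac C.r_neg C.r_neg1 C.r_neg2)
      then show ?thesis using b' by (simp add: hd hb b2)
    next
      case c
      then show ?thesis using b[OF c(2,3)] by (simp add: hd hb b3 b4 a_minus_def C.r_neg)
    qed
  next
    case (diff x y)
    then show ?case by (simp add: hd rels_frags a_minus_def C.r_neg)
  qed (rule h0)
  have hs: "h (scale r x) = r \<odot> h x" if r: "r \<in> \<L>" and x: "x \<in> frags" for r x
    using x
  proof (induction rule: frags_induct)
    case (diff x y)
    then show ?case using r hc[of x] hc[of y] by (simp add: hd a_minus_def C.smult_r_distr C.smult_r_minus)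
  qed (use r in \<open>auto simp: h0 hb b3\<close>)
  define T where "T \<alpha> = h (SOME x. x \<in> \<alpha> \<and> x \<in> frags)" for \<alpha>
  have T: "T (tc x) = h x" if x: "x \<in> frags" for x
  proof -
    have "(SOME y. y \<in> tc x \<and> y \<in> frags) \<in> tc x \<and> (SOME y. y \<in> tc x \<and> y \<in> frags) \<in> frags"
      by (rule someI[of _ x]) (use x in \<open>auto simp: mem_tc\<close>)
    then have y: "(SOME y. y \<in> tc x \<and> y \<in> frags) - x \<in> rels" "(SOME y. y \<in> tc x \<and> y \<in> frags) \<in> frags" by (auto simp: mem_tc)
    have "T (tc x) = h ((SOME y. y \<in> tc x \<and> y \<in> frags) - x) \<oplus> h x"
      using ha[OF rels_frags[OF y(1)] x] by (simp add: T_def)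
    then show ?thesis using hr[OF y(1)] hc[OF x] by simp
  qed
  show thesis
  proof (rule that[of T])
    show "T \<alpha> \<in> carrier C" if "\<alpha> \<in> carrier TM" for \<alpha> using that hc by (auto simp: TM_carrier T)
    show "T (\<alpha> \<oplus>\<^bsub>TM\<^esub> \<beta>) = T \<alpha> \<oplus> T \<beta>" if "\<alpha> \<in> carrier TM" "\<beta> \<in> carrier TM" for \<alpha> \<beta>
      using that by (auto simp: TM_carrier TM_add T ha)
    show "T (r \<odot>\<^bsub>TM\<^esub> \<alpha>) = r \<odot> T \<alpha>" if "r \<in> \<L>" "\<alpha> \<in> carrier TM" for r \<alpha>
      using that by (auto simp: TM_carrier TM_smult T hs)
    show "T (te v w) = b v w" if "v \<in> carrier M" "w \<in> carrier N" for v w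
      using that by (simp add: tensor_elem_def T hb)
  qed
qed

text \<open>
  \<open>trep \<alpha> s\<close>: the class \<open>s\<close> is the sum \<open>\<Sum>i. \<bar>v i\<bar> \<bar>w i\<bar>\<close> of some representation of \<open>\<alpha>\<close>.
\<close>

inductive trep :: "('m \<times> 'n \<Rightarrow>\<^sub>0 int) set \<Rightarrow> 'a l0 \<Rightarrow> bool" where
  trep_zero: "trep \<zero>\<^bsub>TM\<^esub> \<zero>\<^sub>0"
| trep_step: "trep \<alpha> s \<Longrightarrow> v \<in> carrier M \<Longrightarrow> w \<in> carrier N \<Longrightarrow>
    trep (\<alpha> \<oplus>\<^bsub>TM\<^esub> te v w) (s \<oplus>\<^sub>0 \<parallel>v\<parallel>\<^bsub>M\<^esub> \<otimes>\<^sub>0 \<parallel>w\<parallel>\<^bsub>N\<^esub>)"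

lemma trep_closed: "trep \<alpha> s \<Longrightarrow> \<alpha> \<in> carrier TM \<and> s \<in> L0_pos m"
  by (induction rule: trep.induct) auto

lemma trep_te: "v \<in> carrier M \<Longrightarrow> w \<in> carrier N \<Longrightarrow> trep (te v w) (\<parallel>v\<parallel>\<^bsub>M\<^esub> \<otimes>\<^sub>0 \<parallel>w\<parallel>\<^bsub>N\<^esub>)"
  using trep_step[OF trep_zero, of v w] by simp

lemma trep_add:
  assumes a: "trep \<alpha> s" and b: "trep \<beta> t"
  shows "trep (\<alpha> \<oplus>\<^bsub>TM\<^esub> \<beta>) (s \<oplus>\<^sub>0 t)"
  using b
proof (induction rule: trep.induct)
  case trep_zero then show ?case using a trep_closed[OF a] by simp
next
  case (trep_step \<beta> t v w)
  then show ?case using trep.trep_step[OF trep_step(4,2,3)] trep_closed[OF a] trep_closed[OF trep_step(1)]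
    by (simp add: TM.M.a_assoc L0.a_assoc)
qed

lemma trep_smult:
  assumes r: "r \<in> \<L>" and a: "trep \<alpha> s"
  shows "trep (r \<odot>\<^bsub>TM\<^esub> \<alpha>) (\<parallel>r\<parallel>\<^sub>0 \<otimes>\<^sub>0 s)"
  using a
proof (induction rule: trep.induct)
  case trep_zero then show ?case using r trep.trep_zero by simp
next
  case (trep_step \<alpha> s v w)
  have "trep (r \<odot>\<^bsub>TM\<^esub> \<alpha> \<oplus>\<^bsub>TM\<^esub> te (r \<odot>\<^bsub>M\<^esub> v) w) (\<parallel>r\<parallel>\<^sub>0 \<otimes>\<^sub>0 s \<oplus>\<^sub>0 \<parallel>r \<odot>\<^bsub>M\<^esub> v\<parallel>\<^bsub>M\<^esub> \<otimes>\<^sub>0 \<parallel>w\<parallel>\<^bsub>N\<^esub>)"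
    by (rule trep.trep_step) (use trep_step r in auto)
  then show ?case using r trep_step trep_closed[OF trep_step(1)]
    by (simp add: te_smult_left TM.smult_r_distr M.norm_smult L0.r_distr L0.m_assoc)
qed

lemma trep_exists:
  assumes "\<alpha> \<in> carrier TM" shows "\<exists>s. trep \<alpha> s"
proof -
  obtain x where x: "x \<in> frags" "\<alpha> = tc x" using assms by (auto simp: TM_carrier)
  have "\<exists>s. trep (tc x) s" using x(1)
  proof (induction rule: frags_induct)
    case zero then show ?case using trep_zero by (auto simp: TM_zero)
  next
    case (diff x y)
    then obtain s t where st: "trep (tc x) s" "trep (tc y) t" by blast
    \<comment> \<open>The induction over formal sums produces differences; the minus sign is
      absorbed as the scalar -1, which \<open>trep_smult\<close> can handle.\<close>
    have "tc x \<oplus>\<^bsub>TM\<^esub> (\<ominus>\<^bsub>L0 m\<^esub> \<one>\<^sub>0) \<odot>\<^bsub>TM\<^esub> tc y = tc (x - y)"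
    proof -
      have "\<ominus>\<^bsub>TM\<^esub> tc y = tc (- y)"
        by (rule TM.M.minus_equality) (use diff in \<open>auto simp: TM_add TM_zero\<close>)
      then show ?thesis using diff by (simp add: TM.smult_l_minus TM_add)
    qed
    then show ?case using trep_add[OF st(1) trep_smult[OF _ st(2), of "\<ominus>\<^bsub>L0 m\<^esub> \<one>\<^sub>0"]] by auto
  next
    case (of v w)
    then show ?case using trep_te[of v w] by (auto simp: tensor_elem_def)
  qed
  then show ?thesis using x by simp
qed

text \<open>Connects the inductive predicate, made for inductions over a representation, with the
  indexed sums that occur in \<open>proj_norm\<close>.\<close>

lemma trep_iff:
  "trep \<alpha> s \<longleftrightarrow> (\<exists>(n::nat) v w. (\<forall>i<n. v i \<in> carrier M \<and> w i \<in> carrier N) \<and>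
      \<alpha> = (\<Oplus>\<^bsub>TM\<^esub>i\<in>{..<n}. te (v i) (w i)) \<and> s = (\<Oplus>\<^bsub>L0 m\<^esub>i\<in>{..<n}. \<parallel>v i\<parallel>\<^bsub>M\<^esub> \<otimes>\<^sub>0 \<parallel>w i\<parallel>\<^bsub>N\<^esub>))"
proof
  assume "trep \<alpha> s"
  then show "\<exists>(n::nat) v w. (\<forall>i<n. v i \<in> carrier M \<and> w i \<in> carrier N) \<and>
      \<alpha> = (\<Oplus>\<^bsub>TM\<^esub>i\<in>{..<n}. te (v i) (w i)) \<and> s = (\<Oplus>\<^bsub>L0 m\<^esub>i\<in>{..<n}. \<parallel>v i\<parallel>\<^bsub>M\<^esub> \<otimes>\<^sub>0 \<parallel>w i\<parallel>\<^bsub>N\<^esub>)"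
  proof (induction rule: trep.induct)
    case trep_zero
    show ?case by (rule exI[of _ 0]) simp
  next
    case (trep_step \<alpha> s v0 w0)
    then obtain n :: nat and v w where vw: "\<forall>i<n. v i \<in> carrier M \<and> w i \<in> carrier N"
      "\<alpha> = (\<Oplus>\<^bsub>TM\<^esub>i\<in>{..<n}. te (v i) (w i))" "s = (\<Oplus>\<^bsub>L0 m\<^esub>i\<in>{..<n}. \<parallel>v i\<parallel>\<^bsub>M\<^esub> \<otimes>\<^sub>0 \<parallel>w i\<parallel>\<^bsub>N\<^esub>)" by blast
    \<comment> \<open>Updating at index \<open>n\<close> appends the new pair and leaves the smaller
      indices untouched.\<close>
    let ?v = "v(n := v0)" and ?w = "w(n := w0)"
    have 1: "(\<Oplus>\<^bsub>TM\<^esub>i\<in>{..<n}. te (?v i) (?w i)) = \<alpha>"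
      unfolding vw(2) by (rule TM.M.finsum_cong') (use vw(1) in auto)
    have 2: "(\<Oplus>\<^bsub>L0 m\<^esub>i\<in>{..<n}. \<parallel>?v i\<parallel>\<^bsub>M\<^esub> \<otimes>\<^sub>0 \<parallel>?w i\<parallel>\<^bsub>N\<^esub>) = s"
      unfolding vw(3) by (rule L0.finsum_cong') (use vw(1) in auto)
    have 3: "(\<Oplus>\<^bsub>TM\<^esub>i\<in>{..<Suc n}. te (?v i) (?w i)) = te v0 w0 \<oplus>\<^bsub>TM\<^esub> \<alpha>"
      unfolding lessThan_Suc by (subst TM.M.finsum_insert) (use vw(1) trep_step(2,3) 1 in auto)
    have 4: "(\<Oplus>\<^bsub>L0 m\<^esub>i\<in>{..<Suc n}. \<parallel>?v i\<parallel>\<^bsub>M\<^esub> \<otimes>\<^sub>0 \<parallel>?w i\<parallel>\<^bsub>N\<^esub>) = \<parallel>v0\<parallel>\<^bsub>M\<^esub> \<otimes>\<^sub>0 \<parallel>w0\<parallel>\<^bsub>N\<^esub> \<oplus>\<^sub>0 s"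
      unfolding lessThan_Suc by (subst L0.finsum_insert) (use vw(1) trep_step(2,3) 2 in auto)
    show ?case
      using vw(1) trep_step 3 4 trep_closed[OF trep_step(1)]
      by (intro exI[of _ "Suc n"] exI[of _ ?v] exI[of _ ?w]) (auto simp: TM.M.a_comm L0.a_comm less_Suc_eq)
  qed
next
  assume "\<exists>(n::nat) v w. (\<forall>i<n. v i \<in> carrier M \<and> w i \<in> carrier N) \<and>
      \<alpha> = (\<Oplus>\<^bsub>TM\<^esub>i\<in>{..<n}. te (v i) (w i)) \<and> s = (\<Oplus>\<^bsub>L0 m\<^esub>i\<in>{..<n}. \<parallel>v i\<parallel>\<^bsub>M\<^esub> \<otimes>\<^sub>0 \<parallel>w i\<parallel>\<^bsub>N\<^esub>)"
  then obtain n :: nat and v w where vw: "\<forall>i<n. v i \<in> carrier M \<and> w i \<in> carrier N"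
      "\<alpha> = (\<Oplus>\<^bsub>TM\<^esub>i\<in>{..<n}. te (v i) (w i))" "s = (\<Oplus>\<^bsub>L0 m\<^esub>i\<in>{..<n}. \<parallel>v i\<parallel>\<^bsub>M\<^esub> \<otimes>\<^sub>0 \<parallel>w i\<parallel>\<^bsub>N\<^esub>)" by blast
  have "trep (\<Oplus>\<^bsub>TM\<^esub>i\<in>{..<k}. te (v i) (w i)) (\<Oplus>\<^bsub>L0 m\<^esub>i\<in>{..<k}. \<parallel>v i\<parallel>\<^bsub>M\<^esub> \<otimes>\<^sub>0 \<parallel>w i\<parallel>\<^bsub>N\<^esub>)" if "k \<le> n" for k
    using that
  proof (induction k)
    case 0 show ?case using trep_zero by simp
  next
    case (Suc k)
    then have *: "\<forall>i\<le>k. v i \<in> carrier M \<and> w i \<in> carrier N" using vw(1) by auto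
    have IH: "trep (\<Oplus>\<^bsub>TM\<^esub>i\<in>{..<k}. te (v i) (w i)) (\<Oplus>\<^bsub>L0 m\<^esub>i\<in>{..<k}. \<parallel>v i\<parallel>\<^bsub>M\<^esub> \<otimes>\<^sub>0 \<parallel>w i\<parallel>\<^bsub>N\<^esub>)" using Suc by simp
    have "(\<Oplus>\<^bsub>TM\<^esub>i\<in>{..<Suc k}. te (v i) (w i)) = te (v k) (w k) \<oplus>\<^bsub>TM\<^esub> (\<Oplus>\<^bsub>TM\<^esub>i\<in>{..<k}. te (v i) (w i))"
      unfolding lessThan_Suc by (rule TM.M.finsum_insert) (use * in auto)
    moreover have "(\<Oplus>\<^bsub>L0 m\<^esub>i\<in>{..<Suc k}. \<parallel>v i\<parallel>\<^bsub>M\<^esub> \<otimes>\<^sub>0 \<parallel>w i\<parallel>\<^bsub>N\<^esub>) = \<parallel>v k\<parallel>\<^bsub>M\<^esub> \<otimes>\<^sub>0 \<parallel>w k\<parallel>\<^bsub>N\<^esub> \<oplus>\<^sub>0 (\<Oplus>\<^bsub>L0 m\<^esub>i\<in>{..<k}. \<parallel>v i\<parallel>\<^bsub>M\<^esub> \<otimes>\<^sub>0 \<parallel>w i\<parallel>\<^bsub>N\<^esub>)"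
      unfolding lessThan_Suc by (rule L0.finsum_insert) (use * in auto)
    ultimately show ?case using trep_step[OF IH, of "v k" "w k"] * trep_closed[OF IH] by (auto simp: TM.M.a_comm L0.a_comm)
  qed
  then show "trep \<alpha> s" using vw by auto
qed

section \<open>The projective seminorm\<close>

abbreviation "pn \<equiv> proj_norm m M N"

text \<open>Every tensor has a representation and all representation sums are nonnegative, so the
  infimum runs over a nonempty family bounded below by 0 and lies in \<open>L0\<close>.\<close>

lemma pn_inf:
  assumes a: "\<alpha> \<in> carrier TM"
  shows pn_pos: "pn \<alpha> \<in> L0_pos m"
    and pn_le: "trep \<alpha> s \<Longrightarrow> L0_le m (pn \<alpha>) s"
    and pn_greatest: "G \<in> \<L> \<Longrightarrow> (\<And>s. trep \<alpha> s \<Longrightarrow> L0_le m G s) \<Longrightarrow> L0_le m G (pn \<alpha>)"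
proof -
  have eq: "pn \<alpha> = L0_of_bar m (\<Sqinter>\<^bsub>L0bar m\<^esub> (L0_to_bar m ` {s. trep \<alpha> s}))"
    unfolding proj_norm_def trep_iff by (rule arg_cong[where f="\<lambda>S. L0_of_bar m (\<Sqinter>\<^bsub>L0bar m\<^esub> S)"]) blast
  have "{s. trep \<alpha> s} \<subseteq> \<L>" "{s. trep \<alpha> s} \<noteq> {}" using trep_closed trep_exists[OF a] by auto
  note s = L0_inf[OF this L0.zero_closed, folded eq]
  have s0: "\<And>F. F \<in> {s. trep \<alpha> s} \<Longrightarrow> L0_le m \<zero>\<^sub>0 F" using trep_closed L0_pos_le by auto
  have "L0_le m \<zero>\<^sub>0 (pn \<alpha>)" by (rule s(3)[OF s0]) (use s0 in auto)
  then show "pn \<alpha> \<in> L0_pos m" using s(1)[OF s0] by (simp add: L0_pos_def del: L0_pos_closed)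
  show "trep \<alpha> s \<Longrightarrow> L0_le m (pn \<alpha>) s" by (rule s(2)[OF s0]) auto
  show "G \<in> \<L> \<Longrightarrow> (\<And>s. trep \<alpha> s \<Longrightarrow> L0_le m G s) \<Longrightarrow> L0_le m G (pn \<alpha>)" by (rule s(3)[OF s0]) auto
qed

text \<open>The two infima are taken one after the other. With a representation of \<beta> fixed,
  the inequality is rearranged into a lower bound for all representations of \<alpha>; rearranged
  again, it becomes a lower bound for all representations of \<beta>.\<close>

lemma pn_triangle:
  assumes a: "\<alpha> \<in> carrier TM" "\<beta> \<in> carrier TM"
  shows "L0_le m (pn (\<alpha> \<oplus>\<^bsub>TM\<^esub> \<beta>)) (pn \<alpha> \<oplus>\<^sub>0 pn \<beta>)"
proof -
  have ab: "\<alpha> \<oplus>\<^bsub>TM\<^esub> \<beta> \<in> carrier TM" using a by simp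
  note c = L0_pos_closed[OF pn_pos[OF a(1)]] L0_pos_closed[OF pn_pos[OF a(2)]] L0_pos_closed[OF pn_pos[OF ab]]
  have t: "L0_le m (pn (\<alpha> \<oplus>\<^bsub>TM\<^esub> \<beta>) \<ominus>\<^sub>0 pn \<alpha>) t" if t: "trep \<beta> t" for t
  proof -
    have tc: "t \<in> \<L>" using trep_closed[OF t] by auto
    have "L0_le m (pn (\<alpha> \<oplus>\<^bsub>TM\<^esub> \<beta>) \<ominus>\<^sub>0 t) (pn \<alpha>)"
    proof (rule pn_greatest[OF a(1)])
      fix s assume s: "trep \<alpha> s"
      then have sc: "s \<in> \<L>" using trep_closed[OF s] by auto
      have "L0_le m (pn (\<alpha> \<oplus>\<^bsub>TM\<^esub> \<beta>)) (t \<oplus>\<^sub>0 s)"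
        using pn_le[OF ab trep_add[OF s t]] sc tc by (simp add: L0.a_comm)
      then show "L0_le m (pn (\<alpha> \<oplus>\<^bsub>TM\<^esub> \<beta>) \<ominus>\<^sub>0 t) s" using sc tc c by (simp add: L0_diff_le_iff)
    qed (use c tc in auto)
    then show ?thesis using c tc by (simp add: L0_diff_le_iff L0.a_comm)
  qed
  have "L0_le m (pn (\<alpha> \<oplus>\<^bsub>TM\<^esub> \<beta>) \<ominus>\<^sub>0 pn \<alpha>) (pn \<beta>)"
    by (rule pn_greatest[OF a(2)]) (use c t in auto)
  then show ?thesis using c by (simp add: L0_diff_le_iff)
qed

text \<open>The factor |f| cannot be divided out where \<open>f\<close> vanishes. With the partial
  inverse \<open>g\<close>, the class |g| times the norm of \<open>f \<odot> \<alpha>\<close> is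
  below every representation sum of \<alpha>, hence below \<open>pn \<alpha>\<close>; multiplying by
  |f| gives the claim where \<open>f\<close> is nonzero.\<close>

lemma pn_smult_le:
  assumes f: "f \<in> \<L>" and a: "\<alpha> \<in> carrier TM"
  shows "L0_le m (pn (f \<odot>\<^bsub>TM\<^esub> \<alpha>)) (\<parallel>f\<parallel>\<^sub>0 \<otimes>\<^sub>0 pn \<alpha>)"
proof -
  have fa: "f \<odot>\<^bsub>TM\<^esub> \<alpha> \<in> carrier TM" using f a by simp
  note c = L0_pos_closed[OF pn_pos[OF a]] L0_pos_closed[OF pn_pos[OF fa]]
  obtain g where g: "g \<in> \<L>" "AE x in m. L0_rep g x = (if L0_rep f x = 0 then 0 else 1 / L0_rep f x)"
    using L0_inverse_exists[OF f] by blast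
  let ?G = "\<parallel>g\<parallel>\<^sub>0 \<otimes>\<^sub>0 pn (f \<odot>\<^bsub>TM\<^esub> \<alpha>)"
  have G: "AE x in m. L0_rep ?G x = \<bar>L0_rep g x\<bar> * L0_rep (pn (f \<odot>\<^bsub>TM\<^esub> \<alpha>)) x"
    using AE_rep_mult[OF L0_norm_closed[OF g(1)] c(2)] AE_rep_norm[OF g(1)] by eventually_elim simp
  have le: "AE x in m. L0_rep (pn (f \<odot>\<^bsub>TM\<^esub> \<alpha>)) x \<le> \<bar>L0_rep f x\<bar> * L0_rep s x" if s: "trep \<alpha> s" for s
  proof -
    have sc: "s \<in> \<L>" using trep_closed[OF s] by auto
    have "AE x in m. L0_rep (pn (f \<odot>\<^bsub>TM\<^esub> \<alpha>)) x \<le> L0_rep (\<parallel>f\<parallel>\<^sub>0 \<otimes>\<^sub>0 s) x"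
      using pn_le[OF fa trep_smult[OF f s]] f sc c by (simp add: L0_le_iff)
    then show ?thesis using AE_rep_mult[OF L0_norm_closed[OF f] sc] AE_rep_norm[OF f] by eventually_elim simp
  qed
  have "L0_le m ?G (pn \<alpha>)"
  proof (rule pn_greatest[OF a])
    show "?G \<in> \<L>" using g c by simp
    fix s assume s: "trep \<alpha> s"
    have sp: "s \<in> L0_pos m" using trep_closed[OF s] by auto
    have "AE x in m. L0_rep ?G x \<le> L0_rep s x"
      using le[OF s] AE_rep_pos[OF sp] G g(2)
    proof eventually_elim
      case (elim x)
      show ?case
      proof (cases "L0_rep f x = 0")
        case False
        then have "L0_rep ?G x = L0_rep (pn (f \<odot>\<^bsub>TM\<^esub> \<alpha>)) x / \<bar>L0_rep f x\<bar>" using elim by simp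
        also have "\<dots> \<le> L0_rep s x" using elim(1) False by (simp add: divide_le_eq mult.commute)
        finally show ?thesis .
      qed (use elim in simp)
    qed
    then show "L0_le m ?G s" using g c sp by (simp add: L0_le_iff)
  qed
  then have 1: "AE x in m. L0_rep ?G x \<le> L0_rep (pn \<alpha>) x" using g c by (simp add: L0_le_iff)
  \<comment> \<open>Where \<open>f\<close> vanishes, a single representation of \<alpha> is enough:
    scaled by \<open>f\<close>, its sum is 0 there.\<close>
  obtain s where s: "trep \<alpha> s" using trep_exists[OF a] by blast
  have "AE x in m. L0_rep (pn (f \<odot>\<^bsub>TM\<^esub> \<alpha>)) x \<le> L0_rep (\<parallel>f\<parallel>\<^sub>0 \<otimes>\<^sub>0 pn \<alpha>) x"
    using 1 G g(2) le[OF s] AE_rep_mult[OF L0_norm_closed[OF f] c(1)] AE_rep_norm[OF f]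
  proof eventually_elim
    case (elim x)
    then show ?case by (cases "L0_rep f x = 0") (auto simp: field_simps)
  qed
  then show ?thesis using f c by (simp add: L0_le_iff)
qed

lemma AT_simps [simp]: "carrier AT = carrier TM" "\<zero>\<^bsub>AT\<^esub> = \<zero>\<^bsub>TM\<^esub>" "add AT = add TM" "smult AT = smult TM" "rnorm AT = pn"
  by (simp_all add: alg_proj_tensor_def module.extend_def)

lemma AT_module: "module (L0 m) AT"
proof (intro moduleI L0_cring abelian_groupI)
  show "\<exists>y\<in>carrier AT. y \<oplus>\<^bsub>AT\<^esub> x = \<zero>\<^bsub>AT\<^esub>" if "x \<in> carrier AT" for x
    using that by (auto intro!: bexI[of _ "\<ominus>\<^bsub>TM\<^esub> x"] simp: TM.M.l_neg)
  show "x \<oplus>\<^bsub>AT\<^esub> y = y \<oplus>\<^bsub>AT\<^esub> x" if "x \<in> carrier AT" "y \<in> carrier AT" for x y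
    using that by (simp add: TM.M.a_comm)
qed (auto simp: TM.M.a_assoc TM.smult_l_distr TM.smult_r_distr TM.smult_assoc1)

lemma AT_seminormed: "seminormed_L0_module m AT"
  by (rule seminormed_of_subhomogeneous[OF AT_module]) (auto intro: pn_pos pn_triangle pn_smult_le)

sublocale AT: seminormed_L0_module m AT by (rule AT_seminormed)

lemma pn_te: "v \<in> carrier M \<Longrightarrow> w \<in> carrier N \<Longrightarrow> L0_le m (pn (te v w)) (\<parallel>v\<parallel>\<^bsub>M\<^esub> \<otimes>\<^sub>0 \<parallel>w\<parallel>\<^bsub>N\<^esub>)"
  by (rule pn_le) (auto intro: trep_te)

text \<open>Adding up the bound over a representation of \<alpha> places the norm of
  \<open>T \<alpha>\<close> below its sum, and \<open>pn \<alpha>\<close> is the greatest lower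
  bound of all these sums.\<close>

lemma pn_contraction:
  assumes C: "seminormed_L0_module m C"
    and Tc: "\<And>\<alpha>. \<alpha> \<in> carrier TM \<Longrightarrow> T \<alpha> \<in> carrier C"
    and Ta: "\<And>\<alpha> \<beta>. \<alpha> \<in> carrier TM \<Longrightarrow> \<beta> \<in> carrier TM \<Longrightarrow> T (\<alpha> \<oplus>\<^bsub>TM\<^esub> \<beta>) = T \<alpha> \<oplus>\<^bsub>C\<^esub> T \<beta>"
    and T0: "T \<zero>\<^bsub>TM\<^esub> = \<zero>\<^bsub>C\<^esub>"
    and Tb: "\<And>v w. v \<in> carrier M \<Longrightarrow> w \<in> carrier N \<Longrightarrow> L0_le m \<parallel>T (te v w)\<parallel>\<^bsub>C\<^esub> (\<parallel>v\<parallel>\<^bsub>M\<^esub> \<otimes>\<^sub>0 \<parallel>w\<parallel>\<^bsub>N\<^esub>)"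
    and a: "\<alpha> \<in> carrier TM"
  shows "L0_le m \<parallel>T \<alpha>\<parallel>\<^bsub>C\<^esub> (pn \<alpha>)"
proof (rule pn_greatest[OF a])
  interpret C: seminormed_L0_module m C by (rule C)
  show "\<parallel>T \<alpha>\<parallel>\<^bsub>C\<^esub> \<in> \<L>" using Tc[OF a] by simp
  fix s assume "trep \<alpha> s"
  then show "L0_le m \<parallel>T \<alpha>\<parallel>\<^bsub>C\<^esub> s"
  proof (induction rule: trep.induct)
    case trep_zero then show ?case by (simp add: T0)
  next
    case (trep_step \<alpha> s v w)
    note p = trep_closed[OF trep_step(1)]
    have te: "te v w \<in> carrier TM" using trep_step by simp
    have "L0_le m \<parallel>T (\<alpha> \<oplus>\<^bsub>TM\<^esub> te v w)\<parallel>\<^bsub>C\<^esub> (\<parallel>T \<alpha>\<parallel>\<^bsub>C\<^esub> \<oplus>\<^sub>0 \<parallel>T (te v w)\<parallel>\<^bsub>C\<^esub>)"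
      using p te by (simp add: Ta) (intro C.norm_triangle Tc; simp)
    moreover have "L0_le m (\<parallel>T \<alpha>\<parallel>\<^bsub>C\<^esub> \<oplus>\<^sub>0 \<parallel>T (te v w)\<parallel>\<^bsub>C\<^esub>) (s \<oplus>\<^sub>0 \<parallel>v\<parallel>\<^bsub>M\<^esub> \<otimes>\<^sub>0 \<parallel>w\<parallel>\<^bsub>N\<^esub>)"
      by (rule L0_add_mono[OF trep_step.IH Tb[OF trep_step(2,3)]]) (use p te trep_step(2,3) Tc in auto)
    ultimately show ?case
      by (rule L0_le_trans) (use p te trep_step(2,3) Tc in auto)
  qed
qed

end

section \<open>The isomorphism\<close>

locale L0_bochner_tensor = L0_bochner m \<Omega> \<A> \<mu> M + L: L0_bochner m \<Omega> \<A> \<mu> "L0 m"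
  for m :: "'a measure" and \<Omega> :: "'b set" and \<A> \<mu> and M :: "('a l0, 'c) rnm" (structure)
begin

sublocale Q: banach_L0_module m SM.Cpl by (rule SM.Cpl_banach)
sublocale X: banach_L0_module m L.SM.Cpl by (rule L.SM.Cpl_banach)
sublocale T: L0_tensor m L.SM.Cpl M
  by (intro L0_tensor.intro L0_base_axioms X.seminormed_L0_module_axioms M.seminormed_L0_module_axioms)

lemma srep_mult:
  assumes s: "L.srep C c s" and w: "w \<in> carrier M"
  shows "srep C (\<lambda>n. c n \<odot> w) (\<lambda>\<omega>. s \<omega> \<odot> w)"
    and "rep_norm C (\<lambda>n. c n \<odot> w) = \<parallel>w\<parallel> \<otimes>\<^sub>0 L.rep_norm C c"
proof -
  note C = L.srepD[OF s]
  note p = L0_pos_closed[OF L.rep_norm(1)[OF s]]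
  have "AE x in m. \<forall>n. L0_rep \<parallel>c n \<odot> w\<parallel> x = L0_rep \<parallel>c n\<parallel>\<^sub>0 x * L0_rep \<parallel>w\<parallel> x"
    using C(3) w by (subst AE_all_countable) (auto simp: M.norm_smult intro!: AE_rep_mult)
  then have *: "AE x in m. (\<lambda>n. L0_rep (V (C n)) x * L0_rep \<parallel>c n \<odot> w\<parallel> x) sums L0_rep (\<parallel>w\<parallel> \<otimes>\<^sub>0 L.rep_norm C c) x"
    using L.rep_norm(2)[OF s] AE_rep_mult[OF M.norm_closed[OF w] p]
  proof eventually_elim
    case (elim x)
    have "(\<lambda>n. L0_rep (V (C n)) x * L0_rep \<parallel>c n\<parallel>\<^sub>0 x * L0_rep \<parallel>w\<parallel> x) sums (L0_rep (L.rep_norm C c) x * L0_rep \<parallel>w\<parallel> x)"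
      by (rule sums_mult2[OF elim(2)])
    then show ?case using elim(1,3) by (simp add: mult_ac)
  qed
  then have "AE x in m. summable (\<lambda>n. L0_rep (V (C n)) x * L0_rep \<parallel>c n \<odot> w\<parallel> x)"
    by (rule eventually_mono) (rule sums_summable)
  then show r: "srep C (\<lambda>n. c n \<odot> w) (\<lambda>\<omega>. s \<omega> \<odot> w)"
    unfolding srep_iff using C(1,3,4) w by auto
  show "rep_norm C (\<lambda>n. c n \<odot> w) = \<parallel>w\<parallel> \<otimes>\<^sub>0 L.rep_norm C c"
    by (rule rep_norm_eqI[OF r _ *]) (use w p in auto)
qed

lemma S1f_mult [simp, intro]: "s \<in> L.S1f \<Longrightarrow> w \<in> carrier M \<Longrightarrow> (\<lambda>\<omega>. s \<omega> \<odot> w) \<in> S1f"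
  unfolding S1f_iff L.S1f_iff using srep_mult(1) by blast

text \<open>The vector comes first because, for fixed \<open>w\<close>, this is the homomorphism to
  be extended to the completion. The chosen representative is immaterial by
  \<open>S1_mult_cl\<close>.\<close>

definition S1_mult :: "'c \<Rightarrow> ('b \<Rightarrow> 'a l0) set \<Rightarrow> ('b \<Rightarrow> 'c) set" where
  "S1_mult w S = cl (\<lambda>\<omega>. (SOME s. s \<in> S) \<omega> \<odot> w)"

lemma S1_mult_cl:
  assumes s: "s \<in> L.S1f" and w: "w \<in> carrier M"
  shows "S1_mult w (L.cl s) = cl (\<lambda>\<omega>. s \<omega> \<odot> w)"
proof -
  have "(SOME s'. s' \<in> L.cl s) \<in> L.cl s" by (rule someI[of "\<lambda>s'. s' \<in> L.cl s"]) (rule L.cl_self[OF s])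
  then obtain N where N: "(SOME s'. s' \<in> L.cl s) \<in> L.S1f" "N \<in> \<A>" "V N = \<zero>\<^sub>0" "\<forall>\<omega>\<in>\<Omega> - N. s \<omega> = (SOME s'. s' \<in> L.cl s) \<omega>"
    using L.mem_cl[OF s] by blast
  then show ?thesis
    unfolding S1_mult_def using s w by (subst cl_eq_iff) (auto intro!: bexI[of _ N])
qed

lemma S1_mult_closed [simp, intro]: "S \<in> carrier L.SM \<Longrightarrow> w \<in> carrier M \<Longrightarrow> S1_mult w S \<in> carrier SM"
  by (erule L.SM_cases) (simp add: S1_mult_cl)

lemma S1_mult_add_left:
  assumes "S \<in> carrier L.SM" "S' \<in> carrier L.SM" "w \<in> carrier M"
  shows "S1_mult w (S \<oplus>\<^bsub>L.SM\<^esub> S') = S1_mult w S \<oplus>\<^bsub>SM\<^esub> S1_mult w S'"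
proof -
  obtain s s' where *: "s \<in> L.S1f" "s' \<in> L.S1f" "S = L.cl s" "S' = L.cl s'" using assms by (metis L.SM_cases)
  show ?thesis unfolding *(3,4) using *(1,2) assms(3)
    by (simp add: S1_mult_cl cl_add L.cl_add) (rule cl_eqI; simp add: M.smult_l_distr L.S1f_closed)
qed

lemma S1_mult_smult_left:
  assumes "f \<in> \<L>" "S \<in> carrier L.SM" "w \<in> carrier M"
  shows "S1_mult w (f \<odot>\<^bsub>L.SM\<^esub> S) = f \<odot>\<^bsub>SM\<^esub> S1_mult w S"
proof -
  obtain s where *: "s \<in> L.S1f" "S = L.cl s" using assms by (metis L.SM_cases)
  have f: "(\<lambda>\<omega>. f \<otimes>\<^sub>0 s \<omega>) \<in> L.S1f" using L.S1f_smult[OF assms(1) *(1)] by simp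
  show ?thesis unfolding *(2) using *(1) assms(1,3) f S1f_mult[OF f assms(3)]
    by (simp add: S1_mult_cl cl_smult L.cl_smult) (rule cl_eqI; simp add: M.smult_assoc1 L.S1f_closed)
qed

lemma S1_mult_add_right:
  assumes "S \<in> carrier L.SM" "w \<in> carrier M" "w' \<in> carrier M"
  shows "S1_mult (w \<oplus> w') S = S1_mult w S \<oplus>\<^bsub>SM\<^esub> S1_mult w' S"
proof -
  obtain s where *: "s \<in> L.S1f" "S = L.cl s" using assms by (metis L.SM_cases)
  show ?thesis unfolding *(2) using *(1) assms(2,3)
    by (simp add: S1_mult_cl cl_add) (rule cl_eqI; simp add: M.smult_r_distr L.S1f_closed)
qed

lemma S1_mult_smult_right:
  assumes "f \<in> \<L>" "S \<in> carrier L.SM" "w \<in> carrier M"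
  shows "S1_mult (f \<odot> w) S = f \<odot>\<^bsub>SM\<^esub> S1_mult w S"
proof -
  obtain s where *: "s \<in> L.S1f" "S = L.cl s" using assms by (metis L.SM_cases)
  show ?thesis unfolding *(2) using *(1) assms(1,3)
    by (simp add: S1_mult_cl cl_smult) (rule cl_eqI; simp add: M.smult_assoc1[symmetric] L.S1f_closed L0.m_comm)
qed

lemma S1_mult_norm:
  assumes "S \<in> carrier L.SM" "w \<in> carrier M"
  shows "\<parallel>S1_mult w S\<parallel>\<^bsub>SM\<^esub> = \<parallel>w\<parallel> \<otimes>\<^sub>0 \<parallel>S\<parallel>\<^bsub>L.SM\<^esub>"
proof -
  obtain s where *: "s \<in> L.S1f" "S = L.cl s" using assms by (metis L.SM_cases)
  obtain C c where r: "L.srep C c s" using *(1) by (auto simp: L.S1f_iff)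
  show ?thesis
    unfolding *(2) S1_mult_cl[OF *(1) assms(2)] cl_norm[OF srep_mult(1)[OF r assms(2)]] L.cl_norm[OF r]
    by (rule srep_mult(2)[OF r assms(2)])
qed

lemma S1_mult_ind:
  assumes "A \<in> \<A>" "f \<in> \<L>" "v \<in> carrier M"
  shows "S1_mult v (L.cl (L.ind A f)) = cl (ind A (f \<odot> v))"
  using assms by (simp add: S1_mult_cl) (rule cl_eqI[symmetric, OF S1f_ind]; simp add: ind_def L.ind_def)

text \<open>The bounding factor is the class |w|, possibly unbounded; this is the reason why
  \<open>bounded_L0_hom\<close> allows a factor from \<open>L0\<close>.\<close>

lemma S1_mult_hom:
  assumes w: "w \<in> carrier M"
  shows "bounded_L0_hom m L.SM SM.Cpl (\<lambda>S. SM.emb (S1_mult w S)) \<parallel>w\<parallel>"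
proof (intro bounded_L0_hom.intro bounded_L0_hom_axioms.intro L0_base_axioms L.SM_seminormed SM.Cpl_banach)
  show "L0_le m \<parallel>SM.emb (S1_mult w S)\<parallel>\<^bsub>SM.Cpl\<^esub> (\<parallel>w\<parallel> \<otimes>\<^sub>0 \<parallel>S\<parallel>\<^bsub>L.SM\<^esub>)" if "S \<in> carrier L.SM" for S
    using that w by (simp add: SM.emb_norm S1_mult_norm)
qed (use w in \<open>auto simp: S1_mult_add_left S1_mult_smult_left SM.emb_add SM.emb_smult\<close>)

definition L1_mult :: "(nat \<Rightarrow> ('b \<Rightarrow> 'a l0) set) set \<Rightarrow> 'c \<Rightarrow> (nat \<Rightarrow> ('b \<Rightarrow> 'c) set) set" where
  "L1_mult X w = bounded_L0_hom.ext m SM.Cpl (\<lambda>S. SM.emb (S1_mult w S)) X"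

lemma L1_mult_left:
  assumes w: "w \<in> carrier M"
  shows L1_mult_closed: "X \<in> carrier L.SM.Cpl \<Longrightarrow> L1_mult X w \<in> carrier SM.Cpl"
    and L1_mult_add_left: "X \<in> carrier L.SM.Cpl \<Longrightarrow> X' \<in> carrier L.SM.Cpl \<Longrightarrow> L1_mult (X \<oplus>\<^bsub>L.SM.Cpl\<^esub> X') w = L1_mult X w \<oplus>\<^bsub>SM.Cpl\<^esub> L1_mult X' w"
    and L1_mult_smult_left: "f \<in> \<L> \<Longrightarrow> X \<in> carrier L.SM.Cpl \<Longrightarrow> L1_mult (f \<odot>\<^bsub>L.SM.Cpl\<^esub> X) w = f \<odot>\<^bsub>SM.Cpl\<^esub> L1_mult X w"
    and L1_mult_emb: "S \<in> carrier L.SM \<Longrightarrow> L1_mult (L.SM.emb S) w = SM.emb (S1_mult w S)"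
    and L1_mult_bound: "X \<in> carrier L.SM.Cpl \<Longrightarrow> L0_le m \<parallel>L1_mult X w\<parallel>\<^bsub>SM.Cpl\<^esub> (\<parallel>w\<parallel> \<otimes>\<^sub>0 \<parallel>X\<parallel>\<^bsub>L.SM.Cpl\<^esub>)"
    and L1_mult_lim: "\<sigma> \<in> L.SM.Cauchy_seqs \<Longrightarrow> (\<lambda>n. Q.dst (SM.emb (S1_mult w (\<sigma> n))) (L1_mult (L.SM.cls \<sigma>) w)) \<longlonglongrightarrow> 0"
proof -
  interpret B: bounded_L0_hom m L.SM SM.Cpl "\<lambda>S. SM.emb (S1_mult w S)" "\<parallel>w\<parallel>" by (rule S1_mult_hom[OF w])
  show "X \<in> carrier L.SM.Cpl \<Longrightarrow> L1_mult X w \<in> carrier SM.Cpl"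
    "X \<in> carrier L.SM.Cpl \<Longrightarrow> X' \<in> carrier L.SM.Cpl \<Longrightarrow> L1_mult (X \<oplus>\<^bsub>L.SM.Cpl\<^esub> X') w = L1_mult X w \<oplus>\<^bsub>SM.Cpl\<^esub> L1_mult X' w"
    "f \<in> \<L> \<Longrightarrow> X \<in> carrier L.SM.Cpl \<Longrightarrow> L1_mult (f \<odot>\<^bsub>L.SM.Cpl\<^esub> X) w = f \<odot>\<^bsub>SM.Cpl\<^esub> L1_mult X w"
    "S \<in> carrier L.SM \<Longrightarrow> L1_mult (L.SM.emb S) w = SM.emb (S1_mult w S)"
    "X \<in> carrier L.SM.Cpl \<Longrightarrow> L0_le m \<parallel>L1_mult X w\<parallel>\<^bsub>SM.Cpl\<^esub> (\<parallel>w\<parallel> \<otimes>\<^sub>0 \<parallel>X\<parallel>\<^bsub>L.SM.Cpl\<^esub>)"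
    "\<sigma> \<in> L.SM.Cauchy_seqs \<Longrightarrow> (\<lambda>n. Q.dst (SM.emb (S1_mult w (\<sigma> n))) (L1_mult (L.SM.cls \<sigma>) w)) \<longlonglongrightarrow> 0"
    unfolding L1_mult_def
    by (rule B.ext_closed B.ext_add B.ext_smult B.ext_emb B.ext_bound B.ext_cls(2); assumption)+
qed

text \<open>The extension is made separately for each vector, so additivity in the vector is not
  inherited from it. Both sides are limits of the same sequence of embedded simple classes, and
  limits are unique.\<close>

lemma L1_mult_add_right:
  assumes X: "X \<in> carrier L.SM.Cpl" and w: "w \<in> carrier M" "w' \<in> carrier M"
  shows "L1_mult X (w \<oplus> w') = L1_mult X w \<oplus>\<^bsub>SM.Cpl\<^esub> L1_mult X w'"
proof -
  obtain \<sigma> where s: "\<sigma> \<in> L.SM.Cauchy_seqs" "X = L.SM.cls \<sigma>" using X by (metis L.SM.Cpl_cases)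
  have sn: "\<sigma> n \<in> carrier L.SM" for n by (rule L.SM.Cauchy_seqsD[OF s(1)])
  have ww: "w \<oplus> w' \<in> carrier M" using w by simp
  show ?thesis
  proof (rule Q.lim_unique)
    show "(\<lambda>n. Q.dst (SM.emb (S1_mult (w \<oplus> w') (\<sigma> n))) (L1_mult X (w \<oplus> w'))) \<longlonglongrightarrow> 0"
      unfolding s(2) by (rule L1_mult_lim[OF ww s(1)])
    have "(\<lambda>n. Q.dst (SM.emb (S1_mult w (\<sigma> n)) \<oplus>\<^bsub>SM.Cpl\<^esub> SM.emb (S1_mult w' (\<sigma> n))) (L1_mult X w \<oplus>\<^bsub>SM.Cpl\<^esub> L1_mult X w')) \<longlonglongrightarrow> 0"
      by (rule Q.dst_add_tendsto) (use sn w X L1_mult_closed L1_mult_lim[OF _ s(1)] in \<open>auto simp: s(2)\<close>)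
    then show "(\<lambda>n. Q.dst (SM.emb (S1_mult (w \<oplus> w') (\<sigma> n))) (L1_mult X w \<oplus>\<^bsub>SM.Cpl\<^esub> L1_mult X w')) \<longlonglongrightarrow> 0"
      using sn w by (simp add: S1_mult_add_right SM.emb_add)
  qed (use sn w ww X L1_mult_closed in auto)
qed

lemma L1_mult_smult_right:
  assumes X: "X \<in> carrier L.SM.Cpl" and w: "w \<in> carrier M" and f: "f \<in> \<L>"
  shows "L1_mult X (f \<odot> w) = f \<odot>\<^bsub>SM.Cpl\<^esub> L1_mult X w"
proof -
  obtain \<sigma> where s: "\<sigma> \<in> L.SM.Cauchy_seqs" "X = L.SM.cls \<sigma>" using X by (metis L.SM.Cpl_cases)
  have sn: "\<sigma> n \<in> carrier L.SM" for n by (rule L.SM.Cauchy_seqsD[OF s(1)])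
  have fw: "f \<odot> w \<in> carrier M" using w f by simp
  show ?thesis
  proof (rule Q.lim_unique)
    show "(\<lambda>n. Q.dst (SM.emb (S1_mult (f \<odot> w) (\<sigma> n))) (L1_mult X (f \<odot> w))) \<longlonglongrightarrow> 0"
      unfolding s(2) by (rule L1_mult_lim[OF fw s(1)])
    have "(\<lambda>n. Q.dst (f \<odot>\<^bsub>SM.Cpl\<^esub> SM.emb (S1_mult w (\<sigma> n))) (f \<odot>\<^bsub>SM.Cpl\<^esub> L1_mult X w)) \<longlonglongrightarrow> 0"
      by (rule Q.dst_smult_tendsto) (use sn w f X L1_mult_closed L1_mult_lim[OF _ s(1)] in \<open>auto simp: s(2)\<close>)
    then show "(\<lambda>n. Q.dst (SM.emb (S1_mult (f \<odot> w) (\<sigma> n))) (f \<odot>\<^bsub>SM.Cpl\<^esub> L1_mult X w)) \<longlonglongrightarrow> 0"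
      using sn w f by (simp add: S1_mult_smult_right SM.emb_smult)
  qed (use sn w fw f X L1_mult_closed in auto)
qed

section \<open>The induced map on the algebraic tensor product\<close>

definition realize :: "((nat \<Rightarrow> ('b \<Rightarrow> 'a l0) set) set \<times> 'c \<Rightarrow>\<^sub>0 int) set \<Rightarrow> (nat \<Rightarrow> ('b \<Rightarrow> 'c) set) set" where
  "realize = (SOME T. (\<forall>\<alpha>\<in>carrier T.TM. T \<alpha> \<in> carrier SM.Cpl) \<and>
    (\<forall>\<alpha>\<in>carrier T.TM. \<forall>\<beta>\<in>carrier T.TM. T (\<alpha> \<oplus>\<^bsub>T.TM\<^esub> \<beta>) = T \<alpha> \<oplus>\<^bsub>SM.Cpl\<^esub> T \<beta>) \<and>
    (\<forall>r\<in>\<L>. \<forall>\<alpha>\<in>carrier T.TM. T (r \<odot>\<^bsub>T.TM\<^esub> \<alpha>) = r \<odot>\<^bsub>SM.Cpl\<^esub> T \<alpha>) \<and>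
    (\<forall>X\<in>carrier L.SM.Cpl. \<forall>w\<in>carrier M. T (T.te X w) = L1_mult X w))"

text \<open>\<open>L1_mult\<close> is bilinear, so \<open>tensor_lift\<close> provides maps with
  these properties; the choice in \<open>realize\<close> fixes one of them under a name.\<close>

lemma realize_spec:
  shows realize_closed [simp, intro]: "\<alpha> \<in> carrier T.TM \<Longrightarrow> realize \<alpha> \<in> carrier SM.Cpl"
    and realize_add: "\<alpha> \<in> carrier T.TM \<Longrightarrow> \<beta> \<in> carrier T.TM \<Longrightarrow> realize (\<alpha> \<oplus>\<^bsub>T.TM\<^esub> \<beta>) = realize \<alpha> \<oplus>\<^bsub>SM.Cpl\<^esub> realize \<beta>"
    and realize_smult: "r \<in> \<L> \<Longrightarrow> \<alpha> \<in> carrier T.TM \<Longrightarrow> realize (r \<odot>\<^bsub>T.TM\<^esub> \<alpha>) = r \<odot>\<^bsub>SM.Cpl\<^esub> realize \<alpha>"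
    and realize_te: "X \<in> carrier L.SM.Cpl \<Longrightarrow> w \<in> carrier M \<Longrightarrow> realize (T.te X w) = L1_mult X w"
proof -
  obtain T where "\<And>\<alpha>. \<alpha> \<in> carrier T.TM \<Longrightarrow> T \<alpha> \<in> carrier SM.Cpl"
    "\<And>\<alpha> \<beta>. \<alpha> \<in> carrier T.TM \<Longrightarrow> \<beta> \<in> carrier T.TM \<Longrightarrow> T (\<alpha> \<oplus>\<^bsub>T.TM\<^esub> \<beta>) = T \<alpha> \<oplus>\<^bsub>SM.Cpl\<^esub> T \<beta>"
    "\<And>r \<alpha>. r \<in> \<L> \<Longrightarrow> \<alpha> \<in> carrier T.TM \<Longrightarrow> T (r \<odot>\<^bsub>T.TM\<^esub> \<alpha>) = r \<odot>\<^bsub>SM.Cpl\<^esub> T \<alpha>"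
    "\<And>X w. X \<in> carrier L.SM.Cpl \<Longrightarrow> w \<in> carrier M \<Longrightarrow> T (T.te X w) = L1_mult X w"
    by (rule T.tensor_lift[OF SM.Cpl_module, of L1_mult])
       ((rule that; assumption) | simp add: L1_mult_closed L1_mult_add_left L1_mult_add_right L1_mult_smult_left L1_mult_smult_right)+
  then have "\<exists>T. (\<forall>\<alpha>\<in>carrier T.TM. T \<alpha> \<in> carrier SM.Cpl) \<and>
    (\<forall>\<alpha>\<in>carrier T.TM. \<forall>\<beta>\<in>carrier T.TM. T (\<alpha> \<oplus>\<^bsub>T.TM\<^esub> \<beta>) = T \<alpha> \<oplus>\<^bsub>SM.Cpl\<^esub> T \<beta>) \<and>
    (\<forall>r\<in>\<L>. \<forall>\<alpha>\<in>carrier T.TM. T (r \<odot>\<^bsub>T.TM\<^esub> \<alpha>) = r \<odot>\<^bsub>SM.Cpl\<^esub> T \<alpha>) \<and>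
    (\<forall>X\<in>carrier L.SM.Cpl. \<forall>w\<in>carrier M. T (T.te X w) = L1_mult X w)"
    by (intro exI[of _ T] conjI ballI)
  from someI_ex[OF this, folded realize_def]
  show "\<alpha> \<in> carrier T.TM \<Longrightarrow> realize \<alpha> \<in> carrier SM.Cpl"
    "\<alpha> \<in> carrier T.TM \<Longrightarrow> \<beta> \<in> carrier T.TM \<Longrightarrow> realize (\<alpha> \<oplus>\<^bsub>T.TM\<^esub> \<beta>) = realize \<alpha> \<oplus>\<^bsub>SM.Cpl\<^esub> realize \<beta>"
    "r \<in> \<L> \<Longrightarrow> \<alpha> \<in> carrier T.TM \<Longrightarrow> realize (r \<odot>\<^bsub>T.TM\<^esub> \<alpha>) = r \<odot>\<^bsub>SM.Cpl\<^esub> realize \<alpha>"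
    "X \<in> carrier L.SM.Cpl \<Longrightarrow> w \<in> carrier M \<Longrightarrow> realize (T.te X w) = L1_mult X w"
    by blast+
qed

lemma realize_zero: "realize \<zero>\<^bsub>T.TM\<^esub> = \<zero>\<^bsub>SM.Cpl\<^esub>"
  using realize_smult[of "\<zero>\<^sub>0" "\<zero>\<^bsub>T.TM\<^esub>"] by simp

lemma realize_le: "\<alpha> \<in> carrier T.TM \<Longrightarrow> L0_le m \<parallel>realize \<alpha>\<parallel>\<^bsub>SM.Cpl\<^esub> (T.pn \<alpha>)"
  by (rule T.pn_contraction[OF SM.Cpl_seminormed])
     (simp_all add: realize_add realize_zero realize_te L0.m_comm[of _ "\<parallel>_\<parallel>"] L1_mult_bound)

lemma realize_hom: "bounded_L0_hom m T.AT SM.Cpl realize \<one>\<^sub>0"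
  by (intro bounded_L0_hom.intro bounded_L0_hom_axioms.intro L0_base_axioms T.AT_seminormed SM.Cpl_banach)
     (simp_all add: realize_add realize_smult realize_le L0_pos_closed[OF T.pn_pos])

section \<open>Isometry on finite sums of tensors with characteristic functions\<close>

definition chi :: "'b set \<Rightarrow> (nat \<Rightarrow> ('b \<Rightarrow> 'a l0) set) set" where
  "chi A = L.SM.emb (L.cl (L.ind A \<one>\<^sub>0))"

definition chi_tensor :: "'b set \<Rightarrow> 'c \<Rightarrow> ((nat \<Rightarrow> ('b \<Rightarrow> 'a l0) set) set \<times> 'c \<Rightarrow>\<^sub>0 int) set" where
  "chi_tensor A v = T.te (chi A) v"

lemma chi_closed [simp, intro]: "A \<in> \<A> \<Longrightarrow> chi A \<in> carrier L.SM.Cpl"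
  unfolding chi_def by (intro L.SM.emb_closed L.cl_closed L.S1f_ind) auto

lemma chi_tensor_closed [simp, intro]: "A \<in> \<A> \<Longrightarrow> v \<in> carrier M \<Longrightarrow> chi_tensor A v \<in> carrier T.TM"
  unfolding chi_tensor_def by (intro T.te_closed chi_closed)

lemma chi_Un: "A \<in> \<A> \<Longrightarrow> B \<in> \<A> \<Longrightarrow> A \<inter> B = {} \<Longrightarrow> chi (A \<union> B) = chi A \<oplus>\<^bsub>L.SM.Cpl\<^esub> chi B"
  unfolding chi_def by (simp add: L.ind_Un L.SM.emb_add L.S1f_ind)

lemma chi_tensor_Un: "A \<in> \<A> \<Longrightarrow> B \<in> \<A> \<Longrightarrow> A \<inter> B = {} \<Longrightarrow> v \<in> carrier M \<Longrightarrow> chi_tensor (A \<union> B) v = chi_tensor A v \<oplus>\<^bsub>T.TM\<^esub> chi_tensor B v"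
  unfolding chi_tensor_def by (simp add: chi_Un T.te_add_left)

lemma chi_tensor_add: "A \<in> \<A> \<Longrightarrow> v \<in> carrier M \<Longrightarrow> w \<in> carrier M \<Longrightarrow> chi_tensor A (v \<oplus> w) = chi_tensor A v \<oplus>\<^bsub>T.TM\<^esub> chi_tensor A w"
  unfolding chi_tensor_def by (simp add: T.te_add_right)

lemma te_zero_right: "X \<in> carrier L.SM.Cpl \<Longrightarrow> T.te X \<zero> = \<zero>\<^bsub>T.TM\<^esub>"
  using T.te_smult_right[of "\<zero>\<^sub>0" X "\<zero>"] T.te_smult_left[of "\<zero>\<^sub>0" X "\<zero>"] by simp

lemma te_zero_left: "w \<in> carrier M \<Longrightarrow> T.te \<zero>\<^bsub>L.SM.Cpl\<^esub> w = \<zero>\<^bsub>T.TM\<^esub>"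
  using T.te_smult_left[of "\<zero>\<^sub>0" "\<zero>\<^bsub>L.SM.Cpl\<^esub>" w] by simp

lemma realize_te_ind:
  assumes "A \<in> \<A>" "f \<in> \<L>" "v \<in> carrier M"
  shows "realize (T.te (L.SM.emb (L.cl (L.ind A f))) v) = SM.emb (cl (ind A (f \<odot> v)))"
  using assms by (simp add: realize_te L1_mult_emb S1_mult_ind L.S1f_ind)

lemma realize_chi_tensor: "A \<in> \<A> \<Longrightarrow> v \<in> carrier M \<Longrightarrow> realize (chi_tensor A v) = SM.emb (cl (ind A v))"
  unfolding chi_tensor_def chi_def by (simp add: realize_te_ind)

text \<open>The coefficient \<open>f\<close> crosses the tensor sign. This is why tensors with plain
  characteristic functions suffice to represent those with truncated simple functions.\<close>

lemma te_ind:
  assumes "A \<in> \<A>" "f \<in> \<L>" "v \<in> carrier M"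
  shows "T.te (L.SM.emb (L.cl (L.ind A f))) v = chi_tensor A (f \<odot> v)"
proof -
  have "L.cl (L.ind A f) = f \<odot>\<^bsub>L.SM\<^esub> L.cl (L.ind A \<one>\<^sub>0)"
    using L.ind_smult[of A "\<one>\<^sub>0" f] assms by simp
  then have "L.SM.emb (L.cl (L.ind A f)) = f \<odot>\<^bsub>L.SM.Cpl\<^esub> chi A"
    using assms by (simp add: chi_def L.SM.emb_smult L.S1f_ind)
  then show ?thesis using assms T.te_smult_right[of f "chi A" v] by (simp add: chi_tensor_def)
qed

text \<open>The norm of the characteristic function of \<open>A\<close> is |\<mu>|(A), so the
  one-term representation already has the value |\<mu>|(A) |v|, which is the norm of the
  image.\<close>

lemma pn_chi_tensor:
  assumes A: "A \<in> \<A>" and v: "v \<in> carrier M"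
  shows "L0_le m (T.pn (chi_tensor A v)) \<parallel>cl (ind A v)\<parallel>\<^bsub>SM\<^esub>"
proof -
  have "\<parallel>chi A\<parallel>\<^bsub>L.SM.Cpl\<^esub> = V A"
    unfolding chi_def using A by (simp add: L.SM.emb_norm L.ind_norm L.S1f_ind L0_norm_eq_self V_closed)
  then show ?thesis using T.pn_te[OF chi_closed[OF A] v] A v by (simp add: chi_tensor_def ind_norm)
qed

text \<open>
  For a list of pairs \<open>(A i, v i)\<close>, the function \<open>B \<mapsto> \<Sum>i. \<one>\<^bsub>A i \<inter> B\<^esub> \<otimes> v i\<close>.  Keeping the restrictions to all
  sets \<open>B\<close> makes the induction over the list below possible.
\<close>

inductive simple_tensor :: "('b set \<Rightarrow> ((nat \<Rightarrow> ('b \<Rightarrow> 'a l0) set) set \<times> 'c \<Rightarrow>\<^sub>0 int) set) \<Rightarrow> bool" where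
  zero: "simple_tensor (\<lambda>B. \<zero>\<^bsub>T.TM\<^esub>)"
| step: "simple_tensor F \<Longrightarrow> A \<in> \<A> \<Longrightarrow> v \<in> carrier M \<Longrightarrow> simple_tensor (\<lambda>B. F B \<oplus>\<^bsub>T.TM\<^esub> chi_tensor (A \<inter> B) v)"

lemma simple_tensor_closed: "simple_tensor F \<Longrightarrow> B \<in> \<A> \<Longrightarrow> F B \<in> carrier T.TM"
  by (induction rule: simple_tensor.induct) auto

lemma TM_add_swap:
  assumes "a \<in> carrier T.TM" "b \<in> carrier T.TM" "c \<in> carrier T.TM" "d \<in> carrier T.TM"
  shows "(a \<oplus>\<^bsub>T.TM\<^esub> b) \<oplus>\<^bsub>T.TM\<^esub> (c \<oplus>\<^bsub>T.TM\<^esub> d) = (a \<oplus>\<^bsub>T.TM\<^esub> c) \<oplus>\<^bsub>T.TM\<^esub> (b \<oplus>\<^bsub>T.TM\<^esub> d)"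
  using assms by (simp add: T.TM.M.a_ac)

lemma simple_tensor_Un:
  assumes "simple_tensor F" "B \<in> \<A>" "B' \<in> \<A>" "B \<inter> B' = {}"
  shows "F (B \<union> B') = F B \<oplus>\<^bsub>T.TM\<^esub> F B'"
  using assms
proof (induction rule: simple_tensor.induct)
  case (step F A v)
  have "A \<inter> (B \<union> B') = (A \<inter> B) \<union> (A \<inter> B')" by auto
  then have "chi_tensor (A \<inter> (B \<union> B')) v = chi_tensor (A \<inter> B) v \<oplus>\<^bsub>T.TM\<^esub> chi_tensor (A \<inter> B') v"
    using chi_tensor_Un[of "A \<inter> B" "A \<inter> B'" v] step by auto
  then show ?case
    using step TM_add_swap[of "F B" "F B'" "chi_tensor (A \<inter> B) v" "chi_tensor (A \<inter> B') v"] simple_tensor_closed[OF step(1)] by auto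
qed simp

text \<open>Bundles the estimate of the projective norm with a support condition on the image,
  because the estimate can be added up only for disjoint supports.\<close>

definition realized_on :: "'b set \<Rightarrow> ((nat \<Rightarrow> ('b \<Rightarrow> 'a l0) set) set \<times> 'c \<Rightarrow>\<^sub>0 int) set \<Rightarrow> bool" where
  "realized_on B \<alpha> \<longleftrightarrow> \<alpha> \<in> carrier T.TM \<and>
    (\<exists>u\<in>S1f. (\<forall>\<omega>\<in>\<Omega> - B. u \<omega> = \<zero>) \<and> realize \<alpha> = SM.emb (cl u) \<and> L0_le m (T.pn \<alpha>) \<parallel>cl u\<parallel>\<^bsub>SM\<^esub>)"

text \<open>The projective norm is subadditive, whereas the norm of simple maps is additive on
  disjoint supports; so the two estimates add up without loss.\<close>

lemma realized_on_Un:
  assumes "realized_on B \<alpha>" "realized_on B' \<beta>" "B \<inter> B' = {}"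
  shows "realized_on (B \<union> B') (\<alpha> \<oplus>\<^bsub>T.TM\<^esub> \<beta>)"
proof -
  obtain u u' where u: "\<alpha> \<in> carrier T.TM" "u \<in> S1f" "\<forall>\<omega>\<in>\<Omega> - B. u \<omega> = \<zero>" "realize \<alpha> = SM.emb (cl u)" "L0_le m (T.pn \<alpha>) \<parallel>cl u\<parallel>\<^bsub>SM\<^esub>"
    and u': "\<beta> \<in> carrier T.TM" "u' \<in> S1f" "\<forall>\<omega>\<in>\<Omega> - B'. u' \<omega> = \<zero>" "realize \<beta> = SM.emb (cl u')" "L0_le m (T.pn \<beta>) \<parallel>cl u'\<parallel>\<^bsub>SM\<^esub>"
    using assms by (auto simp: realized_on_def)
  let ?u = "\<lambda>\<omega>. u \<omega> \<oplus> u' \<omega>"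
  note p = T.pn_pos[OF u(1)] T.pn_pos[OF u'(1)]
  have ab: "\<alpha> \<oplus>\<^bsub>T.TM\<^esub> \<beta> \<in> carrier T.TM" using u(1) u'(1) by simp
  have "\<forall>\<omega>\<in>\<Omega> - (B \<union> B'). ?u \<omega> = \<zero>" using u(3) u'(3) by simp
  moreover have "realize (\<alpha> \<oplus>\<^bsub>T.TM\<^esub> \<beta>) = SM.emb (cl ?u)"
    using u u' by (simp add: realize_add cl_add[symmetric] SM.emb_add)
  moreover have "L0_le m (T.pn (\<alpha> \<oplus>\<^bsub>T.TM\<^esub> \<beta>)) \<parallel>cl ?u\<parallel>\<^bsub>SM\<^esub>"
  proof -
    have "L0_le m (T.pn (\<alpha> \<oplus>\<^bsub>T.TM\<^esub> \<beta>)) (\<parallel>cl u\<parallel>\<^bsub>SM\<^esub> \<oplus>\<^sub>0 \<parallel>cl u'\<parallel>\<^bsub>SM\<^esub>)"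
      by (rule L0_le_trans[OF T.pn_triangle[OF u(1) u'(1)] L0_add_mono[OF u(5) u'(5)]])
         (use p T.pn_pos[OF ab] u(2) u'(2) in auto)
    also have "\<parallel>cl u\<parallel>\<^bsub>SM\<^esub> \<oplus>\<^sub>0 \<parallel>cl u'\<parallel>\<^bsub>SM\<^esub> = \<parallel>cl ?u\<parallel>\<^bsub>SM\<^esub>"
      by (rule norm_add_disjoint[symmetric, OF u(2) u'(2) assms(3)]) (use u(3) u'(3) in auto)
    finally show ?thesis .
  qed
  ultimately show ?thesis unfolding realized_on_def using ab u(2) u'(2) by (intro conjI bexI[of _ ?u]) auto
qed

lemma realized_on_chi_tensor: "A \<in> \<A> \<Longrightarrow> v \<in> carrier M \<Longrightarrow> realized_on A (chi_tensor A v)"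
  unfolding realized_on_def
  by (intro conjI bexI[of _ "ind A v"]) (auto simp: realize_chi_tensor pn_chi_tensor, auto simp: ind_def)

text \<open>
  A further pair \<open>(A, v)\<close> splits \<open>B\<close> into \<open>B \<inter> A\<close>, where the constant \<open>w\<close> becomes \<open>v + w\<close>, and \<open>B - A\<close>, where it
  is unchanged; the two contributions have disjoint supports.
\<close>

lemma realized_on_simple_tensor:
  assumes "simple_tensor F" "B \<in> \<A>" "w \<in> carrier M"
  shows "realized_on B (F B \<oplus>\<^bsub>T.TM\<^esub> chi_tensor B w)"
  using assms
proof (induction arbitrary: B w rule: simple_tensor.induct)
  case zero
  then show ?case using realized_on_chi_tensor by simp
next
  case (step F A v)
  let ?C = "B \<inter> A" and ?D = "B - A"
  note c = simple_tensor_closed[OF step(1)]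
  have CD: "?C \<in> \<A>" "?D \<in> \<A>" "?C \<inter> ?D = {}" "?C \<union> ?D = B" using step by auto
  have "F B = F ?C \<oplus>\<^bsub>T.TM\<^esub> F ?D" using simple_tensor_Un[OF step(1) CD(1-3)] CD(4) by simp
  moreover have "chi_tensor B w = chi_tensor ?C w \<oplus>\<^bsub>T.TM\<^esub> chi_tensor ?D w" using chi_tensor_Un[OF CD(1-3) step.prems(2)] CD(4) by simp
  ultimately have "(F B \<oplus>\<^bsub>T.TM\<^esub> chi_tensor (A \<inter> B) v) \<oplus>\<^bsub>T.TM\<^esub> chi_tensor B w =
      (F ?C \<oplus>\<^bsub>T.TM\<^esub> chi_tensor ?C (v \<oplus> w)) \<oplus>\<^bsub>T.TM\<^esub> (F ?D \<oplus>\<^bsub>T.TM\<^esub> chi_tensor ?D w)"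
    using c[OF CD(1)] c[OF CD(2)] CD step(3) step.prems(2) by (simp add: chi_tensor_add T.TM.M.a_ac Int_commute)
  moreover have "realized_on (?C \<union> ?D) ((F ?C \<oplus>\<^bsub>T.TM\<^esub> chi_tensor ?C (v \<oplus> w)) \<oplus>\<^bsub>T.TM\<^esub> (F ?D \<oplus>\<^bsub>T.TM\<^esub> chi_tensor ?D w))"
    by (rule realized_on_Un[OF step.IH step.IH]) (use CD step in auto)
  ultimately show ?case using CD(4) by simp
qed

lemma simple_tensor_isometric:
  assumes F: "simple_tensor F"
  shows "\<parallel>realize (F \<Omega>)\<parallel>\<^bsub>SM.Cpl\<^esub> = T.pn (F \<Omega>)"
proof -
  have c: "F \<Omega> \<in> carrier T.TM" by (rule simple_tensor_closed[OF F]) auto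
  \<comment> \<open>The zero vector removes the extra constant that the induction had to
    carry.\<close>
  have "F \<Omega> \<oplus>\<^bsub>T.TM\<^esub> chi_tensor \<Omega> \<zero> = F \<Omega>" using c by (simp add: chi_tensor_def te_zero_right)
  then have "realized_on \<Omega> (F \<Omega>)" using realized_on_simple_tensor[OF F SA.top, of "\<zero>"] by simp
  then obtain u where u: "u \<in> S1f" "realize (F \<Omega>) = SM.emb (cl u)" "L0_le m (T.pn (F \<Omega>)) \<parallel>cl u\<parallel>\<^bsub>SM\<^esub>"
    by (auto simp: realized_on_def)
  then have "L0_le m (T.pn (F \<Omega>)) \<parallel>realize (F \<Omega>)\<parallel>\<^bsub>SM.Cpl\<^esub>" by (simp add: SM.emb_norm)
  then show ?thesis using realize_le[OF c] T.pn_pos[OF c] c by (intro L0_le_antisym) auto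
qed

text \<open>Induction on the number of cells: by \<open>te_ind\<close> each new cell contributes
  \<open>chi_tensor (C N) (c N \<odot> w)\<close>, which is one more step of
  \<open>simple_tensor\<close>.\<close>

lemma simple_tensor_add_trunc:
  assumes F: "simple_tensor F" and r: "L.srep C c s" and w: "w \<in> carrier M"
  shows "\<exists>G. simple_tensor G \<and> G \<Omega> = F \<Omega> \<oplus>\<^bsub>T.TM\<^esub> T.te (L.SM.emb (L.cl (L.trunc C s N))) w"
proof (induction N)
  case 0
  have "L.SM.emb (L.cl (L.trunc C s 0)) = \<zero>\<^bsub>L.SM.Cpl\<^esub>" using L.SM.emb_zero by (simp add: L.trunc_0 L.SM_zero)
  then show ?case using F simple_tensor_closed[OF F SA.top] w by (intro exI[of _ F]) (simp add: te_zero_left)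
next
  case (Suc N)
  note C = L.srepD[OF r]
  obtain G where G: "simple_tensor G" "G \<Omega> = F \<Omega> \<oplus>\<^bsub>T.TM\<^esub> T.te (L.SM.emb (L.cl (L.trunc C s N))) w" using Suc by blast
  have tr: "L.cl (L.trunc C s N) \<in> carrier L.SM" using L.S1f_trunc[OF r] by simp
  have i: "L.cl (L.ind (C N) (c N)) \<in> carrier L.SM" using C L.S1f_ind by auto
  have "T.te (L.SM.emb (L.cl (L.trunc C s (Suc N)))) w =
      T.te (L.SM.emb (L.cl (L.trunc C s N))) w \<oplus>\<^bsub>T.TM\<^esub> chi_tensor (C N) (c N \<odot> w)"
    unfolding L.trunc_Suc[OF r] using tr i w C te_ind[of "C N" "c N" w] by (simp add: L.SM.emb_add T.te_add_left)
  \<comment> \<open>At \<Omega> a step of \<open>simple_tensor\<close> reads its set as an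
    intersection with \<Omega>, which has to be removed.\<close>
  moreover have "C N \<inter> \<Omega> = C N" using C(2) SA.sets_into_space by auto
  ultimately have "G \<Omega> \<oplus>\<^bsub>T.TM\<^esub> chi_tensor (C N \<inter> \<Omega>) (c N \<odot> w) = F \<Omega> \<oplus>\<^bsub>T.TM\<^esub> T.te (L.SM.emb (L.cl (L.trunc C s (Suc N)))) w"
    using G(2) simple_tensor_closed[OF F SA.top] tr w C by (simp add: T.TM.M.a_assoc)
  then show ?case
    using simple_tensor.step[OF G(1) C(2), of "c N \<odot> w" N] C(3) w by (intro exI[of _ "\<lambda>B. G B \<oplus>\<^bsub>T.TM\<^esub> chi_tensor (C N \<inter> B) (c N \<odot> w)"]) auto
qed

text \<open>For fixed \<open>w\<close> the map X \<mapsto> X \<otimes> w is linear with bound |w|,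
  hence uniformly continuous, with a modulus that depends on \<open>w\<close>.\<close>

lemma te_dist_eps:
  assumes w: "w \<in> carrier M" and e: "\<epsilon> > 0"
  obtains \<delta> where "\<delta> > 0" "\<And>X Y. X \<in> carrier L.SM.Cpl \<Longrightarrow> Y \<in> carrier L.SM.Cpl \<Longrightarrow>
    X.dst X Y < \<delta> \<Longrightarrow> T.AT.dst (T.te X w) (T.te Y w) < \<epsilon>"
proof -
  have te_diff: "T.te X w \<ominus>\<^bsub>T.AT\<^esub> T.te Y w = T.te (X \<ominus>\<^bsub>L.SM.Cpl\<^esub> Y) w" if XY: "X \<in> carrier L.SM.Cpl" "Y \<in> carrier L.SM.Cpl" for X Y
  proof -
    have "T.te X w \<ominus>\<^bsub>T.AT\<^esub> T.te Y w = T.te X w \<oplus>\<^bsub>T.TM\<^esub> (\<ominus>\<^bsub>L0 m\<^esub> \<one>\<^sub>0) \<odot>\<^bsub>T.TM\<^esub> T.te Y w"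
      using T.AT.smult_minus_one[of "T.te Y w"] XY w by (simp add: a_minus_def)
    also have "\<dots> = T.te (X \<oplus>\<^bsub>L.SM.Cpl\<^esub> (\<ominus>\<^bsub>L0 m\<^esub> \<one>\<^sub>0) \<odot>\<^bsub>L.SM.Cpl\<^esub> Y) w"
      using XY w by (simp add: T.te_add_left T.te_smult_left)
    also have "X \<oplus>\<^bsub>L.SM.Cpl\<^esub> (\<ominus>\<^bsub>L0 m\<^esub> \<one>\<^sub>0) \<odot>\<^bsub>L.SM.Cpl\<^esub> Y = X \<ominus>\<^bsub>L.SM.Cpl\<^esub> Y"
      using X.smult_minus_one[OF XY(2)] by (simp add: a_minus_def)
    finally show ?thesis .
  qed
  have "\<exists>\<delta>>0. \<forall>X\<in>carrier L.SM.Cpl. \<forall>Y\<in>carrier L.SM.Cpl. X.dst X Y < \<delta> \<longrightarrow>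
      T.AT.dst (T.te X w) (T.te Y w) < \<epsilon>"
  proof (rule uniformly_continuous_norm_bound[OF X.seminormed_L0_module_axioms T.AT_seminormed _ M.norm_in_pos[OF w] _ e])
    fix X Y assume XY: "X \<in> carrier L.SM.Cpl" "Y \<in> carrier L.SM.Cpl"
    then have XY': "X \<ominus>\<^bsub>L.SM.Cpl\<^esub> Y \<in> carrier L.SM.Cpl" by simp
    show "L0_le m \<parallel>T.te X w \<ominus>\<^bsub>T.AT\<^esub> T.te Y w\<parallel>\<^bsub>T.AT\<^esub> (\<parallel>w\<parallel> \<otimes>\<^sub>0 \<parallel>X \<ominus>\<^bsub>L.SM.Cpl\<^esub> Y\<parallel>\<^bsub>L.SM.Cpl\<^esub>)"
      unfolding te_diff[OF XY] using T.pn_te[OF XY' w] XY' w by (simp add: L0.m_comm)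
  qed (use w in auto)
  then show thesis using that by blast
qed

text \<open>Induction on a representation: the left factor of each elementary tensor is replaced by
  a nearby truncated simple function. The tolerance is generalised in the induction because half of
  it is passed on to the earlier summands.\<close>

lemma simple_tensor_dense:
  assumes "\<alpha> \<in> carrier T.TM" "\<epsilon> > 0"
  shows "\<exists>F. simple_tensor F \<and> T.AT.dst (F \<Omega>) \<alpha> < \<epsilon>"
proof -
  obtain s where "T.trep \<alpha> s" using T.trep_exists[OF assms(1)] by blast
  then show ?thesis using assms(2)
  proof (induction arbitrary: \<epsilon> rule: T.trep.induct)
    case trep_zero
    then show ?case using zero T.AT.dst_self[of "\<zero>\<^bsub>T.TM\<^esub>"] by (intro exI[of _ "\<lambda>_. \<zero>\<^bsub>T.TM\<^esub>"]) simp
  next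
    case (trep_step \<alpha> s X w)
    have a: "\<alpha> \<in> carrier T.TM" using T.trep_closed[OF trep_step(1)] by simp
    have e2: "\<epsilon>/2 > 0" using trep_step by simp
    obtain F where F: "simple_tensor F" "T.AT.dst (F \<Omega>) \<alpha> < \<epsilon>/2"
      using trep_step.IH[OF e2] by blast
    obtain \<delta> where d: "\<delta> > 0" "\<And>X Y. X \<in> carrier L.SM.Cpl \<Longrightarrow> Y \<in> carrier L.SM.Cpl \<Longrightarrow>
        X.dst X Y < \<delta> \<Longrightarrow> T.AT.dst (T.te X w) (T.te Y w) < \<epsilon>/2"
      using te_dist_eps[OF trep_step(3) e2] by blast
    obtain C c s N where r: "L.srep C c s" "X.dst (L.SM.emb (L.cl (L.trunc C s N))) X < \<delta>"
      using L.trunc_dense[OF trep_step(2) d(1)] by blast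
    let ?Y = "L.SM.emb (L.cl (L.trunc C s N))"
    have Y: "?Y \<in> carrier L.SM.Cpl" using L.S1f_trunc[OF r(1)] by auto
    obtain G where G: "simple_tensor G" "G \<Omega> = F \<Omega> \<oplus>\<^bsub>T.TM\<^esub> T.te ?Y w"
      using simple_tensor_add_trunc[OF F(1) r(1) trep_step(3)] by blast
    have "T.AT.dst (F \<Omega> \<oplus>\<^bsub>T.AT\<^esub> T.te ?Y w) (\<alpha> \<oplus>\<^bsub>T.AT\<^esub> T.te X w) \<le>
        T.AT.dst (F \<Omega>) \<alpha> + T.AT.dst (T.te ?Y w) (T.te X w)"
      by (rule T.AT.dst_add) (use simple_tensor_closed[OF F(1) SA.top] Y a trep_step in auto)
    then have "T.AT.dst (G \<Omega>) (\<alpha> \<oplus>\<^bsub>T.TM\<^esub> T.te X w) < \<epsilon>"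
      using F(2) d(2)[OF Y trep_step(2) r(2)] by (simp add: G(2))
    then show ?case using G(1) by blast
  qed
qed

text \<open>Both sides are limits along approximating simple tensors, on which they agree.\<close>

lemma realize_isometric:
  assumes a: "\<alpha> \<in> carrier T.TM"
  shows "\<parallel>realize \<alpha>\<parallel>\<^bsub>SM.Cpl\<^esub> = T.pn \<alpha>"
proof -
  interpret B: bounded_L0_hom m T.AT SM.Cpl realize "\<one>\<^sub>0" by (rule realize_hom)
  have "\<exists>F. simple_tensor F \<and> T.AT.dst (F \<Omega>) \<alpha> < inverse (real (Suc n))" for n
    by (rule simple_tensor_dense[OF a]) simp
  then obtain F where F: "\<And>n. simple_tensor (F n)" "\<And>n. T.AT.dst (F n \<Omega>) \<alpha> < inverse (real (Suc n))" by metis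
  have c: "F n \<Omega> \<in> carrier T.AT" for n using simple_tensor_closed[OF F(1) SA.top] by simp
  have lim: "(\<lambda>n. T.AT.dst (F n \<Omega>) \<alpha>) \<longlonglongrightarrow> 0"
    by (rule tendsto_zero_inverse) (rule T.AT.dst_nonneg, rule less_imp_le, rule F(2))
  have 1: "L0_lim m (\<lambda>n. T.pn (F n \<Omega>)) (T.pn \<alpha>)" using T.AT.norm_lim[OF c _ lim] a by simp
  have "(\<lambda>n. Q.dst (realize (F n \<Omega>)) (realize \<alpha>)) \<longlonglongrightarrow> 0"
    by (rule B.T_dist_tendsto[OF c _ lim]) (use a in simp)
  then have "L0_lim m (\<lambda>n. \<parallel>realize (F n \<Omega>)\<parallel>\<^bsub>SM.Cpl\<^esub>) \<parallel>realize \<alpha>\<parallel>\<^bsub>SM.Cpl\<^esub>"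
    using c a by (intro Q.norm_lim) auto
  then show ?thesis using 1 L0_lim_unique by (simp add: simple_tensor_isometric[OF F(1)])
qed

text \<open>A truncation is a finite sum of one-cell maps, each of which has an explicit preimage;
  no limit is involved.\<close>

lemma realize_trunc:
  assumes r: "srep C c v"
  shows "\<exists>\<alpha>\<in>carrier T.TM. realize \<alpha> = SM.emb (cl (trunc C v N))"
proof (induction N)
  case 0
  have "SM.emb (cl (trunc C v 0)) = \<zero>\<^bsub>SM.Cpl\<^esub>" using SM.emb_zero by (simp add: trunc_0 SM_zero)
  then show ?case using realize_zero by (intro bexI[of _ "\<zero>\<^bsub>T.TM\<^esub>"]) auto
next
  case (Suc N)
  note C = srepD[OF r]
  obtain \<alpha> where a: "\<alpha> \<in> carrier T.TM" "realize \<alpha> = SM.emb (cl (trunc C v N))" using Suc by blast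
  have "realize (\<alpha> \<oplus>\<^bsub>T.TM\<^esub> chi_tensor (C N) (c N)) = SM.emb (cl (trunc C v (Suc N)))"
    unfolding trunc_Suc[OF r] using a C S1f_trunc[OF r] by (simp add: realize_add realize_chi_tensor SM.emb_add)
  then show ?case using a C by (intro bexI[of _ "\<alpha> \<oplus>\<^bsub>T.TM\<^esub> chi_tensor (C N) (c N)"]) auto
qed

lemma realize_dense:
  assumes "X \<in> carrier SM.Cpl" "\<epsilon> > 0"
  shows "\<exists>\<alpha>\<in>carrier T.TM. Q.dst (realize \<alpha>) X < \<epsilon>"
  using trunc_dense[OF assms] realize_trunc by metis

section \<open>The isomorphism and its uniqueness\<close>

definition L1_iso :: "(nat \<Rightarrow> ((nat \<Rightarrow> ('b \<Rightarrow> 'a l0) set) set \<times> 'c \<Rightarrow>\<^sub>0 int) set) set \<Rightarrow> (nat \<Rightarrow> ('b \<Rightarrow> 'c) set) set" where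
  "L1_iso = bounded_L0_hom.ext m SM.Cpl realize"

lemma L1_iso_iso: "rnm_isometric_iso m T.AT.Cpl SM.Cpl L1_iso"
  unfolding L1_iso_def
  by (rule bounded_L0_hom.ext_iso[OF realize_hom]) (use realize_isometric realize_dense in auto)

lemma L1_iso_emb: "\<alpha> \<in> carrier T.TM \<Longrightarrow> L1_iso (T.AT.emb \<alpha>) = realize \<alpha>"
  unfolding L1_iso_def by (rule bounded_L0_hom.ext_emb[OF realize_hom]) simp

lemma iso_closed:
  assumes "rnm_isometric_iso m T.AT.Cpl SM.Cpl J" "x \<in> carrier T.AT.Cpl"
  shows "J x \<in> carrier SM.Cpl"
  using rnm_isometric_iso.bij[OF assms(1)] assms(2) by (auto simp: bij_betw_def)

lemma iso_dist:
  assumes "rnm_isometric_iso m T.AT.Cpl SM.Cpl J" and x: "x \<in> carrier T.AT.Cpl" "y \<in> carrier T.AT.Cpl"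
  shows "Q.dst (J x) (J y) = rnm_dist m T.AT.Cpl x y"
proof -
  interpret J: rnm_isometric_iso m T.AT.Cpl SM.Cpl J by fact
  interpret P: banach_L0_module m T.AT.Cpl by (rule T.AT.Cpl_banach)
  note Jc = iso_closed[OF assms(1)]
  have "J (x \<ominus>\<^bsub>T.AT.Cpl\<^esub> y) = J (x \<oplus>\<^bsub>T.AT.Cpl\<^esub> (\<ominus>\<^bsub>L0 m\<^esub> \<one>\<^sub>0) \<odot>\<^bsub>T.AT.Cpl\<^esub> y)"
    using P.smult_minus_one[OF x(2)] by (simp add: a_minus_def)
  also have "\<dots> = J x \<oplus>\<^bsub>SM.Cpl\<^esub> (\<ominus>\<^bsub>L0 m\<^esub> \<one>\<^sub>0) \<odot>\<^bsub>SM.Cpl\<^esub> J y"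
    using x by (simp add: J.additive J.homogeneous)
  also have "\<dots> = J x \<ominus>\<^bsub>SM.Cpl\<^esub> J y" using Q.smult_minus_one[OF Jc[OF x(2)]] by (simp add: a_minus_def)
  finally have *: "J (x \<ominus>\<^bsub>T.AT.Cpl\<^esub> y) = J x \<ominus>\<^bsub>SM.Cpl\<^esub> J y" .
  show "Q.dst (J x) (J y) = rnm_dist m T.AT.Cpl x y"
    using x Jc J.isometric[of "x \<ominus>\<^bsub>T.AT.Cpl\<^esub> y"] * by (simp add: Q.dst_eq P.dst_eq)
qed

text \<open>Additivity extends the agreement from \<open>chi_tensor\<close> to simple tensors, and
  isometries that agree on a dense set agree everywhere.\<close>

lemma iso_unique:
  assumes J: "rnm_isometric_iso m T.AT.Cpl SM.Cpl J" and J': "rnm_isometric_iso m T.AT.Cpl SM.Cpl J'"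
    and gen: "\<And>A v. A \<in> \<A> \<Longrightarrow> v \<in> carrier M \<Longrightarrow> J (T.AT.emb (chi_tensor A v)) = J' (T.AT.emb (chi_tensor A v))"
    and X: "X \<in> carrier T.AT.Cpl"
  shows "J X = J' X"
proof -

  interpret J: rnm_isometric_iso m T.AT.Cpl SM.Cpl J by fact
  interpret J': rnm_isometric_iso m T.AT.Cpl SM.Cpl J' by fact
  interpret P: banach_L0_module m T.AT.Cpl by (rule T.AT.Cpl_banach)
  have simple: "J (T.AT.emb (F B)) = J' (T.AT.emb (F B))" if "simple_tensor F" "B \<in> \<A>" for F B
    using that
  proof (induction rule: simple_tensor.induct)
    case zero
    have "T.AT.emb \<zero>\<^bsub>T.TM\<^esub> = \<zero>\<^bsub>T.AT.Cpl\<^esub>" using T.AT.emb_zero by simp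
    then show ?case
      using J.homogeneous[of "\<zero>\<^sub>0" "\<zero>\<^bsub>T.AT.Cpl\<^esub>"] J'.homogeneous[of "\<zero>\<^sub>0" "\<zero>\<^bsub>T.AT.Cpl\<^esub>"]
        iso_closed[OF J, of "\<zero>\<^bsub>T.AT.Cpl\<^esub>"] iso_closed[OF J', of "\<zero>\<^bsub>T.AT.Cpl\<^esub>"] by simp
  next
    case (step F A v)
    have c: "F B \<in> carrier T.TM" "chi_tensor (A \<inter> B) v \<in> carrier T.TM" using step simple_tensor_closed[OF step(1)] by auto
    have "T.AT.emb (F B \<oplus>\<^bsub>T.TM\<^esub> chi_tensor (A \<inter> B) v) = T.AT.emb (F B) \<oplus>\<^bsub>T.AT.Cpl\<^esub> T.AT.emb (chi_tensor (A \<inter> B) v)"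
      using T.AT.emb_add[of "F B" "chi_tensor (A \<inter> B) v"] c by simp
    then show ?case using step gen[of "A \<inter> B" v] SA.Int[of A B] c by (simp add: J.additive J'.additive)
  qed
  have "Q.dst (J X) (J' X) \<le> \<epsilon>" if e: "\<epsilon> > 0" for \<epsilon>
  proof -
    \<comment> \<open>Two approximations within \<epsilon>/4 put \<open>X\<close> within
      \<epsilon>/2 of a simple tensor; this distance is then counted once for \<open>J\<close> and
      once for \<open>J'\<close>.\<close>
    obtain \<alpha> where a: "\<alpha> \<in> carrier T.AT" "rnm_dist m T.AT.Cpl (T.AT.emb \<alpha>) X < \<epsilon>/4"
      using T.AT.emb_dense[OF X, of "\<epsilon>/4"] e by auto
    obtain F where F: "simple_tensor F" "T.AT.dst (F \<Omega>) \<alpha> < \<epsilon>/4"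
      using simple_tensor_dense[of \<alpha> "\<epsilon>/4"] a e by auto
    have Fc: "F \<Omega> \<in> carrier T.AT" using simple_tensor_closed[OF F(1) SA.top] by simp
    let ?Y = "T.AT.emb (F \<Omega>)"
    have Y: "?Y \<in> carrier T.AT.Cpl" using T.AT.emb_closed[OF Fc] .
    have "rnm_dist m T.AT.Cpl ?Y X \<le> rnm_dist m T.AT.Cpl ?Y (T.AT.emb \<alpha>) + rnm_dist m T.AT.Cpl (T.AT.emb \<alpha>) X"
      by (rule P.dst_triangle[OF Y _ X]) (use T.AT.emb_closed[OF a(1)] in simp)
    then have d: "rnm_dist m T.AT.Cpl ?Y X < \<epsilon>/2" using F(2) a T.AT.emb_dist[OF Fc a(1)] by simp
    have "Q.dst (J X) (J' X) \<le> Q.dst (J X) (J ?Y) + Q.dst (J ?Y) (J' X)"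
      by (rule Q.dst_triangle) (use iso_closed[OF J] iso_closed[OF J'] X Y in auto)
    also have "Q.dst (J X) (J ?Y) = rnm_dist m T.AT.Cpl ?Y X"
      using iso_dist[OF J X Y] P.dst_commute[OF X Y] by simp
    also have "Q.dst (J ?Y) (J' X) = rnm_dist m T.AT.Cpl ?Y X"
      using iso_dist[OF J' Y X] simple[OF F(1) SA.top] by simp
    finally show ?thesis using d by simp
  qed
  then have "Q.dst (J X) (J' X) \<le> 0" by (rule field_le_epsilon[of _ 0, simplified])
  then show ?thesis
    using Q.dst_nonneg[of "J X" "J' X"] iso_closed[OF J X] iso_closed[OF J' X]
    by (intro Q.dst_eq_zeroD) auto
qed

text \<open>Serves to pass from \<open>L1_iso\<close> to its restriction, the extensional map that
  uniqueness refers to.\<close>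

lemma iso_cong:
  assumes "rnm_isometric_iso m T.AT.Cpl SM.Cpl J" and e: "\<And>x. x \<in> carrier T.AT.Cpl \<Longrightarrow> J' x = J x"
  shows "rnm_isometric_iso m T.AT.Cpl SM.Cpl J'"
proof -
  interpret J: rnm_isometric_iso m T.AT.Cpl SM.Cpl J by fact
  interpret P: banach_L0_module m T.AT.Cpl by (rule T.AT.Cpl_banach)
  show ?thesis
  proof (intro rnm_isometric_iso.intro rnm_isometric_iso_axioms.intro P.random_normed Q.random_normed)
    show "bij_betw J' (carrier T.AT.Cpl) (carrier SM.Cpl)" using J.bij e by (simp cong: bij_betw_cong)
  qed (simp_all add: e J.additive J.homogeneous J.isometric)
qed

lemma L1_ind_eq: "L1_ind m \<Omega> \<A> \<mu> M A v = SM.emb (cl (ind A v))" "L1_ind m \<Omega> \<A> \<mu> (L0 m) A f = L.SM.emb (L.cl (L.ind A f))"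
  by (simp_all add: L1_ind_def ind_def L.ind_def)

lemma proj_tensor_elem_ind:
  assumes "A \<in> \<A>" "f \<in> \<L>" "v \<in> carrier M"
  shows "proj_tensor_elem m (L1 m \<Omega> \<A> \<mu> (L0 m)) M (L1_ind m \<Omega> \<A> \<mu> (L0 m) A f) v = T.AT.emb (chi_tensor A (f \<odot> v))"
  unfolding proj_tensor_elem_def L1_ind_eq L1_def te_ind[OF assms] ..

text \<open>The choice of the whole space for E turns the prescribed values into values on all
  \<open>chi_tensor A v\<close>, the generators used by \<open>iso_unique\<close>.\<close>

lemma L0_ind_space: "L0_ind m (space m) = \<one>\<^sub>0"
  unfolding L0_ind_def L0_one by (subst L0_class_eq_iff) (auto intro!: AE_I2)

lemma L0_ind_closed: "E \<in> sets m \<Longrightarrow> L0_ind m E \<in> \<L>"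
  unfolding L0_ind_def by (rule L0_class_closed) simp

text \<open>Functions are total, so two isomorphisms can only be shown to agree on the carrier;
  extensionality fixes the values elsewhere and turns this agreement into equality.\<close>

theorem exists_unique_iso:
  "\<exists>!J. J \<in> extensional (carrier (proj_tensor m (L1 m \<Omega> \<A> \<mu> (L0 m)) M)) \<and>
    rnm_isometric_iso m (proj_tensor m (L1 m \<Omega> \<A> \<mu> (L0 m)) M) (L1 m \<Omega> \<A> \<mu> M) J \<and>
    (\<forall>A\<in>\<A>. \<forall>E\<in>sets m. \<forall>v\<in>carrier M.
      J (proj_tensor_elem m (L1 m \<Omega> \<A> \<mu> (L0 m)) M (L1_ind m \<Omega> \<A> \<mu> (L0 m) A (L0_ind m E)) v) =
      L1_ind m \<Omega> \<A> \<mu> M A (L0_ind m E \<odot> v))" (is "\<exists>!J. ?P J")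
proof (rule ex_ex1I)
  have eq: "proj_tensor m (L1 m \<Omega> \<A> \<mu> (L0 m)) M = T.AT.Cpl" "L1 m \<Omega> \<A> \<mu> M = SM.Cpl"
    by (simp_all add: proj_tensor_def L1_def)
  let ?J = "restrict L1_iso (carrier T.AT.Cpl)"
  have "rnm_isometric_iso m T.AT.Cpl SM.Cpl ?J" by (rule iso_cong[OF L1_iso_iso]) simp
  moreover have "?J (T.AT.emb (chi_tensor A (L0_ind m E \<odot> v))) = SM.emb (cl (ind A (L0_ind m E \<odot> v)))"
    if "A \<in> \<A>" "E \<in> sets m" "v \<in> carrier M" for A E v
    using that L0_ind_closed[of E] T.AT.emb_closed[of "chi_tensor A (L0_ind m E \<odot> v)"] by (simp add: L1_iso_emb realize_chi_tensor)
  ultimately show "\<exists>J. ?P J"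
    unfolding eq by (intro exI[of _ ?J]) (auto simp: proj_tensor_elem_ind L0_ind_closed L1_ind_eq(1))
  fix J J' assume J: "?P J" and J': "?P J'"
  have gen: "J (T.AT.emb (chi_tensor A v)) = J' (T.AT.emb (chi_tensor A v))" if "A \<in> \<A>" "v \<in> carrier M" for A v
  proof -
    have "T.AT.emb (chi_tensor A v) =
        proj_tensor_elem m (L1 m \<Omega> \<A> \<mu> (L0 m)) M (L1_ind m \<Omega> \<A> \<mu> (L0 m) A (L0_ind m (space m))) v"
      using that proj_tensor_elem_ind[of A "\<one>\<^sub>0" v] by (simp add: L0_ind_space)
    then show ?thesis using J J' that by simp
  qed
  show "J = J'"
    by (rule extensionalityI[of _ "carrier T.AT.Cpl"]) (use J J' eq iso_unique[of J J', OF _ _ gen] in auto)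
qed

end

theorem theorem4p14:
  fixes m :: "'a measure"
    and \<Omega> :: "'b set" and \<A> :: "'b set set"
    and M :: "('a l0, 'c) rnm"
    and \<mu> :: "'b set \<Rightarrow> 'a l0"
  assumes "prob_space m"
    and "sigma_algebra \<Omega> \<A>"
    and "complete_random_normed_module m M"
    and "L0_valued_measure m \<A> \<mu>"
    and "bounded_variation m \<Omega> \<A> \<mu>"
  shows "\<exists>!J. J \<in> extensional (carrier (proj_tensor m (L1 m \<Omega> \<A> \<mu> (L0 m)) M)) \<and>
    rnm_isometric_iso m (proj_tensor m (L1 m \<Omega> \<A> \<mu> (L0 m)) M) (L1 m \<Omega> \<A> \<mu> M) J \<and>
    (\<forall>A\<in>\<A>. \<forall>E\<in>sets m. \<forall>v\<in>carrier M.
      J (proj_tensor_elem m (L1 m \<Omega> \<A> \<mu> (L0 m)) M (L1_ind m \<Omega> \<A> \<mu> (L0 m) A (L0_ind m E)) v) =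
      L1_ind m \<Omega> \<A> \<mu> M A (L0_ind m E \<odot>\<^bsub>M\<^esub> v))"
proof -
  interpret L0_base m by (simp add: L0_base_def assms(1))
  have M: "seminormed_L0_module m M"
    using assms(3) random_normed_module_iff[of M] by (simp add: complete_random_normed_module_def)
  have "L0_vector_measure m \<Omega> \<A> \<mu>"
    by (intro L0_vector_measure.intro L0_vector_measure_axioms.intro L0_base_axioms assms)
  then have "L0_bochner_tensor m \<Omega> \<A> \<mu> M"
    using M L0_seminormed by (intro L0_bochner_tensor.intro L0_bochner.intro)
  then show ?thesis by (rule L0_bochner_tensor.exists_unique_iso)
qed

end
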